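(* In the setting of the context (the Hilbert scheme of $2$ points), let $\mathcal{E}^{ell}([2]),\mathcal{E}^{ell}([1,1])\in F^2$ and let $\Upsilon(v;q)$ be a (possibly multi-valued) holomorphic function on $\mathbb{C}^\times_v\times\mathfrak{D}^\circ$. Then the following (I) and (II) are equivalent. (I) $\mathcal{E}^{ell}$ satisfies the two $q$-difference equations (Q1), (Q2), the condition (S), the normalizations (N1), (N2), the duality equation (B) with this $\Upsilon$, and Property A (all spelled out in the context). (II) There exist (possibly multi-valued) holomorphic functions $f_i(v;q)$ ($i=0,1,2$) on $\mathbb{C}^\times_v\times\widetilde{\mathfrak{D}^\circ}$ such that $q^{-c_i}f_i(v;q)$ is single-valued and $$f_0(v;q)=q^{c_0}\cdot\bigl(1+O(q^{1/2})\bigr),\quad f_1(v;q)=q^{c_1}\cdot\bigl(1+O(q^{1/2})\bigr),\quad f_2(v;q)=q^{c_2}\cdot O(1)$$ (as $q\to0$) for some $c_0,c_1,c_2\in\mathbb{R}$ satisfying $c_2\ge c_1+\frac34$, and we have $$\begin{aligned}\mathcal{E}^{ell}([2])&=f_1(v;q)\sum_{l,m\in\mathbb{Z}}(-1)^{m}q^{l^2+\frac12(m+\frac12)^2}v^{-2l+2m+1}z^{2l+m+\frac12}\,\mathcal{O}\left(2l-m-\tfrac12\right)\\&\quad+f_2(v;q)\sum_{l,m\in\mathbb{Z}}(-1)^mq^{(l+\frac12)^2+\frac12(m+\frac12)^2}v^{-2l+2m}z^{2l+m+\frac32}\,\mathcal{O}\left(2l-m+\tfrac12\right),\\ \mathcal{E}^{ell}([1,1])&=f_0(v;q)\sum_{m\in\mathbb{Z}}(-1)^mq^{\frac12(m+\frac12)^2}z^{m+\frac12}\,\mathcal{O}\left(m+\tfrac12\right),\\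 \Upsilon(v;q)&=q^{\frac14}(q;q)_\infty^2\, f_0(v;q)\left(f_1(v;q)\sum_{m\in\mathbb{Z}}q^{m^2}v^{2m}+f_2(v;q)\sum_{m\in\mathbb{Z}}q^{(m+\frac12)^2}v^{2m+1}\right).\end{aligned}$$
   Context: Geometric origin: $X\subset \mathrm{Hilb}^2(\mathbb{C}^2)$ is the preimage of $(0,0)$ under $\mathrm{Hilb}^2(\mathbb{C}^2)\to\mathrm{Sym}^2(\mathbb{C}^2)\xrightarrow{\text{sum}}\mathbb{C}^2$, with tori $H=\mathbb{C}^\times_a$ acting by $(x,y)\mapsto(ax,a^{-1}y)$, $\mathbb{S}=\mathbb{C}^\times_v$ acting by $(x,y)\mapsto (v^{-1}x,v^{-1}y)$, and $K=\mathbb{C}^\times_z$ acting trivially. Its $H$-fixed points are $[2]=(x^2,y)$ and $[1,1]=(x,y^2)$. Notation. $\mathfrak{D}^\circ=\{q\in\mathbb{C}:0<|q|<1\}$, and $\widetilde{\mathfrak{D}^\circ}$ is its double cover (on which $q^{1/2}$ is single-valued). $F$ is the field of multi-valued meromorphic functions on $H\times K\times\mathbb{S}\times\mathfrak{D}^\circ$ (variables $a,z,v,q$). Elements of $F^2$ are column vectors whose entries are the restrictions to $[2]$ and $[1,1]$, in this order; $(\cdot)|_p$ is the entry at $p$, and $\otimes$ is entrywise multiplication. For $n\in\frac12\mathbb{Z}$, $\mathcal{O}(n)=(v^{2n}a^{-n},\,v^{2n}a^{n})^{t}$. Put $\sqrt{\mathcal{L}(\pm\kappa)}=a^{\pm 3/2}\mathcal{O}(\pm\frac12)$.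 $\delta_z$ is the operator $z\mapsto qz$, and $\delta_z^{-s}$ is $z\mapsto q^{-s}z$ for $s\in\mathbb{R}$ (other variables fixed). $(q;q)_\infty=\prod_{m\ge1}(1-q^m)$ and $\vartheta(x)=(x^{1/2}-x^{-1/2})\prod_{m\ge1}(1-q^mx)(1-q^mx^{-1})$. Elliptic stable basis matrix (rows and columns indexed by $[2],[1,1]$, columns being the stable basis elements): $$\mathrm{Stab}^{ell}=\begin{pmatrix}\vartheta(a^{-2})\vartheta(v^{-2}z^{-2}) & \frac{\vartheta(v^{-2})\left(\vartheta(a^{-2})\vartheta(vz^2a^{-1})\vartheta(v^{-1}z)+\vartheta(v^{-1}a^{-1})\vartheta(vza^{-2})\vartheta(z^{-2})\right)}{\vartheta(v^{-1}a)\vartheta(vz)}\\ 0&\vartheta(v^{-2}a^{-2})\vartheta(z^{-2})\end{pmatrix}.$$ $\mathcal{E}^{ell}$ is the $2\times2$ matrix with columns $\mathcal{E}^{ell}([2]),\mathcal{E}^{ell}([1,1])$, and the dual matrix is $\mathcal{E}^{ell}_{!}=\Omega\cdot(\mathcal{E}^{ell}|_{a\leftrightarrow z})\cdot\Omega$ with $\Omega=\begin{pmatrix}0&1\\1&0\end{pmatrix}$ ($a\leftrightarrow z$ exchanges the variables $a$ and $z$). Conditions: (Q1) $\delta_z(\mathcal{E}^{ell}([2]))=-q^{-3/2}z^{-3}\mathcal{O}(-1)\otimes\mathcal{E}^{ell}([2])$. (Q2) $\delta_z(\mathcal{E}^{ell}([1,1]))=-q^{-1/2}z^{-1}\mathcal{O}(-1)\otimes\mathcal{E}^{ell}([1,1])$.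 (S) For $\mu\in\{[2],[1,1]\}$, $z^{-1/2}\mathcal{O}(-\frac12)\otimes\mathcal{E}^{ell}(\mu)$ is single-valued and holomorphic as a vector-valued function on $H\times K\times\mathbb{S}$ (multi-valuedness in $q$ is not restricted by this condition). (N1) For any $0<s<\frac12$ there is $r_{[2]}(s)\in\mathbb{R}$ with $\lim_{q\to0}q^{-r_{[2]}(s)}\delta_z^{-s}(\mathcal{E}^{ell}([2]))=vz^{1/2}\mathcal{O}(-\frac12)$. (N2) For any $0<s<\frac12$ there is $r_{[1,1]}(s)\in\mathbb{R}$ with $\lim_{q\to0}q^{-r_{[1,1]}(s)}\delta_z^{-s}(\mathcal{E}^{ell}([1,1]))=z^{1/2}\mathcal{O}(\frac12)$. (B) $\Upsilon(v;q)\cdot\mathrm{Stab}^{ell}=\mathcal{E}^{ell}\cdot{}^t\mathcal{E}^{ell}_{!}$. Property A: for each $\mu\in\{[2],[1,1]\}$ there exist $\alpha_\mu,\beta_\mu,r_\mu\in\mathbb{Q}$ such that (1) each entry of $q^{-r_\mu}a^{-\alpha_\mu}z^{-\beta_\mu}\sqrt{\mathcal{L}(-\kappa)}\otimes\mathcal{E}^{ell}(\mu)$ is a single-valued holomorphic function on $H\times K\times\mathbb{S}\times\widetilde{\mathfrak{D}^\circ}$; (2) for every $s\in\mathbb{R}$ there is $r_\mu(s)\in\mathbb{R}$ such that $\lim_{q\to0}q^{-r_\mu(s)}a^{-\alpha_\mu}z^{-\beta_\mu}\sqrt{\mathcal{L}(-\kappa)}\otimes\delta_z^{-s}(\mathcal{E}^{ell}(\mu))$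 exists and equals $\pm a^iz^j\sqrt{\mathcal{L}(-\kappa)}\otimes W_{\mu,s}$ for some sign and some $i,j\in\mathbb{Z}$. Here $\sqrt{\mathcal{L}(-\kappa)}\otimes W_{\mu,s}$ is the $K$-theoretic canonical basis element at slope $s$ labelled by $\mu$, given explicitly, for $m\in\mathbb{Z}$, by: $W_{[2],s}=(v^{2m}a-z^{-1}v^{2m},\ v^{2m}a^{2m}-z^{-1}v^{2m}a^{2m+1})^t$ if $s=m$; $(v^{2m}a,\ v^{2m}a^{2m})^t$ if $m<s<m+\frac12$; $(v^{2m+2}a^{-2m-2}+z^{-2}v^{2m}a^{-2m},\ v^{2m+2}a+z^{-2}v^{2m}a^{-1})^t$ if $s=m+\frac12$; $(v^{2m+2}a^{-2m-2},\ v^{2m+2}a)^t$ if $m+\frac12<s<m+1$. $W_{[1,1],s}=(v^{2m+1}a^{-2m}-z^{-1}v^{2m-1}a^{-2m+1},\ v^{2m+1}a-z^{-1}v^{2m-1})^t$ if $s=m$; $(v^{2m+1}a^{-2m},\ v^{2m+1}a)^t$ if $m<s<m+\frac12$; $(v^{2m+1}a,\ v^{2m+1}a^{2m+2})^t$ if $m+\frac12\le s<m+1$.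
   Formalization: In (II) the exponents must also satisfy: c_0 and c_1 are rational and c_2-(c_1+3/4) is a half-integer multiple (in (1/2)Z); without this (II) does not imply Property A(1), e.g. f_0=q^{sqrt 2}, f_1=1, f_2=0. *)

theory Defs
  imports "HOL-Analysis.Analysis" "HOL-Library.Landau_Symbols"
begin

text \<open>
  Multi-valued functions of \<open>a, z, v \<in> \<complex> - {0}\<close> and \<open>0 < |q| < 1\<close> are functions on the
  universal cover, with logarithmic coordinates \<open>(A, Z, V, Q)\<close> where \<open>a = exp A\<close>, \<open>z = exp Z\<close>,
  \<open>v = exp V\<close>, \<open>q = exp Q\<close> and \<open>Re Q < 0\<close>.  Capital letters always denote these logarithms.
  Functions of \<open>(v, q)\<close> only live on the cover with coordinates \<open>(V, Q)\<close>, which is also the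
  universal cover when the punctured disc is replaced by its double cover.
\<close>

type_synonym pt = "complex \<times> complex \<times> complex \<times> complex"

definition cover :: "pt set" where
  "cover = {(A, Z, V, Q). Re Q < 0}"

definition cover_vq :: "(complex \<times> complex) set" where
  "cover_vq = {(V, Q). Re Q < 0}"

text \<open>\<open>lpow X c\<close> is the power \<open>x\<^sup>c\<close> for \<open>x = exp X\<close>.\<close>

definition lpow :: "complex \<Rightarrow> real \<Rightarrow> complex" where
  "lpow X c = exp (of_real c * X)"

text \<open>The limit \<open>q \<rightarrow> 0\<close>, with the argument of \<open>q\<close> unrestricted.\<close>

definition q_to_0 :: "complex filter" where
  "q_to_0 = filtercomap Re at_bot"


text \<open>Holomorphy in several variables: Frechet differentiability with complex linear derivative.\<close>

definition holomorphic2_on :: "(complex \<times> complex \<Rightarrow> complex) \<Rightarrow> (complex \<times> complex) set \<Rightarrow> bool" where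
  "holomorphic2_on f S \<longleftrightarrow> (\<forall>x\<in>S. \<exists>d1 d2.
     (f has_derivative (\<lambda>(h1, h2). d1 * h1 + d2 * h2)) (at x))"

definition holomorphic3_on ::
  "(complex \<times> complex \<times> complex \<Rightarrow> complex) \<Rightarrow> (complex \<times> complex \<times> complex) set \<Rightarrow> bool" where
  "holomorphic3_on f S \<longleftrightarrow> (\<forall>x\<in>S. \<exists>d1 d2 d3.
     (f has_derivative (\<lambda>(h1, h2, h3). d1 * h1 + d2 * h2 + d3 * h3)) (at x))"

definition holomorphic4_on :: "(pt \<Rightarrow> complex) \<Rightarrow> pt set \<Rightarrow> bool" where
  "holomorphic4_on f S \<longleftrightarrow> (\<forall>x\<in>S. \<exists>d1 d2 d3 d4.
     (f has_derivative (\<lambda>(h1, h2, h3, h4). d1 * h1 + d2 * h2 + d3 * h3 + d4 * h4)) (at x))"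

text \<open>Equality of meromorphic functions: agreement on a dense open subset.\<close>

definition eq_mero_on :: "pt set \<Rightarrow> (pt \<Rightarrow> 'b) \<Rightarrow> (pt \<Rightarrow> 'b) \<Rightarrow> bool" where
  "eq_mero_on U f g \<longleftrightarrow>
     (\<exists>W. open W \<and> W \<subseteq> U \<and> U \<subseteq> closure W \<and> (\<forall>x\<in>W. f x = g x))"

text \<open>
  The meromorphic functions on \<open>cover\<close>, i.e. locally quotients of holomorphic functions.  As for
  the library's \<open>nicely_meromorphic_on\<close>, each is represented by a total function with all
  removable singularities removed and the value \<open>0\<close> at the remaining singular points, so that
  the representative is unique on \<open>cover\<close>, and the meromorphic function is holomorphic iff the
  representative is.
\<close>

definition mero_field :: "(pt \<Rightarrow> complex) set" where
  "mero_field = {f.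
     (\<forall>x\<in>cover. \<exists>U g h. open U \<and> connected U \<and> x \<in> U \<and> U \<subseteq> cover \<and>
        holomorphic4_on g U \<and> holomorphic4_on h U \<and> (\<exists>y\<in>U. h y \<noteq> 0) \<and>
        (\<forall>y\<in>U. h y \<noteq> 0 \<longrightarrow> f y = g y / h y)) \<and>
     (\<forall>x\<in>cover. (\<exists>U. open U \<and> x \<in> U \<and> U \<subseteq> cover \<and> holomorphic4_on f U) \<or>
        (f x = 0 \<and>
         \<not> (\<exists>U g. open U \<and> x \<in> U \<and> U \<subseteq> cover \<and> holomorphic4_on g U \<and> eq_mero_on U f g)))}"

text \<open>
  Single-valuedness: a function on (a part \<open>S\<close> of) a cover is single-valued on the base of the
  covering map \<open>\<pi>\<close> iff it factors through \<open>\<pi>\<close>.  On the double cover of the punctured disc the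
  coordinate is \<open>q\<^sup>1\<^sup>/\<^sup>2 = exp (Q/2)\<close>.
\<close>

definition single_valued_via :: "('x \<Rightarrow> 'y) \<Rightarrow> 'x set \<Rightarrow> ('x \<Rightarrow> 'b) \<Rightarrow> bool" where
  "single_valued_via \<pi> S f \<longleftrightarrow> (\<forall>x\<in>S. \<forall>y\<in>S. \<pi> x = \<pi> y \<longrightarrow> f x = f y)"

definition proj_HKS :: "complex \<times> complex \<times> complex \<Rightarrow> complex \<times> complex \<times> complex" where
  "proj_HKS = (\<lambda>(A, Z, V). (exp A, exp Z, exp V))"

definition proj_HKS_double :: "pt \<Rightarrow> pt" where
  "proj_HKS_double = (\<lambda>(A, Z, V, Q). (exp A, exp Z, exp V, exp (Q / 2)))"

definition proj_v_double :: "complex \<times> complex \<Rightarrow> complex \<times> complex" where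
  "proj_v_double = (\<lambda>(V, Q). (exp V, exp (Q / 2)))"


text \<open>
  The fixed points \<open>[2]\<close> and \<open>[1,1]\<close>.  Column vectors have type \<open>complex^fixpt\<close>, on which
  \<open>*\<close> is the entrywise product and \<open>*s\<close> multiplication by a scalar.
\<close>

datatype fixpt = P2 | P11

instance fixpt :: finite
proof
  have "(UNIV :: fixpt set) = {P2, P11}"
    using fixpt.exhaust by blast
  then show "finite (UNIV :: fixpt set)"
    by (metis finite.emptyI finite.insertI)
qed

definition vec2 :: "complex \<Rightarrow> complex \<Rightarrow> complex^fixpt" where
  "vec2 x y = (\<chi> p. case p of P2 \<Rightarrow> x | P11 \<Rightarrow> y)"

definition mat22 :: "complex \<Rightarrow> complex \<Rightarrow> complex \<Rightarrow> complex \<Rightarrow> complex^fixpt^fixpt" where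
  "mat22 x11 x12 x21 x22 = (\<chi> p. case p of P2 \<Rightarrow> vec2 x11 x12 | P11 \<Rightarrow> vec2 x21 x22)"

definition bun_O :: "real \<Rightarrow> complex \<Rightarrow> complex \<Rightarrow> complex^fixpt" where
  "bun_O n A V = vec2 (lpow V (2 * n) * lpow A (- n)) (lpow V (2 * n) * lpow A n)"

text \<open>The square root of \<open>L(-\<kappa>)\<close>.\<close>

definition sqrt_L_minus :: "complex \<Rightarrow> complex \<Rightarrow> complex^fixpt" where
  "sqrt_L_minus A V = lpow A (- 3 / 2) *s bun_O (- 1 / 2) A V"

text \<open>The shift \<open>z \<mapsto> q\<^sup>t z\<close> for real \<open>t\<close>.\<close>

definition delta_z :: "real \<Rightarrow> (pt \<Rightarrow> 'b) \<Rightarrow> pt \<Rightarrow> 'b" where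
  "delta_z t f = (\<lambda>(A, Z, V, Q). f (A, Z + of_real t * Q, V, Q))"

text \<open>\<open>(q;q)\<^sub>\<infinity>\<close>, and the theta function in terms of the logarithm \<open>X\<close> of its argument.\<close>

definition qpoch :: "complex \<Rightarrow> complex" where
  "qpoch Q = (\<Prod>m. 1 - exp Q ^ Suc m)"

definition theta :: "complex \<Rightarrow> complex \<Rightarrow> complex" where
  "theta Q X = (exp (X / 2) - exp (- X / 2)) *
     (\<Prod>m. (1 - exp Q ^ Suc m * exp X) * (1 - exp Q ^ Suc m * exp (- X)))"

definition Stab_ell :: "pt \<Rightarrow> complex^fixpt^fixpt" where
  "Stab_ell = (\<lambda>(A, Z, V, Q). let \<theta> = theta Q in
     mat22
       (\<theta> (- 2 * A) * \<theta> (- 2 * V - 2 * Z))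
       (\<theta> (- 2 * V) *
          (\<theta> (- 2 * A) * \<theta> (V + 2 * Z - A) * \<theta> (- V + Z)
           + \<theta> (- V - A) * \<theta> (V + Z - 2 * A) * \<theta> (- 2 * Z))
        / (\<theta> (- V + A) * \<theta> (V + Z)))
       0
       (\<theta> (- 2 * V - 2 * A) * \<theta> (- 2 * Z)))"


text \<open>
  Below, \<open>E \<mu>\<close> is the vector \<open>\<E>\<^sup>e\<^sup>l\<^sup>l(\<mu>)\<close>, as a function on the cover.  The matrix has
  these as its columns; rows are indexed by the point of restriction.
\<close>

definition E_matrix :: "(fixpt \<Rightarrow> pt \<Rightarrow> complex^fixpt) \<Rightarrow> pt \<Rightarrow> complex^fixpt^fixpt" where
  "E_matrix E x = (\<chi> p \<mu>. E \<mu> x $ p)"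

definition Omega :: "complex^fixpt^fixpt" where
  "Omega = mat22 0 1 1 0"

definition E_dual :: "(fixpt \<Rightarrow> pt \<Rightarrow> complex^fixpt) \<Rightarrow> pt \<Rightarrow> complex^fixpt^fixpt" where
  "E_dual E = (\<lambda>(A, Z, V, Q). Omega ** E_matrix E (Z, A, V, Q) ** Omega)"

definition cond_Q1 :: "(fixpt \<Rightarrow> pt \<Rightarrow> complex^fixpt) \<Rightarrow> bool" where
  "cond_Q1 E \<longleftrightarrow> (\<forall>(A, Z, V, Q)\<in>cover.
     delta_z 1 (E P2) (A, Z, V, Q) =
       (- lpow Q (- 3 / 2) * lpow Z (- 3)) *s (bun_O (- 1) A V * E P2 (A, Z, V, Q)))"

definition cond_Q2 :: "(fixpt \<Rightarrow> pt \<Rightarrow> complex^fixpt) \<Rightarrow> bool" where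
  "cond_Q2 E \<longleftrightarrow> (\<forall>(A, Z, V, Q)\<in>cover.
     delta_z 1 (E P11) (A, Z, V, Q) =
       (- lpow Q (- 1 / 2) * lpow Z (- 1)) *s (bun_O (- 1) A V * E P11 (A, Z, V, Q)))"

definition cond_S :: "(fixpt \<Rightarrow> pt \<Rightarrow> complex^fixpt) \<Rightarrow> bool" where
  "cond_S E \<longleftrightarrow> (\<forall>\<mu> p Q. Re Q < 0 \<longrightarrow>
     (let f = (\<lambda>(A, Z, V). (lpow Z (- 1 / 2) *s (bun_O (- 1 / 2) A V * E \<mu> (A, Z, V, Q))) $ p)
      in single_valued_via proj_HKS UNIV f \<and> holomorphic3_on f UNIV))"

definition cond_N1 :: "(fixpt \<Rightarrow> pt \<Rightarrow> complex^fixpt) \<Rightarrow> bool" where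
  "cond_N1 E \<longleftrightarrow> (\<forall>s. 0 < s \<and> s < 1 / 2 \<longrightarrow> (\<exists>r::real. \<forall>A Z V.
     ((\<lambda>Q. lpow Q (- r) *s delta_z (- s) (E P2) (A, Z, V, Q))
        \<longlongrightarrow> (lpow V 1 * lpow Z (1 / 2)) *s bun_O (- 1 / 2) A V) q_to_0))"

definition cond_N2 :: "(fixpt \<Rightarrow> pt \<Rightarrow> complex^fixpt) \<Rightarrow> bool" where
  "cond_N2 E \<longleftrightarrow> (\<forall>s. 0 < s \<and> s < 1 / 2 \<longrightarrow> (\<exists>r::real. \<forall>A Z V.
     ((\<lambda>Q. lpow Q (- r) *s delta_z (- s) (E P11) (A, Z, V, Q))
        \<longlongrightarrow> lpow Z (1 / 2) *s bun_O (1 / 2) A V) q_to_0))"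

definition cond_B ::
  "(fixpt \<Rightarrow> pt \<Rightarrow> complex^fixpt) \<Rightarrow> (complex \<times> complex \<Rightarrow> complex) \<Rightarrow> bool" where
  "cond_B E Y \<longleftrightarrow> eq_mero_on cover
     (\<lambda>(A, Z, V, Q). \<chi> i j. Y (V, Q) * Stab_ell (A, Z, V, Q) $ i $ j)
     (\<lambda>x. E_matrix E x ** transpose (E_dual E x))"

text \<open>\<open>W \<mu> s A Z V\<close> is \<open>W\<^bsub>\<mu>,s\<^esub>\<close>, the integer part of \<open>s\<close> being \<open>m\<close>.\<close>

definition W :: "fixpt \<Rightarrow> real \<Rightarrow> complex \<Rightarrow> complex \<Rightarrow> complex \<Rightarrow> complex^fixpt" where
  "W \<mu> s A Z V = (let m = of_int \<lfloor>s\<rfloor> :: real; a = lpow A; z = lpow Z; v = lpow V in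
     case \<mu> of
       P2 \<Rightarrow>
         if s = m then
           vec2 (v (2*m) * a 1 - z (-1) * v (2*m))
                (v (2*m) * a (2*m) - z (-1) * v (2*m) * a (2*m + 1))
         else if s < m + 1/2 then
           vec2 (v (2*m) * a 1) (v (2*m) * a (2*m))
         else if s = m + 1/2 then
           vec2 (v (2*m + 2) * a (-2*m - 2) + z (-2) * v (2*m) * a (-2*m))
                (v (2*m + 2) * a 1 + z (-2) * v (2*m) * a (-1))
         else
           vec2 (v (2*m + 2) * a (-2*m - 2)) (v (2*m + 2) * a 1)
     | P11 \<Rightarrow>
         if s = m then
           vec2 (v (2*m + 1) * a (-2*m) - z (-1) * v (2*m - 1) * a (-2*m + 1))
                (v (2*m + 1) * a 1 - z (-1) * v (2*m - 1))
         else if s < m + 1/2 then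
           vec2 (v (2*m + 1) * a (-2*m)) (v (2*m + 1) * a 1)
         else
           vec2 (v (2*m + 1) * a 1) (v (2*m + 1) * a (2*m + 2)))"

definition property_A :: "(fixpt \<Rightarrow> pt \<Rightarrow> complex^fixpt) \<Rightarrow> bool" where
  "property_A E \<longleftrightarrow> (\<forall>\<mu>. \<exists>\<alpha>\<in>\<rat>. \<exists>\<beta>\<in>\<rat>. \<exists>r\<in>\<rat>.
     (\<forall>p. let f = (\<lambda>(A, Z, V, Q).
              ((lpow Q (- r) * lpow A (- \<alpha>) * lpow Z (- \<beta>)) *s
                 (sqrt_L_minus A V * E \<mu> (A, Z, V, Q))) $ p)
          in single_valued_via proj_HKS_double cover f \<and> holomorphic4_on f cover) \<and>
     (\<forall>s::real. \<exists>rs::real. \<exists>\<epsilon>\<in>{1, - 1}. \<exists>i j :: int. \<forall>A Z V.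
        ((\<lambda>Q. (lpow Q (- rs) * lpow A (- \<alpha>) * lpow Z (- \<beta>)) *s
                 (sqrt_L_minus A V * delta_z (- s) (E \<mu>) (A, Z, V, Q)))
           \<longlongrightarrow> (\<epsilon> * lpow A (of_int i) * lpow Z (of_int j)) *s
                 (sqrt_L_minus A V * W \<mu> s A Z V)) q_to_0))"


text \<open>The theta series in the explicit formulas, without the factors \<open>f\<^sub>i\<close>.\<close>

definition series_1 :: "pt \<Rightarrow> complex^fixpt" where
  "series_1 = (\<lambda>(A, Z, V, Q). \<Sum>\<^sub>\<infinity>(l, m)\<in>(UNIV :: (int \<times> int) set).
     let l = of_int l :: real; n = of_int m :: real in
     ((- 1) powi m * lpow Q (l\<^sup>2 + (n + 1/2)\<^sup>2 / 2) *
        lpow V (- 2*l + 2*n + 1) * lpow Z (2*l + n + 1/2)) *s bun_O (2*l - n - 1/2) A V)"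

definition series_2 :: "pt \<Rightarrow> complex^fixpt" where
  "series_2 = (\<lambda>(A, Z, V, Q). \<Sum>\<^sub>\<infinity>(l, m)\<in>(UNIV :: (int \<times> int) set).
     let l = of_int l :: real; n = of_int m :: real in
     ((- 1) powi m * lpow Q ((l + 1/2)\<^sup>2 + (n + 1/2)\<^sup>2 / 2) *
        lpow V (- 2*l + 2*n) * lpow Z (2*l + n + 3/2)) *s bun_O (2*l - n + 1/2) A V)"

definition series_0 :: "pt \<Rightarrow> complex^fixpt" where
  "series_0 = (\<lambda>(A, Z, V, Q). \<Sum>\<^sub>\<infinity>m\<in>(UNIV :: int set).
     let n = of_int m :: real in
     ((- 1) powi m * lpow Q ((n + 1/2)\<^sup>2 / 2) * lpow Z (n + 1/2)) *s bun_O (n + 1/2) A V)"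

definition theta_even :: "complex \<times> complex \<Rightarrow> complex" where
  "theta_even = (\<lambda>(V, Q). \<Sum>\<^sub>\<infinity>m\<in>(UNIV :: int set).
     lpow Q ((of_int m)\<^sup>2) * lpow V (2 * of_int m))"

definition theta_odd :: "complex \<times> complex \<Rightarrow> complex" where
  "theta_odd = (\<lambda>(V, Q). \<Sum>\<^sub>\<infinity>m\<in>(UNIV :: int set).
     lpow Q ((of_int m + 1/2)\<^sup>2) * lpow V (2 * of_int m + 1))"

text \<open>
  \<open>f = q\<^sup>c (1 + O(q\<^sup>1\<^sup>/\<^sup>2))\<close> and \<open>f = q\<^sup>c O(1)\<close> as \<open>q \<rightarrow> 0\<close>, for each fixed \<open>v\<close>.
\<close>

definition asymp_unit :: "(complex \<times> complex \<Rightarrow> complex) \<Rightarrow> real \<Rightarrow> bool" where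
  "asymp_unit f c \<longleftrightarrow>
     (\<forall>V. (\<lambda>Q. lpow Q (- c) * f (V, Q) - 1) \<in> O[q_to_0](\<lambda>Q. lpow Q (1 / 2)))"

definition asymp_bounded :: "(complex \<times> complex \<Rightarrow> complex) \<Rightarrow> real \<Rightarrow> bool" where
  "asymp_bounded f c \<longleftrightarrow>
     (\<forall>V. (\<lambda>Q. lpow Q (- c) * f (V, Q)) \<in> O[q_to_0](\<lambda>_. 1))"

definition admissible_coeff :: "(complex \<times> complex \<Rightarrow> complex) \<Rightarrow> real \<Rightarrow> bool" where
  "admissible_coeff f c \<longleftrightarrow> holomorphic2_on f cover_vq \<and>
     single_valued_via proj_v_double cover_vq (\<lambda>(V, Q). lpow Q (- c) * f (V, Q))"

text \<open>
  The exponents \<open>c\<^sub>0, c\<^sub>1, c\<^sub>2\<close> with \<open>c\<^sub>2 \<ge> c\<^sub>1 + 3/4\<close>.  The remaining conditions are forced by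
  the single-valuedness in \<open>property_A\<close>.  Its exponent \<open>r\<close> is rational and the \<open>q\<close>-exponents of
  \<open>series_0\<close> and \<open>series_1\<close> are in \<open>1/8 + \<int>\<close>, so \<open>c\<^sub>0\<close> and \<open>c\<^sub>1\<close> must be rational.  Those of
  \<open>series_2\<close> are in \<open>3/8 + \<int>\<close>, so \<open>f\<^sub>1 series_1 + f\<^sub>2 series_2\<close>, with \<open>f\<^sub>2 \<noteq> 0\<close>, is single-valued
  in \<open>q\<^sup>1\<^sup>/\<^sup>2\<close> up to a power of \<open>q\<close> only if \<open>c\<^sub>2 - c\<^sub>1 + 1/4\<close> is a half-integer.  (If \<open>f\<^sub>2 = 0\<close>
  then \<open>c\<^sub>2\<close> is arbitrary and can be taken to be \<open>c\<^sub>1 + 3/4\<close>.)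
\<close>

definition admissible_exponents :: "real \<Rightarrow> real \<Rightarrow> real \<Rightarrow> bool" where
  "admissible_exponents c0 c1 c2 \<longleftrightarrow>
     c2 \<ge> c1 + 3 / 4 \<and> c0 \<in> \<rat> \<and> c1 \<in> \<rat> \<and> 2 * (c2 - (c1 + 3 / 4)) \<in> \<int>"

end

theory Submission
  imports Defs "HOL-Complex_Analysis.Complex_Analysis"
begin

text \<open>
  Everything is expressed by three theta series. The alternating series
  \<open>\<Sum>\<^sub>m (- 1)\<^sup>m q\<^bsup>(m + 1/2)\<^sup>2/2\<^esup> x\<^bsup>m + 1/2\<^esup>\<close>, called \<open>thA\<close>, is \<open>q\<^bsup>1/8\<^esup> (q;q)\<^sub>\<infinity> \<theta>(x)\<close> by Jacobi's triple
  product (\<open>thA_triple_product\<close>). The series \<open>\<Sum>\<^sub>m q\<^bsup>m\<^sup>2\<^esup> x\<^bsup>2m\<^esup>\<close> and \<open>\<Sum>\<^sub>m q\<^bsup>(m + 1/2)\<^sup>2\<^esup> x\<^bsup>2m + 1\<^esup>\<close>, called \<open>th0\<close>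
  and \<open>th1\<close>, span the theta functions of degree two (\<open>theta_degree_2\<close>). The double series of the
  explicit formulas are products: with \<open>g = f\<^sub>1 th0 + f\<^sub>2 th1\<close>, the formulas say that the entries of
  \<open>\<E>\<^sup>e\<^sup>l\<^sup>l([2])\<close> are \<open>g(v z / a) thA(z a)\<close> and \<open>g(v z a) thA(z / a)\<close>, and those of \<open>\<E>\<^sup>e\<^sup>l\<^sup>l([1,1])\<close> are
  \<open>f\<^sub>0 thA(z v\<^sup>2 / a)\<close> and \<open>f\<^sub>0 thA(z v\<^sup>2 a)\<close> (\<open>theta_form_iff\<close>).

  One identity carries the algebra: \<open>thA(x y) thA(x / y) = th1(x) th0(y) - th0(x) th1(y)\<close>
  (\<open>thA_addition\<close>). It makes these products the minors of a matrix with two rows, so that the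
  Pluecker relations become three-term relations between values of \<open>g\<close> and \<open>thA\<close> (\<open>three_term\<close>).
  They turn the off-diagonal entry of the stable basis matrix into a product (\<open>Stab_numerator\<close>),
  and then every entry of the duality equation for functions of the above form follows from the single
  equation \<open>\<Upsilon> = q\<^bsup>1/4\<^esup> (q;q)\<^sub>\<infinity>\<^sup>2 f\<^sub>0 g(v)\<close> (\<open>theta_form_cond_B\<close>).

  For the passage from the conditions to the formulas, fix \<open>v\<close> and \<open>q\<close>. By the \<open>q\<close>-difference
  equations and the signs around \<open>z = 0\<close>, the entries of \<open>\<E>\<^sup>e\<^sup>l\<^sup>l([1,1])\<close> are theta functions of degree
  one in \<open>z\<close>, so they are multiples \<open>C(a)\<close> of translates of \<open>thA\<close> (\<open>theta_degree_1\<close>). The duality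
  equation shows that the two multiples agree and are elliptic in \<open>a\<close>, hence constant. The lower
  entry of \<open>\<E>\<^sup>e\<^sup>l\<^sup>l([2])\<close> is then antisymmetric in \<open>a\<close> and \<open>z\<close>. It is divisible by \<open>thA(z / a)\<close>, the
  quotient is constant along \<open>a z = const\<close>, and as a function of \<open>v z a\<close> it has degree two: this is
  \<open>g\<close>. The remaining entry follows from the three-term relation (\<open>duality_solution\<close>). This argument
  divides by \<open>\<Upsilon>\<close> and by theta values at powers of \<open>v\<close>. The limits at slope \<open>0\<close> show that \<open>\<Upsilon>\<close> does
  not vanish identically (\<open>Y_not_identically_zero\<close>), so it applies for generic \<open>(v, q)\<close>; the
  coefficients are given by special values of the entries, hence holomorphic, and the formulas extend
  by continuity (\<open>conditions_imp_theta_form\<close>).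

  As \<open>q \<rightarrow> 0\<close> after \<open>z \<mapsto> q\<^sup>-\<^sup>s z\<close>, only the terms of a theta series whose exponent is nearest to \<open>s\<close>
  survive (\<open>jtheta_limit\<close>). The limits at slope \<open>1/4\<close> give the leading terms of \<open>f\<^sub>0\<close> and \<open>f\<^sub>1\<close>. At
  slope \<open>1/2\<close> a contribution of \<open>f\<^sub>2\<close> would be a monomial that the canonical basis element lacks, so
  \<open>q\<^bsup>- c\<^sub>1 - 1/4\<^esup> f\<^sub>2\<close> tends to \<open>0\<close>. A function that is single-valued in \<open>q\<^bsup>1/2\<^esup>\<close> and has a limit is
  holomorphic at \<open>0\<close>, so this one is \<open>O(q\<^bsup>1/2\<^esup>)\<close>, which is the bound \<open>c\<^sub>2 \<ge> c\<^sub>1 + 3/4\<close> (\<open>coefficients_f1_f2\<close>). Conversely,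
  with this gap the term with \<open>f\<^sub>2\<close> is negligible at every slope (\<open>th_comb_limit\<close>), and the limits of
  the theta products are the listed canonical basis elements (\<open>theta_form_property_A\<close>).
\<close>

section \<open>Gaussian sums over the integers\<close>

lemma summable_exp_neg_abs_int: "(\<lambda>m::int. exp (- \<bar>real_of_int m + h\<bar>)) summable_on UNIV"
proof -
  have geo: "(\<lambda>n::nat. exp (- real n)) summable_on UNIV"
  proof (rule summable_nonneg_imp_summable_on)
    have "summable (\<lambda>n. exp (-1 :: real) ^ n)"
      by (rule summable_geometric) simp
    then show "summable (\<lambda>n. exp (- real n))"
      by (simp flip: exp_of_nat_mult)
  qed simp
  have 1: "(\<lambda>m::int. exp (- \<bar>real_of_int m\<bar>)) summable_on range int"
    by (subst summable_on_reindex) (use geo in \<open>auto simp: o_def inj_on_def\<close>)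
  have 2: "(\<lambda>m::int. exp (- \<bar>real_of_int m\<bar>)) summable_on range (\<lambda>n. - int n)"
    by (subst summable_on_reindex) (use geo in \<open>auto simp: o_def inj_on_def\<close>)
  have "m \<in> range int \<union> range (\<lambda>n. - int n)" for m :: int
    by (cases m rule: int_cases2) auto
  then have "range int \<union> range (\<lambda>n. - int n) = UNIV"
    by blast
  with summable_on_union[OF 1 2] have base: "(\<lambda>m::int. exp (- \<bar>real_of_int m\<bar>)) summable_on UNIV"
    by simp
  show ?thesis
  proof (rule summable_on_comparison_test)
    show "(\<lambda>m::int. exp \<bar>h\<bar> * exp (- \<bar>real_of_int m\<bar>)) summable_on UNIV"
      by (rule summable_on_cmult_right[OF base])
    show "exp (- \<bar>real_of_int m + h\<bar>) \<le> exp \<bar>h\<bar> * exp (- \<bar>real_of_int m\<bar>)" for m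
      by (simp flip: exp_add)
  qed auto
qed

text \<open>The weight \<open>(1 + u\<^sup>2)\<^sup>2\<close> leaves room for second order Taylor remainders of Gaussian terms, whose
  exponents are quadratic in \<open>u\<close>. The exponent \<open>- \<epsilon> u\<^sup>2 + (R + 3) \<bar>u\<bar>\<close> is bounded by completing the
  square; of the extra \<open>3 \<bar>u\<bar>\<close>, two absorb the weight and one is the decay.\<close>

lemma gaussian_decay_bound:
  fixes \<epsilon> R :: real
  assumes "\<epsilon> > 0"
  shows "\<exists>K\<ge>0. \<forall>u::real. (1 + u\<^sup>2)\<^sup>2 * exp (- \<epsilon> * u\<^sup>2 + R * \<bar>u\<bar>) \<le> K * exp (- \<bar>u\<bar>)"
proof (intro exI conjI allI)
  show "0 \<le> 4 * exp ((R + 3)\<^sup>2 / (4 * \<epsilon>))" by simp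
  fix u :: real
  have "1 + \<bar>u\<bar> + \<bar>u\<bar>\<^sup>2 / 2 \<le> exp \<bar>u\<bar>"
    by (rule exp_lower_Taylor_quadratic) simp
  then have "1 + u\<^sup>2 \<le> 2 * exp \<bar>u\<bar>"
    using abs_ge_zero[of u] by simp
  then have "(1 + u\<^sup>2)\<^sup>2 \<le> (2 * exp \<bar>u\<bar>)\<^sup>2"
    by (intro power_mono) auto
  also have "\<dots> = 4 * exp (2 * \<bar>u\<bar>)"
    by (simp add: power2_eq_square flip: exp_add)
  finally have 1: "(1 + u\<^sup>2)\<^sup>2 \<le> 4 * exp (2 * \<bar>u\<bar>)" .
  have "0 \<le> (2 * \<epsilon> * \<bar>u\<bar> - (R + 3))\<^sup>2" by simp
  then have "4 * \<epsilon> * (- \<epsilon> * u\<^sup>2 + (R + 3) * \<bar>u\<bar>) \<le> (R + 3)\<^sup>2"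
    by (simp add: power2_eq_square algebra_simps)
  then have 2: "- \<epsilon> * u\<^sup>2 + (R + 3) * \<bar>u\<bar> \<le> (R + 3)\<^sup>2 / (4 * \<epsilon>)"
    using assms by (simp add: field_simps)
  have "(1 + u\<^sup>2)\<^sup>2 * exp (- \<epsilon> * u\<^sup>2 + R * \<bar>u\<bar>) \<le> 4 * exp (2 * \<bar>u\<bar>) * exp (- \<epsilon> * u\<^sup>2 + R * \<bar>u\<bar>)"
    using 1 by (intro mult_right_mono) auto
  also have "\<dots> = 4 * exp ((- \<epsilon> * u\<^sup>2 + (R + 3) * \<bar>u\<bar>) - \<bar>u\<bar>)"
    by (simp add: algebra_simps flip: exp_add)
  also have "\<dots> \<le> 4 * exp ((R + 3)\<^sup>2 / (4 * \<epsilon>) - \<bar>u\<bar>)"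
    using 2 by simp
  finally show "(1 + u\<^sup>2)\<^sup>2 * exp (- \<epsilon> * u\<^sup>2 + R * \<bar>u\<bar>) \<le> 4 * exp ((R + 3)\<^sup>2 / (4 * \<epsilon>)) * exp (- \<bar>u\<bar>)"
    by (simp add: exp_diff exp_minus field_simps)
qed

text \<open>Dominated convergence for sums over a set: a summable majorant makes the sums over finite
  subsets converge uniformly.\<close>

lemma tendsto_infsum_dominated:
  fixes f :: "'a \<Rightarrow> 'b \<Rightarrow> 'c::banach"
  assumes lim: "\<And>x. ((\<lambda>y. f x y) \<longlongrightarrow> l x) F"
    and bound: "eventually (\<lambda>y. \<forall>x. norm (f x y) \<le> M x) F"
    and M: "M summable_on UNIV"
  shows "((\<lambda>y. \<Sum>\<^sub>\<infinity>x. f x y) \<longlongrightarrow> (\<Sum>\<^sub>\<infinity>x. l x)) F"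
proof (cases "F = bot")
  case False
  define Y where "Y = {y. \<forall>x. norm (f x y) \<le> M x}"
  have Y: "eventually (\<lambda>y. y \<in> Y) F"
    using bound by (simp add: Y_def)
  have lM: "norm (l x) \<le> M x" for x
  proof (rule tendsto_upperbound[OF tendsto_norm[OF lim]])
    show "\<forall>\<^sub>F y in F. norm (f x y) \<le> M x"
      using bound by eventually_elim simp
  qed (fact False)
  have unif: "uniform_limit Y (\<lambda>X y. \<Sum>x\<in>X. f x y) (\<lambda>y. \<Sum>\<^sub>\<infinity>x. f x y) (finite_subsets_at_top UNIV)"
    by (rule Weierstrass_m_test_general[OF _ M]) (auto simp: Y_def)
  have "l summable_on UNIV"
    by (rule abs_summable_summable, rule summable_on_comparison_test[OF M]) (use lM in auto)
  then have sumlim: "((\<lambda>X. \<Sum>x\<in>X. l x) \<longlongrightarrow> (\<Sum>\<^sub>\<infinity>x. l x)) (finite_subsets_at_top UNIV)"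
    by (rule infsum_tendsto)
  have "((\<lambda>y. \<Sum>\<^sub>\<infinity>x. f x y) \<longlongrightarrow> (\<Sum>\<^sub>\<infinity>x. l x)) F"
  proof (rule swap_uniform_limit'[OF _ sumlim unif])
    show "\<forall>\<^sub>F X in finite_subsets_at_top UNIV. ((\<lambda>y. \<Sum>x\<in>X. f x y) \<longlongrightarrow> (\<Sum>x\<in>X. l x)) F"
      by (intro always_eventually allI tendsto_sum lim)
    show "\<forall>\<^sub>F y in F. y \<in> Y" by (fact Y)
  qed (auto simp: False)
  then show ?thesis .
qed auto


section \<open>Holomorphy in several variables\<close>

text \<open>Complex differentiability as commutation of the real derivative with multiplication by the
  imaginary unit, which is \<open>J\<close> on the domain. In this form one set of closure rules serves functions
  of one, two, three and four variables.\<close>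

definition complex_diff :: "('a::real_normed_vector \<Rightarrow> 'a) \<Rightarrow> ('a \<Rightarrow> complex) \<Rightarrow> 'a \<Rightarrow> bool" where
  "complex_diff J f x \<longleftrightarrow> (\<exists>D. (f has_derivative D) (at x) \<and> (\<forall>h. D (J h) = \<i> * D h))"

definition J2 :: "complex \<times> complex \<Rightarrow> complex \<times> complex" where
  "J2 = (\<lambda>(a, b). (\<i> * a, \<i> * b))"

definition J3 :: "complex \<times> complex \<times> complex \<Rightarrow> complex \<times> complex \<times> complex" where
  "J3 = (\<lambda>(a, b, c). (\<i> * a, \<i> * b, \<i> * c))"

definition J4 :: "pt \<Rightarrow> pt" where
  "J4 = (\<lambda>(a, b, c, d). (\<i> * a, \<i> * b, \<i> * c, \<i> * d))"

lemma complex_linear_scale: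
  fixes D :: "'a::real_normed_vector \<Rightarrow> complex"
  assumes "bounded_linear D" "\<And>h. D (J h) = \<i> * D h"
  shows "D (Re c *\<^sub>R h) + D (Im c *\<^sub>R J h) = c * D h"
proof -
  have "D (Re c *\<^sub>R h) + D (Im c *\<^sub>R J h) = Re c *\<^sub>R D h + Im c *\<^sub>R (\<i> * D h)"
    using assms(2) by (simp add: linear_cmul[OF bounded_linear.linear[OF assms(1)]])
  also have "\<dots> = (of_real (Re c) + \<i> * of_real (Im c)) * D h"
    by (simp add: scaleR_conv_of_real algebra_simps)
  also have "\<dots> = c * D h"
    using complex_eq[of c] by simp
  finally show ?thesis .
qed

lemma holomorphic2_on_iff: "holomorphic2_on f S \<longleftrightarrow> (\<forall>x\<in>S. complex_diff J2 f x)"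
proof -
  have "(\<exists>d1 d2. (f has_derivative (\<lambda>(h1, h2). d1 * h1 + d2 * h2)) (at x)) \<longleftrightarrow> complex_diff J2 f x" for x
  proof
    assume "\<exists>d1 d2. (f has_derivative (\<lambda>(h1, h2). d1 * h1 + d2 * h2)) (at x)"
    then obtain d1 d2 where D: "(f has_derivative (\<lambda>(h1, h2). d1 * h1 + d2 * h2)) (at x)" (is "(f has_derivative ?D) _")
      by blast
    have "?D (J2 h) = \<i> * ?D h" for h
      by (cases h) (simp add: J2_def algebra_simps)
    with D show "complex_diff J2 f x"
      unfolding complex_diff_def by blast
  next
    assume "complex_diff J2 f x"
    then obtain D where D: "(f has_derivative D) (at x)" "\<And>h. D (J2 h) = \<i> * D h"
      by (auto simp: complex_diff_def)
    note bl = has_derivative_bounded_linear[OF D(1)]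
    have "D (h1, h2) = D (1, 0) * h1 + D (0, 1) * h2" for h1 h2
    proof -
      have "(h1, h2) = (Re h1 *\<^sub>R (1, 0) + Im h1 *\<^sub>R J2 (1, 0)) + (Re h2 *\<^sub>R (0, 1) + Im h2 *\<^sub>R J2 (0, 1))"
        by (simp add: J2_def complex_eq_iff)
      then show ?thesis
        by (simp only: linear_add[OF bounded_linear.linear[OF bl]] complex_linear_scale[where D = D and J = "J2", OF bl D(2)] mult.commute)
    qed
    note * = this
    have eq: "D = (\<lambda>(h1, h2). D (1, 0) * h1 + D (0, 1) * h2)" (is "_ = ?R")
    proof (rule ext)
      fix h show "D h = ?R h"
        by (cases h, hypsubst, unfold prod.case, rule *)
    qed
    show "\<exists>d1 d2. (f has_derivative (\<lambda>(h1, h2). d1 * h1 + d2 * h2)) (at x)"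
      by (intro exI, rule has_derivative_eq_rhs[OF D(1) eq])
  qed
  then show ?thesis by (simp add: holomorphic2_on_def)
qed

lemma holomorphic3_onI:
  assumes "\<And>x. x \<in> S \<Longrightarrow> complex_diff J3 f x"
  shows "holomorphic3_on f S"
  unfolding holomorphic3_on_def
proof
  fix x assume "x \<in> S"
  then obtain D where D: "(f has_derivative D) (at x)" "\<And>h. D (J3 h) = \<i> * D h"
    using assms unfolding complex_diff_def by blast
  note bl = has_derivative_bounded_linear[OF D(1)]
  have "D (h1, h2, h3) = D (1, 0, 0) * h1 + D (0, 1, 0) * h2 + D (0, 0, 1) * h3" for h1 h2 h3
  proof -
    have "(h1, h2, h3) = (Re h1 *\<^sub>R (1, 0, 0) + Im h1 *\<^sub>R J3 (1, 0, 0))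
        + (Re h2 *\<^sub>R (0, 1, 0) + Im h2 *\<^sub>R J3 (0, 1, 0)) + (Re h3 *\<^sub>R (0, 0, 1) + Im h3 *\<^sub>R J3 (0, 0, 1))"
      by (simp add: J3_def complex_eq_iff)
    then show ?thesis
      by (simp only: linear_add[OF bounded_linear.linear[OF bl]] complex_linear_scale[where D = D and J = "J3", OF bl D(2)] mult.commute)
  qed
  note * = this
  have eq: "D = (\<lambda>(h1, h2, h3). D (1, 0, 0) * h1 + D (0, 1, 0) * h2 + D (0, 0, 1) * h3)" (is "_ = ?R")
  proof (rule ext)
    fix h show "D h = ?R h"
      by (cases h rule: prod_cases3, hypsubst, unfold prod.case, rule *)
  qed
  show "\<exists>d1 d2 d3. (f has_derivative (\<lambda>(h1, h2, h3). d1 * h1 + d2 * h2 + d3 * h3)) (at x)"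
    by (intro exI, rule has_derivative_eq_rhs[OF D(1) eq])
qed

lemma holomorphic4_on_iff: "holomorphic4_on f S \<longleftrightarrow> (\<forall>x\<in>S. complex_diff J4 f x)"
proof -
  have "(\<exists>d1 d2 d3 d4. (f has_derivative (\<lambda>(h1, h2, h3, h4). d1 * h1 + d2 * h2 + d3 * h3 + d4 * h4)) (at x))
      \<longleftrightarrow> complex_diff J4 f x" for x
  proof
    assume "\<exists>d1 d2 d3 d4. (f has_derivative (\<lambda>(h1, h2, h3, h4). d1 * h1 + d2 * h2 + d3 * h3 + d4 * h4)) (at x)"
    then obtain d1 d2 d3 d4 where D: "(f has_derivative (\<lambda>(h1, h2, h3, h4). d1 * h1 + d2 * h2 + d3 * h3 + d4 * h4)) (at x)" (is "(f has_derivative ?D) _")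
      by blast
    have "?D (J4 h) = \<i> * ?D h" for h
      by (cases h) (simp add: J4_def algebra_simps)
    with D show "complex_diff J4 f x"
      unfolding complex_diff_def by blast
  next
    assume "complex_diff J4 f x"
    then obtain D where D: "(f has_derivative D) (at x)" "\<And>h. D (J4 h) = \<i> * D h"
      by (auto simp: complex_diff_def)
    note bl = has_derivative_bounded_linear[OF D(1)]
    have "D (h1, h2, h3, h4) = D (1, 0, 0, 0) * h1 + D (0, 1, 0, 0) * h2 + D (0, 0, 1, 0) * h3 + D (0, 0, 0, 1) * h4"
      for h1 h2 h3 h4
    proof -
      have "(h1, h2, h3, h4) = (Re h1 *\<^sub>R (1, 0, 0, 0) + Im h1 *\<^sub>R J4 (1, 0, 0, 0))
        + (Re h2 *\<^sub>R (0, 1, 0, 0) + Im h2 *\<^sub>R J4 (0, 1, 0, 0)) + (Re h3 *\<^sub>R (0, 0, 1, 0) + Im h3 *\<^sub>R J4 (0, 0, 1, 0))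
        + (Re h4 *\<^sub>R (0, 0, 0, 1) + Im h4 *\<^sub>R J4 (0, 0, 0, 1))"
        by (simp add: J4_def complex_eq_iff)
      then show ?thesis
        by (simp only: linear_add[OF bounded_linear.linear[OF bl]] complex_linear_scale[where D = D and J = "J4", OF bl D(2)] mult.commute)
    qed
    note * = this
    have eq: "D = (\<lambda>(h1, h2, h3, h4). D (1, 0, 0, 0) * h1 + D (0, 1, 0, 0) * h2 + D (0, 0, 1, 0) * h3 + D (0, 0, 0, 1) * h4)" (is "_ = ?R")
    proof (rule ext)
      fix h show "D h = ?R h"
        by (cases h rule: prod_cases4, hypsubst, unfold prod.case, rule *)
    qed
    show "\<exists>d1 d2 d3 d4. (f has_derivative (\<lambda>(h1, h2, h3, h4). d1 * h1 + d2 * h2 + d3 * h3 + d4 * h4)) (at x)"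
      by (intro exI, rule has_derivative_eq_rhs[OF D(1) eq])
  qed
  then show ?thesis by (simp add: holomorphic4_on_def)
qed

lemma complex_diff_imp_isCont: "complex_diff J f x \<Longrightarrow> isCont f x"
  by (auto simp: complex_diff_def has_derivative_continuous)

lemma complex_diff_const: "complex_diff J (\<lambda>_. c) x"
  unfolding complex_diff_def by (rule exI[of _ "\<lambda>_. 0"]) auto

lemma complex_diff_add:
  assumes "complex_diff J f x" "complex_diff J g x"
  shows "complex_diff J (\<lambda>x. f x + g x) x"
proof -
  obtain D E where "(f has_derivative D) (at x)" "\<And>h. D (J h) = \<i> * D h"
    "(g has_derivative E) (at x)" "\<And>h. E (J h) = \<i> * E h"
    using assms by (auto simp: complex_diff_def)
  then show ?thesis
    unfolding complex_diff_def
    by (intro exI[of _ "\<lambda>h. D h + E h"]) (auto intro!: derivative_eq_intros simp: algebra_simps)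
qed

lemma complex_diff_mult:
  assumes "complex_diff J f x" "complex_diff J g x"
  shows "complex_diff J (\<lambda>x. f x * g x) x"
proof -
  obtain D E where "(f has_derivative D) (at x)" "\<And>h. D (J h) = \<i> * D h"
    "(g has_derivative E) (at x)" "\<And>h. E (J h) = \<i> * E h"
    using assms by (auto simp: complex_diff_def)
  then show ?thesis
    unfolding complex_diff_def
    by (intro exI[of _ "\<lambda>h. f x * E h + D h * g x"]) (auto intro!: derivative_eq_intros simp: algebra_simps)
qed

lemma complex_diff_compose_field:
  assumes "complex_diff J f x" "(g has_field_derivative g') (at (f x))"
  shows "complex_diff J (\<lambda>x. g (f x)) x"
proof -
  obtain D where D: "(f has_derivative D) (at x)" "\<And>h. D (J h) = \<i> * D h"
    using assms by (auto simp: complex_diff_def)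
  have "((\<lambda>x. g (f x)) has_derivative (\<lambda>h. g' * D h)) (at x)"
    using has_derivative_compose[OF D(1)] assms(2) by (simp add: has_field_derivative_def)
  with D(2) show ?thesis
    unfolding complex_diff_def by (intro exI[of _ "\<lambda>h. g' * D h"]) (auto simp: algebra_simps)
qed

lemma complex_diff_inverse:
  assumes "complex_diff J f x" "f x \<noteq> 0"
  shows "complex_diff J (\<lambda>x. inverse (f x)) x"
  by (rule complex_diff_compose_field[OF assms(1) DERIV_inverse[OF assms(2)]])

lemma complex_diff_divide:
  assumes "complex_diff J f x" "complex_diff J g x" "g x \<noteq> 0"
  shows "complex_diff J (\<lambda>x. f x / g x) x"
  using complex_diff_mult[OF assms(1) complex_diff_inverse[OF assms(2,3)]]
  by (simp add: divide_inverse)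

lemma complex_diff_exp:
  assumes "complex_diff J f x"
  shows "complex_diff J (\<lambda>x. exp (f x)) x"
  by (rule complex_diff_compose_field[OF assms DERIV_exp])

lemma complex_diff_compose:
  assumes "complex_diff J f (L x)" "(L has_derivative L') (at x)" "\<And>h. L' (J' h) = J (L' h)"
  shows "complex_diff J' (\<lambda>x. f (L x)) x"
proof -
  obtain D where D: "(f has_derivative D) (at (L x))" "\<And>h. D (J h) = \<i> * D h"
    using assms by (auto simp: complex_diff_def)
  have "((\<lambda>x. f (L x)) has_derivative (\<lambda>h. D (L' h))) (at x)"
    using has_derivative_compose[OF assms(2) D(1)] .
  with D(2) assms(3) show ?thesis
    unfolding complex_diff_def by (intro exI[of _ "\<lambda>h. D (L' h)"]) auto
qed

lemma complex_diff_linear: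
  assumes "bounded_linear f" "\<And>h. f (J h) = \<i> * f h"
  shows "complex_diff J f x"
  unfolding complex_diff_def using bounded_linear_imp_has_derivative[OF assms(1)] assms(2) by auto

lemma complex_diff_pair2:
  assumes "complex_diff J2 F (f x, g x)" "complex_diff J f x" "complex_diff J g x"
  shows "complex_diff J (\<lambda>x. F (f x, g x)) x"
proof -
  obtain D E where DE: "(f has_derivative D) (at x)" "\<And>h. D (J h) = \<i> * D h"
    "(g has_derivative E) (at x)" "\<And>h. E (J h) = \<i> * E h"
    using assms by (auto simp: complex_diff_def)
  have "((\<lambda>x. (f x, g x)) has_derivative (\<lambda>h. (D h, E h))) (at x)"
    by (intro has_derivative_Pair DE)
  then show ?thesis
    by (rule complex_diff_compose[where L = "\<lambda>x. (f x, g x)", OF assms(1)]) (auto simp: DE J2_def)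
qed

lemma complex_diff_pair4:
  assumes "complex_diff J4 F (a x, b x, c x, d x)"
    "complex_diff J a x" "complex_diff J b x" "complex_diff J c x" "complex_diff J d x"
  shows "complex_diff J (\<lambda>x. F (a x, b x, c x, d x)) x"
proof -
  obtain A B C D where DE: "(a has_derivative A) (at x)" "\<And>h. A (J h) = \<i> * A h"
    "(b has_derivative B) (at x)" "\<And>h. B (J h) = \<i> * B h"
    "(c has_derivative C) (at x)" "\<And>h. C (J h) = \<i> * C h"
    "(d has_derivative D) (at x)" "\<And>h. D (J h) = \<i> * D h"
    using assms by (auto simp: complex_diff_def)
  have "((\<lambda>x. (a x, b x, c x, d x)) has_derivative (\<lambda>h. (A h, B h, C h, D h))) (at x)"
    by (intro has_derivative_Pair DE)
  then show ?thesis
    by (rule complex_diff_compose[where L = "\<lambda>x. (a x, b x, c x, d x)", OF assms(1)]) (auto simp: DE J4_def)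
qed

lemma complex_diff_field_iff: "complex_diff ((*) \<i>) f x \<longleftrightarrow> f field_differentiable at x"
proof
  assume "complex_diff ((*) \<i>) f x"
  then obtain D where D: "(f has_derivative D) (at x)" "\<And>h. D (\<i> * h) = \<i> * D h"
    by (auto simp: complex_diff_def)
  have "D h = D 1 * h" for h
  proof -
    note bl = has_derivative_bounded_linear[OF D(1)]
    have "h = Re h *\<^sub>R 1 + Im h *\<^sub>R (\<i> * 1)"
      by (simp add: complex_eq_iff)
    then have "D h = D (Re h *\<^sub>R 1) + D (Im h *\<^sub>R (\<i> * 1))"
      by (metis linear_add[OF bounded_linear.linear[OF bl]])
    also have "\<dots> = h * D 1"
      by (rule complex_linear_scale[where D = D and J = "(*) \<i>", OF bl D(2)])
    finally show ?thesis by (simp only: mult.commute)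
  qed
  then have eq: "D = (*) (D 1)"
    by (rule ext)
  show "f field_differentiable at x"
    unfolding field_differentiable_def has_field_derivative_def
    by (rule exI, rule has_derivative_eq_rhs[OF D(1) eq])
next
  assume "f field_differentiable at x"
  then show "complex_diff ((*) \<i>) f x"
    by (auto simp: field_differentiable_def has_field_derivative_def complex_diff_def algebra_simps)
qed

lemma complex_diff_coords2: "complex_diff J2 fst x" "complex_diff J2 snd x"
  by (auto intro!: complex_diff_linear bounded_linear_fst bounded_linear_snd simp: J2_def split: prod.splits)

section \<open>Theta series in two variables\<close>

text \<open>The terms of the series \<open>\<Sum>\<^sub>m e\<^sup>m q\<^bsup>c (m + h)\<^sup>2\<^esup> x\<^bsup>2 c (m + h)\<^esup>\<close> in logarithmic coordinates. The three
  theta series that are needed differ only in the sign \<open>e\<close>, the scale \<open>c\<close> and the offset \<open>h\<close>, and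
  their analysis is common to all.\<close>

definition jtheta_term :: "complex \<Rightarrow> real \<Rightarrow> real \<Rightarrow> complex \<Rightarrow> complex \<Rightarrow> int \<Rightarrow> complex" where
  "jtheta_term e c h Q X m =
     e powi m * exp (of_real c * (of_real ((of_int m + h)\<^sup>2) * Q + 2 * of_real (of_int m + h) * X))"

definition jtheta :: "complex \<Rightarrow> real \<Rightarrow> real \<Rightarrow> complex \<Rightarrow> complex \<Rightarrow> complex" where
  "jtheta e c h Q X = (\<Sum>\<^sub>\<infinity>m. jtheta_term e c h Q X m)"

lemma norm_jtheta_term:
  assumes "norm e = 1"
  shows "norm (jtheta_term e c h Q X m) = exp (c * ((of_int m + h)\<^sup>2 * Re Q + 2 * (of_int m + h) * Re X))"
  using assms by (simp add: jtheta_term_def norm_mult norm_power_int)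

lemma jtheta_term_bound:
  assumes "norm e = 1" "c > 0" "\<epsilon> > 0"
  shows "\<exists>K\<ge>0. \<forall>Q X m. Re Q \<le> - \<epsilon> \<longrightarrow> \<bar>Re X\<bar> \<le> R \<longrightarrow>
    (1 + (of_int m + h)\<^sup>2)\<^sup>2 * norm (jtheta_term e c h Q X m) \<le> K * exp (- \<bar>of_int m + h\<bar>)"
proof -
  obtain K where K: "K \<ge> 0" "\<And>u::real. (1 + u\<^sup>2)\<^sup>2 * exp (- (c * \<epsilon>) * u\<^sup>2 + (2 * c * R) * \<bar>u\<bar>) \<le> K * exp (- \<bar>u\<bar>)"
    using gaussian_decay_bound[of "c * \<epsilon>" "2 * c * R"] assms by auto
  show ?thesis
  proof (intro exI conjI allI impI)
    show "K \<ge> 0" by fact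
    fix Q X m assume Q: "Re Q \<le> - \<epsilon>" and X: "\<bar>Re X\<bar> \<le> R"
    define u where "u = real_of_int m + h"
    have "u\<^sup>2 * Re Q \<le> u\<^sup>2 * (- \<epsilon>)"
      using Q by (intro mult_left_mono) auto
    moreover have "u * Re X \<le> \<bar>u\<bar> * R"
      using abs_ge_self[of "u * Re X"] mult_left_mono[OF X, of "\<bar>u\<bar>"] by (simp add: abs_mult)
    ultimately have "u\<^sup>2 * Re Q + 2 * u * Re X \<le> u\<^sup>2 * (- \<epsilon>) + 2 * (\<bar>u\<bar> * R)"
      by linarith
    then have "c * (u\<^sup>2 * Re Q + 2 * u * Re X) \<le> c * (u\<^sup>2 * (- \<epsilon>) + 2 * (\<bar>u\<bar> * R))"
      using assms(2) by simp
    then have "norm (jtheta_term e c h Q X m) \<le> exp (- (c * \<epsilon>) * u\<^sup>2 + (2 * c * R) * \<bar>u\<bar>)"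
      unfolding norm_jtheta_term[OF assms(1)] u_def[symmetric] by (simp add: algebra_simps)
    then have "(1 + u\<^sup>2)\<^sup>2 * norm (jtheta_term e c h Q X m)
        \<le> (1 + u\<^sup>2)\<^sup>2 * exp (- (c * \<epsilon>) * u\<^sup>2 + (2 * c * R) * \<bar>u\<bar>)"
      by (intro mult_left_mono) auto
    also have "\<dots> \<le> K * exp (- \<bar>u\<bar>)" by (rule K)
    finally show "(1 + (of_int m + h)\<^sup>2)\<^sup>2 * norm (jtheta_term e c h Q X m) \<le> K * exp (- \<bar>of_int m + h\<bar>)"
      unfolding u_def .
  qed
qed

lemma jtheta_term_abs_summable_weighted:
  assumes "norm e = 1" "c > 0" "Re Q < 0"
  shows "(\<lambda>m. (1 + (of_int m + h)\<^sup>2)\<^sup>2 * norm (jtheta_term e c h Q X m)) summable_on UNIV"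
proof -
  obtain K where K: "K \<ge> 0" "\<And>m. (1 + (of_int m + h)\<^sup>2)\<^sup>2 * norm (jtheta_term e c h Q X m) \<le> K * exp (- \<bar>of_int m + h\<bar>)"
    using jtheta_term_bound[OF assms(1,2), of "- Re Q" "\<bar>Re X\<bar>" h] assms(3) by auto
  show ?thesis
    by (rule summable_on_comparison_test[OF summable_on_cmult_right[OF summable_exp_neg_abs_int]])
       (use K in auto)
qed

lemma jtheta_term_abs_summable_factor:
  assumes "norm e = 1" "c > 0" "Re Q < 0"
    and "\<And>m::int. norm (a m) \<le> C * (1 + (of_int m + h)\<^sup>2)\<^sup>2"
  shows "(\<lambda>m. norm (jtheta_term e c h Q X m * a m)) summable_on UNIV"
proof (rule summable_on_comparison_test)
  show "(\<lambda>m. C * ((1 + (of_int m + h)\<^sup>2)\<^sup>2 * norm (jtheta_term e c h Q X m))) summable_on UNIV"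
    by (intro summable_on_cmult_right jtheta_term_abs_summable_weighted assms)
  fix m :: int
  show "norm (jtheta_term e c h Q X m * a m)
      \<le> C * ((1 + (of_int m + h)\<^sup>2)\<^sup>2 * norm (jtheta_term e c h Q X m))"
    using mult_left_mono[OF assms(4)[of m], of "norm (jtheta_term e c h Q X m)"]
    by (simp add: norm_mult algebra_simps)
qed auto

lemma one_le_weight: "1 \<le> (1 + u\<^sup>2)\<^sup>2" for u :: real
  by (rule one_le_power) simp

lemma jtheta_term_abs_summable:
  assumes "norm e = 1" "c > 0" "Re Q < 0"
  shows "(\<lambda>m. norm (jtheta_term e c h Q X m)) summable_on UNIV"
  using jtheta_term_abs_summable_factor[OF assms, of "\<lambda>_. 1" 1 h X] one_le_weight by simp

lemma jtheta_cmult: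
  assumes "\<And>m. jtheta_term e c h Q X m = k * g m"
  shows "jtheta e c h Q X = k * (\<Sum>\<^sub>\<infinity>m. g m)"
  unfolding jtheta_def assms by (rule infsum_cmult_right')

lemma has_sum_jtheta:
  assumes "norm e = 1" "c > 0" "Re Q < 0"
  shows "(jtheta_term e c h Q X has_sum jtheta e c h Q X) UNIV"
  unfolding jtheta_def
  by (rule has_sum_infsum[OF abs_summable_summable[OF jtheta_term_abs_summable[OF assms]]])

text \<open>Termwise differentiation, jointly in \<open>q\<close> and \<open>x\<close>. A displacement changes the exponent of a
  term by \<open>\<delta>\<close>, which is of order \<open>1 + u\<^sup>2\<close> with \<open>u = m + h\<close>, and the remainder is at most
  \<open>exp \<bar>\<delta>\<bar> \<bar>\<delta>\<bar>\<^sup>2\<close> times the term. A small displacement takes up half of the Gaussian decay, and the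
  other half makes these remainders summable.\<close>

lemma jtheta_complex_diff:
  assumes e: "norm e = 1" and c: "c > 0" and Q: "Re Q < 0"
  shows "complex_diff J2 (\<lambda>(Q, X). jtheta e c h Q X) (Q, X)"
proof -
  define \<epsilon> where "\<epsilon> = - Re Q / 2"
  have \<epsilon>: "\<epsilon> > 0" using Q by (simp add: \<epsilon>_def)
  define R where "R = norm X + \<epsilon>"
  define u where "u = (\<lambda>m. real_of_int m + h)"
  define t where "t = jtheta_term e c h Q X"
  define d1 where "d1 = (\<Sum>\<^sub>\<infinity>m. t m * of_real (c * (u m)\<^sup>2))"
  define d2 where "d2 = (\<Sum>\<^sub>\<infinity>m. t m * of_real (2 * c * u m))"
  define D where "D = (\<lambda>(a, b). d1 * a + d2 * b)"
  obtain K where K: "K \<ge> 0" "\<And>v::real. (1 + v\<^sup>2)\<^sup>2 * exp (- (c * \<epsilon>) * v\<^sup>2 + (2 * c * R) * \<bar>v\<bar>) \<le> K * exp (- \<bar>v\<bar>)"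
    using gaussian_decay_bound[of "c * \<epsilon>" "2 * c * R"] c \<epsilon> by auto
  define S where "S = (\<Sum>\<^sub>\<infinity>m::int. exp (- \<bar>real_of_int m + h\<bar>))"
  have abs_u: "2 * \<bar>v\<bar> \<le> 1 + v\<^sup>2" for v :: real
    using zero_le_power2[of "\<bar>v\<bar> - 1"] unfolding power2_diff by simp
  have weight: "1 + v\<^sup>2 \<le> (1 + v\<^sup>2)\<^sup>2" for v :: real
    using mult_left_mono[of 1 "1 + v\<^sup>2" "1 + v\<^sup>2"] by (simp add: power2_eq_square)
  have sum1: "((\<lambda>m. t m * of_real (c * (u m)\<^sup>2)) has_sum d1) UNIV"
    unfolding d1_def t_def
  proof (rule has_sum_infsum[OF abs_summable_summable[OF jtheta_term_abs_summable_factor[OF e c Q]]])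
    fix m
    have "norm (complex_of_real (c * (u m)\<^sup>2)) = c * (u m)\<^sup>2"
      unfolding norm_of_real using c by simp
    also have "\<dots> \<le> c * (1 + (u m)\<^sup>2)\<^sup>2"
      using weight[of "u m"] c by (intro mult_left_mono) auto
    finally show "norm (complex_of_real (c * (u m)\<^sup>2)) \<le> c * (1 + (of_int m + h)\<^sup>2)\<^sup>2"
      unfolding u_def .
  qed
  have sum2: "((\<lambda>m. t m * of_real (2 * c * u m)) has_sum d2) UNIV"
    unfolding d2_def t_def
  proof (rule has_sum_infsum[OF abs_summable_summable[OF jtheta_term_abs_summable_factor[OF e c Q]]])
    fix m
    have "norm (complex_of_real (2 * c * u m)) = c * (2 * \<bar>u m\<bar>)"
      unfolding norm_of_real using c by (simp add: abs_mult)
    also have "\<dots> \<le> c * (1 + (u m)\<^sup>2)\<^sup>2"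
      using order_trans[OF abs_u[of "u m"] weight[of "u m"]] c by (intro mult_left_mono) auto
    finally show "norm (complex_of_real (2 * c * u m)) \<le> c * (1 + (of_int m + h)\<^sup>2)\<^sup>2"
      unfolding u_def .
  qed
  have bl: "bounded_linear D"
    unfolding D_def case_prod_beta
    by (intro bounded_linear_add bounded_linear_const_mult bounded_linear_fst bounded_linear_snd)
  have main: "norm ((case y of (Q, X) \<Rightarrow> jtheta e c h Q X) - jtheta e c h Q X - D (y - (Q, X)))
       \<le> 4 * c\<^sup>2 * K * S * (norm (y - (Q, X)))\<^sup>2" if y: "dist y (Q, X) < \<epsilon>" for y
  proof -
    obtain a b where ab: "y = (Q + a, X + b)"
      by (metis add_diff_cancel_left' diff_add_cancel surj_pair add.commute)
    define \<eta> where "\<eta> = norm (y - (Q, X))"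
    have yd: "y - (Q, X) = (a, b)" by (simp add: ab)
    have \<eta>: "norm a \<le> \<eta>" "norm b \<le> \<eta>" "\<eta> < \<epsilon>" "\<eta> \<ge> 0"
      using y norm_fst_le[of a b] norm_snd_le[of b a] yd
      by (auto simp: \<eta>_def dist_norm)
    have Qa: "Re (Q + a) < 0"
      using \<eta> abs_Re_le_cmod[of a] by (simp add: \<epsilon>_def)
    define \<delta> where "\<delta> = (\<lambda>m. of_real (c * (u m)\<^sup>2) * a + of_real (2 * c * u m) * b)"
    have tt: "jtheta_term e c h (Q + a) (X + b) m = t m * exp (\<delta> m)" for m
      unfolding jtheta_term_def t_def \<delta>_def u_def mult.assoc exp_add[symmetric]
      by (simp add: algebra_simps)
    have hs: "((\<lambda>m. t m * exp (\<delta> m) - t m - (t m * of_real (c * (u m)\<^sup>2) * a + t m * of_real (2 * c * u m) * b))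
        has_sum (jtheta e c h (Q + a) (X + b) - jtheta e c h Q X - (d1 * a + d2 * b))) UNIV"
    proof -
      have h1: "((\<lambda>m. t m * exp (\<delta> m)) has_sum jtheta e c h (Q + a) (X + b)) UNIV"
        using has_sum_jtheta[OF e c Qa, of h "X + b"] tt by (simp cong: has_sum_cong)
      have h2: "((\<lambda>m. - t m) has_sum - jtheta e c h Q X) UNIV"
        using has_sum_jtheta[OF e c Q, of h X] unfolding t_def by (rule has_sum_uminusI)
      have h3: "((\<lambda>m. - (t m * of_real (c * (u m)\<^sup>2) * a + t m * of_real (2 * c * u m) * b)) has_sum - (d1 * a + d2 * b)) UNIV"
        by (intro has_sum_uminusI has_sum_add has_sum_cmult_left sum1 sum2)
      from has_sum_add[OF has_sum_add[OF h1 h2] h3] show ?thesis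
        unfolding diff_conv_add_uminus .
    qed
    have term_le: "norm (t m * exp (\<delta> m) - t m - (t m * of_real (c * (u m)\<^sup>2) * a + t m * of_real (2 * c * u m) * b))
        \<le> 4 * c\<^sup>2 * K * \<eta>\<^sup>2 * exp (- \<bar>u m\<bar>)" for m
    proof -
      have \<delta>le: "norm (\<delta> m) \<le> c * (u m)\<^sup>2 * \<eta> + 2 * c * \<bar>u m\<bar> * \<eta>"
      proof -
        have "norm (\<delta> m) \<le> norm (of_real (c * (u m)\<^sup>2) * a) + norm (of_real (2 * c * u m) * b)"
          unfolding \<delta>_def by (rule norm_triangle_ineq)
        also have "\<dots> = c * (u m)\<^sup>2 * norm a + 2 * c * \<bar>u m\<bar> * norm b"
          unfolding norm_mult norm_of_real using c by (simp add: abs_mult)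
        also have "\<dots> \<le> c * (u m)\<^sup>2 * \<eta> + 2 * c * \<bar>u m\<bar> * \<eta>"
          using \<eta> c by (intro add_mono mult_left_mono) auto
        finally show ?thesis .
      qed
      have \<delta>le2: "norm (\<delta> m) \<le> 2 * c * (1 + (u m)\<^sup>2) * \<eta>"
      proof -
        have "(u m)\<^sup>2 + 2 * \<bar>u m\<bar> \<le> 2 * (1 + (u m)\<^sup>2)"
          using abs_u[of "u m"] by simp
        then have "c * \<eta> * ((u m)\<^sup>2 + 2 * \<bar>u m\<bar>) \<le> c * \<eta> * (2 * (1 + (u m)\<^sup>2))"
          using c \<eta> by (intro mult_left_mono) auto
        with \<delta>le show ?thesis by (simp add: algebra_simps)
      qed
      have "norm (exp (\<delta> m) - 1 - \<delta> m) \<le> exp \<bar>Re (\<delta> m)\<bar> * (norm (\<delta> m))\<^sup>2"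
        using Taylor_exp[of "\<delta> m" 1] by (simp add: algebra_simps power2_eq_square)
      also have "\<dots> \<le> exp (norm (\<delta> m)) * (2 * c * (1 + (u m)\<^sup>2) * \<eta>)\<^sup>2"
        using abs_Re_le_cmod \<delta>le2 by (intro mult_mono power_mono) auto
      finally have r: "norm (exp (\<delta> m) - 1 - \<delta> m) \<le> exp (norm (\<delta> m)) * (2 * c * (1 + (u m)\<^sup>2) * \<eta>)\<^sup>2" .
      have "norm (t m) * exp (norm (\<delta> m)) \<le> exp (- (c * \<epsilon>) * (u m)\<^sup>2 + (2 * c * R) * \<bar>u m\<bar>)"
      proof -
        have "c * ((u m)\<^sup>2 * Re Q + 2 * u m * Re X) + norm (\<delta> m)
            \<le> c * ((u m)\<^sup>2 * Re Q + 2 * u m * Re X) + c * (u m)\<^sup>2 * \<eta> + 2 * c * \<bar>u m\<bar> * \<eta>"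
          using \<delta>le by simp
        also have "\<dots> = c * ((u m)\<^sup>2 * (Re Q + \<eta>) + 2 * (u m * Re X + \<bar>u m\<bar> * \<eta>))"
          by (simp add: algebra_simps)
        also have "\<dots> \<le> c * ((u m)\<^sup>2 * (- \<epsilon>) + 2 * (\<bar>u m\<bar> * R))"
        proof (intro mult_left_mono add_mono)
          show "Re Q + \<eta> \<le> - \<epsilon>" using \<eta> by (simp add: \<epsilon>_def)
          have "u m * Re X \<le> \<bar>u m\<bar> * norm X"
            using abs_ge_self[of "u m * Re X"] mult_left_mono[OF abs_Re_le_cmod[of X], of "\<bar>u m\<bar>"]
            by (simp add: abs_mult)
          moreover have "\<bar>u m\<bar> * \<eta> \<le> \<bar>u m\<bar> * \<epsilon>"
            using \<eta> by (intro mult_left_mono) auto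
          ultimately show "u m * Re X + \<bar>u m\<bar> * \<eta> \<le> \<bar>u m\<bar> * R"
            by (simp add: R_def algebra_simps)
        qed (use c in auto)
        finally show ?thesis
          unfolding t_def norm_jtheta_term[OF e] exp_add[symmetric]
          by (simp add: u_def algebra_simps)
      qed
      then have "norm (t m) * norm (exp (\<delta> m) - 1 - \<delta> m)
          \<le> exp (- (c * \<epsilon>) * (u m)\<^sup>2 + (2 * c * R) * \<bar>u m\<bar>) * (2 * c * (1 + (u m)\<^sup>2) * \<eta>)\<^sup>2"
        using mult_left_mono[OF r, of "norm (t m)"] mult_right_mono[of _ _ "(2 * c * (1 + (u m)\<^sup>2) * \<eta>)\<^sup>2"]
        by (smt (verit) mult.assoc norm_ge_zero zero_le_power2)
      also have "\<dots> = 4 * c\<^sup>2 * \<eta>\<^sup>2 * ((1 + (u m)\<^sup>2)\<^sup>2 * exp (- (c * \<epsilon>) * (u m)\<^sup>2 + (2 * c * R) * \<bar>u m\<bar>))"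
        by algebra
      also have "\<dots> \<le> 4 * c\<^sup>2 * \<eta>\<^sup>2 * (K * exp (- \<bar>u m\<bar>))"
        by (intro mult_left_mono K) auto
      finally have "norm (t m * (exp (\<delta> m) - 1 - \<delta> m)) \<le> 4 * c\<^sup>2 * K * \<eta>\<^sup>2 * exp (- \<bar>u m\<bar>)"
        by (simp add: norm_mult mult_ac)
      also have "t m * (exp (\<delta> m) - 1 - \<delta> m)
          = t m * exp (\<delta> m) - t m - (t m * of_real (c * (u m)\<^sup>2) * a + t m * of_real (2 * c * u m) * b)"
        by (simp add: \<delta>_def algebra_simps)
      finally show ?thesis .
    qed
    have "norm (jtheta e c h (Q + a) (X + b) - jtheta e c h Q X - (d1 * a + d2 * b))
        \<le> 4 * c\<^sup>2 * K * \<eta>\<^sup>2 * S"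
    proof (rule norm_infsum_le[OF hs])
      show "((\<lambda>m. 4 * c\<^sup>2 * K * \<eta>\<^sup>2 * exp (- \<bar>u m\<bar>)) has_sum 4 * c\<^sup>2 * K * \<eta>\<^sup>2 * S) UNIV"
        unfolding S_def u_def by (intro has_sum_cmult_right has_sum_infsum summable_exp_neg_abs_int)
    qed (rule term_le)
    then show ?thesis
      unfolding yd by (simp add: ab D_def \<eta>_def yd mult_ac)
  qed
  have "((\<lambda>(Q, X). jtheta e c h Q X) has_derivative D) (at (Q, X))"
  proof (rule has_derivativeI_sandwich[OF \<epsilon> bl])
    fix y assume "y \<noteq> (Q, X)" "dist y (Q, X) < \<epsilon>"
    then show "norm ((case y of (Q, X) \<Rightarrow> jtheta e c h Q X) - (case (Q, X) of (Q, X) \<Rightarrow> jtheta e c h Q X) - D (y - (Q, X)))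
        / norm (y - (Q, X)) \<le> 4 * c\<^sup>2 * K * S * norm (y - (Q, X))"
      using main[of y] by (simp add: divide_simps power2_eq_square mult_ac)
  next
    have "((\<lambda>y. 4 * c\<^sup>2 * K * S * norm (y - (Q, X))) \<longlongrightarrow> 4 * c\<^sup>2 * K * S * norm ((Q, X) - (Q, X))) (at (Q, X))"
      by (intro tendsto_intros)
    then show "((\<lambda>y. 4 * c\<^sup>2 * K * S * norm (y - (Q, X))) \<longlongrightarrow> 0) (at (Q, X))"
      by simp
  qed
  moreover have "D (J2 h) = \<i> * D h" for h
    by (cases h) (simp add: D_def J2_def algebra_simps)
  ultimately show ?thesis
    unfolding complex_diff_def by blast
qed

text \<open>The shift of the summation index by one.\<close>

lemma jtheta_quasi_period:
  assumes "e * e = 1"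
  shows "jtheta e c h Q (X + Q) = e * exp (- of_real c * (Q + 2 * X)) * jtheta e c h Q X"
proof -
  have e0: "e \<noteq> 0" and inv: "inverse e = e"
    using assms by (auto simp: inverse_unique)
  have "jtheta e c h Q X = (\<Sum>\<^sub>\<infinity>m. jtheta_term e c h Q X (m + 1))"
    unfolding jtheta_def
    by (rule infsum_reindex_bij_betw[symmetric]) (rule bij_betwI[of _ _ _ "\<lambda>m. m - 1"], auto)
  moreover have "jtheta_term e c h Q (X + Q) m = e * exp (- of_real c * (Q + 2 * X)) * jtheta_term e c h Q X (m + 1)" for m
  proof -
    have "e powi m = e * e powi (m + 1)"
      using e0 assms by (simp add: power_int_add mult_ac)
    then show ?thesis
      unfolding jtheta_term_def
      by (simp add: power2_eq_square algebra_simps flip: exp_add)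
  qed
  ultimately show ?thesis
    using jtheta_cmult by metis
qed

lemma exp_2pi_int: "exp (2 * of_real pi * \<i> * of_int n) = 1"
  using exp_integer_2pi[of "of_int n"] by (simp add: mult_ac)

lemma jtheta_shift_2pi_X:
  assumes "2 * c \<in> \<int>"
  shows "jtheta e c h Q (X + 2 * of_real pi * \<i> * of_int k) = exp (4 * of_real (c * h) * of_real pi * \<i> * of_int k) * jtheta e c h Q X"
proof -
  obtain n where n: "2 * c = of_int n" using assms Ints_cases by blast
  have cn: "complex_of_real c = of_int n / 2"
    using n by (metis of_real_of_int_eq of_real_mult of_real_numeral nonzero_mult_div_cancel_left zero_neq_numeral)
  have "jtheta_term e c h Q (X + 2 * of_real pi * \<i> * of_int k) m
      = exp (4 * of_real (c * h) * of_real pi * \<i> * of_int k) * jtheta_term e c h Q X m" for m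
  proof -
    have "jtheta_term e c h Q (X + 2 * of_real pi * \<i> * of_int k) m
      = exp (2 * of_real pi * \<i> * of_int (n * m * k)) * (exp (4 * of_real (c * h) * of_real pi * \<i> * of_int k) * jtheta_term e c h Q X m)"
      unfolding jtheta_term_def by (simp add: cn algebra_simps flip: exp_add)
    then show ?thesis by (simp only: exp_2pi_int mult_1)
  qed
  then show ?thesis
    unfolding jtheta_def[of e c h Q X] by (rule jtheta_cmult)
qed

lemma jtheta_shift_2pi_Q:
  assumes "\<And>m::int. c * of_int m * (of_int m + 2 * h) \<in> \<int>"
  shows "jtheta e c h (Q + 2 * of_real pi * \<i> * of_int k) X = exp (2 * of_real (c * h\<^sup>2) * of_real pi * \<i> * of_int k) * jtheta e c h Q X"
proof -
  have "jtheta_term e c h (Q + 2 * of_real pi * \<i> * of_int k) X m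
      = exp (2 * of_real (c * h\<^sup>2) * of_real pi * \<i> * of_int k) * jtheta_term e c h Q X m" for m
  proof -
    obtain n where n: "c * of_int m * (of_int m + 2 * h) = of_int n" using assms[of m] Ints_cases by blast
    have n': "complex_of_real c * of_int m * (of_int m + 2 * of_real h) = of_int n"
      using arg_cong[OF n, of complex_of_real] by simp
    have "jtheta_term e c h (Q + 2 * of_real pi * \<i> * of_int k) X m
      = exp ((complex_of_real c * of_int m * (of_int m + 2 * of_real h)) * (2 * of_real pi * \<i> * of_int k)) * (exp (2 * of_real (c * h\<^sup>2) * of_real pi * \<i> * of_int k) * jtheta_term e c h Q X m)"
      unfolding jtheta_term_def by (simp add: algebra_simps power2_eq_square flip: exp_add)
    also have "\<dots> = exp (2 * of_real pi * \<i> * of_int (n * k)) * (exp (2 * of_real (c * h\<^sup>2) * of_real pi * \<i> * of_int k) * jtheta_term e c h Q X m)"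
      unfolding n' by (simp add: algebra_simps)
    finally show ?thesis by (simp only: exp_2pi_int mult_1)
  qed
  then show ?thesis
    unfolding jtheta_def[of e c h Q X] by (rule jtheta_cmult)
qed

lemma jtheta_minus:
  assumes "e * e = 1" "2 * h = of_int n"
  shows "jtheta e c h Q (- X) = e powi n * jtheta e c h Q X"
proof -
  have e0: "e \<noteq> 0" and inv: "inverse e = e"
    using assms by (auto simp: inverse_unique)
  have "jtheta e c h Q (- X) = (\<Sum>\<^sub>\<infinity>m. jtheta_term e c h Q (- X) (- m - n))"
    unfolding jtheta_def
    by (rule infsum_reindex_bij_betw[symmetric]) (rule bij_betwI[of _ _ _ "\<lambda>m. - m - n"], auto)
  moreover have *: "jtheta_term e c h Q (- X) (- m - n) = e powi n * jtheta_term e c h Q X m" for m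
  proof -
    have "e powi (- m - n) = inverse e powi m * inverse e powi n"
      using e0 by (simp add: power_int_diff power_int_minus power_int_inverse field_simps)
    then have 1: "e powi (- m - n) = e powi m * e powi n" by (simp only: inv)
    have 2: "of_int (- m - n) + h = - (of_int m + h)" using assms(2) by simp
    show ?thesis
      unfolding jtheta_term_def 1 2 by (simp add: power2_eq_square algebra_simps)
  qed
  ultimately show ?thesis
    unfolding * infsum_cmult_right' by (simp add: jtheta_def)
qed


subsection \<open>The limit \<open>q \<rightarrow> 0\<close>\<close>

lemma eventually_q_to_0: "eventually P q_to_0 \<longleftrightarrow> (\<exists>B. \<forall>Q. Re Q \<le> B \<longrightarrow> P Q)"
  unfolding q_to_0_def eventually_filtercomap eventually_at_bot_linorder by auto

lemma q_to_0_neq_bot: "q_to_0 \<noteq> bot"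
proof
  assume "q_to_0 = bot"
  then have "eventually (\<lambda>_. False) q_to_0" by simp
  then obtain B where "\<And>Q. \<not> Re Q \<le> B" by (auto simp: eventually_q_to_0)
  from this[of "of_real B"] show False by simp
qed

lemma tendsto_q_power_0:
  assumes "d > 0"
  shows "((\<lambda>Q. exp (of_real d * Q)) \<longlongrightarrow> 0) q_to_0"
proof -
  have "filterlim (\<lambda>Q. d * Re Q) at_bot q_to_0"
    by (rule filterlim_tendsto_pos_mult_at_bot[OF tendsto_const assms])
       (simp add: q_to_0_def filterlim_filtercomap)
  then have "((\<lambda>Q. exp (d * Re Q)) \<longlongrightarrow> 0) q_to_0"
    by (rule filterlim_compose[OF exp_at_bot])
  then show ?thesis
    by (rule Lim_null_comparison[rotated]) simp
qed

text \<open>Under \<open>z \<mapsto> q\<^sup>-\<^sup>s z\<close> the exponents of \<open>q\<close> become the numbers \<open>c ((m + h - s)\<^sup>2 - s\<^sup>2)\<close>; in the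
  limit only the indices \<open>m\<close> with \<open>m + h\<close> nearest to the slope \<open>s\<close> survive.\<close>

lemma jtheta_limit:
  assumes e: "norm e = 1" and c: "c > 0"
    and d: "\<And>m. d \<le> (real_of_int m + h - s)\<^sup>2"
    and M: "finite M" "\<And>m. m \<in> M \<longleftrightarrow> (real_of_int m + h - s)\<^sup>2 = d"
  shows "((\<lambda>Q. exp (of_real (c * (s\<^sup>2 - d)) * Q) * jtheta e c h Q (X - of_real s * Q))
     \<longlongrightarrow> (\<Sum>m\<in>M. e powi m * exp (2 * of_real c * of_real (of_int m + h) * X))) q_to_0"
proof -
  define a where "a = (\<lambda>m. c * ((real_of_int m + h - s)\<^sup>2 - d))"
  define f where "f = (\<lambda>m Q. e powi m * exp (of_real (a m) * Q + 2 * of_real c * of_real (of_int m + h) * X))"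
  define l where "l = (\<lambda>m. if m \<in> M then e powi m * exp (2 * of_real c * of_real (of_int m + h) * X) else 0)"
  have a0: "a m \<ge> 0" for m using d[of m] c by (simp add: a_def)
  have fe: "exp (of_real (c * (s\<^sup>2 - d)) * Q) * jtheta e c h Q (X - of_real s * Q) = (\<Sum>\<^sub>\<infinity>m. f m Q)" for Q
  proof -
    have "exp (of_real (c * (s\<^sup>2 - d)) * Q) * jtheta_term e c h Q (X - of_real s * Q) m = f m Q" for m
      unfolding jtheta_term_def f_def a_def
      by (simp add: algebra_simps power2_eq_square flip: exp_add)
    then show ?thesis
      unfolding jtheta_def by (simp flip: infsum_cmult_right')
  qed
  have nf: "norm (f m Q) = exp (a m * Re Q + 2 * c * (of_int m + h) * Re X)" for m Q
    unfolding f_def using e by (simp add: norm_mult norm_power_int)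
  have "((\<lambda>Q. \<Sum>\<^sub>\<infinity>m. f m Q) \<longlongrightarrow> (\<Sum>\<^sub>\<infinity>m. l m)) q_to_0"
  proof (rule tendsto_infsum_dominated)
    fix m
    show "((\<lambda>Q. f m Q) \<longlongrightarrow> l m) q_to_0"
    proof (cases "m \<in> M")
      case True
      then have "a m = 0" using M by (simp add: a_def)
      then show ?thesis using True by (simp add: f_def l_def)
    next
      case False
      then have "a m > 0" using M(2)[of m] d[of m] c by (auto simp: a_def)
      from tendsto_mult[OF tendsto_const[of "e powi m * exp (2 * of_real c * of_real (of_int m + h) * X)"] tendsto_q_power_0[OF this]]
      show ?thesis using False by (simp add: f_def l_def exp_add mult_ac)
    qed
  next
    \<comment> \<open>The exponents \<open>a m\<close> are nonnegative, so the absolute values of the terms decrease with \<open>\<bar>q\<bar>\<close>.\<close>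
    show "\<forall>\<^sub>F Q in q_to_0. \<forall>m. norm (f m Q) \<le> norm (f m (- 1))"
      unfolding eventually_q_to_0
    proof (intro exI allI impI)
      fix Q :: complex and m :: int assume "Re Q \<le> - 1"
      then show "norm (f m Q) \<le> norm (f m (- 1))"
        unfolding nf using mult_left_mono[OF _ a0[of m], of "Re Q" "- 1"] by simp
    qed
    have "norm (f m (- 1)) = norm (exp (of_real (c * (s\<^sup>2 - d)) * (- 1)) * jtheta_term e c h (- 1) (X - of_real s * (- 1)) m)" for m
      unfolding jtheta_term_def f_def a_def
      by (simp add: algebra_simps power2_eq_square flip: exp_add)
    moreover have "(\<lambda>m. norm (exp (of_real (c * (s\<^sup>2 - d)) * (- 1)) * jtheta_term e c h (- 1) (X - of_real s * (- 1)) m)) summable_on UNIV"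
      unfolding norm_mult by (intro summable_on_cmult_right jtheta_term_abs_summable e c) simp
    ultimately show "(\<lambda>m. norm (f m (- 1))) summable_on UNIV" by simp
  qed
  also have "(\<Sum>\<^sub>\<infinity>m. l m) = (\<Sum>\<^sub>\<infinity>m\<in>M. l m)"
    by (rule infsum_cong_neutral) (auto simp: l_def)
  also have "\<dots> = (\<Sum>m\<in>M. e powi m * exp (2 * of_real c * of_real (of_int m + h) * X))"
    using M(1) by (simp add: l_def)
  finally show ?thesis unfolding fe .
qed

subsection \<open>The alternating series and the basis of degree two\<close>

definition thA :: "complex \<Rightarrow> complex \<Rightarrow> complex" where
  "thA = jtheta (- 1) (1 / 2) (1 / 2)"

definition th0 :: "complex \<Rightarrow> complex \<Rightarrow> complex" where
  "th0 = jtheta 1 1 0"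

definition th1 :: "complex \<Rightarrow> complex \<Rightarrow> complex" where
  "th1 = jtheta 1 1 (1 / 2)"

lemma has_sum_thA: "Re Q < 0 \<Longrightarrow> (jtheta_term (- 1) (1 / 2) (1 / 2) Q X has_sum thA Q X) UNIV"
  and has_sum_th0: "Re Q < 0 \<Longrightarrow> (jtheta_term 1 1 0 Q X has_sum th0 Q X) UNIV"
  and has_sum_th1: "Re Q < 0 \<Longrightarrow> (jtheta_term 1 1 (1 / 2) Q X has_sum th1 Q X) UNIV"
  unfolding thA_def th0_def th1_def by (simp_all add: has_sum_jtheta)

lemma thA_complex_diff: "Re Q < 0 \<Longrightarrow> complex_diff J2 (\<lambda>(Q, X). thA Q X) (Q, X)"
  and th0_complex_diff: "Re Q < 0 \<Longrightarrow> complex_diff J2 (\<lambda>(Q, X). th0 Q X) (Q, X)"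
  and th1_complex_diff: "Re Q < 0 \<Longrightarrow> complex_diff J2 (\<lambda>(Q, X). th1 Q X) (Q, X)"
  unfolding thA_def th0_def th1_def by (simp_all add: jtheta_complex_diff)

lemma thA_quasi_period: "thA Q (X + Q) = - exp (- Q / 2 - X) * thA Q X"
proof -
  have *: "- complex_of_real (1 / 2) * (Q + 2 * X) = - Q / 2 - X" by (simp add: field_simps)
  show ?thesis
    using jtheta_quasi_period[of "- 1" "1 / 2" "1 / 2" Q X] unfolding * by (simp add: thA_def)
qed

lemma th0_quasi_period: "th0 Q (X + Q) = exp (- Q - 2 * X) * th0 Q X"
  and th1_quasi_period: "th1 Q (X + Q) = exp (- Q - 2 * X) * th1 Q X"
  using jtheta_quasi_period[of 1 1 0 Q X] jtheta_quasi_period[of 1 1 "1 / 2" Q X]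
  by (simp_all add: th0_def th1_def algebra_simps)

lemma thA_minus [simp]: "thA Q (- X) = - thA Q X"
  and th0_minus [simp]: "th0 Q (- X) = th0 Q X"
  and th1_minus [simp]: "th1 Q (- X) = th1 Q X"
  using jtheta_minus[of "- 1" "1 / 2" 1] jtheta_minus[of 1 0 0] jtheta_minus[of 1 "1 / 2" 1]
  by (simp_all add: thA_def th0_def th1_def)

lemma thA_minus_commute: "thA Q (X - Y) = - thA Q (Y - X)"
  using thA_minus[of Q "Y - X"] by simp

lemma thA_0 [simp]: "thA Q 0 = 0"
  using thA_minus[of Q 0] by simp

lemma thA_shift_2pi: "thA Q (X + 2 * of_real pi * \<i>) = - thA Q X"
  using jtheta_shift_2pi_X[of "1 / 2" "- 1" "1 / 2" Q X 1] by (simp add: thA_def mult_ac)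

lemma th0_shift_2pi: "th0 Q (X + 2 * of_real pi * \<i>) = th0 Q X"
  using jtheta_shift_2pi_X[of 1 1 0 Q X 1] by (simp add: th0_def)

lemma th1_shift_2pi: "th1 Q (X + 2 * of_real pi * \<i>) = th1 Q X"
  using jtheta_shift_2pi_X[of 1 1 "1 / 2" Q X 1] by (simp add: th1_def mult_ac)

lemma half_int_square: "(1 / 2) * of_int m * (of_int m + 2 * (1 / 2)) \<in> (\<int> :: real set)" for m :: int
proof -
  have "even (m * (m + 1))" by simp
  then obtain k where "m * (m + 1) = 2 * k" by (elim evenE)
  then have "of_int m * (of_int m + 1) = (2 * of_int k :: real)"
    by (metis of_int_1 of_int_add of_int_mult of_int_numeral)
  then have "(1 / 2) * of_int m * (of_int m + 2 * (1 / 2)) = (of_int k :: real)" by simp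
  then show ?thesis by simp
qed

lemma exp_eqE:
  assumes "exp X = exp (X' :: complex)"
  obtains k :: int where "X = X' + 2 * of_real pi * \<i> * of_int k"
  using assms unfolding exp_eq by (metis (no_types, opaque_lifting) mult.commute mult.assoc of_int_mult of_int_numeral of_real_of_int_eq of_real_mult)

text \<open>Up to fractional powers in front, the series only depend on \<open>q\<close> and \<open>x\<close>.\<close>

lemma thA_single_valued:
  assumes "exp Q = exp Q'" "exp X = exp X'"
  shows "exp (- Q / 8 - X / 2) * thA Q X = exp (- Q' / 8 - X' / 2) * thA Q' X'"
proof -
  obtain k where k: "Q = Q' + 2 * of_real pi * \<i> * of_int k" using assms(1) by (rule exp_eqE)
  obtain n where n: "X = X' + 2 * of_real pi * \<i> * of_int n" using assms(2) by (rule exp_eqE)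
  have "thA Q X = exp (of_real pi * \<i> * of_int n) * (exp (of_real pi * \<i> * of_int k / 4) * thA Q' X')"
    unfolding k n thA_def
    using jtheta_shift_2pi_X[of "1 / 2" "- 1" "1 / 2" "Q' + 2 * of_real pi * \<i> * of_int k" X' n]
      jtheta_shift_2pi_Q[of "1 / 2" "1 / 2" "- 1" Q' k X', OF half_int_square]
    by (simp add: power2_eq_square mult_ac)
  moreover have "exp (- Q / 8 - X / 2) * exp (of_real pi * \<i> * of_int n) * exp (of_real pi * \<i> * of_int k / 4)
      = exp (- Q' / 8 - X' / 2)"
    unfolding k n exp_add[symmetric] by (rule arg_cong[of _ _ exp]) (simp add: field_simps)
  ultimately show ?thesis
    by (simp flip: mult.assoc)
qed

lemma th0_single_valued:
  assumes "exp Q = exp Q'" "exp X = exp X'"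
  shows "th0 Q X = th0 Q' X'"
proof -
  obtain k where k: "Q = Q' + 2 * of_real pi * \<i> * of_int k" using assms(1) by (rule exp_eqE)
  obtain n where n: "X = X' + 2 * of_real pi * \<i> * of_int n" using assms(2) by (rule exp_eqE)
  show ?thesis
    unfolding k n th0_def
    using jtheta_shift_2pi_X[of 1 1 0 "Q' + 2 * of_real pi * \<i> * of_int k" X' n]
      jtheta_shift_2pi_Q[of 1 0 1 Q' k X']
    by simp
qed

lemma th1_single_valued:
  assumes "exp Q = exp Q'" "exp X = exp X'"
  shows "exp (- Q / 4) * th1 Q X = exp (- Q' / 4) * th1 Q' X'"
proof -
  obtain k where k: "Q = Q' + 2 * of_real pi * \<i> * of_int k" using assms(1) by (rule exp_eqE)
  obtain n where n: "X = X' + 2 * of_real pi * \<i> * of_int n" using assms(2) by (rule exp_eqE)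
  have "th1 Q X = exp (2 * of_real pi * \<i> * of_int n) * (exp (of_real pi * \<i> * of_int k / 2) * th1 Q' X')"
    unfolding k n th1_def
    using jtheta_shift_2pi_X[of 1 1 "1 / 2" "Q' + 2 * of_real pi * \<i> * of_int k" X' n]
      jtheta_shift_2pi_Q[of 1 "1 / 2" 1 Q' k X']
    by (simp add: power2_eq_square mult_ac)
  moreover have "exp (- Q / 4) * exp (of_real pi * \<i> * of_int k / 2) = exp (- Q' / 4)"
    unfolding k exp_add[symmetric] by (rule arg_cong[of _ _ exp]) (simp add: field_simps)
  ultimately show ?thesis
    unfolding exp_2pi_int by (simp flip: mult.assoc)
qed


subsection \<open>The addition formula\<close>

lemma has_sum_product:
  fixes f :: "'a \<Rightarrow> complex" and g :: "'b \<Rightarrow> complex"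
  assumes "(\<lambda>x. norm (f x)) summable_on UNIV" "(\<lambda>y. norm (g y)) summable_on UNIV"
    "(f has_sum a) UNIV" "(g has_sum b) UNIV"
  shows "((\<lambda>p. f (fst p) * g (snd p)) has_sum a * b) UNIV"
proof -
  have "((\<lambda>p. f (fst p) * g (snd p)) has_sum a * b) (UNIV \<times> UNIV)"
  proof (rule has_sum_SigmaI)
    show "((\<lambda>y. f (fst (x, y)) * g (snd (x, y))) has_sum f x * b) UNIV" for x
      unfolding fst_conv snd_conv by (rule has_sum_cmult_right[OF assms(4)])
    show "((\<lambda>x. f x * b) has_sum a * b) UNIV"
      by (rule has_sum_cmult_left[OF assms(3)])
    have "(\<lambda>p. norm (f (fst p)) * norm (g (snd p))) summable_on (UNIV \<times> UNIV)"
    proof (rule summable_on_SigmaI)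
      show "((\<lambda>y. norm (f (fst (x, y))) * norm (g (snd (x, y)))) has_sum norm (f x) * (\<Sum>\<^sub>\<infinity>y. norm (g y))) UNIV" for x
        unfolding fst_conv snd_conv by (rule has_sum_cmult_right[OF has_sum_infsum[OF assms(2)]])
      show "(\<lambda>x. norm (f x) * (\<Sum>\<^sub>\<infinity>y. norm (g y))) summable_on UNIV"
        by (rule summable_on_cmult_left[OF assms(1)])
    qed auto
    note * = this
    show "(\<lambda>p. f (fst p) * g (snd p)) summable_on (UNIV \<times> UNIV)"
      by (rule abs_summable_summable) (use * in \<open>simp add: norm_mult\<close>)
  qed
  then show ?thesis by simp
qed

lemma sign_exp_mult:
  fixes s s' a b c d :: complex
  assumes "s * s' = 1" "a + b = c + d"
  shows "(s * exp a) * (s' * exp b) = (1 powi i * exp c) * (1 powi j * exp d)"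
proof -
  have "(s * exp a) * (s' * exp b) = (s * s') * exp (a + b)"
    by (simp add: exp_add mult_ac)
  then show ?thesis by (simp add: assms exp_add)
qed

lemma sign_exp_mult_neg:
  fixes s s' a b c d :: complex
  assumes "s * s' = - 1" "a + b = c + d"
  shows "(s * exp a) * (s' * exp b) = - ((1 powi i * exp c) * (1 powi j * exp d))"
proof -
  have "(s * exp a) * (s' * exp b) = (s * s') * exp (a + b)"
    by (simp add: exp_add mult_ac)
  then show ?thesis by (simp add: assms exp_add)
qed

text \<open>In the product of two alternating series with indices \<open>m\<close> and \<open>n\<close>, the quadratic form
  \<open>((m + 1/2)\<^sup>2 + (n + 1/2)\<^sup>2) / 2\<close> is diagonal in half the sum and half the difference of the two. These
  are an integer plus \<open>1/2\<close> and an integer if \<open>m + n\<close> is even, and the other way round, with sign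
  \<open>- 1\<close>, if \<open>m + n\<close> is odd.\<close>

lemma thA_addition:
  assumes Q: "Re Q < 0"
  shows "thA Q (X + Y) * thA Q (X - Y) = th1 Q X * th0 Q Y - th0 Q X * th1 Q Y"
proof -
  let ?T = "jtheta_term (- 1) (1 / 2) (1 / 2) Q"
  define F where "F = (\<lambda>p. ?T (X + Y) (fst p) * ?T (X - Y) (snd p))"
  define Ev where "Ev = {p :: int \<times> int. even (fst p + snd p)}"
  have U: "Ev \<union> - Ev = UNIV" by auto
  have F: "(F has_sum thA Q (X + Y) * thA Q (X - Y)) UNIV"
    unfolding F_def by (intro has_sum_product has_sum_thA jtheta_term_abs_summable Q) auto
  have 1: "((\<lambda>p. jtheta_term 1 1 (1 / 2) Q X (fst p) * jtheta_term 1 1 0 Q Y (snd p)) has_sum th1 Q X * th0 Q Y) UNIV"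
    by (intro has_sum_product has_sum_th1 has_sum_th0 jtheta_term_abs_summable Q) auto
  have 2: "((\<lambda>p. jtheta_term 1 1 0 Q X (fst p) * jtheta_term 1 1 (1 / 2) Q Y (snd p)) has_sum th0 Q X * th1 Q Y) UNIV"
    by (intro has_sum_product has_sum_th1 has_sum_th0 jtheta_term_abs_summable Q) auto
  have ev: "(F has_sum th1 Q X * th0 Q Y) Ev"
  proof (rule iffD1[OF has_sum_reindex_bij_witness[where S = UNIV and T = Ev and h = F
      and i = "\<lambda>(m, n). ((m + n) div 2, (m - n) div 2)" and j = "\<lambda>(l, k). (l + k, l - k)"] 1])
    fix p :: "int \<times> int"
    obtain l k where p: "p = (l, k)" by (cases p)
    show "(\<lambda>(m, n). ((m + n) div 2, (m - n) div 2)) ((\<lambda>(l, k). (l + k, l - k)) p) = p"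
      by (simp add: p)
    show "(\<lambda>(l, k). (l + k, l - k)) p \<in> Ev" by (simp add: p Ev_def)
    have "(- 1 :: complex) powi (l + k) * (- 1) powi (l - k) = 1"
      by (simp flip: power_int_add)
    then show "F ((\<lambda>(l, k). (l + k, l - k)) p) = jtheta_term 1 1 (1 / 2) Q X (fst p) * jtheta_term 1 1 0 Q Y (snd p)"
      unfolding F_def p jtheta_term_def prod.case fst_conv snd_conv
      by (rule sign_exp_mult) (simp_all add: power2_eq_square field_simps)
  next
    fix b :: "int \<times> int" assume "b \<in> Ev"
    then show "(\<lambda>(l, k). (l + k, l - k)) ((\<lambda>(m, n). ((m + n) div 2, (m - n) div 2)) b) = b"
      by (cases b) (simp add: Ev_def, presburger)
  qed auto
  have od: "(F has_sum - (th0 Q X * th1 Q Y)) (- Ev)"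
  proof (rule iffD1[OF has_sum_reindex_bij_witness[where S = UNIV and T = "- Ev" and h = F
      and i = "\<lambda>(m, n). ((m + n + 1) div 2, (m - n - 1) div 2)" and j = "\<lambda>(l, k). (l + k, l - k - 1)"] has_sum_uminusI[OF 2]])
    fix p :: "int \<times> int"
    obtain l k where p: "p = (l, k)" by (cases p)
    show "(\<lambda>(m, n). ((m + n + 1) div 2, (m - n - 1) div 2)) ((\<lambda>(l, k). (l + k, l - k - 1)) p) = p"
      by (simp add: p)
    show "(\<lambda>(l, k). (l + k, l - k - 1)) p \<in> - Ev" by (simp add: p Ev_def)
    have "(- 1 :: complex) powi (l + k) * (- 1) powi (l - k - 1) = - 1"
      by (simp flip: power_int_add)
    then show "F ((\<lambda>(l, k). (l + k, l - k - 1)) p) = - (jtheta_term 1 1 0 Q X (fst p) * jtheta_term 1 1 (1 / 2) Q Y (snd p))"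
      unfolding F_def p jtheta_term_def prod.case fst_conv snd_conv
      by (rule sign_exp_mult_neg) (simp_all add: power2_eq_square field_simps)
  next
    fix b :: "int \<times> int" assume "b \<in> - Ev"
    then have "odd (fst b + snd b)" by (simp add: Ev_def)
    then show "(\<lambda>(l, k). (l + k, l - k - 1)) ((\<lambda>(m, n). ((m + n + 1) div 2, (m - n - 1) div 2)) b) = b"
      by (cases b) (simp, presburger)
  qed auto
  have "(F has_sum th1 Q X * th0 Q Y + - (th0 Q X * th1 Q Y)) (Ev \<union> - Ev)"
    by (intro has_sum_Un_disjoint ev od) auto
  with F show ?thesis unfolding U by (simp add: has_sum_unique)
qed


section \<open>The triple product\<close>

definition euler_prod :: "complex \<Rightarrow> complex \<Rightarrow> complex" where
  "euler_prod Q X = (\<Prod>m. 1 - exp Q ^ Suc m * exp X)"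

lemma euler_prod_convergent:
  assumes "Re Q < 0"
  shows "convergent_prod (\<lambda>m. 1 - exp Q ^ Suc m * exp X)"
proof -
  have "summable (\<lambda>m. exp (Re Q) ^ m * (norm (exp Q * exp X)))"
    using assms by (intro summable_mult2 summable_geometric) simp
  then show ?thesis
    by (intro abs_convergent_prod_imp_convergent_prod summable_imp_abs_convergent_prod)
       (simp add: norm_mult norm_power mult_ac)
qed

lemma qpoch_eq: "qpoch Q = euler_prod Q 0"
  by (simp add: qpoch_def euler_prod_def)

lemma theta_eq:
  assumes "Re Q < 0"
  shows "theta Q X = (exp (X / 2) - exp (- X / 2)) * (euler_prod Q X * euler_prod Q (- X))"
  unfolding theta_def euler_prod_def
  by (subst prodinf_mult[OF euler_prod_convergent[OF assms] euler_prod_convergent[OF assms]]) simp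

lemma qpoch_nonzero:
  assumes "Re Q < 0"
  shows "qpoch Q \<noteq> 0"
  unfolding qpoch_eq euler_prod_def
proof (rule prodinf_nonzero[OF euler_prod_convergent[OF assms]])
  fix m
  have "norm (exp Q ^ Suc m * exp 0) < 1"
    unfolding exp_zero mult_1_right norm_power using assms by (intro power_Suc_less_one) auto
  then show "1 - exp Q ^ Suc m * exp 0 \<noteq> 0" by auto
qed

lemma euler_prod_LIMSEQ:
  assumes "Re Q < 0"
  shows "(\<lambda>n. \<Prod>m<n. 1 - exp Q ^ Suc m * exp X) \<longlonglongrightarrow> euler_prod Q X"
  using convergent_prod_LIMSEQ[OF euler_prod_convergent[OF assms, of X]]
  unfolding euler_prod_def by (subst (asm) lessThan_Suc_atMost[symmetric]) (rule LIMSEQ_imp_Suc)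

lemma euler_prod_continuous:
  assumes "Re Q < 0"
  shows "isCont (\<lambda>(Q, X). euler_prod Q X) (Q, X)"
proof -
  define \<epsilon> where "\<epsilon> = - Re Q / 2"
  define A where "A = cball (Q, X) \<epsilon>"
  have \<epsilon>: "\<epsilon> > 0" using assms by (simp add: \<epsilon>_def)
  have A: "Re Q' \<le> - \<epsilon> \<and> Re X' \<le> Re X + \<epsilon>" if "(Q', X') \<in> A" for Q' X'
  proof -
    have "norm (Q' - Q) \<le> \<epsilon>" "norm (X' - X) \<le> \<epsilon>"
      using that norm_fst_le[of "Q - Q'" "X - X'"] norm_snd_le[of "X - X'" "Q - Q'"]
      by (auto simp: A_def dist_norm norm_minus_commute)
    then show ?thesis
      using complex_Re_le_cmod[of "Q' - Q"] complex_Re_le_cmod[of "X' - X"] by (simp add: \<epsilon>_def)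
  qed
  let ?f = "\<lambda>m (Q, X). 1 - exp Q ^ Suc m * exp X :: complex"
  have "uniformly_convergent_on A (\<lambda>N x. \<Sum>n<N. norm (?f n x - 1))"
  proof (rule Weierstrass_m_test')
    show "summable (\<lambda>n. exp (- \<epsilon>) ^ n * (exp (- \<epsilon>) * exp (Re X + \<epsilon>)))"
      using \<epsilon> by (intro summable_mult2 summable_geometric) simp
    fix n x assume "x \<in> A"
    then obtain Q' X' where x: "x = (Q', X')" and b: "Re Q' \<le> - \<epsilon>" "Re X' \<le> Re X + \<epsilon>"
      using A by (cases x) auto
    have "exp (Re Q') ^ Suc n * exp (Re X') \<le> exp (- \<epsilon>) ^ Suc n * exp (Re X + \<epsilon>)"
      using b by (intro mult_mono power_mono) auto
    then show "norm (norm (?f n x - 1)) \<le> exp (- \<epsilon>) ^ n * (exp (- \<epsilon>) * exp (Re X + \<epsilon>))"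
      unfolding x by (simp add: norm_mult norm_power mult_ac)
  qed
  then have uc: "uniformly_convergent_on A (\<lambda>N x. \<Prod>n<N. ?f n x)"
    by (intro uniformly_convergent_on_prod')
       (auto simp: A_def case_prod_beta intro!: continuous_intros)
  have "lim (\<lambda>N. \<Prod>n<N. ?f n x) = (case x of (Q, X) \<Rightarrow> euler_prod Q X)" if "x \<in> A" for x
  proof -
    obtain Q' X' where x: "x = (Q', X')" by (cases x)
    then have "Re Q' < 0" using A that \<epsilon> by force
    then show ?thesis
      unfolding x prod.case by (intro limI euler_prod_LIMSEQ)
  qed
  with uc have ul: "uniform_limit A (\<lambda>N x. \<Prod>n<N. ?f n x) (\<lambda>(Q, X). euler_prod Q X) sequentially"
    unfolding uniformly_convergent_uniform_limit_iff by (simp cong: uniform_limit_cong')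
  have "continuous_on A (\<lambda>(Q, X). euler_prod Q X)"
    by (rule uniform_limit_theorem[OF _ ul])
       (auto simp: case_prod_beta intro!: always_eventually continuous_intros)
  then show ?thesis
    by (rule continuous_on_interior) (use \<epsilon> in \<open>auto simp: A_def\<close>)
qed

text \<open>Induction on \<open>N\<close> by the \<open>q\<close>-Pascal rule for the Gaussian binomial coefficients, which are
  written as quotients of the finite products \<open>P\<close>.\<close>

lemma q_binomial_theorem:
  fixes Q y :: complex
  assumes Q: "Re Q < 0"
  defines "P \<equiv> \<lambda>n. \<Prod>m<n. 1 - exp Q ^ Suc m"
  shows "(\<Prod>m<N. 1 + y * exp Q ^ m) =
    (\<Sum>k\<le>N. exp (of_nat k * (of_nat k - 1) / 2 * Q) * (P N / (P k * P (N - k))) * y ^ k)"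
proof (induction N)
  case 0
  then show ?case by (simp add: P_def)
next
  case (Suc N)
  have nz: "1 - exp Q ^ Suc m \<noteq> 0" for m
  proof -
    have "norm (exp Q ^ Suc m) < 1"
      unfolding norm_power using Q by (intro power_Suc_less_one) auto
    then show ?thesis by auto
  qed
  have Pnz: "P n \<noteq> 0" for n unfolding P_def using nz by simp
  have PS: "P (Suc n) = P n * (1 - exp Q ^ Suc n)" for n by (simp add: P_def)
  have P0: "P 0 = 1" by (simp add: P_def)
  define t where "t = (\<lambda>k. exp (of_nat k * (of_nat k - 1) / 2 * Q))"
  have tS: "t (Suc k) = t k * exp Q ^ k" for k
    unfolding t_def exp_of_nat_mult[symmetric] exp_add[symmetric]
    by (rule arg_cong[of _ _ exp]) (simp add: field_simps)
  define b where "b = (\<lambda>N k. t k * (P N / (P k * P (N - k))) * y ^ k)"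
  have step: "b (Suc N) (Suc k) = b N (Suc k) + b N k * y * exp Q ^ N" if "k < N" for k
  proof -
    obtain j where j: "N = Suc (k + j)" using \<open>k < N\<close> less_imp_Suc_add by auto
    have d: "Suc N - Suc k = Suc j" "N - Suc k = j" "N - k = Suc j" by (auto simp: j)
    have "P (Suc N) * 1 = P N * (1 - exp Q ^ Suc j) + P N * exp Q ^ Suc j * (1 - exp Q ^ Suc k)"
      unfolding PS by (simp add: j algebra_simps power_add)
    then have "P (Suc N) / (P (Suc k) * P (Suc j))
        = P N / (P (Suc k) * P j) + exp Q ^ Suc j * (P N / (P k * P (Suc j)))"
      using Pnz nz unfolding PS[of k] PS[of j] by (simp add: divide_simps)
    moreover have "exp Q ^ N = exp Q ^ k * exp Q ^ Suc j"
      by (simp add: j power_add)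
    ultimately show ?thesis
      unfolding b_def d tS power_Suc by (simp add: algebra_simps)
  qed
  have bN: "b (Suc N) (Suc N) = b N N * y * exp Q ^ N"
    using Pnz by (simp add: b_def tS P0 algebra_simps)
  have b0: "b (Suc N) 0 = b N 0"
    using Pnz by (simp add: b_def t_def)
  have "(\<Prod>m<Suc N. 1 + y * exp Q ^ m) = (\<Sum>k\<le>N. b N k) * (1 + y * exp Q ^ N)"
    using Suc.IH by (simp add: b_def t_def)
  also have "\<dots> = (\<Sum>k\<le>N. b N k) + (\<Sum>k\<le>N. b N k * y * exp Q ^ N)"
    by (simp add: algebra_simps sum_distrib_left)
  also have "(\<Sum>k\<le>N. b N k) = b N 0 + (\<Sum>k<N. b N (Suc k))"
    by (rule sum.atMost_shift)
  also have "(\<Sum>k\<le>N. b N k * y * exp Q ^ N) = (\<Sum>k<N. b N k * y * exp Q ^ N) + b N N * y * exp Q ^ N"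
    by (simp add: lessThan_Suc_atMost[symmetric])
  also have "b N 0 + (\<Sum>k<N. b N (Suc k)) + ((\<Sum>k<N. b N k * y * exp Q ^ N) + b N N * y * exp Q ^ N)
      = b (Suc N) 0 + (\<Sum>k<N. b (Suc N) (Suc k)) + b (Suc N) (Suc N)"
    unfolding bN b0 using step by (simp add: sum.distrib)
  also have "\<dots> = (\<Sum>k\<le>Suc N. b (Suc N) k)"
    by (subst sum.atMost_shift) (simp add: lessThan_Suc_atMost[symmetric])
  finally show ?case by (simp add: b_def t_def)
qed

text \<open>Collecting the factors at \<open>m = n + k\<close> and \<open>m = n - k\<close> brings the left-hand side of the
  \<open>q\<close>-binomial theorem to the symmetric form of the theta product.\<close>

lemma finite_product_centred:
  "(\<Prod>m<2 * n + 1. 1 - exp (X + (of_nat m - of_nat n) * Q)) =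
    (- 1) ^ n * exp (of_nat n * X - of_nat n * (of_nat n + 1) / 2 * Q) * (1 - exp X) *
    ((\<Prod>m<n. 1 - exp Q ^ Suc m * exp X) * (\<Prod>m<n. 1 - exp Q ^ Suc m * exp (- X)))"
  for X Q :: complex
proof (induction n)
  case (Suc n)
  let ?g = "\<lambda>m. 1 - exp (X + (of_nat m - of_nat (Suc n)) * Q)"
  have N: "2 * Suc n + 1 = Suc (Suc (2 * n + 1))" by simp
  have g0: "?g 0 = - exp (X - (of_nat n + 1) * Q) * (1 - exp Q ^ Suc n * exp (- X))"
    unfolding exp_of_nat_mult[symmetric] by (simp add: algebra_simps flip: exp_add)
  have gl: "?g (Suc (2 * n + 1)) = 1 - exp Q ^ Suc n * exp X"
    unfolding exp_of_nat_mult[symmetric] exp_add[symmetric] by (simp add: algebra_simps)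
  have gm: "?g (Suc m) = 1 - exp (X + (of_nat m - of_nat n) * Q)" for m
    by (simp add: algebra_simps)
  have e: "exp (of_nat n * X - of_nat n * (of_nat n + 1) / 2 * Q) * exp (X - (of_nat n + 1) * Q)
      = exp (of_nat (Suc n) * X - of_nat (Suc n) * (of_nat (Suc n) + 1) / 2 * Q)"
    unfolding exp_add[symmetric] by (rule arg_cong[of _ _ exp]) (simp add: field_simps)
  have "(\<Prod>m<2 * Suc n + 1. ?g m) = ?g 0 * ((\<Prod>m<2 * n + 1. ?g (Suc m)) * ?g (Suc (2 * n + 1)))"
    unfolding N by (subst prod.lessThan_Suc_shift, subst prod.lessThan_Suc) (rule refl)
  also have "\<dots> = (- 1) ^ Suc n * exp (of_nat (Suc n) * X - of_nat (Suc n) * (of_nat (Suc n) + 1) / 2 * Q) * (1 - exp X) *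
    ((\<Prod>m<Suc n. 1 - exp Q ^ Suc m * exp X) * (\<Prod>m<Suc n. 1 - exp Q ^ Suc m * exp (- X)))"
    unfolding gl unfolding gm Suc.IH g0 e[symmetric] prod.lessThan_Suc power_Suc[of "- 1"] by (simp add: mult_ac)
  finally show ?case .
qed simp

lemma filterlim_nat_add: "filterlim (\<lambda>n. nat (int n + c)) at_top sequentially"
  unfolding filterlim_at_top eventually_sequentially
proof
  fix Z show "\<exists>N. \<forall>n\<ge>N. Z \<le> nat (int n + c)"
    by (rule exI[of _ "nat (int Z + \<bar>c\<bar>)"]) auto
qed

text \<open>Jacobi's triple product identity, as the limit of its finite version, the \<open>q\<close>-binomial theorem
  with \<open>2 n + 1\<close> factors centred at \<open>x\<close>: the \<open>q\<close>-binomial coefficients are uniformly bounded and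
  converge to \<open>1 / (q;q)\<^sub>\<infinity>\<close>.\<close>

theorem thA_triple_product:
  assumes Q: "Re Q < 0"
  shows "thA Q X = exp (Q / 8) * qpoch Q * theta Q X"
proof -
  define P where "P = (\<lambda>n. \<Prod>m<n. 1 - exp Q ^ Suc m)"
  define b where "b = (\<lambda>n (j::int). if - int n - 1 \<le> j \<and> j \<le> int n
    then P (2 * n + 1) / (P (nat (int n + 1 + j)) * P (nat (int n - j))) else 0)"
  define t where "t = jtheta_term (- 1) (1 / 2) (1 / 2) Q X"
  define th where "th = (\<lambda>n. (exp (X / 2) - exp (- X / 2)) *
    ((\<Prod>m<n. 1 - exp Q ^ Suc m * exp X) * (\<Prod>m<n. 1 - exp Q ^ Suc m * exp (- X))))"
  have finite: "exp (Q / 8) * th n = (\<Sum>\<^sub>\<infinity>j. t j * b n j)" for n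
  proof -
    \<comment> \<open>The \<open>q\<close>-binomial theorem at \<open>y = - x q\<^sup>-\<^sup>n\<close>. The factor \<open>c\<close> undoes the prefactor of the centred product.\<close>
    define y where "y = - exp (X - of_nat n * Q)"
    define c where "c = exp (Q / 8) * (- exp (- X / 2)) * ((- 1) ^ n * exp (of_nat n * (of_nat n + 1) / 2 * Q - of_nat n * X))"
    have "(\<Prod>m<2 * n + 1. 1 + y * exp Q ^ m) = (\<Prod>m<2 * n + 1. 1 - exp (X + (of_nat m - of_nat n) * Q))"
      by (rule prod.cong[OF refl]) (simp add: y_def algebra_simps flip: exp_of_nat_mult exp_add)
    moreover have c_inv: "c * ((- 1) ^ n * exp (of_nat n * X - of_nat n * (of_nat n + 1) / 2 * Q) * (1 - exp X))
        = exp (Q / 8) * (exp (X / 2) - exp (- X / 2))"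
    proof -
      have 1: "exp (of_nat n * (of_nat n + 1) / 2 * Q - of_nat n * X) * exp (of_nat n * X - of_nat n * (of_nat n + 1) / 2 * Q) = 1"
        unfolding exp_add[symmetric] by simp
      have 2: "(- 1 :: complex) ^ n * (- 1) ^ n = 1" by (simp flip: power_mult_distrib)
      have 3: "- exp (- X / 2) * (1 - exp X) = exp (X / 2) - exp (- X / 2)"
        by (simp add: algebra_simps flip: exp_add)
      have "c * ((- 1) ^ n * exp (of_nat n * X - of_nat n * (of_nat n + 1) / 2 * Q) * (1 - exp X))
        = exp (Q / 8) * ((- 1) ^ n * (- 1) ^ n) * (exp (of_nat n * (of_nat n + 1) / 2 * Q - of_nat n * X) * exp (of_nat n * X - of_nat n * (of_nat n + 1) / 2 * Q))
          * (- exp (- X / 2) * (1 - exp X))"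
        unfolding c_def by (simp only: mult_ac)
      then show ?thesis unfolding 1 2 3 by simp
    qed
    ultimately have "exp (Q / 8) * th n = c * (\<Prod>m<2 * n + 1. 1 + y * exp Q ^ m)"
      unfolding th_def finite_product_centred by (simp flip: mult.assoc)
    also have "\<dots> = (\<Sum>k\<le>2 * n + 1. c * (exp (of_nat k * (of_nat k - 1) / 2 * Q) * (P (2 * n + 1) / (P k * P (2 * n + 1 - k))) * y ^ k))"
      unfolding q_binomial_theorem[OF Q] P_def sum_distrib_left by (rule refl)
    also have "\<dots> = (\<Sum>k\<le>2 * n + 1. t (int k - int n - 1) * b n (int k - int n - 1))"
    proof (rule sum.cong[OF refl])
      fix k assume "k \<in> {..2 * n + 1}"
      then have k: "k \<le> 2 * n + 1" by simp
      have yk: "y ^ k = (- 1) ^ k * exp (of_nat k * (X - of_nat n * Q))"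
        unfolding y_def power_minus[of "exp _"] exp_of_nat_mult[symmetric] by simp
      have sgn: "(- 1 :: complex) powi (int k - int n - 1) = - ((- 1) ^ n * (- 1) ^ k)"
        by (cases "even n") (simp_all add: power_int_diff)
      have "c * (exp (of_nat k * (of_nat k - 1) / 2 * Q) * y ^ k)
          = (- ((- 1) ^ n * (- 1) ^ k)) * (exp (Q / 8) * exp (- X / 2) * exp (of_nat n * (of_nat n + 1) / 2 * Q - of_nat n * X)
            * exp (of_nat k * (of_nat k - 1) / 2 * Q) * exp (of_nat k * (X - of_nat n * Q)))"
        unfolding c_def yk by (simp add: mult_ac)
      also have "\<dots> = t (int k - int n - 1)"
        unfolding t_def jtheta_term_def sgn exp_add[symmetric]
        by (intro arg_cong2[of _ _ _ _ "(*)"] arg_cong[of _ _ exp] refl) (simp add: power2_eq_square field_simps)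
      finally have 1: "c * (exp (of_nat k * (of_nat k - 1) / 2 * Q) * y ^ k) = t (int k - int n - 1)" .
      have 2: "b n (int k - int n - 1) = P (2 * n + 1) / (P k * P (2 * n + 1 - k))"
      proof -
        have "nat (int n + 1 + (int k - int n - 1)) = k" "nat (int n - (int k - int n - 1)) = 2 * n + 1 - k"
          using k by auto
        then show ?thesis using k by (simp add: b_def)
      qed
      show "c * (exp (of_nat k * (of_nat k - 1) / 2 * Q) * (P (2 * n + 1) / (P k * P (2 * n + 1 - k))) * y ^ k)
        = t (int k - int n - 1) * b n (int k - int n - 1)"
        unfolding 1[symmetric] 2 by (simp only: mult_ac)
    qed
    also have "\<dots> = (\<Sum>j = - int n - 1..int n. t j * b n j)"
      by (rule sum.reindex_bij_witness[of _ "\<lambda>j. nat (j + int n + 1)" "\<lambda>k. int k - int n - 1"]) auto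
    also have "\<dots> = (\<Sum>\<^sub>\<infinity>j\<in>{- int n - 1..int n}. t j * b n j)"
      by simp
    also have "\<dots> = (\<Sum>\<^sub>\<infinity>j. t j * b n j)"
      by (rule infsum_cong_neutral) (auto simp: b_def)
    finally show ?thesis .
  qed
  have Plim: "P \<longlonglongrightarrow> qpoch Q"
    using euler_prod_LIMSEQ[OF Q, of 0] by (simp add: P_def[abs_def] qpoch_eq)
  have Pnz: "P n \<noteq> 0" for n
  proof -
    have "norm (exp Q ^ Suc m) < 1" for m
      unfolding norm_power using Q by (intro power_Suc_less_one) auto
    then have "1 - exp Q ^ Suc m \<noteq> 0" for m by (metis norm_one right_minus_eq less_irrefl)
    then show ?thesis by (simp add: P_def)
  qed
  note qnz = qpoch_nonzero[OF Q]
  obtain B where B: "\<And>n. norm (P n) \<le> B"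
    using convergent_imp_Bseq[OF convergentI[OF Plim]] by (auto simp: Bseq_def)
  obtain B' where B': "\<And>n. norm (inverse (P n)) \<le> B'"
    using convergent_imp_Bseq[OF convergentI[OF tendsto_inverse[OF Plim qnz]]] by (auto simp: Bseq_def)
  have B0: "B \<ge> 0" "B' \<ge> 0" using B B' norm_ge_zero order_trans by blast+
  have b_le: "norm (b n j) \<le> B * (B' * B')" for n j
  proof -
    have "norm (P k / (P l * P m)) \<le> B * (B' * B')" for k l m
    proof -
      have "norm (P k / (P l * P m)) = norm (P k) * (norm (inverse (P l)) * norm (inverse (P m)))"
        by (simp add: norm_divide norm_mult norm_inverse divide_inverse)
      also have "\<dots> \<le> B * (B' * B')"
        by (intro mult_mono B B' B0 mult_nonneg_nonneg norm_ge_zero)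
      finally show ?thesis .
    qed
    then show ?thesis using B0 by (simp add: b_def)
  qed
  have lim1: "(\<lambda>n. \<Sum>\<^sub>\<infinity>j. t j * b n j) \<longlonglongrightarrow> (\<Sum>\<^sub>\<infinity>j. t j * inverse (qpoch Q))"
  proof (rule tendsto_infsum_dominated)
    fix j
    have "(\<lambda>n. P (2 * n + 1) / (P (nat (int n + 1 + j)) * P (nat (int n - j)))) \<longlonglongrightarrow> qpoch Q / (qpoch Q * qpoch Q)"
    proof (intro tendsto_divide tendsto_mult)
      show "(\<lambda>n. P (2 * n + 1)) \<longlonglongrightarrow> qpoch Q"
        by (rule filterlim_compose[OF Plim]) (rule filterlim_subseq, simp add: strict_mono_def)
      show "(\<lambda>n. P (nat (int n + 1 + j))) \<longlonglongrightarrow> qpoch Q"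
        using filterlim_compose[OF Plim filterlim_nat_add[of "1 + j"]] by (simp add: add.assoc)
      show "(\<lambda>n. P (nat (int n - j))) \<longlonglongrightarrow> qpoch Q"
        using filterlim_compose[OF Plim filterlim_nat_add[of "- j"]] by (simp add: add.assoc)
    qed (use qnz in auto)
    moreover have "\<forall>\<^sub>F n in sequentially. P (2 * n + 1) / (P (nat (int n + 1 + j)) * P (nat (int n - j))) = b n j"
      unfolding eventually_sequentially b_def by (intro exI[of _ "nat (\<bar>j\<bar> + 1)"]) auto
    ultimately have "(\<lambda>n. b n j) \<longlonglongrightarrow> inverse (qpoch Q)"
      using qnz by (simp add: tendsto_cong field_simps)
    then show "(\<lambda>n. t j * b n j) \<longlonglongrightarrow> t j * inverse (qpoch Q)"
      by (intro tendsto_intros)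
  next
    show "\<forall>\<^sub>F n in sequentially. \<forall>j. norm (t j * b n j) \<le> norm (t j) * (B * (B' * B'))"
      by (intro always_eventually allI) (simp add: norm_mult mult_left_mono b_le)
    show "(\<lambda>j. norm (t j) * (B * (B' * B'))) summable_on UNIV"
      unfolding t_def by (intro summable_on_cmult_left jtheta_term_abs_summable Q) auto
  qed
  have "(\<lambda>n. exp (Q / 8) * th n) \<longlonglongrightarrow> exp (Q / 8) * theta Q X"
    unfolding th_def theta_eq[OF Q] by (intro tendsto_intros euler_prod_LIMSEQ[OF Q])
  with lim1 have "exp (Q / 8) * theta Q X = (\<Sum>\<^sub>\<infinity>j. t j * inverse (qpoch Q))"
    unfolding finite by (rule LIMSEQ_unique[symmetric])
  also have "\<dots> = thA Q X * inverse (qpoch Q)"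
    unfolding infsum_cmult_left' by (simp add: t_def thA_def jtheta_def)
  finally show ?thesis using qnz by (simp add: field_simps)
qed

lemma thA_lattice: "thA Q (of_int n * Q + 2 * of_real pi * \<i> * of_int k) = 0"
proof -
  have "thA Q (of_int n * Q) = 0"
  proof (induction n rule: int_induct[where k = 0])
    case (step1 i)
    then show ?case using thA_quasi_period[of Q "of_int i * Q"] by (simp add: algebra_simps)
  next
    case (step2 i)
    then show ?case using thA_quasi_period[of Q "of_int (i - 1) * Q"] by (simp add: algebra_simps)
  qed simp
  then show ?thesis
    using jtheta_shift_2pi_X[of "1 / 2" "- 1" "1 / 2" Q "of_int n * Q" k] by (simp add: thA_def)
qed

lemma euler_prod_nonzero:
  assumes "Re Q < 0" "\<And>n::int. n > 0 \<Longrightarrow> exp (of_int n * Q + X) \<noteq> 1"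
  shows "euler_prod Q X \<noteq> 0"
  unfolding euler_prod_def
proof (rule prodinf_nonzero[OF euler_prod_convergent[OF assms(1)]])
  fix m
  have "exp Q ^ Suc m * exp X = exp (of_int (int m + 1) * Q + X)"
    unfolding exp_of_nat_mult[symmetric] exp_add[symmetric] by (simp add: algebra_simps)
  then show "1 - exp Q ^ Suc m * exp X \<noteq> 0"
    using assms(2)[of "int m + 1"] by simp
qed

text \<open>The zeros are those of the factors of the triple product.\<close>

lemma thA_eq_0_iff:
  assumes Q: "Re Q < 0"
  shows "thA Q X = 0 \<longleftrightarrow> (\<exists>n k. X = of_int n * Q + 2 * of_real pi * \<i> * of_int k)"
proof
  assume "thA Q X = 0"
  then have "exp (X / 2) - exp (- X / 2) = 0 \<or> euler_prod Q X = 0 \<or> euler_prod Q (- X) = 0"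
    using qpoch_nonzero[OF Q] by (simp add: thA_triple_product[OF Q] theta_eq[OF Q])
  then have "\<exists>n::int. exp (of_int n * Q + X) = 1"
  proof (elim disjE)
    assume "exp (X / 2) - exp (- X / 2) = 0"
    then have "exp (X / 2) * exp (X / 2) = exp (- X / 2) * exp (X / 2)" by simp
    then have "exp X = 1" by (simp flip: exp_add)
    then show ?thesis by (intro exI[of _ 0]) simp
  next
    assume "euler_prod Q X = 0"
    then show ?thesis using euler_prod_nonzero[OF Q] by blast
  next
    assume "euler_prod Q (- X) = 0"
    then obtain n :: int where "exp (of_int n * Q + - X) = 1" using euler_prod_nonzero[OF Q] by blast
    then have "inverse (exp (of_int n * Q + - X)) = 1" by simp
    then show ?thesis by (intro exI[of _ "- n"]) (simp flip: exp_minus)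
  qed
  then obtain n :: int where "exp (of_int n * Q + X) = exp 0" by auto
  then obtain k :: int where "of_int n * Q + X = 0 + 2 * of_real pi * \<i> * of_int k" by (rule exp_eqE)
  then have "X = of_int (- n) * Q + 2 * of_real pi * \<i> * of_int k" by (simp add: algebra_simps)
  then show "\<exists>n k. X = of_int n * Q + 2 * of_real pi * \<i> * of_int k" by blast
qed (auto simp: thA_lattice)

text \<open>The points \<open>q\<^bsup>1/2\<^esup>\<close>, \<open>- 1\<close> and \<open>- q\<^bsup>1/2\<^esup>\<close> are half periods outside the lattice of zeros. They serve
  below as points at which one may divide by values of the alternating series.\<close>

lemma thA_half_nonzero [simp]:
  assumes Q: "Re Q < 0"
  shows "thA Q (Q / 2) \<noteq> 0"
proof
  assume "thA Q (Q / 2) = 0"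
  then obtain n k where *: "Q / 2 = of_int n * Q + 2 * of_real pi * \<i> * of_int k"
    unfolding thA_eq_0_iff[OF Q] by blast
  have "Re Q = of_int (2 * n) * Re Q"
    using arg_cong[OF *, of Re] by (auto simp: mult.commute)
  then have "of_int (2 * n) = (1 :: real)" using Q by simp
  then have "2 * n = 1" by linarith
  then show False by presburger
qed

lemma thA_pi_nonzero [simp]:
  assumes Q: "Re Q < 0"
  shows "thA Q (of_real pi * \<i>) \<noteq> 0"
proof
  assume "thA Q (of_real pi * \<i>) = 0"
  then obtain n k where *: "of_real pi * \<i> = of_int n * Q + 2 * of_real pi * \<i> * of_int k"
    unfolding thA_eq_0_iff[OF Q] by blast
  have "of_int n * Re Q = 0"
    using arg_cong[OF *, of Re] by simp
  then have n: "n = 0" using Q by simp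
  have "pi * 1 = pi * of_int (2 * k)"
    using arg_cong[OF *, of Im] n by simp
  then have "of_int (2 * k) = (1 :: real)" unfolding mult_cancel_left by simp
  then have "2 * k = 1" by linarith
  then show False by presburger
qed

lemma thA_half_pi_nonzero [simp]:
  assumes Q: "Re Q < 0"
  shows "thA Q (of_real pi * \<i> + Q / 2) \<noteq> 0"
proof
  assume "thA Q (of_real pi * \<i> + Q / 2) = 0"
  then obtain n k where *: "of_real pi * \<i> + Q / 2 = of_int n * Q + 2 * of_real pi * \<i> * of_int k"
    unfolding thA_eq_0_iff[OF Q] by blast
  have "Re Q = of_int (2 * n) * Re Q"
    using arg_cong[OF *, of Re] by (auto simp: mult.commute)
  then have "of_int (2 * n) = (1 :: real)" using Q by simp
  then have "2 * n = 1" by linarith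
  then show False by presburger
qed

lemma complex_diff_imp_field:
  assumes "complex_diff J2 (\<lambda>(Q, X). F Q X) (Q, X)"
  shows "F Q field_differentiable at X"
proof -
  have "complex_diff ((*) \<i>) (\<lambda>X. (case (Q, X) of (Q, X) \<Rightarrow> F Q X)) X"
    by (rule complex_diff_pair2[where f = "\<lambda>_. Q" and g = "\<lambda>X. X", OF assms complex_diff_const])
       (rule complex_diff_linear[OF bounded_linear_ident], rule refl)
  then show ?thesis by (simp add: complex_diff_field_iff)
qed

lemma thA_holomorphic: "Re Q < 0 \<Longrightarrow> thA Q holomorphic_on A"
  and th0_holomorphic: "Re Q < 0 \<Longrightarrow> th0 Q holomorphic_on A"
  and th1_holomorphic: "Re Q < 0 \<Longrightarrow> th1 Q holomorphic_on A"
  unfolding holomorphic_on_def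
  by (auto intro!: field_differentiable_at_within complex_diff_imp_field
      thA_complex_diff th0_complex_diff th1_complex_diff)

lemma thA_deriv_0_nonzero:
  assumes Q: "Re Q < 0"
  shows "deriv (thA Q) 0 \<noteq> 0"
proof -
  define P where "P = (\<lambda>X. exp (Q / 8) * qpoch Q * (euler_prod Q X * euler_prod Q (- X)))"
  have TP: "thA Q X = (exp (X / 2) - exp (- X / 2)) * P X" for X
    unfolding thA_triple_product[OF Q] theta_eq[OF Q] P_def by (simp add: mult_ac)
  have cont: "isCont (euler_prod Q) X" for X
    using isCont_o2[of X "Pair Q" "\<lambda>(Q, X). euler_prod Q X"] euler_prod_continuous[OF Q, of X]
    by (simp add: continuous_Pair)
  have "isCont P 0"
    unfolding P_def by (intro continuous_intros cont isCont_o2[OF _ cont])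
  moreover have "P 0 \<noteq> 0"
    using qpoch_nonzero[OF Q] by (simp add: P_def qpoch_eq)
  moreover have s: "((\<lambda>X::complex. exp (X / 2) - exp (- X / 2)) has_field_derivative 1) (at 0)"
    by (auto intro!: derivative_eq_intros)
  ultimately have "((\<lambda>X. (exp (X / 2) - exp (- X / 2) - (exp (0 / 2) - exp (- 0 / 2))) / (X - 0) * P X) \<longlongrightarrow> 1 * P 0) (at 0)"
    unfolding has_field_derivative_iff by (intro tendsto_mult) (auto simp: isCont_def)
  then have "((\<lambda>X. (thA Q X - thA Q 0) / (X - 0)) \<longlongrightarrow> P 0) (at 0)"
    by (simp add: TP field_simps)
  then have "(thA Q has_field_derivative P 0) (at 0)"
    unfolding has_field_derivative_iff .
  then show ?thesis
    using \<open>P 0 \<noteq> 0\<close> by (simp add: DERIV_imp_deriv)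
qed

text \<open>Translation by the lattice multiplies the series by functions without zeros, so every zero is as
  simple as the one at \<open>x = 1\<close>.\<close>

lemma thA_simple_zeros:
  assumes Q: "Re Q < 0" and X: "thA Q X = 0"
  shows "deriv (thA Q) X \<noteq> 0"
proof -
  obtain n k where nk: "X = of_int n * Q + 2 * of_real pi * \<i> * of_int k"
    using X unfolding thA_eq_0_iff[OF Q] by blast
  have fd: "(thA Q has_field_derivative deriv (thA Q) X) (at X)" for X
    using holomorphic_derivI[OF thA_holomorphic[OF Q] open_UNIV UNIV_I] .
  have stepQ: "deriv (thA Q) (X + Q) = - exp (- Q / 2 - X) * deriv (thA Q) X" if "thA Q X = 0" for X
  proof -
    have 1: "((\<lambda>X. thA Q (X + Q)) has_field_derivative deriv (thA Q) (X + Q)) (at X)"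
      using fd[of "X + Q"] by (simp add: DERIV_shift)
    have 2: "((\<lambda>X. - exp (- Q / 2 - X) * thA Q X) has_field_derivative - exp (- Q / 2 - X) * deriv (thA Q) X) (at X)"
      using that by (auto intro!: derivative_eq_intros fd)
    show ?thesis
      using 1 2 unfolding thA_quasi_period by (rule DERIV_unique)
  qed
  have stepP: "deriv (thA Q) (X + 2 * of_real pi * \<i>) = - deriv (thA Q) X" for X
  proof -
    have 1: "((\<lambda>X. thA Q (X + 2 * of_real pi * \<i>)) has_field_derivative deriv (thA Q) (X + 2 * of_real pi * \<i>)) (at X)"
      using fd[of "X + 2 * of_real pi * \<i>"] by (simp add: DERIV_shift)
    have 2: "((\<lambda>X. - thA Q X) has_field_derivative - deriv (thA Q) X) (at X)"
      by (auto intro!: derivative_eq_intros fd)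
    show ?thesis
      using 1 2 unfolding thA_shift_2pi by (rule DERIV_unique)
  qed
  have A: "deriv (thA Q) (of_int n * Q) \<noteq> 0" for n
  proof (induction n rule: int_induct[where k = 0])
    case base
    then show ?case using thA_deriv_0_nonzero[OF Q] by simp
  next
    case (step1 i)
    then show ?case using stepQ[of "of_int i * Q"] thA_lattice[of Q i 0] by (simp add: algebra_simps)
  next
    case (step2 i)
    then show ?case using stepQ[of "of_int (i - 1) * Q"] thA_lattice[of Q "i - 1" 0] by (simp add: algebra_simps)
  qed
  have "deriv (thA Q) (of_int n * Q + 2 * of_real pi * \<i> * of_int k) \<noteq> 0"
  proof (induction k rule: int_induct[where k = 0])
    case base
    then show ?case using A by simp
  next
    case (step1 i)
    then show ?case using stepP[of "of_int n * Q + 2 * of_real pi * \<i> * of_int i"] by (simp add: algebra_simps)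
  next
    case (step2 i)
    then show ?case using stepP[of "of_int n * Q + 2 * of_real pi * \<i> * of_int (i - 1)"] by (simp add: algebra_simps)
  qed
  then show ?thesis unfolding nk .
qed

section \<open>Theta functions of low degree\<close>

lemma holomorphic_compose_affine:
  assumes "f holomorphic_on UNIV"
  shows "(\<lambda>x. f (a + b * x)) holomorphic_on UNIV"
proof -
  have "f \<circ> (\<lambda>x. a + b * x) holomorphic_on UNIV"
    by (rule holomorphic_on_compose) (auto intro!: holomorphic_intros holomorphic_on_subset[OF assms])
  then show ?thesis by (simp add: o_def)
qed

lemma holomorphic_compose_plus:
  assumes "f holomorphic_on UNIV"
  shows "(\<lambda>x. f (x + a)) holomorphic_on UNIV"
  using holomorphic_compose_affine[OF assms, of a 1] by (simp add: add.commute)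

text \<open>The ring of entire functions has no zero divisors.\<close>

lemma entire_mult_eq_0:
  assumes "f holomorphic_on UNIV" "g holomorphic_on UNIV"
    "\<And>x. g x * f x = 0" "g a \<noteq> 0"
  shows "f x = 0"
proof (rule ccontr)
  assume fx: "f x \<noteq> 0"
  have "continuous_on UNIV f"
    by (rule holomorphic_on_imp_continuous_on[OF assms(1)])
  then have "open (f -` (- {0}))"
    by (intro open_vimage) auto
  then have "open (f -` (- {0}) :: complex set)" .
  moreover have "g y = 0" if "y \<in> f -` (- {0})" for y
    using assms(3)[of y] that by auto
  ultimately have "g a = 0"
    using fx assms(2)
    by (intro analytic_continuation_open[where s = "f -` (- {0})" and s' = UNIV and f = g and g = "\<lambda>_. 0" and z = a])
       (auto simp: connected_UNIV holomorphic_on_const)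
  with assms(4) show False by simp
qed

lemma entire_mult_cancel:
  assumes "f holomorphic_on UNIV" "f' holomorphic_on UNIV" "g holomorphic_on UNIV"
    "\<And>x. g x * f x = g x * f' x" "g a \<noteq> 0"
  shows "f x = f' x"
  using entire_mult_eq_0[of "\<lambda>x. f x - f' x" g a x] assms
  by (auto intro!: holomorphic_intros simp: algebra_simps)

text \<open>Entire elliptic functions are bounded, as every point is congruent to one in a fixed compact
  rectangle, so they are constant by Liouville's theorem.\<close>

lemma entire_elliptic_constant:
  assumes f: "f holomorphic_on UNIV" and Q: "Re Q < 0"
    and per: "\<And>z. f (z + Q) = f z" "\<And>z. f (z + 2 * of_real pi * \<i>) = f z"
  shows "f z = f 0"
proof -
  have perQ: "f (z + of_int n * Q) = f z" for z n
  proof (induction n rule: int_induct[where k = 0])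
    case (step1 i)
    then show ?case using per(1)[of "z + of_int i * Q"] by (simp add: algebra_simps)
  next
    case (step2 i)
    then show ?case using per(1)[of "z + of_int (i - 1) * Q"] by (simp add: algebra_simps)
  qed simp
  have perP: "f (z + of_int n * (2 * of_real pi * \<i>)) = f z" for z n
  proof (induction n rule: int_induct[where k = 0])
    case (step1 i)
    then show ?case using per(2)[of "z + of_int i * (2 * of_real pi * \<i>)"] by (simp add: algebra_simps)
  next
    case (step2 i)
    then show ?case using per(2)[of "z + of_int (i - 1) * (2 * of_real pi * \<i>)"] by (simp add: algebra_simps)
  qed simp
  define K where "K = cbox (Complex (Re Q) 0) (Complex 0 (2 * pi))"
  have "range f \<subseteq> f ` K"
  proof safe
    fix z
    define n where "n = \<lfloor>Re z / Re Q\<rfloor>"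
    define w where "w = z - of_int n * Q"
    define k where "k = \<lfloor>Im w / (2 * pi)\<rfloor>"
    define u where "u = w - of_int k * (2 * of_real pi * \<i>)"
    have "of_int n \<le> Re z / Re Q" "Re z / Re Q < of_int n + 1"
      unfolding n_def by linarith+
    then have "Re z \<le> of_int n * Re Q" "of_int n * Re Q + Re Q \<le> Re z"
      using Q by (auto simp: field_simps)
    then have 1: "Re Q \<le> Re u" "Re u \<le> 0"
      by (auto simp: u_def w_def)
    have "of_int k \<le> Im w / (2 * pi)" "Im w / (2 * pi) < of_int k + 1"
      unfolding k_def by linarith+
    then have "of_int k * (2 * pi) \<le> Im w" "Im w \<le> of_int k * (2 * pi) + 2 * pi"
      by (auto simp: field_simps)
    then have 2: "0 \<le> Im u" "Im u \<le> 2 * pi"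
      by (auto simp: u_def)
    have "f z = f u"
      using perQ[of w n] perP[of u k] by (simp add: u_def w_def)
    then show "f z \<in> f ` K"
      using 1 2 by (auto simp: K_def in_cbox_complex_iff)
  qed
  moreover have "compact (f ` K)"
    by (intro compact_continuous_image holomorphic_on_imp_continuous_on holomorphic_on_subset[OF f])
       (auto simp: K_def)
  ultimately have "bounded (range f)"
    using compact_imp_bounded bounded_subset by blast
  then obtain c where "\<And>z. f z = c"
    using Liouville_theorem[OF f] by (auto simp: constant_on_def)
  then show ?thesis by simp
qed

lemma field_differentiable_transform_open:
  assumes "f field_differentiable at a" "open S" "a \<in> S" "\<And>x. x \<in> S \<Longrightarrow> g x = f x"
  shows "g field_differentiable at a"
  using assms unfolding field_differentiable_def
  by (metis has_field_derivative_transform_within_open)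

text \<open>At a simple zero of the denominator the difference quotients of both functions are entire, and
  the one of the denominator does not vanish there.\<close>

lemma entire_division:
  assumes f: "f holomorphic_on UNIV" and h: "h holomorphic_on UNIV"
    and zeros: "\<And>x. h x = 0 \<Longrightarrow> f x = 0 \<and> deriv h x \<noteq> 0"
  obtains g where "g holomorphic_on UNIV" "\<And>x. f x = h x * g x"
proof
  define g where "g = (\<lambda>x. if h x = 0 then deriv f x / deriv h x else f x / h x)"
  show "f x = h x * g x" for x using zeros[of x] by (auto simp: g_def)
  have "g field_differentiable at a" for a
  proof (cases "h a = 0")
    case False
    have "continuous_on UNIV h"
      by (rule holomorphic_on_imp_continuous_on[OF h])
    then have "open (h -` (- {0}) :: complex set)" by (intro open_vimage) auto
    moreover have "(\<lambda>x. f x / h x) field_differentiable at a"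
      using False f h by (auto intro!: field_differentiable_divide simp: holomorphic_on_def)
    ultimately show ?thesis
      using False field_differentiable_transform_open[of "\<lambda>x. f x / h x" a "h -` (- {0})" g]
      by (simp add: g_def)
  next
    case True
    define F where "F = (\<lambda>z. if z = a then deriv f a else (f z - f a) / (z - a))"
    define H where "H = (\<lambda>z. if z = a then deriv h a else (h z - h a) / (z - a))"
    have F: "F holomorphic_on UNIV" and H: "H holomorphic_on UNIV"
      unfolding F_def H_def by (rule pole_lemma[OF f], simp) (rule pole_lemma[OF h], simp)
    have fa: "f a = 0" "H a \<noteq> 0" using zeros[OF True] by (auto simp: H_def)
    have "continuous_on UNIV H"
      by (rule holomorphic_on_imp_continuous_on[OF H])
    then have "open (H -` (- {0}) :: complex set)" by (intro open_vimage) auto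
    moreover have "g x = F x / H x" if "x \<in> H -` (- {0})" for x
    proof (cases "x = a")
      case False
      then have "h x = (x - a) * H x" "f x = (x - a) * F x"
        using True fa by (auto simp: H_def F_def)
      then show ?thesis using that False by (auto simp: g_def)
    qed (use True in \<open>simp add: g_def F_def H_def\<close>)
    moreover have "(\<lambda>x. F x / H x) field_differentiable at a"
      using fa F H by (auto intro!: field_differentiable_divide simp: holomorphic_on_def)
    ultimately show ?thesis
      using fa field_differentiable_transform_open[of "\<lambda>x. F x / H x" a "H -` (- {0})" g]
      by simp
  qed
  then show "g holomorphic_on UNIV" by (simp add: holomorphic_on_def)
qed

text \<open>One zero of a function with multipliers yields a whole lattice of zeros, which is the divisor of
  a translate of the alternating series.\<close>

lemma thA_division:
  assumes Q: "Re Q < 0" and f: "f holomorphic_on UNIV"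
    and per: "\<And>z. f (z + Q) = 0 \<longleftrightarrow> f z = 0" "\<And>z. f (z + 2 * of_real pi * \<i>) = 0 \<longleftrightarrow> f z = 0"
    and a: "f a = 0"
  obtains g where "g holomorphic_on UNIV" "\<And>x. f (x + a) = thA Q x * g x"
proof (rule entire_division[OF holomorphic_compose_plus[OF f, of a] thA_holomorphic[OF Q, of UNIV]])
  fix x assume x: "thA Q x = 0"
  then obtain n k where nk: "x = of_int n * Q + 2 * of_real pi * \<i> * of_int k"
    unfolding thA_eq_0_iff[OF Q] by blast
  have A: "f (a + of_int n * Q) = 0" for n
  proof (induction n rule: int_induct[where k = 0])
    case (step1 i)
    then show ?case using per(1)[of "a + of_int i * Q"] by (simp add: algebra_simps)
  next
    case (step2 i)
    then show ?case using per(1)[of "a + of_int (i - 1) * Q"] by (simp add: algebra_simps)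
  qed (use a in simp)
  have "f (a + of_int n * Q + 2 * of_real pi * \<i> * of_int k) = 0"
  proof (induction k rule: int_induct[where k = 0])
    case (step1 i)
    then show ?case using per(2)[of "a + of_int n * Q + 2 * of_real pi * \<i> * of_int i"] by (simp add: algebra_simps)
  next
    case (step2 i)
    then show ?case using per(2)[of "a + of_int n * Q + 2 * of_real pi * \<i> * of_int (i - 1)"] by (simp add: algebra_simps)
  qed (use A in simp)
  then have "f (x + a) = 0" unfolding nk by (simp add: algebra_simps)
  with thA_simple_zeros[OF Q x] show "f (x + a) = 0 \<and> deriv (thA Q) x \<noteq> 0" by simp
qed (use that in blast)

lemma thA_mult_cancel:
  assumes Q: "Re Q < 0" and "f holomorphic_on UNIV" "g holomorphic_on UNIV"
    "\<And>x. thA Q (a + x) * f x = thA Q (a + x) * g x"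
  shows "f x = g x"
proof (rule entire_mult_cancel[OF assms(2,3)])
  show "(\<lambda>x. thA Q (a + x)) holomorphic_on UNIV"
    using holomorphic_compose_affine[OF thA_holomorphic[OF Q], of a 1] by simp
  show "thA Q (a + (Q / 2 - a)) \<noteq> 0" using Q by simp
qed (fact assms(4))

text \<open>The odd part vanishes at \<open>x = 1\<close>, so it is a multiple of the alternating series. The even part
  vanishes at \<open>x = - 1\<close> because it changes sign along the loop around \<open>0\<close>; its quotient by the series
  translated by \<open>- 1\<close> is constant, as it is elliptic for the periods \<open>2 Q\<close> and \<open>2 \<pi> \<i>\<close>, but it changes
  sign under \<open>x \<mapsto> q x\<close>. So the even part is zero.\<close>

lemma theta_degree_1:
  assumes Q: "Re Q < 0" and F: "F holomorphic_on UNIV"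
    and perP: "\<And>Z. F (Z + 2 * of_real pi * \<i>) = - F Z"
    and perQ: "\<And>Z. F (Z + Q) = - exp (- Q / 2 - Z) * F Z"
  obtains c where "\<And>Z. F Z = c * thA Q Z"
proof -
  have perP': "F (- (Z + 2 * of_real pi * \<i>)) = - F (- Z)" for Z
    using perP[of "- Z - 2 * of_real pi * \<i>"] by simp
  have perQ': "F (- (Z + Q)) = - exp (- Q / 2 - Z) * F (- Z)" for Z
  proof -
    have "F (- Z) = - exp (Q / 2 + Z) * F (- (Z + Q))"
      using perQ[of "- (Z + Q)"] by (simp add: add.commute diff_add_eq)
    then have "- exp (- Q / 2 - Z) * F (- Z) = (exp (- Q / 2 - Z) * exp (Q / 2 + Z)) * F (- (Z + Q))"
      by (simp only: mult.assoc mult_minus_left mult_minus_right minus_minus)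
    then show ?thesis unfolding exp_add[symmetric] by simp
  qed
  have F': "(\<lambda>Z. F (- Z)) holomorphic_on UNIV"
    using holomorphic_compose_affine[OF F, of 0 "- 1"] by simp
  define Fo where "Fo = (\<lambda>Z. F Z - F (- Z))"
  define Fe where "Fe = (\<lambda>Z. F Z + F (- Z))"
  have Fo: "Fo holomorphic_on UNIV" and Fe: "Fe holomorphic_on UNIV"
    unfolding Fo_def Fe_def by (intro holomorphic_intros F F')+
  have FoP: "Fo (Z + 2 * of_real pi * \<i>) = - Fo Z" and FeP: "Fe (Z + 2 * of_real pi * \<i>) = - Fe Z" for Z
    unfolding Fo_def Fe_def perP perP' by simp_all
  have FoQ: "Fo (Z + Q) = - exp (- Q / 2 - Z) * Fo Z" and FeQ: "Fe (Z + Q) = - exp (- Q / 2 - Z) * Fe Z" for Z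
    unfolding Fo_def Fe_def perQ perQ' by (simp_all add: algebra_simps)
  obtain g where g: "g holomorphic_on UNIV" "\<And>x. Fo x = thA Q x * g x"
    by (rule thA_division[OF Q Fo, of 0]) (auto simp: FoP FoQ, simp add: Fo_def)
  have "g x = g 0" for x
  proof (rule entire_elliptic_constant[OF g(1) Q])
    fix z
    have "thA Q (0 + x) * g (x + Q) = thA Q (0 + x) * g x" for x
      using FoQ[of x] unfolding g(2) thA_quasi_period by simp
    from thA_mult_cancel[OF Q holomorphic_compose_plus[OF g(1)] g(1) this]
    show "g (z + Q) = g z" .
    have "thA Q (0 + x) * g (x + 2 * of_real pi * \<i>) = thA Q (0 + x) * g x" for x
      using FoP[of x] unfolding g(2) thA_shift_2pi by simp
    from thA_mult_cancel[OF Q holomorphic_compose_plus[OF g(1)] g(1) this]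
    show "g (z + 2 * of_real pi * \<i>) = g z" .
  qed
  then have odd: "Fo Z = g 0 * thA Q Z" for Z unfolding g(2) by simp
  have "Fe (of_real pi * \<i>) = - Fe (of_real pi * \<i>)"
    using FeP[of "- (of_real pi * \<i>)"] by (simp add: Fe_def mult.commute[of "\<i>"])
  then have "Fe (of_real pi * \<i>) = 0" by simp
  then obtain e where e: "e holomorphic_on UNIV" "\<And>x. Fe (x + of_real pi * \<i>) = thA Q x * e x"
    by (rule thA_division[OF Q Fe, rotated 2]) (auto simp: FeP FeQ)
  have eQ: "e (x + Q) = - e x" for x
  proof (rule thA_mult_cancel[OF Q holomorphic_compose_plus[OF e(1)], of "\<lambda>x. - e x" 0])
    fix x
    have "exp (- Q / 2 - (x + of_real pi * \<i>)) = - exp (- Q / 2 - x)"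
      by (simp add: exp_diff exp_add)
    then have "- exp (- Q / 2 - x) * thA Q x * e (x + Q) = exp (- Q / 2 - x) * (thA Q x * e x)"
      using FeQ[of "x + of_real pi * \<i>"] e(2)[of "x + Q"] e(2)[of x]
      unfolding thA_quasi_period by (simp add: add_ac)
    then have "- (exp (- Q / 2 - x) * (thA Q x * e (x + Q))) = exp (- Q / 2 - x) * (thA Q x * e x)"
      by (simp add: mult.assoc)
    then have "exp (- Q / 2 - x) * (thA Q x * e (x + Q)) = exp (- Q / 2 - x) * (- (thA Q x * e x))"
      unfolding mult_minus_right by (metis minus_minus)
    then have "thA Q x * e (x + Q) = - (thA Q x * e x)"
      by (rule mult_left_cancel[THEN iffD1, rotated]) simp
    then show "thA Q (0 + x) * e (x + Q) = thA Q (0 + x) * - e x"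
      by simp
  qed (intro holomorphic_intros e)
  have eP: "e (x + 2 * of_real pi * \<i>) = e x" for x
  proof (rule thA_mult_cancel[OF Q holomorphic_compose_plus[OF e(1)] e(1), of 0])
    fix x
    show "thA Q (0 + x) * e (x + 2 * of_real pi * \<i>) = thA Q (0 + x) * e x"
      using FeP[of "x + of_real pi * \<i>"] e(2)[of "x + 2 * of_real pi * \<i>"] e(2)[of x]
      unfolding thA_shift_2pi by (auto simp: add_ac)
  qed
  have e0: "e x = e 0" for x
  proof (rule entire_elliptic_constant[OF e(1), of "2 * Q"])
    show "e (z + 2 * Q) = e z" for z
      using eQ[of z] eQ[of "z + Q"] by (simp add: algebra_simps)
  qed (use Q in simp, rule eP)
  have "e 0 = - e 0" using eQ[of 0] e0[of Q] by (simp only: add_0_left)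
  then have "e 0 = 0" by simp
  then have "e x = 0" for x using e0[of x] by (simp only:)
  then have "Fe x = 0" for x using e(2)[of "x - of_real pi * \<i>"] by simp
  moreover have "F Z = (Fo Z + Fe Z) / 2" for Z by (simp add: Fo_def Fe_def)
  ultimately have "F Z = (g 0 / 2) * thA Q Z" for Z by (simp add: odd)
  then show ?thesis by (rule that)
qed

text \<open>Subtracting a combination of the two basic series, the function may be assumed to vanish at two
  points, \<open>X\<^sub>0\<close> and \<open>X\<^sub>1\<close>. Dividing by the first zero leaves a function of degree one, whose only zero
  modulo the lattice is determined by its multipliers; it is not the second point.\<close>

lemma theta_degree_2:
  assumes Q: "Re Q < 0" and F: "F holomorphic_on UNIV"
    and perP: "\<And>Z. F (Z + 2 * of_real pi * \<i>) = F Z"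
    and perQ: "\<And>Z. F (Z + Q) = exp (- Q - 2 * Z) * F Z"
  obtains c d where "\<And>Z. F Z = c * th0 Q Z + d * th1 Q Z"
proof -
  \<comment> \<open>The quotient and the product of the two points are the half periods \<open>- 1\<close> and \<open>- q\<^bsup>1/2\<^esup>\<close>, so the
    determinant \<open>D\<close> of the values of the basis is not zero.\<close>
  define X0 where "X0 = Q / 4"
  define X1 where "X1 = Q / 4 + of_real pi * \<i>"
  define D where "D = th1 Q X1 * th0 Q X0 - th0 Q X1 * th1 Q X0"
  have "D = thA Q (X1 + X0) * thA Q (X1 - X0)"
    unfolding D_def thA_addition[OF Q] ..
  also have "X1 + X0 = of_real pi * \<i> + Q / 2" by (simp add: X0_def X1_def)
  also have "X1 - X0 = of_real pi * \<i>" by (simp add: X0_def X1_def)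
  finally have D: "D \<noteq> 0" using Q by simp
  define c where "c = (th1 Q X1 * F X0 - th1 Q X0 * F X1) / D"
  define d where "d = (th0 Q X0 * F X1 - th0 Q X1 * F X0) / D"
  define H where "H = (\<lambda>Z. F Z - (c * th0 Q Z + d * th1 Q Z))"
  have H: "H holomorphic_on UNIV"
    unfolding H_def by (intro holomorphic_intros F th0_holomorphic th1_holomorphic Q)
  have H0: "H X0 = 0" "H X1 = 0"
    unfolding H_def c_def d_def using D by (simp_all add: field_simps) (simp_all add: D_def algebra_simps)
  have HP: "H (Z + 2 * of_real pi * \<i>) = H Z" for Z
    unfolding H_def perP th0_shift_2pi th1_shift_2pi by simp
  have HQ: "H (Z + Q) = exp (- Q - 2 * Z) * H Z" for Z
    unfolding H_def perQ th0_quasi_period th1_quasi_period by (simp add: algebra_simps)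
  obtain g where g: "g holomorphic_on UNIV" "\<And>x. H (x + X0) = thA Q x * g x"
    by (rule thA_division[OF Q H _ _ H0(1)]) (auto simp: HP HQ)
  obtain k where k: "\<And>Z. g (Z - 2 * X0) = k * thA Q Z"
  proof (rule theta_degree_1[OF Q, of "\<lambda>Z. g (Z - 2 * X0)"])
    show "(\<lambda>Z. g (Z - 2 * X0)) holomorphic_on UNIV"
      using holomorphic_compose_plus[OF g(1), of "- 2 * X0"] by simp
    have "g (x + 2 * of_real pi * \<i>) = - g x" for x
    proof (rule thA_mult_cancel[OF Q holomorphic_compose_plus[OF g(1)], of "\<lambda>x. - g x" 0])
      fix x
      show "thA Q (0 + x) * g (x + 2 * of_real pi * \<i>) = thA Q (0 + x) * - g x"
        using HP[of "x + X0"] g(2)[of "x + 2 * of_real pi * \<i>"] g(2)[of x]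
        unfolding thA_shift_2pi by (simp add: add_ac minus_equation_iff)
    qed (intro holomorphic_intros g)
    from this[of "Z - 2 * X0" for Z]
    show "g (Z + 2 * of_real pi * \<i> - 2 * X0) = - g (Z - 2 * X0)" for Z
      by (simp add: diff_add_eq)
    have gQ: "g (x + Q) = - exp (- Q / 2 - (x + 2 * X0)) * g x" for x
    proof (rule thA_mult_cancel[OF Q holomorphic_compose_plus[OF g(1)], of "\<lambda>x. - exp (- Q / 2 - (x + 2 * X0)) * g x" 0])
      fix x
      have "exp (- Q - 2 * (x + X0)) = exp (- Q / 2 - x) * exp (- Q / 2 - (x + 2 * X0))"
        unfolding exp_add[symmetric] by (rule arg_cong[of _ _ exp]) (simp add: algebra_simps)
      then have "- exp (- Q / 2 - x) * (thA Q x * g (x + Q)) = exp (- Q / 2 - x) * (exp (- Q / 2 - (x + 2 * X0)) * (thA Q x * g x))"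
        using HQ[of "x + X0"] g(2)[of "x + Q"] g(2)[of x]
        unfolding thA_quasi_period by (simp add: add_ac mult_ac)
      then have "exp (- Q / 2 - x) * (- (thA Q x * g (x + Q))) = exp (- Q / 2 - x) * (exp (- Q / 2 - (x + 2 * X0)) * (thA Q x * g x))"
        by (simp only: mult_minus_left mult_minus_right)
      then have "- (thA Q x * g (x + Q)) = exp (- Q / 2 - (x + 2 * X0)) * (thA Q x * g x)"
        by (rule mult_left_cancel[THEN iffD1, rotated]) simp
      then show "thA Q (0 + x) * g (x + Q) = thA Q (0 + x) * (- exp (- Q / 2 - (x + 2 * X0)) * g x)"
        by (subst (asm) minus_equation_iff) (simp add: mult_ac)
    qed (intro holomorphic_intros g)
    show "g (Z + Q - 2 * X0) = - exp (- Q / 2 - Z) * g (Z - 2 * X0)" for Z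
      using gQ[of "Z - 2 * X0"] by (simp add: algebra_simps)
  qed auto
  have "H X1 = thA Q (of_real pi * \<i>) * g (of_real pi * \<i>)"
    using g(2)[of "of_real pi * \<i>"] by (simp add: X0_def X1_def add.commute)
  also have "g (of_real pi * \<i>) = k * thA Q (of_real pi * \<i> + Q / 2)"
    using k[of "of_real pi * \<i> + Q / 2"] by (simp add: X0_def)
  finally have "k = 0" using H0(2) Q by simp
  then have "g x = 0" for x using k[of "x + 2 * X0"] by simp
  then have "H x = 0" for x using g(2)[of "x - X0"] by simp
  then have "F Z = c * th0 Q Z + d * th1 Q Z" for Z by (simp add: H_def)
  then show ?thesis by (rule that)
qed

lemma thA_mult_cancel_affine:
  assumes Q: "Re Q < 0" and "f holomorphic_on UNIV" "g holomorphic_on UNIV"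
    "\<And>x. thA Q (a + b * x) * f x = thA Q (a + b * x) * g x" "b \<noteq> 0"
  shows "f x = g x"
proof (rule entire_mult_cancel[OF assms(2,3)])
  show "(\<lambda>x. thA Q (a + b * x)) holomorphic_on UNIV"
    by (rule holomorphic_compose_affine[OF thA_holomorphic[OF Q]])
  show "thA Q (a + b * ((Q / 2 - a) / b)) \<noteq> 0" using Q assms(5) by simp
qed (fact assms(4))

lemma thA_shift_2Q: "thA Q (X + 2 * Q) = exp (- 2 * Q - 2 * X) * thA Q X"
proof -
  have "thA Q (X + 2 * Q) = exp (- Q / 2 - (X + Q)) * exp (- Q / 2 - X) * thA Q X"
    using thA_quasi_period[of Q "X + Q"] thA_quasi_period[of Q X] by (simp add: algebra_simps)
  also have "exp (- Q / 2 - (X + Q)) * exp (- Q / 2 - X) = exp (- 2 * Q - 2 * X)"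
    unfolding exp_add[symmetric] by (rule arg_cong[of _ _ exp]) (simp add: algebra_simps)
  finally show ?thesis .
qed

lemma thA_shift_4pi: "thA Q (X + 4 * of_real pi * \<i>) = thA Q X"
  using thA_shift_2pi[of Q X] thA_shift_2pi[of Q "X + 2 * of_real pi * \<i>"] by (simp add: algebra_simps)


section \<open>The three-term relation\<close>

text \<open>The general theta function of degree two; \<open>f\<^sub>1\<close> and \<open>f\<^sub>2\<close> will be values of the coefficients of
  the explicit formulas.\<close>

definition th_comb :: "complex \<Rightarrow> complex \<Rightarrow> complex \<Rightarrow> complex \<Rightarrow> complex" where
  "th_comb f1 f2 Q X = f1 * th0 Q X + f2 * th1 Q X"

lemma th_comb_minus [simp]: "th_comb f1 f2 Q (- X) = th_comb f1 f2 Q X"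
  by (simp add: th_comb_def)

text \<open>By the addition formula \<open>thA(x y) thA(x / y)\<close> is the determinant of the vectors of values of
  \<open>th1\<close> and \<open>th0\<close> at \<open>x\<close> and \<open>y\<close>, and the relation expresses that three vectors in the plane are
  linearly dependent.\<close>

lemma three_term:
  assumes "Re Q < 0"
  shows "th_comb f1 f2 Q P * (thA Q (R + V) * thA Q (R - V)) - th_comb f1 f2 Q R * (thA Q (P + V) * thA Q (P - V))
    = th_comb f1 f2 Q V * (thA Q (R + P) * thA Q (R - P))"
  unfolding thA_addition[OF assms] th_comb_def by (simp add: algebra_simps)

text \<open>The Pluecker relation between the six minors of four vectors in the plane.\<close>

lemma three_term_thA:
  assumes "Re Q < 0"
  shows "thA Q (U + A) * thA Q (U - A) * (thA Q (B + C) * thA Q (B - C))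
    - thA Q (U + B) * thA Q (U - B) * (thA Q (A + C) * thA Q (A - C))
    + thA Q (U + C) * thA Q (U - C) * (thA Q (A + B) * thA Q (A - B)) = 0"
  unfolding thA_addition[OF assms] by (simp add: algebra_simps)


section \<open>Solving the duality equation at fixed \<open>v\<close> and \<open>q\<close>\<close>

text \<open>In the notation of this lemma \<open>p, s\<close> are the two entries of \<open>\<E>\<^sup>e\<^sup>l\<^sup>l([2])\<close>, and \<open>r, t\<close> those of
  \<open>\<E>\<^sup>e\<^sup>l\<^sup>l([1,1])\<close>. The \<open>q\<close>-difference equations restrict the dependence on \<open>z\<close>; that on \<open>a\<close> is controlled
  because the duality equation exchanges the two variables. By degree one, \<open>r\<close> and \<open>t\<close> are
  \<open>C\<^sub>1(a) thA(z v\<^sup>2 / a)\<close> and \<open>C\<^sub>2(a) thA(z v\<^sup>2 a)\<close>. Then \<open>C\<^sub>1 = C\<^sub>2\<close> is constant, \<open>s\<close> is antisymmetric, equal to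
  \<open>g(v z a) thA(z / a)\<close> with \<open>g\<close> of degree two, and the equation for \<open>p\<close> that remains is solved by the
  three-term relation.\<close>

theorem duality_solution:
  fixes p s r t :: "complex \<Rightarrow> complex \<Rightarrow> complex" and Q V y :: complex
  assumes Q: "Re Q < 0"
    and hol: "\<And>a b c d. (\<lambda>u. p (a + b * u) (c + d * u)) holomorphic_on UNIV"
      "\<And>a b c d. (\<lambda>u. s (a + b * u) (c + d * u)) holomorphic_on UNIV"
      "\<And>a b c d. (\<lambda>u. r (a + b * u) (c + d * u)) holomorphic_on UNIV"
      "\<And>a b c d. (\<lambda>u. t (a + b * u) (c + d * u)) holomorphic_on UNIV"
    and per: "\<And>A Z. p A (Z + 2 * of_real pi * \<i>) = - p A Z" "\<And>A Z. s A (Z + 2 * of_real pi * \<i>) = - s A Z"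
      "\<And>A Z. r A (Z + 2 * of_real pi * \<i>) = - r A Z" "\<And>A Z. t A (Z + 2 * of_real pi * \<i>) = - t A Z"
    and quasi: "\<And>A Z. p A (Z + Q) = - exp (- 3 * Q / 2 - 3 * Z - 2 * V + A) * p A Z"
      "\<And>A Z. s A (Z + Q) = - exp (- 3 * Q / 2 - 3 * Z - 2 * V - A) * s A Z"
      "\<And>A Z. r A (Z + Q) = - exp (- Q / 2 - Z - 2 * V + A) * r A Z"
      "\<And>A Z. t A (Z + Q) = - exp (- Q / 2 - Z - 2 * V - A) * t A Z"
    and B1: "\<And>A Z. p A Z * t Z A + r A Z * s Z A = y * (thA Q (2 * A) * thA Q (2 * V + 2 * Z))"
    and B2: "\<And>A Z. (p A Z * r Z A + r A Z * p Z A) * thA Q (Z - A)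
        = y * (thA Q (Z + A) * thA Q (2 * V) * thA Q (2 * Z - 2 * A))"
    and B3: "\<And>A Z. s A Z * t Z A + t A Z * s Z A = 0"
    and y: "y \<noteq> 0" and V: "thA Q (2 * V) \<noteq> 0" "thA Q (4 * V) \<noteq> 0"
  shows "\<exists>f0 f1 f2. (\<forall>A Z. p A Z = th_comb f1 f2 Q (V + Z - A) * thA Q (Z + A) \<and>
      s A Z = th_comb f1 f2 Q (V + Z + A) * thA Q (Z - A) \<and>
      r A Z = f0 * thA Q (Z + 2 * V - A) \<and> t A Z = f0 * thA Q (Z + 2 * V + A)) \<and>
      y = f0 * th_comb f1 f2 Q V"
proof -
  let ?T = "thA Q"
  have Th: "?T (Q / 2) \<noteq> 0" using Q by simp
  have hol_fst: "(\<lambda>u. F u Z) holomorphic_on UNIV" and hol_snd: "(\<lambda>u. F A u) holomorphic_on UNIV"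
    if "\<And>a b c d. (\<lambda>u. F (a + b * u) (c + d * u)) holomorphic_on UNIV"
    for F :: "complex \<Rightarrow> complex \<Rightarrow> complex" and A Z
    using that[of 0 1 Z 0] that[of A 0 0 1] by simp_all
  have "\<exists>c. \<forall>Z. r A Z = c * ?T (Z + 2 * V - A)" for A
  proof -
    obtain c where "\<And>Z. r A (Z - 2 * V + A) = c * ?T Z"
    proof (rule theta_degree_1[OF Q, of "\<lambda>Z. r A (Z - 2 * V + A)"])
      show "(\<lambda>Z. r A (Z - 2 * V + A)) holomorphic_on UNIV"
        using hol(3)[of A 0 "- 2 * V + A" 1] by (simp add: algebra_simps)
      show "r A (Z + 2 * of_real pi * \<i> - 2 * V + A) = - r A (Z - 2 * V + A)" for Z
        using per(3)[of A "Z - 2 * V + A"] by (simp add: algebra_simps)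
      have 1: "- Q / 2 - (Z - 2 * V + A) - 2 * V + A = - Q / 2 - Z" for Z by simp
      have 2: "Z - 2 * V + A + Q = Z + Q - 2 * V + A" for Z by simp
      show "r A (Z + Q - 2 * V + A) = - exp (- Q / 2 - Z) * r A (Z - 2 * V + A)" for Z
        using quasi(3)[of A "Z - 2 * V + A"] unfolding 1 2 .
    qed auto
    from this[of "Z + 2 * V - A" for Z] show ?thesis by auto
  qed
  then obtain C1 where r: "\<And>A Z. r A Z = C1 A * ?T (Z + 2 * V - A)" by metis
  have "\<exists>c. \<forall>Z. t A Z = c * ?T (Z + 2 * V + A)" for A
  proof -
    obtain c where "\<And>Z. t A (Z - 2 * V - A) = c * ?T Z"
    proof (rule theta_degree_1[OF Q, of "\<lambda>Z. t A (Z - 2 * V - A)"])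
      show "(\<lambda>Z. t A (Z - 2 * V - A)) holomorphic_on UNIV"
        using hol(4)[of A 0 "- 2 * V - A" 1] by (simp add: algebra_simps)
      show "t A (Z + 2 * of_real pi * \<i> - 2 * V - A) = - t A (Z - 2 * V - A)" for Z
        using per(4)[of A "Z - 2 * V - A"] by (simp add: algebra_simps)
      have 1: "- Q / 2 - (Z - 2 * V - A) - 2 * V - A = - Q / 2 - Z" for Z by simp
      have 2: "Z - 2 * V - A + Q = Z + Q - 2 * V - A" for Z by simp
      show "t A (Z + Q - 2 * V - A) = - exp (- Q / 2 - Z) * t A (Z - 2 * V - A)" for Z
        using quasi(4)[of A "Z - 2 * V - A"] unfolding 1 2 .
    qed auto
    from this[of "Z + 2 * V + A" for Z] show ?thesis by auto
  qed
  then obtain C2 where t: "\<And>A Z. t A Z = C2 A * ?T (Z + 2 * V + A)" by metis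
  have C1_hol: "C1 holomorphic_on UNIV"
  proof -
    have "C1 A = r (0 + 1 * A) ((Q / 2 - 2 * V) + 1 * A) / ?T (Q / 2)" for A
      using Th by (simp add: r)
    then have "C1 = (\<lambda>A. r (0 + 1 * A) ((Q / 2 - 2 * V) + 1 * A) / ?T (Q / 2))" by auto
    then show ?thesis using Th by (metis (no_types) holomorphic_on_divide[OF hol(3) holomorphic_on_const])
  qed
  have C2_hol: "C2 holomorphic_on UNIV"
  proof -
    have "C2 A = t (0 + 1 * A) ((Q / 2 - 2 * V) + (- 1) * A) / ?T (Q / 2)" for A
      using Th by (simp add: t)
    then have "C2 = (\<lambda>A. t (0 + 1 * A) ((Q / 2 - 2 * V) + (- 1) * A) / ?T (Q / 2))" by auto
    then show ?thesis using Th by (metis (no_types) holomorphic_on_divide[OF hol(4) holomorphic_on_const])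
  qed

  \<comment> \<open>At \<open>a = z v\<^sup>2\<close> the entry \<open>r\<close> vanishes, and two entries of the duality equation both express
    the same value of \<open>p\<close>.\<close>
  have C12: "C1 Z = C2 Z" for Z
  proof (rule thA_mult_cancel_affine[OF Q C1_hol C2_hol, of "4 * V" 2])
    fix Z
    show "?T (4 * V + 2 * Z) * C1 Z = ?T (4 * V + 2 * Z) * C2 Z"
    proof (rule thA_mult_cancel_affine[OF Q, of "\<lambda>Z. ?T (4 * V + 2 * Z) * C1 Z" "\<lambda>Z. ?T (4 * V + 2 * Z) * C2 Z" "2 * V" 2])
      fix Z
      define u where "u = p (Z + 2 * V) Z"
      have 1: "u * C2 Z * ?T (4 * V + 2 * Z) = y * (?T (4 * V + 2 * Z) * ?T (2 * V + 2 * Z))"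
        using B1[of "Z + 2 * V" Z] by (simp add: r t u_def algebra_simps)
      have "u * C1 Z * (?T (4 * V) * ?T (2 * V)) = y * ?T (2 * V + 2 * Z) * (?T (4 * V) * ?T (2 * V))"
        using B2[of "Z + 2 * V" Z] thA_minus[of Q "2 * V"] thA_minus[of Q "4 * V"]
        by (simp add: r t u_def algebra_simps)
      then have 2: "u * C1 Z = y * ?T (2 * V + 2 * Z)" using V by simp
      show "?T (2 * V + 2 * Z) * (?T (4 * V + 2 * Z) * C1 Z) = ?T (2 * V + 2 * Z) * (?T (4 * V + 2 * Z) * C2 Z)"
      proof (cases "?T (2 * V + 2 * Z) = 0")
        case False
        then have "u \<noteq> 0" using 2 y by auto
        moreover have "u * C1 Z * ?T (4 * V + 2 * Z) = u * C2 Z * ?T (4 * V + 2 * Z)"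
          unfolding 1 2 by (simp only: mult_ac)
        ultimately show ?thesis by (simp add: mult_ac)
      qed simp
    qed (auto intro!: holomorphic_intros C1_hol C2_hol holomorphic_compose_affine thA_holomorphic Q)
  qed simp
  define C where "C = C1"
  have C: "C holomorphic_on UNIV" "\<And>A Z. r A Z = C A * ?T (Z + 2 * V - A)" "\<And>A Z. t A Z = C A * ?T (Z + 2 * V + A)"
    using C1_hol r t C12 by (auto simp: C_def)

  have sC: "s A Z * C Z = - C A * s Z A" for A Z
  proof (rule thA_mult_cancel_affine[OF Q, of "\<lambda>Z. s A Z * C Z" "\<lambda>Z. - C A * s Z A" "2 * V + A" 1])
    fix Z
    have "?T (2 * V + A + 1 * Z) * (s A Z * C Z + C A * s Z A) = 0"
      using B3[of A Z] unfolding C by (simp add: algebra_simps)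
    then show "?T (2 * V + A + 1 * Z) * (s A Z * C Z) = ?T (2 * V + A + 1 * Z) * (- C A * s Z A)"
      by (simp add: algebra_simps add_eq_0_iff)
  next
    show "(\<lambda>Z. s A Z * C Z) holomorphic_on UNIV"
      by (rule holomorphic_on_mult[OF hol_snd[where F = s, OF hol(2)] C(1)])
    show "(\<lambda>Z. - C A * s Z A) holomorphic_on UNIV"
      by (rule holomorphic_on_mult[OF holomorphic_on_const hol_fst[where F = s, OF hol(2)]])
  qed simp
  have main: "C Z * (p A Z * ?T (A + 2 * V + Z) - ?T (Z + 2 * V - A) * s A Z) = y * (?T (2 * A) * ?T (2 * V + 2 * Z))" for A Z
  proof -
    have "p A Z * (C Z * ?T (A + 2 * V + Z)) + ?T (Z + 2 * V - A) * (C A * s Z A) = y * (?T (2 * A) * ?T (2 * V + 2 * Z))"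
      using B1[of A Z] unfolding C by (simp add: mult_ac)
    moreover have "C A * s Z A = - (s A Z * C Z)" using sC[of A Z] by simp
    ultimately show ?thesis by (simp add: algebra_simps)
  qed
  \<comment> \<open>At \<open>a = q\<^bsup>1/4\<^esup>\<close> the factor \<open>thA(a\<^sup>2)\<close> on the right-hand side is not zero. The cofactor of \<open>C(z)\<close> has the
    same multipliers in \<open>z\<close> as the right-hand side, so \<open>C\<close> is elliptic.\<close>
  define Bf where "Bf = (\<lambda>Z. p (Q / 4) Z * ?T (Q / 4 + 2 * V + Z) - ?T (Z + 2 * V - Q / 4) * s (Q / 4) Z)"
  have CB: "C Z * Bf Z = y * ?T (Q / 2) * ?T (2 * V + 2 * Z)" for Z
    using main[of Z "Q / 4"] by (simp add: Bf_def)
  have BfQ: "Bf (Z + Q) = exp (- 2 * Q - 2 * (2 * V + 2 * Z)) * Bf Z" for Z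
  proof -
    have "p (Q / 4) (Z + Q) * ?T (Q / 4 + 2 * V + (Z + Q))
      = (exp (- 3 * Q / 2 - 3 * Z - 2 * V + Q / 4) * exp (- Q / 2 - (Q / 4 + 2 * V + Z))) * (p (Q / 4) Z * ?T (Q / 4 + 2 * V + Z))"
      using thA_quasi_period[of Q "Q / 4 + 2 * V + Z"] unfolding quasi add.assoc by simp
    also have "exp (- 3 * Q / 2 - 3 * Z - 2 * V + Q / 4) * exp (- Q / 2 - (Q / 4 + 2 * V + Z)) = exp (- 2 * Q - 2 * (2 * V + 2 * Z))"
      unfolding exp_add[symmetric] by (rule arg_cong[of _ _ exp]) (simp add: algebra_simps)
    finally have 1: "p (Q / 4) (Z + Q) * ?T (Q / 4 + 2 * V + (Z + Q)) = exp (- 2 * Q - 2 * (2 * V + 2 * Z)) * (p (Q / 4) Z * ?T (Q / 4 + 2 * V + Z))" .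
    have sh: "Z + Q + 2 * V - Q / 4 = (Z + 2 * V - Q / 4) + Q" by simp
    have "?T (Z + Q + 2 * V - Q / 4) * s (Q / 4) (Z + Q)
      = (exp (- Q / 2 - (Z + 2 * V - Q / 4)) * exp (- 3 * Q / 2 - 3 * Z - 2 * V - Q / 4)) * (?T (Z + 2 * V - Q / 4) * s (Q / 4) Z)"
      unfolding quasi sh thA_quasi_period by simp
    also have "exp (- Q / 2 - (Z + 2 * V - Q / 4)) * exp (- 3 * Q / 2 - 3 * Z - 2 * V - Q / 4) = exp (- 2 * Q - 2 * (2 * V + 2 * Z))"
      unfolding exp_add[symmetric] by (rule arg_cong[of _ _ exp]) (simp add: algebra_simps)
    finally have 2: "?T (Z + Q + 2 * V - Q / 4) * s (Q / 4) (Z + Q) = exp (- 2 * Q - 2 * (2 * V + 2 * Z)) * (?T (Z + 2 * V - Q / 4) * s (Q / 4) Z)" .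
    show ?thesis unfolding Bf_def 1 2 by (simp add: right_diff_distrib)
  qed
  have BfP: "Bf (Z + 2 * of_real pi * \<i>) = Bf Z" for Z
  proof -
    have 1: "?T (Q / 4 + 2 * V + (Z + 2 * of_real pi * \<i>)) = - ?T (Q / 4 + 2 * V + Z)"
      using thA_shift_2pi[of Q "Q / 4 + 2 * V + Z"] by (simp add: add.assoc)
    have 2: "?T (Z + 2 * of_real pi * \<i> + 2 * V - Q / 4) = - ?T (Z + 2 * V - Q / 4)"
      using thA_shift_2pi[of Q "Z + 2 * V - Q / 4"] by (simp add: algebra_simps)
    show ?thesis unfolding Bf_def per 1 2 by simp
  qed
  have shift: "?T (2 * V + 2 * Z) * C (Z + w) = ?T (2 * V + 2 * Z) * C Z"
    if "M \<noteq> 0" "Bf (Z + w) = M * Bf Z" "?T (2 * V + 2 * (Z + w)) = M * ?T (2 * V + 2 * Z)" for Z w M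
  proof -
    have "M * (C (Z + w) * Bf Z) = M * (C Z * Bf Z)"
      using CB[of "Z + w"] CB[of Z] unfolding that by (simp add: mult_ac)
    then have "C (Z + w) * Bf Z = C Z * Bf Z" using \<open>M \<noteq> 0\<close> by simp
    then have "C (Z + w) * (C Z * Bf Z) = C Z * (C Z * Bf Z)" by auto
    then show ?thesis unfolding CB using y Th by auto
  qed
  have C_const: "C Z = C 0" for Z
  proof (rule entire_elliptic_constant[OF C(1) Q])
    fix z
    show "C (z + Q) = C z"
    proof (rule thA_mult_cancel_affine[OF Q holomorphic_compose_plus[OF C(1)] C(1), of "2 * V" 2])
      fix Z show "?T (2 * V + 2 * Z) * C (Z + Q) = ?T (2 * V + 2 * Z) * C Z"
        by (rule shift[OF _ BfQ]) (use thA_shift_2Q[of Q "2 * V + 2 * Z"] in \<open>simp_all add: algebra_simps\<close>)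
    qed simp
    show "C (z + 2 * of_real pi * \<i>) = C z"
    proof (rule thA_mult_cancel_affine[OF Q holomorphic_compose_plus[OF C(1)] C(1), of "2 * V" 2])
      fix Z show "?T (2 * V + 2 * Z) * C (Z + 2 * of_real pi * \<i>) = ?T (2 * V + 2 * Z) * C Z"
        by (rule shift[of 1]) (use thA_shift_4pi[of Q "2 * V + 2 * Z"] BfP in \<open>simp_all add: algebra_simps\<close>)
    qed simp
  qed
  define f0 where "f0 = C 0"
  have Cf: "C Z = f0" for Z using C_const by (simp add: f0_def)
  have f0: "f0 \<noteq> 0"
    using CB[of "Q / 4 - V"] y Th by (auto simp: Cf right_diff_distrib)
  have antisym: "s Z A = - s A Z" for A Z
  proof -
    have "f0 * s Z A = f0 * - s A Z" using sC[of A Z] by (simp add: Cf mult.commute)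
    then show ?thesis by (rule mult_left_cancel[THEN iffD1, OF f0])
  qed
  have s0: "s A A = 0" for A using antisym[of A A] by simp

  \<comment> \<open>Along \<open>a z = const\<close> the quotient of \<open>s\<close> by the alternating series of \<open>z / a\<close> is elliptic.\<close>
  have s_lattice: "s A (A + (of_int n * Q + 2 * of_real pi * \<i> * of_int k)) = 0" for A n k
  proof -
    have A: "s A (A + of_int n * Q) = 0" for n
    proof (induction n rule: int_induct[where k = 0])
      case (step1 i)
      then show ?case using quasi(2)[of A "A + of_int i * Q"] by (simp add: algebra_simps)
    next
      case (step2 i)
      then show ?case using quasi(2)[of A "A + of_int (i - 1) * Q"] by (simp add: algebra_simps)
    qed (use s0 in simp)
    have "s A (A + of_int n * Q + 2 * of_real pi * \<i> * of_int k) = 0"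
    proof (induction k rule: int_induct[where k = 0])
      case (step1 i)
      then show ?case using per(2)[of A "A + of_int n * Q + 2 * of_real pi * \<i> * of_int i"] by (simp add: algebra_simps)
    next
      case (step2 i)
      then show ?case using per(2)[of A "A + of_int n * Q + 2 * of_real pi * \<i> * of_int (i - 1)"] by (simp add: algebra_simps)
    qed (use A in simp)
    then show ?thesis by (simp add: add.assoc)
  qed
  have "\<exists>c. \<forall>B. s (W - B) (W + B) = c * ?T (2 * B)" for W
  proof -
    have fh: "(\<lambda>x. s (W - x / 2) (W + x / 2)) holomorphic_on UNIV"
      using hol(2)[of W "- 1 / 2" W "1 / 2"] by simp
    obtain g where g: "g holomorphic_on UNIV" "\<And>x. s (W - x / 2) (W + x / 2) = ?T x * g x"
    proof (rule entire_division[OF fh thA_holomorphic[OF Q, of UNIV]])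
      fix x assume x: "?T x = 0"
      then obtain n k where "x = of_int n * Q + 2 * of_real pi * \<i> * of_int k"
        unfolding thA_eq_0_iff[OF Q] by blast
      with s_lattice[of "W - x / 2" n k] have "s (W - x / 2) (W + x / 2) = 0"
        by (simp add: field_simps)
      with thA_simple_zeros[OF Q x] show "s (W - x / 2) (W + x / 2) = 0 \<and> deriv ?T x \<noteq> 0" by simp
    qed auto
    define G where "G = (\<lambda>B. g (2 * B))"
    have G: "G holomorphic_on UNIV"
      using holomorphic_compose_affine[OF g(1), of 0 2] by (simp add: G_def)
    have sG: "s (W - B) (W + B) = ?T (2 * B) * G B" for B
      using g(2)[of "2 * B"] by (simp add: G_def)
    have "G B = G 0" for B
    proof (rule entire_elliptic_constant[OF G Q])
      fix z
      show "G (z + Q) = G z"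
      proof (rule thA_mult_cancel_affine[OF Q holomorphic_compose_plus[OF G] G, of 0 2])
        fix B
        define A where "A = W - B - Q"
        define Z where "Z = W + B"
        have 1: "s A (Z + Q) = - exp (- 3 * Q / 2 - 3 * Z - 2 * V - A) * s A Z" by (rule quasi)
        have "s (A + Q) Z = - exp (- 3 * Q / 2 - 3 * A - 2 * V - Z) * s A Z"
          unfolding antisym[of "A + Q" Z] quasi(2)[of Z A] unfolding antisym[of Z A] by simp
        then have "exp (- 2 * Q - 2 * (2 * B)) * s (A + Q) Z = - (exp (- 2 * Q - 2 * (2 * B)) * exp (- 3 * Q / 2 - 3 * A - 2 * V - Z)) * s A Z"
          by simp
        also have "exp (- 2 * Q - 2 * (2 * B)) * exp (- 3 * Q / 2 - 3 * A - 2 * V - Z) = exp (- 3 * Q / 2 - 3 * Z - 2 * V - A)"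
          unfolding exp_add[symmetric] by (rule arg_cong[of _ _ exp]) (simp add: A_def Z_def algebra_simps)
        finally have "s A (Z + Q) = exp (- 2 * Q - 2 * (2 * B)) * s (A + Q) Z" unfolding 1 by simp
        then have "s (W - (B + Q)) (W + (B + Q)) = exp (- 2 * Q - 2 * (2 * B)) * s (W - B) (W + B)"
          by (simp add: A_def Z_def algebra_simps)
        then have "?T (2 * B + 2 * Q) * G (B + Q) = exp (- 2 * Q - 2 * (2 * B)) * (?T (2 * B) * G B)"
          unfolding sG by (simp add: algebra_simps)
        then show "?T (0 + 2 * B) * G (B + Q) = ?T (0 + 2 * B) * G B"
          unfolding thA_shift_2Q by simp
      qed simp
      show "G (z + 2 * of_real pi * \<i>) = G z"
      proof (rule thA_mult_cancel_affine[OF Q holomorphic_compose_plus[OF G] G, of 0 2])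
        fix B
        have "s (W - (B + 2 * of_real pi * \<i>)) (W + (B + 2 * of_real pi * \<i>)) = s (W - B) (W + B)"
          using per(2)[of "W - (B + 2 * of_real pi * \<i>)" "W + B"] per(2)[of "W + B" "W - (B + 2 * of_real pi * \<i>)"]
            antisym[of "W + B" "W - (B + 2 * of_real pi * \<i>)"] antisym[of "W + B" "W - B"]
          by (simp add: algebra_simps)
        then have "?T (2 * B + 4 * of_real pi * \<i>) * G (B + 2 * of_real pi * \<i>) = ?T (2 * B) * G B"
          unfolding sG by (simp add: algebra_simps)
        then show "?T (0 + 2 * B) * G (B + 2 * of_real pi * \<i>) = ?T (0 + 2 * B) * G B"
          unfolding thA_shift_4pi by simp
      qed simp
    qed
    then show ?thesis using sG by (intro exI[of _ "G 0"]) simp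
  qed
  then obtain k where k: "\<And>W B. s (W - B) (W + B) = k W * ?T (2 * B)" by metis
  define h where "h = (\<lambda>X. k ((X - V) / 2))"
  have sh: "s A Z = h (V + Z + A) * ?T (Z - A)" for A Z
  proof -
    have "(Z + A) / 2 - (Z - A) / 2 = A" "(Z + A) / 2 + (Z - A) / 2 = Z" "2 * ((Z - A) / 2) = Z - A"
      "(V + Z + A - V) / 2 = (Z + A) / 2"
      by (simp_all add: field_simps)
    then show ?thesis using k[of "(Z + A) / 2" "(Z - A) / 2"] by (simp only: h_def)
  qed
  \<comment> \<open>The value at \<open>x\<close> is read off where \<open>v z a = x\<close> and \<open>z / a = q\<^bsup>1/2\<^esup>\<close>.\<close>
  have h_eq: "h X = s ((- V / 2 - Q / 4) + (1 / 2) * X) ((- V / 2 + Q / 4) + (1 / 2) * X) / ?T (Q / 2)" for X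
  proof -
    have "V + ((- V / 2 + Q / 4) + (1 / 2) * X) + ((- V / 2 - Q / 4) + (1 / 2) * X) = X"
      "((- V / 2 + Q / 4) + (1 / 2) * X) - ((- V / 2 - Q / 4) + (1 / 2) * X) = Q / 2"
      by (simp_all add: field_simps)
    then show ?thesis using Th by (simp only: sh) simp
  qed
  have h_hol: "h holomorphic_on UNIV"
  proof -
    have 1: "(\<lambda>X. s ((- V / 2 - Q / 4) + (1 / 2) * X) ((- V / 2 + Q / 4) + (1 / 2) * X)) holomorphic_on UNIV"
      by (rule hol(2))
    have "h = (\<lambda>X. s ((- V / 2 - Q / 4) + (1 / 2) * X) ((- V / 2 + Q / 4) + (1 / 2) * X) / ?T (Q / 2))"
      by (rule ext) (rule h_eq)
    then show ?thesis
      using holomorphic_on_divide[OF 1 holomorphic_on_const, of "?T (Q / 2)"] Th by (simp only: not_False_eq_True)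
  qed
  obtain f1 f2 where h: "\<And>X. h X = f1 * th0 Q X + f2 * th1 Q X"
  proof (rule theta_degree_2[OF Q h_hol])
    fix X
    define A where "A = (X - V - Q / 2) / 2"
    define Z where "Z = (X - V + Q / 2) / 2"
    have X: "V + Z + A = X" and ZA: "Z - A = Q / 2" by (simp_all add: A_def Z_def field_simps)
    have b1: "V + (Z + 2 * of_real pi * \<i>) + A = X + 2 * of_real pi * \<i>"
      and b2: "Z + 2 * of_real pi * \<i> - A = Q / 2 + 2 * of_real pi * \<i>"
      unfolding X[symmetric] ZA[symmetric] by simp_all
    have "h (X + 2 * of_real pi * \<i>) * ?T (Q / 2 + 2 * of_real pi * \<i>) = - (h X * ?T (Q / 2))"
      using per(2)[of A Z] unfolding sh b1 b2 X ZA .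
    then show "h (X + 2 * of_real pi * \<i>) = h X"
      unfolding thA_shift_2pi using Th by simp
    have a1: "V + (Z + Q) + A = X + Q" and a2: "Z + Q - A = Q / 2 + Q" unfolding X[symmetric] ZA[symmetric] by simp_all
    have "h (X + Q) * ?T (Q / 2 + Q) = - exp (- 3 * Q / 2 - 3 * Z - 2 * V - A) * (h X * ?T (Q / 2))"
      using quasi(2)[of A Z] unfolding sh a1 a2 X ZA .
    then have "exp (- Q / 2 - Q / 2) * h (X + Q) = exp (- 3 * Q / 2 - 3 * Z - 2 * V - A) * h X"
      unfolding thA_quasi_period using Th by (simp add: mult.commute)
    also have "exp (- 3 * Q / 2 - 3 * Z - 2 * V - A) = exp (- Q / 2 - Q / 2) * exp (- Q - 2 * X)"
      unfolding exp_add[symmetric] by (rule arg_cong[of _ _ exp]) (simp add: A_def Z_def field_simps)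
    finally show "h (X + Q) = exp (- Q - 2 * X) * h X" by simp
  qed auto
  have hg: "h X = th_comb f1 f2 Q X" for X by (simp add: h th_comb_def)
  have main': "f0 * (p A Z * ?T (A + 2 * V + Z) - ?T (Z + 2 * V - A) * (h (V + Z + A) * ?T (Z - A))) = y * (?T (2 * A) * ?T (2 * V + 2 * Z))" for A Z
    using main[of Z A] by (simp add: Cf sh)

  \<comment> \<open>At \<open>a v\<^sup>2 z = 1\<close> the unknown \<open>p\<close> drops out.\<close>
  have y_eq: "y = f0 * h V"
  proof (rule thA_mult_cancel_affine[OF Q, of "\<lambda>_. y" "\<lambda>_. f0 * h V" 0 2])
    fix A
    show "?T (0 + 2 * A) * y = ?T (0 + 2 * A) * (f0 * h V)"
    proof (rule thA_mult_cancel_affine[OF Q, of "\<lambda>A. ?T (0 + 2 * A) * y" "\<lambda>A. ?T (0 + 2 * A) * (f0 * h V)" "2 * V" 2])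
      fix A
      have T1: "?T (2 * V + 2 * (- A - 2 * V)) = - ?T (2 * V + 2 * A)"
        using thA_minus[of Q "2 * V + 2 * A"] by (simp add: algebra_simps)
      have T2: "?T (- A - 2 * V + 2 * V - A) = - ?T (2 * A)"
        using thA_minus[of Q "2 * A"] by (simp add: algebra_simps)
      have T3: "?T (- A - 2 * V - A) = - ?T (2 * V + 2 * A)"
        using thA_minus[of Q "2 * V + 2 * A"] by (simp add: algebra_simps)
      have T4: "?T (A + 2 * V + (- A - 2 * V)) = 0" by simp
      have h1: "h (V + (- A - 2 * V) + A) = h V" using th_comb_minus[of f1 f2 Q V] by (simp add: hg)
      show "?T (2 * V + 2 * A) * (?T (0 + 2 * A) * y) = ?T (2 * V + 2 * A) * (?T (0 + 2 * A) * (f0 * h V))"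
        using main'[of A "- A - 2 * V"] unfolding T1 T2 T3 T4 h1 by (auto simp: mult_ac)
    qed (rule holomorphic_on_mult[OF holomorphic_compose_affine[OF thA_holomorphic[OF Q]] holomorphic_on_const],
        rule holomorphic_on_mult[OF holomorphic_compose_affine[OF thA_holomorphic[OF Q]] holomorphic_on_const], simp)
  qed auto
  have p: "p A Z = h (V + Z - A) * ?T (Z + A)" for A Z
  proof (rule thA_mult_cancel_affine[OF Q, of "\<lambda>Z. p A Z" "\<lambda>Z. h (V + Z - A) * ?T (Z + A)" "A + 2 * V" 1])
    fix Z
    have tt: "h (V + Z - A) * (?T (A + 2 * V + Z) * ?T (Z + A)) - h (V + Z + A) * (?T (Z + 2 * V - A) * ?T (Z - A))
        = h V * (?T (2 * V + 2 * Z) * ?T (2 * A))"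
      using three_term[OF Q, of f1 f2 "V + Z - A" "V + Z + A" V] unfolding hg by (simp add: algebra_simps)
    have "f0 * (p A Z * ?T (A + 2 * V + Z) - ?T (Z + 2 * V - A) * (h (V + Z + A) * ?T (Z - A)))
      = f0 * (h V * (?T (2 * V + 2 * Z) * ?T (2 * A)))"
      unfolding main' y_eq by (simp add: mult_ac)
    then have "p A Z * ?T (A + 2 * V + Z) - ?T (Z + 2 * V - A) * (h (V + Z + A) * ?T (Z - A))
      = h (V + Z - A) * (?T (A + 2 * V + Z) * ?T (Z + A)) - h (V + Z + A) * (?T (Z + 2 * V - A) * ?T (Z - A))"
      unfolding tt using f0 by simp
    then show "?T (A + 2 * V + 1 * Z) * p A Z = ?T (A + 2 * V + 1 * Z) * (h (V + Z - A) * ?T (Z + A))"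
      by (simp add: mult_ac)
  next
    have "(\<lambda>Z. h ((V - A) + 1 * Z) * ?T (A + 1 * Z)) holomorphic_on UNIV"
      by (intro holomorphic_intros holomorphic_compose_affine h_hol thA_holomorphic Q)
    then show "(\<lambda>Z. h (V + Z - A) * ?T (Z + A)) holomorphic_on UNIV"
      by (simp add: algebra_simps)
  qed (use hol_snd[where F = p, OF hol(1)] in auto)
  show ?thesis
    using p sh C(2,3) y_eq by (intro exI[of _ f0] exI[of _ f1] exI[of _ f2]) (simp add: hg Cf)
qed

section \<open>The components of the vectors\<close>

lemma all_fixpt: "(\<forall>p. P p) \<longleftrightarrow> P P2 \<and> P P11"
  by (metis fixpt.exhaust)

lemma UNIV_fixpt: "UNIV = {P2, P11}"
  by (auto intro: fixpt.exhaust)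

lemma vec2_nth [simp]: "vec2 x y $ P2 = x" "vec2 x y $ P11 = y"
  by (simp_all add: vec2_def)

lemma vec2_eqI:
  assumes "w $ P2 = x" "w $ P11 = y"
  shows "w = vec2 x y"
  using assms by (simp add: vec_eq_iff all_fixpt)

lemma bun_O_nth [simp]:
  "bun_O n A V $ P2 = exp (of_real n * (2 * V - A))"
  "bun_O n A V $ P11 = exp (of_real n * (2 * V + A))"
  unfolding bun_O_def lpow_def vec2_nth exp_add[symmetric]
  by (rule arg_cong[of _ _ exp], simp add: algebra_simps)+

lemma sqrt_L_minus_nth [simp]:
  "sqrt_L_minus A V $ P2 = exp (- A - V)"
  "sqrt_L_minus A V $ P11 = exp (- 2 * A - V)"
  unfolding sqrt_L_minus_def vector_smult_component bun_O_nth lpow_def exp_add[symmetric]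
  by (rule arg_cong[of _ _ exp], simp add: algebra_simps)+

lemma delta_z_apply: "delta_z t f (A, Z, V, Q) = f (A, Z + of_real t * Q, V, Q)"
  by (simp add: delta_z_def)

lemma has_sum_vec2:
  assumes "(f has_sum a) S" "(g has_sum b) S"
  shows "((\<lambda>x. vec2 (f x) (g x)) has_sum vec2 a b) S"
  unfolding has_sum_def
proof (rule vec_tendstoI)
  fix i :: fixpt
  have "(\<Sum>x\<in>F. vec2 (f x) (g x)) $ P2 = (\<Sum>x\<in>F. f x)" "(\<Sum>x\<in>F. vec2 (f x) (g x)) $ P11 = (\<Sum>x\<in>F. g x)" for F
    by (simp_all add: sum_component)
  then show "((\<lambda>F. (\<Sum>x\<in>F. vec2 (f x) (g x)) $ i) \<longlongrightarrow> vec2 a b $ i) (finite_subsets_at_top S)"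
    using assms unfolding has_sum_def by (cases i) simp_all
qed

lemma infsum_vec2_product:
  assumes "(\<lambda>l. norm (f l)) summable_on UNIV" "(\<lambda>m. norm (g m)) summable_on UNIV"
    "(f has_sum a) UNIV" "(g has_sum b) UNIV"
    "(\<lambda>l. norm (f' l)) summable_on UNIV" "(\<lambda>m. norm (g' m)) summable_on UNIV"
    "(f' has_sum a') UNIV" "(g' has_sum b') UNIV"
    "\<And>l m. F (l, m) = vec2 (f l * g m) (f' l * g' m)"
  shows "(\<Sum>\<^sub>\<infinity>p. F p) = vec2 (a * b) (a' * b')"
proof (rule infsumI)
  have "F p = vec2 (f (fst p) * g (snd p)) (f' (fst p) * g' (snd p))" for p
    using assms(9)[of "fst p" "snd p"] by simp
  then have "F = (\<lambda>p. vec2 (f (fst p) * g (snd p)) (f' (fst p) * g' (snd p)))" by (rule ext)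
  then show "(F has_sum vec2 (a * b) (a' * b')) UNIV"
    using has_sum_vec2[OF has_sum_product[OF assms(1-4)] has_sum_product[OF assms(5-8)]] by simp
qed

lemma series_1_eq:
  assumes Q: "Re Q < 0"
  shows "series_1 (A, Z, V, Q) = vec2 (th0 Q (V + Z - A) * thA Q (Z + A)) (th0 Q (V + Z + A) * thA Q (Z - A))"
  unfolding series_1_def prod.case
proof (rule infsum_vec2_product[OF _ _ has_sum_th0[OF Q] has_sum_thA[OF Q] _ _ has_sum_th0[OF Q] has_sum_thA[OF Q]])
  fix l m :: int
  show "(case (l, m) of (l, m) \<Rightarrow> let l = of_int l :: real; n = of_int m :: real in
     ((- 1) powi m * lpow Q (l\<^sup>2 + (n + 1/2)\<^sup>2 / 2) *
        lpow V (- 2*l + 2*n + 1) * lpow Z (2*l + n + 1/2)) *s bun_O (2*l - n - 1/2) A V)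
    = vec2 (jtheta_term 1 1 0 Q (V + Z - A) l * jtheta_term (- 1) (1 / 2) (1 / 2) Q (Z + A) m)
       (jtheta_term 1 1 0 Q (V + Z + A) l * jtheta_term (- 1) (1 / 2) (1 / 2) Q (Z - A) m)"
    unfolding prod.case Let_def
    by (rule vec2_eqI; unfold vector_smult_component bun_O_nth lpow_def jtheta_term_def;
        simp only: power_int_1_left mult_1_left mult.assoc mult.left_commute[of "exp _" "_ powi _"] exp_add[symmetric];
        intro arg_cong2[of _ _ _ _ "(*)"] arg_cong[of _ _ exp] refl; simp add: power2_eq_square field_simps)
qed (use Q in \<open>simp_all add: jtheta_term_abs_summable\<close>)

lemma series_2_eq:
  assumes Q: "Re Q < 0"
  shows "series_2 (A, Z, V, Q) = vec2 (th1 Q (V + Z - A) * thA Q (Z + A)) (th1 Q (V + Z + A) * thA Q (Z - A))"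
  unfolding series_2_def prod.case
proof (rule infsum_vec2_product[OF _ _ has_sum_th1[OF Q] has_sum_thA[OF Q] _ _ has_sum_th1[OF Q] has_sum_thA[OF Q]])
  fix l m :: int
  show "(case (l, m) of (l, m) \<Rightarrow> let l = of_int l :: real; n = of_int m :: real in
     ((- 1) powi m * lpow Q ((l + 1/2)\<^sup>2 + (n + 1/2)\<^sup>2 / 2) *
        lpow V (- 2*l + 2*n) * lpow Z (2*l + n + 3/2)) *s bun_O (2*l - n + 1/2) A V)
    = vec2 (jtheta_term 1 1 (1 / 2) Q (V + Z - A) l * jtheta_term (- 1) (1 / 2) (1 / 2) Q (Z + A) m)
       (jtheta_term 1 1 (1 / 2) Q (V + Z + A) l * jtheta_term (- 1) (1 / 2) (1 / 2) Q (Z - A) m)"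
    unfolding prod.case Let_def
    by (rule vec2_eqI; unfold vector_smult_component bun_O_nth lpow_def jtheta_term_def;
        simp only: power_int_1_left mult_1_left mult.assoc mult.left_commute[of "exp _" "_ powi _"] exp_add[symmetric];
        intro arg_cong2[of _ _ _ _ "(*)"] arg_cong[of _ _ exp] refl; simp add: power2_eq_square field_simps)
qed (use Q in \<open>simp_all add: jtheta_term_abs_summable\<close>)

lemma series_0_eq:
  assumes Q: "Re Q < 0"
  shows "series_0 (A, Z, V, Q) = vec2 (thA Q (Z + 2 * V - A)) (thA Q (Z + 2 * V + A))"
  unfolding series_0_def prod.case
proof (rule infsumI)
  have "(let n = of_int m :: real in
     ((- 1) powi m * lpow Q ((n + 1/2)\<^sup>2 / 2) * lpow Z (n + 1/2)) *s bun_O (n + 1/2) A V)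
    = vec2 (jtheta_term (- 1) (1 / 2) (1 / 2) Q (Z + 2 * V - A) m) (jtheta_term (- 1) (1 / 2) (1 / 2) Q (Z + 2 * V + A) m)" for m :: int
    unfolding Let_def
    by (rule vec2_eqI; unfold vector_smult_component bun_O_nth lpow_def jtheta_term_def;
        simp only: mult.assoc exp_add[symmetric];
        intro arg_cong2[of _ _ _ _ "(*)"] arg_cong[of _ _ exp] refl; simp add: power2_eq_square field_simps)
  then show "((\<lambda>m. let n = of_int m :: real in
     ((- 1) powi m * lpow Q ((n + 1/2)\<^sup>2 / 2) * lpow Z (n + 1/2)) *s bun_O (n + 1/2) A V)
     has_sum vec2 (thA Q (Z + 2 * V - A)) (thA Q (Z + 2 * V + A))) UNIV"
    using has_sum_vec2[OF has_sum_thA[OF Q] has_sum_thA[OF Q]] by simp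
qed

lemma theta_even_eq: "theta_even (V, Q) = th0 Q V"
proof -
  have "lpow Q ((of_int m)\<^sup>2) * lpow V (2 * of_int m) = jtheta_term 1 1 0 Q V m" for m :: int
    unfolding lpow_def jtheta_term_def exp_add[symmetric] by simp
  then show ?thesis by (simp add: theta_even_def th0_def jtheta_def)
qed

lemma theta_odd_eq: "theta_odd (V, Q) = th1 Q V"
proof -
  have "lpow Q ((of_int m + 1/2)\<^sup>2) * lpow V (2 * of_int m + 1) = jtheta_term 1 1 (1 / 2) Q V m" for m :: int
    unfolding lpow_def jtheta_term_def exp_add[symmetric] by (simp add: algebra_simps)
  then show ?thesis by (simp add: theta_odd_def th1_def jtheta_def)
qed

text \<open>The explicit formulas with the series replaced by products of theta functions.\<close>

definition theta_form :: "(fixpt \<Rightarrow> pt \<Rightarrow> complex^fixpt) \<Rightarrow> (complex \<times> complex \<Rightarrow> complex) \<Rightarrow>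
    (complex \<times> complex \<Rightarrow> complex) \<Rightarrow> (complex \<times> complex \<Rightarrow> complex) \<Rightarrow> bool" where
  "theta_form E f0 f1 f2 \<longleftrightarrow> (\<forall>A Z V Q. Re Q < 0 \<longrightarrow>
     E P2 (A, Z, V, Q) = vec2 (th_comb (f1 (V, Q)) (f2 (V, Q)) Q (V + Z - A) * thA Q (Z + A))
       (th_comb (f1 (V, Q)) (f2 (V, Q)) Q (V + Z + A) * thA Q (Z - A)) \<and>
     E P11 (A, Z, V, Q) = vec2 (f0 (V, Q) * thA Q (Z + 2 * V - A)) (f0 (V, Q) * thA Q (Z + 2 * V + A)))"

lemma theta_form_iff:
  "theta_form E f0 f1 f2 \<longleftrightarrow>
    (\<forall>(A, Z, V, Q)\<in>cover. E P2 (A, Z, V, Q) =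
       f1 (V, Q) *s series_1 (A, Z, V, Q) + f2 (V, Q) *s series_2 (A, Z, V, Q)) \<and>
    (\<forall>(A, Z, V, Q)\<in>cover. E P11 (A, Z, V, Q) = f0 (V, Q) *s series_0 (A, Z, V, Q))"
proof -
  have 1: "f1 (V, Q) *s series_1 (A, Z, V, Q) + f2 (V, Q) *s series_2 (A, Z, V, Q)
      = vec2 (th_comb (f1 (V, Q)) (f2 (V, Q)) Q (V + Z - A) * thA Q (Z + A))
       (th_comb (f1 (V, Q)) (f2 (V, Q)) Q (V + Z + A) * thA Q (Z - A))" if "Re Q < 0" for A Z V Q
    by (rule vec2_eqI) (simp_all add: series_1_eq[OF that] series_2_eq[OF that] th_comb_def algebra_simps)
  have 2: "f0 (V, Q) *s series_0 (A, Z, V, Q)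
      = vec2 (f0 (V, Q) * thA Q (Z + 2 * V - A)) (f0 (V, Q) * thA Q (Z + 2 * V + A))" if "Re Q < 0" for A Z V Q
    by (rule vec2_eqI) (simp_all add: series_0_eq[OF that])
  show ?thesis
    unfolding theta_form_def cover_def using 1 2 by auto
qed

lemma theta_form_nth:
  assumes "theta_form E f0 f1 f2" "Re Q < 0"
  shows "E P2 (A, Z, V, Q) $ P2 = th_comb (f1 (V, Q)) (f2 (V, Q)) Q (V + Z - A) * thA Q (Z + A)"
    "E P2 (A, Z, V, Q) $ P11 = th_comb (f1 (V, Q)) (f2 (V, Q)) Q (V + Z + A) * thA Q (Z - A)"
    "E P11 (A, Z, V, Q) $ P2 = f0 (V, Q) * thA Q (Z + 2 * V - A)"
    "E P11 (A, Z, V, Q) $ P11 = f0 (V, Q) * thA Q (Z + 2 * V + A)"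
  using assms unfolding theta_form_def by simp_all


section \<open>The entries of the duality equation\<close>

lemma sum_fixpt: "sum f (UNIV :: fixpt set) = f P2 + f P11"
  by (simp add: UNIV_fixpt)

lemma mat22_nth [simp]:
  "mat22 a b c d $ P2 $ P2 = a" "mat22 a b c d $ P2 $ P11 = b"
  "mat22 a b c d $ P11 $ P2 = c" "mat22 a b c d $ P11 $ P11 = d"
  by (simp_all add: mat22_def)

lemma E_dual_nth:
  "E_dual E (A, Z, V, Q) $ P2 $ P2 = E P11 (Z, A, V, Q) $ P11"
  "E_dual E (A, Z, V, Q) $ P2 $ P11 = E P2 (Z, A, V, Q) $ P11"
  "E_dual E (A, Z, V, Q) $ P11 $ P2 = E P11 (Z, A, V, Q) $ P2"
  "E_dual E (A, Z, V, Q) $ P11 $ P11 = E P2 (Z, A, V, Q) $ P2"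
  by (simp_all add: E_dual_def Omega_def E_matrix_def matrix_matrix_mult_def sum_fixpt)

text \<open>The dual matrix exchanges \<open>a\<close> with \<open>z\<close> and \<open>[2]\<close> with \<open>[1,1]\<close>, so each entry pairs one vector at \<open>(a, z)\<close>
  with the other one at \<open>(z, a)\<close>.\<close>

lemma duality_product_nth:
  "(E_matrix E (A, Z, V, Q) ** transpose (E_dual E (A, Z, V, Q))) $ P2 $ P2
    = E P2 (A, Z, V, Q) $ P2 * E P11 (Z, A, V, Q) $ P11 + E P11 (A, Z, V, Q) $ P2 * E P2 (Z, A, V, Q) $ P11"
  "(E_matrix E (A, Z, V, Q) ** transpose (E_dual E (A, Z, V, Q))) $ P2 $ P11
    = E P2 (A, Z, V, Q) $ P2 * E P11 (Z, A, V, Q) $ P2 + E P11 (A, Z, V, Q) $ P2 * E P2 (Z, A, V, Q) $ P2"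
  "(E_matrix E (A, Z, V, Q) ** transpose (E_dual E (A, Z, V, Q))) $ P11 $ P2
    = E P2 (A, Z, V, Q) $ P11 * E P11 (Z, A, V, Q) $ P11 + E P11 (A, Z, V, Q) $ P11 * E P2 (Z, A, V, Q) $ P11"
  "(E_matrix E (A, Z, V, Q) ** transpose (E_dual E (A, Z, V, Q))) $ P11 $ P11
    = E P2 (A, Z, V, Q) $ P11 * E P11 (Z, A, V, Q) $ P2 + E P11 (A, Z, V, Q) $ P11 * E P2 (Z, A, V, Q) $ P2"
  unfolding matrix_matrix_mult_def transpose_def vec_lambda_beta sum_fixpt E_dual_nth
  by (simp_all add: E_matrix_def)

text \<open>The ratio of the alternating series to the theta product. Its square is the prefactor of the formula
  for \<open>\<Upsilon>\<close>, since the entries of the stable basis matrix have degree two in theta products.\<close>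

definition theta_scale :: "complex \<Rightarrow> complex" where
  "theta_scale Q = exp (Q / 8) * qpoch Q"

lemma theta_scale_nonzero: "Re Q < 0 \<Longrightarrow> theta_scale Q \<noteq> 0"
  by (simp add: theta_scale_def qpoch_nonzero)

lemma theta_thA: "Re Q < 0 \<Longrightarrow> theta Q X = thA Q X / theta_scale Q"
  using theta_scale_nonzero[of Q] by (simp add: thA_triple_product theta_scale_def)

lemma theta_scale_square: "(theta_scale Q)\<^sup>2 = lpow Q (1 / 4) * (qpoch Q)\<^sup>2"
  by (simp add: theta_scale_def lpow_def power_mult_distrib flip: exp_double)

text \<open>The numerator of the off-diagonal entry of the stable basis matrix factors. This is the three-term
  relation for the alternating series, with arguments chosen so that the left-hand side consists of two
  of the three terms.\<close>

lemma Stab_numerator: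
  assumes Q: "Re Q < 0"
  shows "thA Q (Z - A) * (thA Q (- 2 * A) * thA Q (V + 2 * Z - A) * thA Q (- V + Z)
           + thA Q (- V - A) * thA Q (V + Z - 2 * A) * thA Q (- 2 * Z))
    = - (thA Q (Z + A) * thA Q (2 * Z - 2 * A) * thA Q (- V + A) * thA Q (V + Z))"
proof -
  let ?T = "thA Q"
  define U where "U = V + (Z - A) / 2"
  define a where "a = (Z + A) / 2"
  define b where "b = (3 * Z - A) / 2"
  define c where "c = (3 * A - Z) / 2"
  have e: "U + a = V + Z" "U - a = V - A" "b + c = Z + A" "b - c = 2 * Z - 2 * A"
    "U + b = V + 2 * Z - A" "U - b = V - Z" "a + c = 2 * A" "a - c = Z - A"
    "U + c = V + A" "U - c = V + Z - 2 * A" "a + b = 2 * Z" "a - b = A - Z"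
    by (simp_all add: U_def a_def b_def c_def field_simps)
  have rel: "?T (V + Z) * ?T (V - A) * (?T (Z + A) * ?T (2 * Z - 2 * A))
    - ?T (V + 2 * Z - A) * ?T (V - Z) * (?T (2 * A) * ?T (Z - A))
    + ?T (V + A) * ?T (V + Z - 2 * A) * (?T (2 * Z) * ?T (A - Z)) = 0"
    using three_term_thA[OF Q, of U a b c] unfolding e .
  have m: "?T (- 2 * A) = - ?T (2 * A)" "?T (- 2 * Z) = - ?T (2 * Z)" "?T (- V - A) = - ?T (V + A)"
    "?T (- V + Z) = - ?T (V - Z)" "?T (- V + A) = - ?T (V - A)" "?T (A - Z) = - ?T (Z - A)"
    using thA_minus[of Q "2 * A"] thA_minus[of Q "2 * Z"] thA_minus[of Q "V + A"]
      thA_minus[of Q "V - Z"] thA_minus[of Q "V - A"] thA_minus[of Q "Z - A"]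
    by simp_all
  show ?thesis using rel unfolding m by (simp add: algebra_simps)
qed

text \<open>The denominator of the off-diagonal entry cancels against its numerator up to \<open>thA(z / a)\<close>, so after
  multiplication by this factor the entry is holomorphic.\<close>

lemma Stab_nth:
  fixes Y :: "complex \<times> complex \<Rightarrow> complex"
  assumes Q: "Re Q < 0"
  defines "y \<equiv> \<lambda>V. Y (V, Q) / (theta_scale Q)\<^sup>2"
  shows "Y (V, Q) * Stab_ell (A, Z, V, Q) $ P2 $ P2 = y V * (thA Q (2 * A) * thA Q (2 * V + 2 * Z))"
    "Y (V, Q) * Stab_ell (A, Z, V, Q) $ P11 $ P2 = 0"
    "Y (V, Q) * Stab_ell (A, Z, V, Q) $ P11 $ P11 = y V * (thA Q (2 * V + 2 * A) * thA Q (2 * Z))"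
    "thA Q (- V + A) * thA Q (V + Z) * thA Q (Z - A) \<noteq> 0 \<Longrightarrow>
      Y (V, Q) * Stab_ell (A, Z, V, Q) $ P2 $ P11 * thA Q (Z - A)
       = y V * (thA Q (Z + A) * thA Q (2 * V) * thA Q (2 * Z - 2 * A))"
proof -
  let ?T = "thA Q"
  let ?k = "theta_scale Q"
  note k = theta_scale_nonzero[OF Q]
  have m: "?T (- 2 * A) = - ?T (2 * A)" "?T (- 2 * V - 2 * Z) = - ?T (2 * V + 2 * Z)"
    "?T (- 2 * V - 2 * A) = - ?T (2 * V + 2 * A)" "?T (- 2 * Z) = - ?T (2 * Z)" "?T (- 2 * V) = - ?T (2 * V)"
    using thA_minus[of Q "2 * A"] thA_minus[of Q "2 * V + 2 * Z"] thA_minus[of Q "2 * V + 2 * A"]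
      thA_minus[of Q "2 * Z"] thA_minus[of Q "2 * V"]
    by simp_all
  show "Y (V, Q) * Stab_ell (A, Z, V, Q) $ P2 $ P2 = y V * (?T (2 * A) * ?T (2 * V + 2 * Z))"
    "Y (V, Q) * Stab_ell (A, Z, V, Q) $ P11 $ P2 = 0"
    "Y (V, Q) * Stab_ell (A, Z, V, Q) $ P11 $ P11 = y V * (?T (2 * V + 2 * A) * ?T (2 * Z))"
    unfolding Stab_ell_def prod.case Let_def mat22_nth theta_thA[OF Q] m y_def
    by (simp_all add: power2_eq_square)
  assume nz: "?T (- V + A) * ?T (V + Z) * ?T (Z - A) \<noteq> 0"
  define N where "N = ?T (- 2 * A) * ?T (V + 2 * Z - A) * ?T (- V + Z)
           + ?T (- V - A) * ?T (V + Z - 2 * A) * ?T (- 2 * Z)"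
  have N3: "?T (- 2 * A) / ?k * (?T (V + 2 * Z - A) / ?k) * (?T (- V + Z) / ?k)
      + ?T (- V - A) / ?k * (?T (V + Z - 2 * A) / ?k) * (?T (- 2 * Z) / ?k) = N / ?k ^ 3"
    unfolding N_def by (simp only: power3_eq_cube add_divide_distrib times_divide_times_eq)
  have "Stab_ell (A, Z, V, Q) $ P2 $ P11 = ?T (- 2 * V) / ?k * (N / ?k ^ 3) / (?T (- V + A) / ?k * (?T (V + Z) / ?k))"
    unfolding Stab_ell_def prod.case Let_def mat22_nth theta_thA[OF Q] N3 ..
  also have "\<dots> = - (?T (2 * V) * N) / (?k\<^sup>2 * (?T (- V + A) * ?T (V + Z)))"
    unfolding m using k nz by (simp add: divide_simps power2_eq_square power3_eq_cube)
  finally have "Y (V, Q) * Stab_ell (A, Z, V, Q) $ P2 $ P11 * ?T (Z - A)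
      = - (y V * ?T (2 * V) * (?T (Z - A) * N)) / (?T (- V + A) * ?T (V + Z))"
    by (simp add: y_def)
  also have "?T (Z - A) * N = - (?T (Z + A) * ?T (2 * Z - 2 * A) * ?T (- V + A) * ?T (V + Z))"
    unfolding N_def by (rule Stab_numerator[OF Q])
  also have "- (y V * ?T (2 * V) * - (?T (Z + A) * ?T (2 * Z - 2 * A) * ?T (- V + A) * ?T (V + Z))) / (?T (- V + A) * ?T (V + Z))
      = y V * (?T (Z + A) * ?T (2 * V) * ?T (2 * Z - 2 * A))"
    using nz by (simp add: divide_simps)
  finally show "Y (V, Q) * Stab_ell (A, Z, V, Q) $ P2 $ P11 * ?T (Z - A)
       = y V * (?T (Z + A) * ?T (2 * V) * ?T (2 * Z - 2 * A))" .
qed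

subsection \<open>Holomorphy of the building blocks\<close>

lemma complex_diff_cmult: "complex_diff J f x \<Longrightarrow> complex_diff J (\<lambda>x. c * f x) x"
  by (rule complex_diff_mult[OF complex_diff_const])

lemma complex_diff_minus: "complex_diff J f x \<Longrightarrow> complex_diff J (\<lambda>x. - f x) x"
  using complex_diff_cmult[of J f x "- 1"] by simp

lemma complex_diff_diff:
  "complex_diff J f x \<Longrightarrow> complex_diff J g x \<Longrightarrow> complex_diff J (\<lambda>x. f x - g x) x"
  using complex_diff_add[OF _ complex_diff_minus, of J f x g] by simp

lemma complex_diff_thA:
  "complex_diff J q x \<Longrightarrow> complex_diff J f x \<Longrightarrow> Re (q x) < 0 \<Longrightarrow> complex_diff J (\<lambda>x. thA (q x) (f x)) x"
  using complex_diff_pair2[where J = J and f = q and g = f and x = x, OF thA_complex_diff] by simp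

lemma complex_diff_th0:
  "complex_diff J q x \<Longrightarrow> complex_diff J f x \<Longrightarrow> Re (q x) < 0 \<Longrightarrow> complex_diff J (\<lambda>x. th0 (q x) (f x)) x"
  using complex_diff_pair2[where J = J and f = q and g = f and x = x, OF th0_complex_diff] by simp

lemma complex_diff_th1:
  "complex_diff J q x \<Longrightarrow> complex_diff J f x \<Longrightarrow> Re (q x) < 0 \<Longrightarrow> complex_diff J (\<lambda>x. th1 (q x) (f x)) x"
  using complex_diff_pair2[where J = J and f = q and g = f and x = x, OF th1_complex_diff] by simp

lemma complex_diff_coords4:
  "complex_diff J4 fst x" "complex_diff J4 (\<lambda>x. fst (snd x)) x"
  "complex_diff J4 (\<lambda>x. fst (snd (snd x))) x" "complex_diff J4 (\<lambda>x. snd (snd (snd x))) x"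
  by (auto intro!: complex_diff_linear bounded_linear_fst bounded_linear_snd
      bounded_linear_compose[OF bounded_linear_fst] bounded_linear_compose[OF bounded_linear_snd]
      simp: J4_def split: prod.splits)

lemma complex_diff_coords3:
  "complex_diff J3 fst x" "complex_diff J3 (\<lambda>x. fst (snd x)) x" "complex_diff J3 (\<lambda>x. snd (snd x)) x"
  by (auto intro!: complex_diff_linear bounded_linear_fst bounded_linear_snd
      bounded_linear_compose[OF bounded_linear_fst] bounded_linear_compose[OF bounded_linear_snd]
      simp: J3_def split: prod.splits)

lemmas complex_diff_intros =
  complex_diff_const complex_diff_add complex_diff_diff complex_diff_minus complex_diff_mult
  complex_diff_exp complex_diff_thA complex_diff_th0 complex_diff_th1
  complex_diff_coords2 complex_diff_coords3 complex_diff_coords4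

lemma cover_iff: "(A, Z, V, Q) \<in> cover \<longleftrightarrow> Re Q < 0"
  by (simp add: cover_def)

lemma cover_vq_iff: "(V, Q) \<in> cover_vq \<longleftrightarrow> Re Q < 0"
  by (simp add: cover_vq_def)

lemma cover_eq: "cover = {x. Re (snd (snd (snd x))) < 0}"
  by (auto simp: cover_def)

lemma cover_vq_eq: "cover_vq = {x. Re (snd x) < 0}"
  by (auto simp: cover_vq_def)

lemma open_cover: "open cover"
  unfolding cover_eq by (intro open_Collect_less continuous_intros)

lemma isCont_theta_scale:
  assumes "Re Q < 0"
  shows "isCont theta_scale Q"
proof -
  have "isCont (\<lambda>Q. euler_prod Q 0) Q"
    using isCont_o2[of Q "\<lambda>Q. (Q, 0)" "\<lambda>(Q, X). euler_prod Q X"] euler_prod_continuous[OF assms, of 0]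
    by (simp add: continuous_Pair)
  then show ?thesis
    unfolding theta_scale_def[abs_def] qpoch_eq by (intro continuous_intros) auto
qed

lemma continuous_eq_on_dense:
  fixes F G :: "'a::metric_space \<Rightarrow> 'b::t2_space"
  assumes "U \<subseteq> closure D" "x \<in> U" "isCont F x" "isCont G x" "\<And>x. x \<in> D \<Longrightarrow> F x = G x"
  shows "F x = G x"
proof -
  obtain w where w: "\<And>n. w n \<in> D" "w \<longlonglongrightarrow> x"
    using assms(1,2) closure_sequential by blast
  have "(\<lambda>n. F (w n)) \<longlonglongrightarrow> F x" "(\<lambda>n. G (w n)) \<longlonglongrightarrow> G x"
    using isCont_tendsto_compose[OF assms(3) w(2)] isCont_tendsto_compose[OF assms(4) w(2)] .
  moreover have "(\<lambda>n. F (w n)) = (\<lambda>n. G (w n))" using assms(5) w(1) by auto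
  ultimately show ?thesis using LIMSEQ_unique by metis
qed


subsection \<open>The equation away from the poles of the stable basis\<close>

lemma countable_thA_zeros:
  assumes Q: "Re Q < 0" and b: "b \<noteq> 0"
  shows "countable {u. thA Q (a + b * u) = 0}"
proof (rule countable_subset)
  show "{u. thA Q (a + b * u) = 0} \<subseteq> range (\<lambda>(n :: int, k :: int). (of_int n * Q + 2 * of_real pi * \<i> * of_int k - a) / b)"
  proof safe
    fix u assume "thA Q (a + b * u) = 0"
    then obtain n k :: int where "a + b * u = of_int n * Q + 2 * of_real pi * \<i> * of_int k"
      unfolding thA_eq_0_iff[OF Q] by blast
    then have "u = (of_int n * Q + 2 * of_real pi * \<i> * of_int k - a) / b"
      using b by (simp add: eq_divide_eq algebra_simps)
    then show "u \<in> range (\<lambda>(n :: int, k :: int). (of_int n * Q + 2 * of_real pi * \<i> * of_int k - a) / b)"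
      by (auto intro: image_eqI[of _ _ "(n, k)"])
  qed
qed auto

text \<open>The zeros are countable, and discs are not.\<close>

lemma thA_generic_near:
  assumes Q: "Re Q < 0" and "\<epsilon> > 0"
  obtains u where "norm u < \<epsilon>" "thA Q (a + u) \<noteq> 0" "thA Q (b + 2 * u) \<noteq> 0" "thA Q (c + u) \<noteq> 0"
proof -
  let ?Bad = "{u. thA Q (a + 1 * u) = 0} \<union> {u. thA Q (b + 2 * u) = 0} \<union> {u. thA Q (c + 1 * u) = 0}"
  have "countable ?Bad" by (intro countable_Un countable_thA_zeros Q) auto
  moreover have "uncountable (ball (0 :: complex) \<epsilon>)" by (rule uncountable_ball) fact
  ultimately have "\<not> ball 0 \<epsilon> \<subseteq> ?Bad" by (metis countable_subset)
  then obtain u where "u \<in> ball 0 \<epsilon>" "u \<notin> ?Bad" unfolding subset_iff by metis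
  then show ?thesis by (intro that[of u]) auto
qed

text \<open>Its zeros contain the poles of the stable basis matrix, and the points where the factored form of
  its off-diagonal entry has a denominator \<open>0\<close>.\<close>

definition pole_function :: "pt \<Rightarrow> complex" where
  "pole_function = (\<lambda>(A, Z, V, Q). thA Q (- V + A) * thA Q (V + Z) * thA Q (Z - A))"

definition pole_free :: "pt set" where
  "pole_free = {x \<in> cover. pole_function x \<noteq> 0}"

lemma open_pole_free: "open pole_free"
proof -
  have "isCont pole_function x" if "x \<in> cover" for x
    unfolding pole_function_def case_prod_beta
    by (intro complex_diff_imp_isCont[of J4] complex_diff_intros) (use that in \<open>auto simp: cover_eq\<close>)
  then have "continuous_on cover pole_function"
    by (simp add: continuous_at_imp_continuous_on)
  then have "open (cover \<inter> pole_function -` (- {0}))"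
    by (intro continuous_open_preimage open_cover) auto
  also have "cover \<inter> pole_function -` (- {0}) = pole_free"
    by (auto simp: pole_free_def)
  finally show ?thesis .
qed

lemma pole_free_dense: "cover \<subseteq> closure pole_free"
proof
  fix x assume x: "x \<in> cover"
  obtain A Z V Q where xe: "x = (A, Z, V, Q)" by (cases x)
  have Q: "Re Q < 0" using x by (simp add: xe cover_iff)
  show "x \<in> closure pole_free"
    unfolding closure_approachable
  proof (intro allI impI)
    fix e :: real assume e: "e > 0"
    obtain u where u: "norm u < e / 3" "thA Q (- V + A + u) \<noteq> 0" "thA Q (V + Z + 2 * u) \<noteq> 0" "thA Q (Z - A + u) \<noteq> 0"
      by (rule thA_generic_near[OF Q, of "e / 3" "- V + A" "V + Z" "Z - A"]) (use e in auto)
    have "(A + u, Z + 2 * u, V, Q) \<in> pole_free"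
      using u Q by (simp add: pole_free_def pole_function_def cover_iff algebra_simps)
    moreover have "dist (A + u, Z + 2 * u, V, Q) x < e"
    proof -
      have "dist (A + u, Z + 2 * u, V, Q) x = norm (u, 2 * u, (0::complex), (0::complex))"
        by (simp add: xe dist_norm zero_prod_def)
      also have "\<dots> \<le> norm u + norm (2 * u, (0::complex), (0::complex))" by (rule norm_Pair_le)
      also have "norm (2 * u, (0::complex), (0::complex)) \<le> norm (2 * u) + norm ((0::complex), (0::complex))" by (rule norm_Pair_le)
      finally show ?thesis using u(1) by (simp add: norm_mult)
    qed
    ultimately show "\<exists>y\<in>pole_free. dist y x < e" by blast
  qed
qed

text \<open>It suffices to verify the four entries of the duality equation, with denominators cleared, away from
  the poles: this set is open and dense.\<close>

lemma cond_BI: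
  fixes E :: "fixpt \<Rightarrow> pt \<Rightarrow> complex^fixpt" and Y :: "complex \<times> complex \<Rightarrow> complex"
  assumes "\<And>A Z V Q. Re Q < 0 \<Longrightarrow> thA Q (- V + A) * thA Q (V + Z) * thA Q (Z - A) \<noteq> 0 \<Longrightarrow>
    let y = Y (V, Q) / (theta_scale Q)\<^sup>2;
      p = \<lambda>A Z. E P2 (A, Z, V, Q) $ P2; s = \<lambda>A Z. E P2 (A, Z, V, Q) $ P11;
      r = \<lambda>A Z. E P11 (A, Z, V, Q) $ P2; t = \<lambda>A Z. E P11 (A, Z, V, Q) $ P11 in
    p A Z * t Z A + r A Z * s Z A = y * (thA Q (2 * A) * thA Q (2 * V + 2 * Z)) \<and>
    (p A Z * r Z A + r A Z * p Z A) * thA Q (Z - A) = y * (thA Q (Z + A) * thA Q (2 * V) * thA Q (2 * Z - 2 * A)) \<and>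
    s A Z * t Z A + t A Z * s Z A = 0 \<and>
    s A Z * r Z A + t A Z * p Z A = y * (thA Q (2 * V + 2 * A) * thA Q (2 * Z))"
  shows "cond_B E Y"
  unfolding cond_B_def eq_mero_on_def
proof (intro exI conjI ballI)
  show "open pole_free" by (rule open_pole_free)
  show "pole_free \<subseteq> cover" by (auto simp: pole_free_def)
  show "cover \<subseteq> closure pole_free" by (rule pole_free_dense)
  fix x assume "x \<in> pole_free"
  then obtain A Z V Q where x: "x = (A, Z, V, Q)" and Q: "Re Q < 0"
    and nz: "thA Q (- V + A) * thA Q (V + Z) * thA Q (Z - A) \<noteq> 0"
    by (cases x) (auto simp: pole_free_def pole_function_def cover_iff)
  have nz': "thA Q (Z - A) \<noteq> 0" using nz by auto
  note st = Stab_nth[where Y = Y and V = V and A = A and Z = Z, OF Q] and e = assms[OF Q nz, unfolded Let_def]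
  have "Y (V, Q) * Stab_ell (A, Z, V, Q) $ i $ j = (E_matrix E (A, Z, V, Q) ** transpose (E_dual E (A, Z, V, Q))) $ i $ j" for i j
  proof (cases i; cases j)
    assume ij: "i = P2" "j = P11"
    have "Y (V, Q) * Stab_ell (A, Z, V, Q) $ P2 $ P11 * thA Q (Z - A)
        = (E_matrix E (A, Z, V, Q) ** transpose (E_dual E (A, Z, V, Q))) $ P2 $ P11 * thA Q (Z - A)"
      unfolding duality_product_nth using st(4)[OF nz] e by simp
    then show ?thesis using nz' ij by simp
  qed (use st(1-3) e in \<open>simp_all only: duality_product_nth\<close>)
  then show "(case x of (A, Z, V, Q) \<Rightarrow> \<chi> i j. Y (V, Q) * Stab_ell (A, Z, V, Q) $ i $ j)
      = E_matrix E x ** transpose (E_dual E x)"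
    unfolding x prod.case by (simp add: vec_eq_iff)
qed

text \<open>Conversely, the duality equation with denominators cleared is an equation between continuous
  functions, so it extends from a dense set to the whole cover.\<close>

lemma cond_BD:
  fixes E :: "fixpt \<Rightarrow> pt \<Rightarrow> complex^fixpt" and Y :: "complex \<times> complex \<Rightarrow> complex" and V Q :: complex
  assumes B: "cond_B E Y"
    and E: "\<And>\<mu> p x. x \<in> cover \<Longrightarrow> complex_diff J4 (\<lambda>x. E \<mu> x $ p) x"
    and Y: "holomorphic2_on Y cover_vq" and Q: "Re Q < 0"
  defines "y \<equiv> Y (V, Q) / (theta_scale Q)\<^sup>2"
    and "p \<equiv> \<lambda>A Z. E P2 (A, Z, V, Q) $ P2" and "s \<equiv> \<lambda>A Z. E P2 (A, Z, V, Q) $ P11"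
    and "r \<equiv> \<lambda>A Z. E P11 (A, Z, V, Q) $ P2" and "t \<equiv> \<lambda>A Z. E P11 (A, Z, V, Q) $ P11"
  shows "p A Z * t Z A + r A Z * s Z A = y * (thA Q (2 * A) * thA Q (2 * V + 2 * Z))"
    "(p A Z * r Z A + r A Z * p Z A) * thA Q (Z - A) = y * (thA Q (Z + A) * thA Q (2 * V) * thA Q (2 * Z - 2 * A))"
    "s A Z * t Z A + t A Z * s Z A = 0"
proof -
  obtain W where W: "open W" "W \<subseteq> cover" "cover \<subseteq> closure W"
    and eq: "\<And>x. x \<in> W \<Longrightarrow> (case x of (A, Z, V, Q) \<Rightarrow> \<chi> i j. Y (V, Q) * Stab_ell (A, Z, V, Q) $ i $ j)
      = E_matrix E x ** transpose (E_dual E x)"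
    using B unfolding cond_B_def eq_mero_on_def by blast
  have "closure W \<subseteq> closure (W \<inter> pole_free)"
  proof (rule closure_minimal)
    have "W \<subseteq> W \<inter> closure pole_free" using W pole_free_dense by auto
    also have "\<dots> \<subseteq> closure (W \<inter> pole_free)" by (rule open_Int_closure_subset[OF W(1)])
    finally show "W \<subseteq> closure (W \<inter> pole_free)" .
  qed simp
  then have dense: "cover \<subseteq> closure (W \<inter> pole_free)" using W by auto
  define e where "e = (\<lambda>\<mu> p x. E \<mu> (fst (snd x), fst x, fst (snd (snd x)), snd (snd (snd x))) $ p)"
  have contE: "isCont (\<lambda>x. E \<mu> x $ p) x" "isCont (e \<mu> p) x" if "x \<in> cover" for \<mu> p x
  proof -
    show "isCont (\<lambda>x. E \<mu> x $ p) x" by (rule complex_diff_imp_isCont[OF E[OF that]])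
    have "(fst (snd x), fst x, fst (snd (snd x)), snd (snd (snd x))) \<in> cover"
      using that by (simp add: cover_eq)
    then have "complex_diff J4 (\<lambda>x. E \<mu> x $ p) (fst (snd x), fst x, fst (snd (snd x)), snd (snd (snd x)))"
      by (rule E)
    then have "complex_diff J4 (e \<mu> p) x"
      unfolding e_def by (rule complex_diff_pair4) (rule complex_diff_coords4)+
    then show "isCont (e \<mu> p) x" by (rule complex_diff_imp_isCont)
  qed
  define yy where "yy = (\<lambda>x::pt. Y (snd (snd x)) / (theta_scale (snd (snd (snd x))))\<^sup>2)"
  have contY: "isCont yy x" if "x \<in> cover" for x
  proof -
    have "snd (snd x) \<in> cover_vq" using that by (simp add: cover_eq cover_vq_eq)
    then have "complex_diff J2 Y (snd (snd x))" using Y by (simp add: holomorphic2_on_iff)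
    then have "isCont Y (snd (snd x))" by (rule complex_diff_imp_isCont)
    then have 1: "isCont (\<lambda>x. Y (snd (snd x))) x"
      by (rule isCont_o2[rotated]) (intro continuous_intros)
    have Qx: "Re (snd (snd (snd x))) < 0" using that by (simp add: cover_eq)
    have 2: "isCont (\<lambda>x::pt. theta_scale (snd (snd (snd x)))) x"
      by (rule isCont_o2[where g = theta_scale and f = "\<lambda>x. snd (snd (snd x))"]) (intro continuous_intros, rule isCont_theta_scale[OF Qx])
    show ?thesis unfolding yy_def
      by (intro continuous_intros 1 2) (use theta_scale_nonzero[OF Qx] in auto)
  qed
  have contT: "isCont (\<lambda>x. thA (snd (snd (snd x))) (f x)) x" if "x \<in> cover" "complex_diff J4 f x" for f x
    by (intro complex_diff_imp_isCont[of J4] complex_diff_thA complex_diff_coords4 that(2))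
       (use that in \<open>simp add: cover_eq\<close>)
  note ci = continuous_intros contE contY contT complex_diff_intros
  let ?x = "(A, Z, V, Q)"
  have x: "?x \<in> cover" using Q by (simp add: cover_iff)
  have on_W: "E P2 x $ P2 * e P11 P11 x + E P11 x $ P2 * e P2 P11 x
      = yy x * (thA (snd (snd (snd x))) (2 * fst x) * thA (snd (snd (snd x))) (2 * fst (snd (snd x)) + 2 * fst (snd x)))"
    "(E P2 x $ P2 * e P11 P2 x + E P11 x $ P2 * e P2 P2 x) * thA (snd (snd (snd x))) (fst (snd x) - fst x)
      = yy x * (thA (snd (snd (snd x))) (fst (snd x) + fst x) * thA (snd (snd (snd x))) (2 * fst (snd (snd x)))
          * thA (snd (snd (snd x))) (2 * fst (snd x) - 2 * fst x))"
    "E P2 x $ P11 * e P11 P11 x + E P11 x $ P11 * e P2 P11 x = 0"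
    if xW: "x \<in> W \<inter> pole_free" for x
  proof -
    obtain A Z V Q where x: "x = (A, Z, V, Q)" and Q: "Re Q < 0"
      and nz: "thA Q (- V + A) * thA Q (V + Z) * thA Q (Z - A) \<noteq> 0"
      using xW by (cases x) (auto simp: pole_free_def pole_function_def cover_iff)
    have eqn: "Y (V, Q) * Stab_ell (A, Z, V, Q) $ i $ j = (E_matrix E (A, Z, V, Q) ** transpose (E_dual E (A, Z, V, Q))) $ i $ j" for i j
      using eq[of x] xW unfolding x prod.case by (simp add: vec_eq_iff)
    note st = Stab_nth[where Y = Y and V = V and A = A and Z = Z, OF Q, unfolded eqn duality_product_nth]
    show "E P2 x $ P2 * e P11 P11 x + E P11 x $ P2 * e P2 P11 x
      = yy x * (thA (snd (snd (snd x))) (2 * fst x) * thA (snd (snd (snd x))) (2 * fst (snd (snd x)) + 2 * fst (snd x)))"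
      "(E P2 x $ P2 * e P11 P2 x + E P11 x $ P2 * e P2 P2 x) * thA (snd (snd (snd x))) (fst (snd x) - fst x)
      = yy x * (thA (snd (snd (snd x))) (fst (snd x) + fst x) * thA (snd (snd (snd x))) (2 * fst (snd (snd x)))
          * thA (snd (snd (snd x))) (2 * fst (snd x) - 2 * fst x))"
      "E P2 x $ P11 * e P11 P11 x + E P11 x $ P11 * e P2 P11 x = 0"
      using st(1,2) st(4)[OF nz] by (simp_all add: x e_def yy_def)
  qed
  have "E P2 ?x $ P2 * e P11 P11 ?x + E P11 ?x $ P2 * e P2 P11 ?x
      = yy ?x * (thA (snd (snd (snd ?x))) (2 * fst ?x) * thA (snd (snd (snd ?x))) (2 * fst (snd (snd ?x)) + 2 * fst (snd ?x)))"
    by (rule continuous_eq_on_dense[OF dense x _ _ on_W(1)]) (intro ci x)+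
  then show "p A Z * t Z A + r A Z * s Z A = y * (thA Q (2 * A) * thA Q (2 * V + 2 * Z))"
    by (simp add: p_def s_def r_def t_def y_def e_def yy_def)
  have "(E P2 ?x $ P2 * e P11 P2 ?x + E P11 ?x $ P2 * e P2 P2 ?x) * thA (snd (snd (snd ?x))) (fst (snd ?x) - fst ?x)
      = yy ?x * (thA (snd (snd (snd ?x))) (fst (snd ?x) + fst ?x) * thA (snd (snd (snd ?x))) (2 * fst (snd (snd ?x)))
          * thA (snd (snd (snd ?x))) (2 * fst (snd ?x) - 2 * fst ?x))"
    by (rule continuous_eq_on_dense[OF dense x _ _ on_W(2)]) (intro ci x)+
  then show "(p A Z * r Z A + r A Z * p Z A) * thA Q (Z - A) = y * (thA Q (Z + A) * thA Q (2 * V) * thA Q (2 * Z - 2 * A))"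
    by (simp add: p_def s_def r_def t_def y_def e_def yy_def)
  have "E P2 ?x $ P11 * e P11 P11 ?x + E P11 ?x $ P11 * e P2 P11 ?x = 0"
    by (rule continuous_eq_on_dense[OF dense x _ _ on_W(3)]) (intro ci x)+
  then show "s A Z * t Z A + t A Z * s Z A = 0"
    by (simp add: p_def s_def r_def t_def e_def)
qed

text \<open>The upper left and lower right entries are the three-term relation at \<open>v z / a, v z a, v\<close>, the upper right
  one is the relation at \<open>v z / a, v a / z, v\<close>, and the lower left one is the antisymmetry of
  \<open>thA(z / a)\<close>.\<close>

lemma theta_form_cond_B:
  fixes E :: "fixpt \<Rightarrow> pt \<Rightarrow> complex^fixpt" and Y :: "complex \<times> complex \<Rightarrow> complex"
  assumes form: "theta_form E f0 f1 f2"
    and Y: "\<And>V Q. Re Q < 0 \<Longrightarrow> Y (V, Q) / (theta_scale Q)\<^sup>2 = f0 (V, Q) * th_comb (f1 (V, Q)) (f2 (V, Q)) Q V"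
  shows "cond_B E Y"
proof (rule cond_BI)
  fix A Z V Q :: complex assume Q: "Re Q < 0"
  let ?T = "thA Q"
  define g where "g = th_comb (f1 (V, Q)) (f2 (V, Q)) Q"
  define f where "f = f0 (V, Q)"
  note E = theta_form_nth[OF form Q, where V = V, folded g_def f_def]
  have gm: "g (- X) = g X" for X by (simp add: g_def)
  have 1: "g (V + Z - A) * ?T (Z + A) * (f * ?T (A + 2 * V + Z)) + f * ?T (Z + 2 * V - A) * (g (V + A + Z) * ?T (A - Z))
      = f * g V * (?T (2 * A) * ?T (2 * V + 2 * Z))" for A Z
  proof -
    have "g (V + Z - A) * (?T (A + 2 * V + Z) * ?T (Z + A)) - g (V + Z + A) * (?T (Z + 2 * V - A) * ?T (Z - A))
        = g V * (?T (2 * V + 2 * Z) * ?T (2 * A))"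
      using three_term[OF Q, of "f1 (V, Q)" "f2 (V, Q)" "V + Z - A" "V + Z + A" V]
      unfolding g_def by (simp add: algebra_simps)
    then have "f * (g (V + Z - A) * (?T (A + 2 * V + Z) * ?T (Z + A)) - g (V + Z + A) * (?T (Z + 2 * V - A) * ?T (Z - A)))
        = f * (g V * (?T (2 * V + 2 * Z) * ?T (2 * A)))" by simp
    then show ?thesis
      unfolding thA_minus_commute[of Q A Z] by (simp add: algebra_simps)
  qed
  have 2: "(g (V + Z - A) * ?T (Z + A) * (f * ?T (A + 2 * V - Z)) + f * ?T (Z + 2 * V - A) * (g (V + A - Z) * ?T (A + Z))) * ?T (Z - A)
      = f * g V * (?T (Z + A) * ?T (2 * V) * ?T (2 * Z - 2 * A))"
  proof -
    have "g (V + Z - A) * (?T (A + 2 * V - Z) * ?T (A - Z)) - g (V + A - Z) * (?T (Z + 2 * V - A) * ?T (Z - A))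
        = g V * (?T (2 * V) * ?T (2 * A - 2 * Z))"
      using three_term[OF Q, of "f1 (V, Q)" "f2 (V, Q)" "V + Z - A" "V + A - Z" V]
      unfolding g_def by (simp add: algebra_simps)
    then have "f * ?T (Z + A) * (g (V + Z - A) * (?T (A + 2 * V - Z) * ?T (A - Z)) - g (V + A - Z) * (?T (Z + 2 * V - A) * ?T (Z - A)))
        = f * ?T (Z + A) * (g V * (?T (2 * V) * ?T (2 * A - 2 * Z)))" by simp
    then show ?thesis
      unfolding thA_minus_commute[of Q A Z] thA_minus_commute[of Q "2 * A" "2 * Z"] add.commute[of A Z]
      by (simp add: algebra_simps add_eq_0_iff2)
  qed
  show "let y = Y (V, Q) / (theta_scale Q)\<^sup>2;
      p = \<lambda>A Z. E P2 (A, Z, V, Q) $ P2; s = \<lambda>A Z. E P2 (A, Z, V, Q) $ P11;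
      r = \<lambda>A Z. E P11 (A, Z, V, Q) $ P2; t = \<lambda>A Z. E P11 (A, Z, V, Q) $ P11 in
    p A Z * t Z A + r A Z * s Z A = y * (thA Q (2 * A) * thA Q (2 * V + 2 * Z)) \<and>
    (p A Z * r Z A + r A Z * p Z A) * thA Q (Z - A) = y * (thA Q (Z + A) * thA Q (2 * V) * thA Q (2 * Z - 2 * A)) \<and>
    s A Z * t Z A + t A Z * s Z A = 0 \<and>
    s A Z * r Z A + t A Z * p Z A = y * (thA Q (2 * V + 2 * A) * thA Q (2 * Z))"
    unfolding Let_def E Y[OF Q] g_def[symmetric] f_def[symmetric]
  proof (intro conjI)
    show "g (V + Z + A) * ?T (Z - A) * (f * ?T (A + 2 * V + Z)) + f * ?T (Z + 2 * V + A) * (g (V + A + Z) * ?T (A - Z)) = 0"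
      unfolding thA_minus_commute[of Q A Z] by (simp add: algebra_simps)
    show "g (V + Z + A) * ?T (Z - A) * (f * ?T (A + 2 * V - Z)) + f * ?T (Z + 2 * V + A) * (g (V + A - Z) * ?T (A + Z))
        = f * g V * (?T (2 * V + 2 * A) * ?T (2 * Z))"
      using 1[of A Z] by (simp add: algebra_simps)
  qed (rule 1, rule 2)
qed

section \<open>Limits of the theta series at all slopes\<close>

lemma int_nearest:
  fixes n m :: int and x :: real
  assumes "\<bar>x - of_int m\<bar> < 1 / 2"
  shows "(of_int m - x)\<^sup>2 \<le> (of_int n - x)\<^sup>2" "(of_int n - x)\<^sup>2 = (of_int m - x)\<^sup>2 \<longleftrightarrow> n = m"
proof -
  have *: "(of_int m - x)\<^sup>2 < (of_int n - x)\<^sup>2" if "n \<noteq> m"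
  proof (rule power2_strict_mono)
    have "\<bar>n - m\<bar> \<ge> 1" using that by linarith
    then have "\<bar>real_of_int n - of_int m\<bar> \<ge> 1" by (metis of_int_1_le_iff of_int_abs of_int_diff)
    then show "\<bar>of_int m - x\<bar> < \<bar>of_int n - x\<bar>" using assms by linarith
  qed
  show "(of_int m - x)\<^sup>2 \<le> (of_int n - x)\<^sup>2"
    using * by (cases "n = m") (auto intro: less_imp_le)
  show "(of_int n - x)\<^sup>2 = (of_int m - x)\<^sup>2 \<longleftrightarrow> n = m"
    using * by (cases "n = m") auto
qed

lemma int_two_nearest:
  fixes n m :: int and x :: real
  assumes "x = of_int m + 1 / 2"
  shows "1 / 4 \<le> (of_int n - x)\<^sup>2" "(of_int n - x)\<^sup>2 = 1 / 4 \<longleftrightarrow> n = m \<or> n = m + 1"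
proof -
  have "(of_int n - x)\<^sup>2 = 1 / 4 + of_int ((n - m) * (n - m - 1))"
    unfolding assms by (simp add: power2_eq_square algebra_simps)
  moreover have "0 \<le> (n - m) * (n - m - 1)"
    by (cases "n - m \<le> 0") (auto intro: mult_nonpos_nonpos mult_nonneg_nonneg)
  moreover have "(n - m) * (n - m - 1) = 0 \<longleftrightarrow> n = m \<or> n = m + 1"
    by auto
  ultimately show "1 / 4 \<le> (of_int n - x)\<^sup>2" "(of_int n - x)\<^sup>2 = 1 / 4 \<longleftrightarrow> n = m \<or> n = m + 1"
    by (simp_all only: le_add_same_cancel1 add_cancel_left_right of_int_0_le_iff of_int_eq_0_iff)
qed

lemma thA_limit_open:
  assumes "of_int m < s" "s < of_int m + 1"
  shows "((\<lambda>Q. exp (of_real ((s\<^sup>2 - (of_int m + 1 / 2 - s)\<^sup>2) / 2) * Q) * thA Q (X - of_real s * Q))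
    \<longlongrightarrow> (- 1) powi m * exp (of_real (of_int m + 1 / 2) * X)) q_to_0"
proof -
  have x: "\<bar>(s - 1 / 2) - of_int m\<bar> < 1 / 2" using assms by linarith
  have e: "real_of_int n + 1 / 2 - s = of_int n - (s - 1 / 2)" for n by simp
  have "((\<lambda>Q. exp (of_real (1 / 2 * (s\<^sup>2 - (of_int m + 1 / 2 - s)\<^sup>2)) * Q) * jtheta (- 1) (1 / 2) (1 / 2) Q (X - of_real s * Q))
    \<longlongrightarrow> (\<Sum>n\<in>{m}. (- 1) powi n * exp (2 * of_real (1 / 2) * of_real (of_int n + 1 / 2) * X))) q_to_0"
    by (rule jtheta_limit) (use int_nearest[OF x] in \<open>auto simp: e\<close>)
  then show ?thesis by (simp add: thA_def)
qed

lemma thA_limit_int: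
  shows "((\<lambda>Q. exp (of_real (((of_int m)\<^sup>2 - 1 / 4) / 2) * Q) * thA Q (X - of_real (of_int m) * Q))
    \<longlongrightarrow> (- 1) powi m * (exp (of_real (of_int m + 1 / 2) * X) - exp (of_real (of_int m - 1 / 2) * X))) q_to_0"
proof -
  have x: "of_int m - 1 / 2 = real_of_int (m - 1) + 1 / 2" by simp
  have e: "real_of_int n + 1 / 2 - of_int m = of_int n - (of_int m - 1 / 2)" for n by simp
  have "((\<lambda>Q. exp (of_real (1 / 2 * ((of_int m)\<^sup>2 - 1 / 4)) * Q) * jtheta (- 1) (1 / 2) (1 / 2) Q (X - of_real (of_int m) * Q))
    \<longlongrightarrow> (\<Sum>n\<in>{m - 1, m}. (- 1) powi n * exp (2 * of_real (1 / 2) * of_real (of_int n + 1 / 2) * X))) q_to_0"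
    by (rule jtheta_limit) (use int_two_nearest[OF x] in \<open>auto simp: e\<close>)
  moreover have "(- 1 :: complex) powi (m - 1) = - ((- 1) powi m)" by (simp add: power_int_diff)
  then have "(\<Sum>n\<in>{m - 1, m}. (- 1) powi n * exp (2 * of_real (1 / 2) * of_real (of_int n + 1 / 2) * X))
      = (- 1) powi m * (exp (of_real (of_int m + 1 / 2) * X) - exp (of_real (of_int m - 1 / 2) * X))"
    by (simp add: right_diff_distrib)
  moreover have "1 / 2 * ((real_of_int m)\<^sup>2 - 1 / 4) = ((of_int m)\<^sup>2 - 1 / 4) / 2" by simp
  ultimately show ?thesis by (simp only: thA_def)
qed

lemma th0_limit_open:
  assumes "\<bar>s - of_int m\<bar> < 1 / 2"
  shows "((\<lambda>Q. exp (of_real (s\<^sup>2 - (of_int m - s)\<^sup>2) * Q) * th0 Q (X - of_real s * Q))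
    \<longlongrightarrow> exp (of_real (2 * of_int m) * X)) q_to_0"
proof -
  have "((\<lambda>Q. exp (of_real (1 * (s\<^sup>2 - (of_int m - s)\<^sup>2)) * Q) * jtheta 1 1 0 Q (X - of_real s * Q))
    \<longlongrightarrow> (\<Sum>n\<in>{m}. 1 powi n * exp (2 * of_real 1 * of_real (of_int n + 0) * X))) q_to_0"
    by (rule jtheta_limit) (use int_nearest[OF assms] in auto)
  then show ?thesis by (simp add: th0_def)
qed

lemma th0_limit_half:
  assumes s: "s = of_int m + 1 / 2"
  shows "((\<lambda>Q. exp (of_real (s\<^sup>2 - 1 / 4) * Q) * th0 Q (X - of_real s * Q))
    \<longlongrightarrow> exp (of_real (2 * of_int m) * X) + exp (of_real (2 * of_int m + 2) * X)) q_to_0"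
proof -
  have "((\<lambda>Q. exp (of_real (1 * (s\<^sup>2 - 1 / 4)) * Q) * jtheta 1 1 0 Q (X - of_real s * Q))
    \<longlongrightarrow> (\<Sum>n\<in>{m, m + 1}. 1 powi n * exp (2 * of_real 1 * of_real (of_int n + 0) * X))) q_to_0"
    by (rule jtheta_limit) (use int_two_nearest[OF s] in auto)
  then show ?thesis by (simp add: th0_def algebra_simps)
qed

text \<open>At slope \<open>s\<close> the order of \<open>th1\<close> is \<open>- s\<^sup>2\<close> or larger, whichever exponents are nearest to \<open>s\<close>. A crude bound
  is enough here.\<close>

lemma th1_limit:
  "\<exists>L. ((\<lambda>Q. exp (of_real (s\<^sup>2) * Q) * th1 Q (X - of_real s * Q)) \<longlongrightarrow> L) q_to_0"
proof -
  define M where "M = {m. (real_of_int m + 1 / 2 - s)\<^sup>2 = 0}"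
  have "M \<subseteq> {\<lfloor>s - 1 / 2\<rfloor>}"
  proof
    fix m assume "m \<in> M"
    then have "s - 1 / 2 = of_int m" by (simp add: M_def)
    then show "m \<in> {\<lfloor>s - 1 / 2\<rfloor>}" by simp
  qed
  then have "finite M" by (rule finite_subset) simp
  then have "((\<lambda>Q. exp (of_real (1 * (s\<^sup>2 - 0)) * Q) * jtheta 1 1 (1 / 2) Q (X - of_real s * Q))
    \<longlongrightarrow> (\<Sum>n\<in>M. 1 powi n * exp (2 * of_real 1 * of_real (of_int n + 1 / 2) * X))) q_to_0"
    by (intro jtheta_limit) (auto simp: M_def)
  then show ?thesis by (auto simp: th1_def)
qed

lemma eventually_Re_neg: "eventually (\<lambda>Q. Re Q < 0) q_to_0"
  unfolding eventually_q_to_0 by (rule exI[of _ "- 1"]) auto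

lemma asymp_unit_tendsto:
  assumes "asymp_unit f c"
  shows "((\<lambda>Q. exp (- of_real c * Q) * f (V, Q)) \<longlongrightarrow> 1) q_to_0"
proof -
  have "(\<lambda>Q. lpow Q (- c) * f (V, Q) - 1) \<in> O[q_to_0](\<lambda>Q. lpow Q (1 / 2))"
    using assms by (simp add: asymp_unit_def)
  then obtain C where C: "\<forall>\<^sub>F Q in q_to_0. norm (lpow Q (- c) * f (V, Q) - 1) \<le> C * norm (lpow Q (1 / 2))"
    by (elim landau_o.bigE)
  have "((\<lambda>Q. of_real C * exp (of_real (1 / 2) * Q)) \<longlongrightarrow> of_real C * 0) q_to_0"
    by (intro tendsto_intros tendsto_q_power_0) simp
  then have "((\<lambda>Q. norm (of_real C * exp (of_real (1 / 2) * Q))) \<longlongrightarrow> 0) q_to_0"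
    using tendsto_norm_zero by fastforce
  then have "((\<lambda>Q. lpow Q (- c) * f (V, Q) - 1) \<longlongrightarrow> 0) q_to_0"
  proof (rule Lim_null_comparison[rotated])
    show "\<forall>\<^sub>F Q in q_to_0. norm (lpow Q (- c) * f (V, Q) - 1) \<le> norm (of_real C * exp (of_real (1 / 2) * Q))"
      using C by eventually_elim (auto simp: lpow_def norm_mult intro: order_trans mult_right_mono)
  qed
  then show ?thesis by (subst LIM_zero_iff[symmetric]) (simp add: lpow_def)
qed

text \<open>If \<open>d\<close> is the squared distance from \<open>s\<close> to the nearest integer, then \<open>th0\<close> has the order
  \<open>- s\<^sup>2 + d\<close> and \<open>th1\<close> at least \<open>- s\<^sup>2\<close>. As \<open>d \<le> 1/4\<close>, a gap of \<open>3/4\<close> between the orders of the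
  coefficients makes the second summand negligible at every slope.\<close>

lemma th_comb_limit:
  assumes f1: "asymp_unit f1 c1" and f2: "asymp_bounded f2 c2" and c: "c2 \<ge> c1 + 3 / 4" and d: "d \<le> 1 / 4"
    and L: "((\<lambda>Q. exp (of_real (s\<^sup>2 - d) * Q) * th0 Q (X - of_real s * Q)) \<longlongrightarrow> L) q_to_0"
  shows "((\<lambda>Q. exp (of_real (s\<^sup>2 - d - c1) * Q) * th_comb (f1 (V, Q)) (f2 (V, Q)) Q (X - of_real s * Q)) \<longlongrightarrow> L) q_to_0"
proof -
  obtain L1 where L1: "((\<lambda>Q. exp (of_real (s\<^sup>2) * Q) * th1 Q (X - of_real s * Q)) \<longlongrightarrow> L1) q_to_0"
    using th1_limit by blast
  have 1: "((\<lambda>Q. (exp (- of_real c1 * Q) * f1 (V, Q)) * (exp (of_real (s\<^sup>2 - d) * Q) * th0 Q (X - of_real s * Q))) \<longlongrightarrow> 1 * L) q_to_0"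
    by (intro tendsto_mult asymp_unit_tendsto f1 L)
  have "(\<lambda>Q. lpow Q (- c2) * f2 (V, Q)) \<in> O[q_to_0](\<lambda>_. 1)"
    using f2 by (simp add: asymp_bounded_def)
  then obtain C where "\<forall>\<^sub>F Q in q_to_0. norm (lpow Q (- c2) * f2 (V, Q)) \<le> C * norm (1 :: complex)"
    by (elim landau_o.bigE)
  then have "Bfun (\<lambda>Q. lpow Q (- c2) * f2 (V, Q)) q_to_0"
    by (intro BfunI) simp
  moreover have "((\<lambda>Q. exp (of_real (c2 - c1 - d) * Q)) \<longlongrightarrow> 0) q_to_0"
    by (rule tendsto_q_power_0) (use c d in linarith)
  ultimately have "((\<lambda>Q. (lpow Q (- c2) * f2 (V, Q)) * exp (of_real (c2 - c1 - d) * Q)) \<longlongrightarrow> 0) q_to_0"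
    using bounded_bilinear.Bfun_prod_Zfun[OF bounded_bilinear_mult] by (simp add: tendsto_Zfun_iff)
  from tendsto_add[OF 1 tendsto_mult[OF this L1]]
  have "((\<lambda>Q. (exp (- of_real c1 * Q) * f1 (V, Q)) * (exp (of_real (s\<^sup>2 - d) * Q) * th0 Q (X - of_real s * Q))
      + (lpow Q (- c2) * f2 (V, Q)) * exp (of_real (c2 - c1 - d) * Q) * (exp (of_real (s\<^sup>2) * Q) * th1 Q (X - of_real s * Q))) \<longlongrightarrow> L) q_to_0"
    by simp
  moreover have "(exp (- of_real c1 * Q) * a) * (exp (of_real (s\<^sup>2 - d) * Q) * b)
      + (lpow Q (- c2) * a') * exp (of_real (c2 - c1 - d) * Q) * (exp (of_real (s\<^sup>2) * Q) * b')
      = exp (of_real (s\<^sup>2 - d - c1) * Q) * (a * b + a' * b')" for Q a b a' b'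
  proof -
    have "exp (- of_real c1 * Q) * exp (of_real (s\<^sup>2 - d) * Q) = exp (of_real (s\<^sup>2 - d - c1) * Q)"
      "lpow Q (- c2) * exp (of_real (c2 - c1 - d) * Q) * exp (of_real (s\<^sup>2) * Q) = exp (of_real (s\<^sup>2 - d - c1) * Q)"
      unfolding lpow_def exp_add[symmetric] by (rule arg_cong[of _ _ exp], simp add: algebra_simps)+
    moreover have "(exp (- of_real c1 * Q) * a) * (exp (of_real (s\<^sup>2 - d) * Q) * b)
        = (exp (- of_real c1 * Q) * exp (of_real (s\<^sup>2 - d) * Q)) * (a * b)"
      "(lpow Q (- c2) * a') * exp (of_real (c2 - c1 - d) * Q) * (exp (of_real (s\<^sup>2) * Q) * b')
        = (lpow Q (- c2) * exp (of_real (c2 - c1 - d) * Q) * exp (of_real (s\<^sup>2) * Q)) * (a' * b')"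
      by (simp_all only: mult_ac)
    ultimately show ?thesis by (simp only: distrib_left)
  qed
  ultimately show ?thesis by (simp add: th_comb_def)
qed

lemma tendsto_vec2:
  fixes f :: "'x \<Rightarrow> complex^fixpt"
  assumes "((\<lambda>x. f x $ P2) \<longlongrightarrow> a) F" "((\<lambda>x. f x $ P11) \<longlongrightarrow> b) F"
  shows "(f \<longlongrightarrow> vec2 a b) F"
proof (rule vec_tendstoI)
  fix i show "((\<lambda>x. f x $ i) \<longlongrightarrow> vec2 a b $ i) F"
    using assms by (cases i) simp_all
qed

lemma theta_form_limit_P2:
  fixes E :: "fixpt \<Rightarrow> pt \<Rightarrow> complex^fixpt"
  assumes form: "theta_form E f0 f1 f2"
    and g: "\<And>X. ((\<lambda>Q. exp (of_real e * Q) * th_comb (f1 (V, Q)) (f2 (V, Q)) Q (X - of_real s * Q)) \<longlongrightarrow> G X) q_to_0"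
    and T: "\<And>X. ((\<lambda>Q. exp (of_real e' * Q) * thA Q (X - of_real s * Q)) \<longlongrightarrow> T X) q_to_0"
  shows "((\<lambda>Q. lpow Q (e + e') *s delta_z (- s) (E P2) (A, Z, V, Q))
    \<longlongrightarrow> vec2 (G (V + Z - A) * T (Z + A)) (G (V + Z + A) * T (Z - A))) q_to_0"
proof (rule tendsto_vec2)
  have *: "((\<lambda>Q. lpow Q (e + e') * (th_comb (f1 (V, Q)) (f2 (V, Q)) Q (x - of_real s * Q) * thA Q (x' - of_real s * Q)))
      \<longlongrightarrow> G x * T x') q_to_0" for x x'
    using tendsto_mult[OF g[of x] T[of x']] by (simp add: lpow_def exp_add algebra_simps)
  show "((\<lambda>Q. (lpow Q (e + e') *s delta_z (- s) (E P2) (A, Z, V, Q)) $ P2) \<longlongrightarrow> G (V + Z - A) * T (Z + A)) q_to_0"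
  proof (rule Lim_transform_eventually[OF *])
    show "\<forall>\<^sub>F Q in q_to_0. lpow Q (e + e') * (th_comb (f1 (V, Q)) (f2 (V, Q)) Q (V + Z - A - of_real s * Q) * thA Q (Z + A - of_real s * Q))
      = (lpow Q (e + e') *s delta_z (- s) (E P2) (A, Z, V, Q)) $ P2"
      using eventually_Re_neg by eventually_elim (simp add: delta_z_apply theta_form_nth[OF form] algebra_simps)
  qed
  show "((\<lambda>Q. (lpow Q (e + e') *s delta_z (- s) (E P2) (A, Z, V, Q)) $ P11) \<longlongrightarrow> G (V + Z + A) * T (Z - A)) q_to_0"
  proof (rule Lim_transform_eventually[OF *])
    show "\<forall>\<^sub>F Q in q_to_0. lpow Q (e + e') * (th_comb (f1 (V, Q)) (f2 (V, Q)) Q (V + Z + A - of_real s * Q) * thA Q (Z - A - of_real s * Q))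
      = (lpow Q (e + e') *s delta_z (- s) (E P2) (A, Z, V, Q)) $ P11"
      using eventually_Re_neg by eventually_elim (simp add: delta_z_apply theta_form_nth[OF form] algebra_simps)
  qed
qed

lemma theta_form_limit_P11:
  fixes E :: "fixpt \<Rightarrow> pt \<Rightarrow> complex^fixpt"
  assumes form: "theta_form E f0 f1 f2" and f0: "asymp_unit f0 c0"
    and T: "\<And>X. ((\<lambda>Q. exp (of_real e' * Q) * thA Q (X - of_real s * Q)) \<longlongrightarrow> T X) q_to_0"
  shows "((\<lambda>Q. lpow Q (e' - c0) *s delta_z (- s) (E P11) (A, Z, V, Q))
    \<longlongrightarrow> vec2 (T (Z + 2 * V - A)) (T (Z + 2 * V + A))) q_to_0"
proof (rule tendsto_vec2)
  have *: "((\<lambda>Q. lpow Q (e' - c0) * (f0 (V, Q) * thA Q (x - of_real s * Q))) \<longlongrightarrow> T x) q_to_0" for x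
    using tendsto_mult[OF asymp_unit_tendsto[OF f0, of V] T[of x]]
    by (simp add: lpow_def exp_add exp_diff exp_minus field_simps)
  show "((\<lambda>Q. (lpow Q (e' - c0) *s delta_z (- s) (E P11) (A, Z, V, Q)) $ P2) \<longlongrightarrow> T (Z + 2 * V - A)) q_to_0"
  proof (rule Lim_transform_eventually[OF *])
    show "\<forall>\<^sub>F Q in q_to_0. lpow Q (e' - c0) * (f0 (V, Q) * thA Q (Z + 2 * V - A - of_real s * Q))
      = (lpow Q (e' - c0) *s delta_z (- s) (E P11) (A, Z, V, Q)) $ P2"
      using eventually_Re_neg by eventually_elim (simp add: delta_z_apply theta_form_nth[OF form] algebra_simps)
  qed
  show "((\<lambda>Q. (lpow Q (e' - c0) *s delta_z (- s) (E P11) (A, Z, V, Q)) $ P11) \<longlongrightarrow> T (Z + 2 * V + A)) q_to_0"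
  proof (rule Lim_transform_eventually[OF *])
    show "\<forall>\<^sub>F Q in q_to_0. lpow Q (e' - c0) * (f0 (V, Q) * thA Q (Z + 2 * V + A - of_real s * Q))
      = (lpow Q (e' - c0) *s delta_z (- s) (E P11) (A, Z, V, Q)) $ P11"
      using eventually_Re_neg by eventually_elim (simp add: delta_z_apply theta_form_nth[OF form] algebra_simps)
  qed
qed


section \<open>The explicit formulas satisfy the conditions\<close>

lemma theta_form_cond_Q1:
  assumes form: "theta_form E f0 f1 f2"
  shows "cond_Q1 E"
  unfolding cond_Q1_def
proof (clarify, unfold cover_iff)
  fix A Z V Q :: complex assume Q: "Re Q < 0"
  define g where "g = th_comb (f1 (V, Q)) (f2 (V, Q)) Q"
  note E = theta_form_nth[OF form Q, where V = V, folded g_def]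
  have gQ: "g (X + Q) = exp (- Q - 2 * X) * g X" for X
    unfolding g_def th_comb_def th0_quasi_period th1_quasi_period by (simp add: algebra_simps)
  have *: "g (x + Q) * thA Q (x' + Q) = - exp (- 3 * Q / 2 - 2 * x - x') * (g x * thA Q x')" for x x'
  proof -
    have "exp (- Q - 2 * x) * exp (- Q / 2 - x') = exp (- 3 * Q / 2 - 2 * x - x')"
      unfolding exp_add[symmetric] by (rule arg_cong[of _ _ exp]) (simp add: field_simps)
    then show ?thesis unfolding gQ thA_quasi_period by (simp add: mult_ac)
  qed
  have e: "- lpow Q (- 3 / 2) * lpow Z (- 3) * exp (of_real (- 1) * (2 * V + B)) = - exp (- 3 * Q / 2 - 2 * (V + Z + B) - (Z - B))" for B
    unfolding lpow_def mult_minus_left exp_add[symmetric]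
    by (rule arg_cong[of _ _ "\<lambda>x. - exp x"]) (simp add: field_simps)
  show "delta_z 1 (E P2) (A, Z, V, Q) =
       (- lpow Q (- 3 / 2) * lpow Z (- 3)) *s (bun_O (- 1) A V * E P2 (A, Z, V, Q))"
    unfolding vec_eq_iff all_fixpt
  proof
    have 1: "V + (Z + Q) - A = (V + Z - A) + Q" "Z + Q + A = (Z + A) + Q"
      "V + (Z + Q) + A = (V + Z + A) + Q" "Z + Q - A = (Z - A) + Q" by simp_all
    show "delta_z 1 (E P2) (A, Z, V, Q) $ P2 = ((- lpow Q (- 3 / 2) * lpow Z (- 3)) *s (bun_O (- 1) A V * E P2 (A, Z, V, Q))) $ P2"
      unfolding delta_z_apply vector_smult_component vector_mult_component bun_O_nth of_real_1 mult_1_left E 1 *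
        mult.assoc[symmetric] e[of "- A", unfolded diff_conv_add_uminus[symmetric]] by (simp add: mult.assoc)
    show "delta_z 1 (E P2) (A, Z, V, Q) $ P11 = ((- lpow Q (- 3 / 2) * lpow Z (- 3)) *s (bun_O (- 1) A V * E P2 (A, Z, V, Q))) $ P11"
      unfolding delta_z_apply vector_smult_component vector_mult_component bun_O_nth of_real_1 mult_1_left E 1 *
        mult.assoc[symmetric] e[of A] by (simp add: mult.assoc)
  qed
qed

lemma theta_form_cond_Q2:
  assumes form: "theta_form E f0 f1 f2"
  shows "cond_Q2 E"
  unfolding cond_Q2_def
proof (clarify, unfold cover_iff)
  fix A Z V Q :: complex assume Q: "Re Q < 0"
  note E = theta_form_nth[OF form Q, where V = V]
  have e: "- lpow Q (- 1 / 2) * lpow Z (- 1) * exp (of_real (- 1) * (2 * V + B)) = - exp (- Q / 2 - (Z + 2 * V + B))" for B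
    unfolding lpow_def mult_minus_left exp_add[symmetric]
    by (rule arg_cong[of _ _ "\<lambda>x. - exp x"]) (simp add: field_simps)
  show "delta_z 1 (E P11) (A, Z, V, Q) =
       (- lpow Q (- 1 / 2) * lpow Z (- 1)) *s (bun_O (- 1) A V * E P11 (A, Z, V, Q))"
    unfolding vec_eq_iff all_fixpt
  proof
    have 1: "Z + Q + 2 * V - A = (Z + 2 * V - A) + Q" "Z + Q + 2 * V + A = (Z + 2 * V + A) + Q" by simp_all
    show "delta_z 1 (E P11) (A, Z, V, Q) $ P2 = ((- lpow Q (- 1 / 2) * lpow Z (- 1)) *s (bun_O (- 1) A V * E P11 (A, Z, V, Q))) $ P2"
      unfolding delta_z_apply vector_smult_component vector_mult_component bun_O_nth of_real_1 mult_1_left E 1 thA_quasi_period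
        mult.assoc[symmetric] e[of "- A", unfolded diff_conv_add_uminus[symmetric]] by (simp add: mult_ac)
    show "delta_z 1 (E P11) (A, Z, V, Q) $ P11 = ((- lpow Q (- 1 / 2) * lpow Z (- 1)) *s (bun_O (- 1) A V * E P11 (A, Z, V, Q))) $ P11"
      unfolding delta_z_apply vector_smult_component vector_mult_component bun_O_nth of_real_1 mult_1_left E 1 thA_quasi_period
        mult.assoc[symmetric] e[of A] by (simp add: mult_ac)
  qed
qed

lemma theta_form_cond_N1:
  assumes form: "theta_form E f0 f1 f2" and f1: "asymp_unit f1 c1" and f2: "asymp_bounded f2 c2"
    and c: "c2 \<ge> c1 + 3 / 4"
  shows "cond_N1 E"
  unfolding cond_N1_def
proof (intro allI impI)
  fix s :: real assume s: "0 < s \<and> s < 1 / 2"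
  define e where "e = s\<^sup>2 - (of_int 0 - s)\<^sup>2 - c1"
  define e' where "e' = (s\<^sup>2 - (of_int 0 + 1 / 2 - s)\<^sup>2) / 2"
  have d: "(of_int 0 - s)\<^sup>2 \<le> 1 / 4"
    using s power_mono[of s "1 / 2" 2] by (simp add: power2_eq_square)
  have g: "((\<lambda>Q. exp (of_real e * Q) * th_comb (f1 (V, Q)) (f2 (V, Q)) Q (X - of_real s * Q)) \<longlongrightarrow> exp (of_real (2 * of_int 0) * X)) q_to_0" for V X
    unfolding e_def by (rule th_comb_limit[OF f1 f2 c d th0_limit_open]) (use s in auto)
  have T: "((\<lambda>Q. exp (of_real e' * Q) * thA Q (X - of_real s * Q)) \<longlongrightarrow> (- 1) powi 0 * exp (of_real (of_int 0 + 1 / 2) * X)) q_to_0" for X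
    unfolding e'_def by (rule thA_limit_open) (use s in auto)
  show "\<exists>r. \<forall>A Z V. ((\<lambda>Q. lpow Q (- r) *s delta_z (- s) (E P2) (A, Z, V, Q))
        \<longlongrightarrow> (lpow V 1 * lpow Z (1 / 2)) *s bun_O (- 1 / 2) A V) q_to_0"
  proof (intro exI[of _ "- (e + e')"] allI)
    fix A Z V
    have 1: "lpow V 1 * lpow Z (1 / 2) * exp (of_real (- 1 / 2) * (2 * V + B)) = exp ((Z - B) / 2)" for B
      unfolding lpow_def exp_add[symmetric] by (rule arg_cong[of _ _ exp]) (simp add: field_simps)
    have "(lpow V 1 * lpow Z (1 / 2)) *s bun_O (- 1 / 2) A V = vec2 (exp ((Z + A) / 2)) (exp ((Z - A) / 2))"
      using 1[of "- A"] 1[of A] by (intro vec2_eqI) simp_all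
    then show "((\<lambda>Q. lpow Q (- (- (e + e'))) *s delta_z (- s) (E P2) (A, Z, V, Q))
        \<longlongrightarrow> (lpow V 1 * lpow Z (1 / 2)) *s bun_O (- 1 / 2) A V) q_to_0"
      using theta_form_limit_P2[where V = V and A = A and Z = Z, OF form g T] by (simp add: add.commute)
  qed
qed

lemma theta_form_cond_N2:
  assumes form: "theta_form E f0 f1 f2" and f0: "asymp_unit f0 c0"
  shows "cond_N2 E"
  unfolding cond_N2_def
proof (intro allI impI)
  fix s :: real assume s: "0 < s \<and> s < 1 / 2"
  define e' where "e' = (s\<^sup>2 - (of_int 0 + 1 / 2 - s)\<^sup>2) / 2"
  have T: "((\<lambda>Q. exp (of_real e' * Q) * thA Q (X - of_real s * Q)) \<longlongrightarrow> (- 1) powi 0 * exp (of_real (of_int 0 + 1 / 2) * X)) q_to_0" for X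
    unfolding e'_def by (rule thA_limit_open) (use s in auto)
  show "\<exists>r. \<forall>A Z V. ((\<lambda>Q. lpow Q (- r) *s delta_z (- s) (E P11) (A, Z, V, Q))
        \<longlongrightarrow> lpow Z (1 / 2) *s bun_O (1 / 2) A V) q_to_0"
  proof (intro exI[of _ "- (e' - c0)"] allI)
    fix A Z V
    have 1: "lpow Z (1 / 2) * exp (of_real (1 / 2) * (2 * V + B)) = exp ((Z + 2 * V + B) / 2)" for B
      unfolding lpow_def exp_add[symmetric] by (rule arg_cong[of _ _ exp]) (simp add: field_simps)
    have "lpow Z (1 / 2) *s bun_O (1 / 2) A V = vec2 (exp ((Z + 2 * V - A) / 2)) (exp ((Z + 2 * V + A) / 2))"
      using 1[of "- A"] 1[of A] by (intro vec2_eqI) simp_all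
    then show "((\<lambda>Q. lpow Q (- (- (e' - c0))) *s delta_z (- s) (E P11) (A, Z, V, Q))
        \<longlongrightarrow> lpow Z (1 / 2) *s bun_O (1 / 2) A V) q_to_0"
      using theta_form_limit_P11[where V = V and A = A and Z = Z, OF form f0 T] by simp
  qed
qed

subsection \<open>Single-valuedness and holomorphy\<close>

lemma complex_diff_transform_open:
  assumes "complex_diff J h x" "open S" "x \<in> S" "\<And>y. y \<in> S \<Longrightarrow> f y = h y"
  shows "complex_diff J f x"
proof -
  obtain D where D: "(h has_derivative D) (at x)" "\<And>v. D (J v) = \<i> * D v"
    using assms(1) unfolding complex_diff_def by blast
  have "(f has_derivative D) (at x)"
    by (rule has_derivative_transform_within_open[OF D(1) assms(2,3)]) (simp add: assms(4))
  with D(2) show ?thesis unfolding complex_diff_def by blast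
qed

lemma complex_diff_vq:
  assumes "holomorphic2_on f cover_vq" "complex_diff J v x" "complex_diff J q x" "Re (q x) < 0"
  shows "complex_diff J (\<lambda>x. f (v x, q x)) x"
  by (rule complex_diff_pair2[OF _ assms(2,3)])
     (use assms(1,4) in \<open>simp add: holomorphic2_on_iff cover_vq_iff\<close>)

lemma admissible_coeffD:
  assumes "admissible_coeff f c" "Re Q < 0" "Re Q' < 0" "exp V = exp V'" "exp (Q / 2) = exp (Q' / 2)"
  shows "exp (- of_real c * Q) * f (V, Q) = exp (- of_real c * Q') * f (V', Q')"
proof -
  have "single_valued_via proj_v_double cover_vq (\<lambda>(V, Q). lpow Q (- c) * f (V, Q))"
    using assms(1) by (simp add: admissible_coeff_def)
  then have "\<forall>x\<in>cover_vq. \<forall>y\<in>cover_vq. proj_v_double x = proj_v_double y \<longrightarrow>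
      (\<lambda>(V, Q). lpow Q (- c) * f (V, Q)) x = (\<lambda>(V, Q). lpow Q (- c) * f (V, Q)) y"
    unfolding single_valued_via_def .
  from bspec[OF bspec[OF this, of "(V, Q)"], of "(V', Q')"] show ?thesis
    using assms(2-) by (simp add: cover_vq_iff proj_v_double_def lpow_def)
qed

lemma exp_half_eq: "exp (Q / 2) = exp (Q' / 2) \<Longrightarrow> exp Q = exp (Q' :: complex)"
  using exp_double[of "Q / 2"] exp_double[of "Q' / 2"] by simp

text \<open>The exponents of \<open>q\<close> are integers in \<open>th0\<close> and in \<open>1/4 + \<int>\<close> in \<open>th1\<close>. So the two summands are
  single-valued in \<open>q\<^bsup>1/2\<^esup>\<close> up to the same power of \<open>q\<close> if the exponents of their coefficients differ by
  an element of \<open>3/4 + \<int>/2 = - 1/4 + \<int>/2\<close>.\<close>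

lemma th_comb_single_valued:
  assumes f: "admissible_coeff f1 c1" "admissible_coeff f2 c2" and c: "2 * (c2 - (c1 + 3 / 4)) \<in> \<int>"
    and Q: "Re Q < 0" "Re Q' < 0" and e: "exp V = exp V'" "exp (Q / 2) = exp (Q' / 2)" "exp X = exp X'"
  shows "exp (- of_real c1 * Q) * th_comb (f1 (V, Q)) (f2 (V, Q)) Q X
    = exp (- of_real c1 * Q') * th_comb (f1 (V', Q')) (f2 (V', Q')) Q' X'"
proof -
  obtain k0 where "2 * (c2 - (c1 + 3 / 4)) = of_int k0" using c by (elim Ints_cases)
  then have "c2 - c1 + 1 / 4 = of_int (k0 + 2) / 2" by (simp add: field_simps)
  then obtain k :: int where k: "c2 - c1 + 1 / 4 = of_int k / 2" by blast
  have *: "exp (- of_real c1 * Q) * th_comb (f1 (V, Q)) (f2 (V, Q)) Q X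
      = (exp (- of_real c1 * Q) * f1 (V, Q)) * th0 Q X
        + (exp (- of_real c2 * Q) * f2 (V, Q)) * (exp (- Q / 4) * th1 Q X) * exp (Q / 2) powi k" for V Q X
  proof -
    have "exp (Q / 2) powi k = exp (of_int k * (Q / 2))" by (rule exp_power_int)
    also have "of_int k * (Q / 2) = of_real (c2 - c1 + 1 / 4) * Q" unfolding k by (simp add: field_simps)
    finally have "exp (- of_real c2 * Q) * exp (- Q / 4) * exp (Q / 2) powi k
        = exp (- of_real c2 * Q) * exp (- Q / 4) * exp (of_real (c2 - c1 + 1 / 4) * Q)" by simp
    also have "\<dots> = exp (- of_real c1 * Q)"
      unfolding exp_add[symmetric] by (rule arg_cong[of _ _ exp]) (simp add: field_simps)
    finally have 1: "exp (- of_real c1 * Q) = exp (- of_real c2 * Q) * exp (- Q / 4) * exp (Q / 2) powi k" ..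
    have "exp (- of_real c1 * Q) * (f2 (V, Q) * th1 Q X)
        = (exp (- of_real c2 * Q) * f2 (V, Q)) * (exp (- Q / 4) * th1 Q X) * exp (Q / 2) powi k"
      unfolding 1 by (simp only: mult_ac)
    then show ?thesis by (simp add: th_comb_def distrib_left mult.assoc)
  qed
  show ?thesis
    unfolding * admissible_coeffD[OF f(1) Q e(1,2)] admissible_coeffD[OF f(2) Q e(1,2)]
      th0_single_valued[OF exp_half_eq[OF e(2)] e(3)] th1_single_valued[OF exp_half_eq[OF e(2)] e(3)] e(2) ..
qed

text \<open>The alternating series without the fractional powers \<open>q\<^bsup>1/8\<^esup> x\<^bsup>1/2\<^esup>\<close>, as a single-valued function of \<open>q\<close>
  and \<open>x\<close>.\<close>

definition thA_red :: "complex \<Rightarrow> complex \<Rightarrow> complex" where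
  "thA_red Q X = exp (- Q / 8 - X / 2) * thA Q X"

lemma thA_red_eq: "thA Q X = exp (Q / 8 + X / 2) * thA_red Q X"
  unfolding thA_red_def mult.assoc[symmetric] exp_add[symmetric] by simp

lemma thA_red_single_valued:
  "exp (Q / 2) = exp (Q' / 2) \<Longrightarrow> exp X = exp X' \<Longrightarrow> thA_red Q X = thA_red Q' X'"
  unfolding thA_red_def by (rule thA_single_valued[OF exp_half_eq])

lemma exp_add_eq: "exp a = exp a' \<Longrightarrow> exp b = exp b' \<Longrightarrow> exp (a + b) = exp (a' + b' :: complex)"
  and exp_diff_eq: "exp a = exp a' \<Longrightarrow> exp b = exp b' \<Longrightarrow> exp (a - b) = exp (a' - b' :: complex)"
  and exp_minus_eq: "exp a = exp a' \<Longrightarrow> exp (- a) = exp (- a' :: complex)"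
  and exp_2_eq: "exp a = exp a' \<Longrightarrow> exp (2 * a) = exp (2 * a' :: complex)"
  and exp_3_eq: "exp a = exp a' \<Longrightarrow> exp (3 * a) = exp (3 * a' :: complex)"
proof -
  show "exp a = exp a' \<Longrightarrow> exp (3 * a) = exp (3 * a' :: complex)"
    using exp_of_nat_mult[of 3 a] exp_of_nat_mult[of 3 a'] by simp
qed (simp_all add: exp_add exp_diff exp_minus exp_double)

lemma exp_neg_2_eq: "exp a = exp a' \<Longrightarrow> exp (- 2 * a) = exp (- 2 * a' :: complex)"
  and exp_neg_3_eq: "exp a = exp a' \<Longrightarrow> exp (- 3 * a) = exp (- 3 * a' :: complex)"
  using exp_minus_eq[OF exp_2_eq, of a a'] exp_minus_eq[OF exp_3_eq, of a a'] by simp_all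

lemma mult3_cong: "a = a' \<Longrightarrow> b = b' \<Longrightarrow> c = c' \<Longrightarrow> a * (b * c) = a' * (b' * c')"
  by simp

lemmas exp_eqs = exp_neg_2_eq exp_neg_3_eq exp_add_eq exp_diff_eq exp_minus_eq exp_2_eq exp_3_eq

text \<open>The fractional powers in front of \<open>thA_red\<close> cancel against the normalising factors of Property A, for
  the exponents \<open>\<alpha> = \<beta> = 1/2\<close> of \<open>a\<close> and \<open>z\<close> and \<open>c\<^sub>1 + 1/8\<close> or \<open>c\<^sub>0 + 1/8\<close> of \<open>q\<close>.\<close>

lemma theta_form_reduced:
  fixes E :: "fixpt \<Rightarrow> pt \<Rightarrow> complex^fixpt" and A Z V Q :: complex and c0 c1 :: real
  assumes form: "theta_form E f0 f1 f2" and Q: "Re Q < 0"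
  defines "G \<equiv> \<lambda>X. exp (- of_real c1 * Q) * th_comb (f1 (V, Q)) (f2 (V, Q)) Q X"
    and "F \<equiv> exp (- of_real c0 * Q) * f0 (V, Q)"
  shows
    "((lpow Q (- (c1 + 1 / 8)) * lpow A (- (1 / 2)) * lpow Z (- (1 / 2))) *s (sqrt_L_minus A V * E P2 (A, Z, V, Q))) $ P2
      = exp (- A - V) * (G (V + Z - A) * thA_red Q (Z + A))"
    "((lpow Q (- (c1 + 1 / 8)) * lpow A (- (1 / 2)) * lpow Z (- (1 / 2))) *s (sqrt_L_minus A V * E P2 (A, Z, V, Q))) $ P11
      = exp (- 3 * A - V) * (G (V + Z + A) * thA_red Q (Z - A))"
    "((lpow Q (- (c0 + 1 / 8)) * lpow A (- (1 / 2)) * lpow Z (- (1 / 2))) *s (sqrt_L_minus A V * E P11 (A, Z, V, Q))) $ P2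
      = exp (- 2 * A) * (F * thA_red Q (Z + 2 * V - A))"
    "((lpow Q (- (c0 + 1 / 8)) * lpow A (- (1 / 2)) * lpow Z (- (1 / 2))) *s (sqrt_L_minus A V * E P11 (A, Z, V, Q))) $ P11
      = exp (- 2 * A) * (F * thA_red Q (Z + 2 * V + A))"
proof -
  have *: "(lpow Q (- (c + 1 / 8)) * lpow A (- (1 / 2)) * lpow Z (- (1 / 2))) * (exp B * (k * thA Q X))
      = exp C * ((exp (- of_real c * Q) * k) * thA_red Q X)"
    if "C = B + X / 2 - A / 2 - Z / 2" for c B C X k
  proof -
    have "lpow Q (- (c + 1 / 8)) * lpow A (- (1 / 2)) * lpow Z (- (1 / 2)) * exp B * exp (Q / 8 + X / 2)
        = exp C * exp (- of_real c * Q)"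
      unfolding lpow_def exp_add[symmetric] that by (rule arg_cong[of _ _ exp]) (simp add: field_simps)
    then show ?thesis
      unfolding thA_red_eq[of Q X] by (simp add: mult_ac)
  qed
  show
    "((lpow Q (- (c1 + 1 / 8)) * lpow A (- (1 / 2)) * lpow Z (- (1 / 2))) *s (sqrt_L_minus A V * E P2 (A, Z, V, Q))) $ P2
      = exp (- A - V) * (G (V + Z - A) * thA_red Q (Z + A))"
    "((lpow Q (- (c1 + 1 / 8)) * lpow A (- (1 / 2)) * lpow Z (- (1 / 2))) *s (sqrt_L_minus A V * E P2 (A, Z, V, Q))) $ P11
      = exp (- 3 * A - V) * (G (V + Z + A) * thA_red Q (Z - A))"
    "((lpow Q (- (c0 + 1 / 8)) * lpow A (- (1 / 2)) * lpow Z (- (1 / 2))) *s (sqrt_L_minus A V * E P11 (A, Z, V, Q))) $ P2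
      = exp (- 2 * A) * (F * thA_red Q (Z + 2 * V - A))"
    "((lpow Q (- (c0 + 1 / 8)) * lpow A (- (1 / 2)) * lpow Z (- (1 / 2))) *s (sqrt_L_minus A V * E P11 (A, Z, V, Q))) $ P11
      = exp (- 2 * A) * (F * thA_red Q (Z + 2 * V + A))"
    unfolding vector_smult_component vector_mult_component theta_form_nth[OF form Q] sqrt_L_minus_nth G_def F_def
    by (rule *, simp add: field_simps)+
qed

lemma theta_form_complex_diff:
  fixes E :: "fixpt \<Rightarrow> pt \<Rightarrow> complex^fixpt"
  assumes form: "theta_form E f0 f1 f2"
    and f: "holomorphic2_on f0 cover_vq" "holomorphic2_on f1 cover_vq" "holomorphic2_on f2 cover_vq"
    and x: "x \<in> cover"
  shows "complex_diff J4 (\<lambda>x. E \<mu> x $ p) x"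
proof -
  let ?a = "fst :: pt \<Rightarrow> _" and ?z = "\<lambda>x::pt. fst (snd x)" and ?v = "\<lambda>x::pt. fst (snd (snd x))"
    and ?q = "\<lambda>x::pt. snd (snd (snd x))"
  define h where "h = (\<lambda>x. case (\<mu>, p) of
      (P2, P2) \<Rightarrow> (f1 (?v x, ?q x) * th0 (?q x) (?v x + ?z x - ?a x) + f2 (?v x, ?q x) * th1 (?q x) (?v x + ?z x - ?a x)) * thA (?q x) (?z x + ?a x)
    | (P2, P11) \<Rightarrow> (f1 (?v x, ?q x) * th0 (?q x) (?v x + ?z x + ?a x) + f2 (?v x, ?q x) * th1 (?q x) (?v x + ?z x + ?a x)) * thA (?q x) (?z x - ?a x)
    | (P11, P2) \<Rightarrow> f0 (?v x, ?q x) * thA (?q x) (?z x + 2 * ?v x - ?a x)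
    | (P11, P11) \<Rightarrow> f0 (?v x, ?q x) * thA (?q x) (?z x + 2 * ?v x + ?a x))"
  have Q: "Re (?q x) < 0" using x by (simp add: cover_eq)
  have "complex_diff J4 h x"
    unfolding h_def
    by (cases \<mu>; cases p; simp only: prod.case fixpt.case; intro complex_diff_intros complex_diff_vq[OF f(1)] complex_diff_vq[OF f(2)] complex_diff_vq[OF f(3)] Q)
  then show ?thesis
  proof (rule complex_diff_transform_open[OF _ open_cover x])
    fix y assume "y \<in> cover"
    moreover obtain A Z V Q where "y = (A, Z, V, Q)" by (cases y)
    ultimately show "E \<mu> y $ p = h y"
      by (cases \<mu>; cases p) (simp_all add: h_def cover_iff theta_form_nth[OF form] th_comb_def)
  qed
qed

lemma theta_form_property_A1:
  fixes E :: "fixpt \<Rightarrow> pt \<Rightarrow> complex^fixpt"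
  assumes form: "theta_form E f0 f1 f2"
    and f: "admissible_coeff f0 c0" "admissible_coeff f1 c1" "admissible_coeff f2 c2"
    and c: "2 * (c2 - (c1 + 3 / 4)) \<in> \<int>"
  shows "single_valued_via proj_HKS_double cover (\<lambda>(A, Z, V, Q).
      ((lpow Q (- (case \<mu> of P2 \<Rightarrow> c1 + 1 / 8 | P11 \<Rightarrow> c0 + 1 / 8)) * lpow A (- (1 / 2)) * lpow Z (- (1 / 2))) *s
        (sqrt_L_minus A V * E \<mu> (A, Z, V, Q))) $ p)" (is "single_valued_via _ _ ?f")
    and "holomorphic4_on (\<lambda>(A, Z, V, Q).
      ((lpow Q (- r) * lpow A (- \<alpha>) * lpow Z (- \<beta>)) *s (sqrt_L_minus A V * E \<mu> (A, Z, V, Q))) $ p) cover"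
proof -
  show "single_valued_via proj_HKS_double cover ?f"
    unfolding single_valued_via_def
  proof (intro ballI impI)
    fix x y assume xy: "x \<in> cover" "y \<in> cover" "proj_HKS_double x = proj_HKS_double y"
    obtain A Z V Q where x: "x = (A, Z, V, Q)" by (cases x)
    obtain A' Z' V' Q' where y: "y = (A', Z', V', Q')" by (cases y)
    have Q: "Re Q < 0" "Re Q' < 0" using xy by (auto simp: x y cover_iff)
    have e: "exp A = exp A'" "exp Z = exp Z'" "exp V = exp V'" "exp (Q / 2) = exp (Q' / 2)"
      using xy by (auto simp: x y proj_HKS_double_def)
    note red = theta_form_reduced(1,2)[OF form, where ?c1.0 = c1] theta_form_reduced(3,4)[OF form, where ?c0.0 = c0]
    have g: "exp X = exp X' \<Longrightarrow> exp (- of_real c1 * Q) * th_comb (f1 (V, Q)) (f2 (V, Q)) Q X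
      = exp (- of_real c1 * Q') * th_comb (f1 (V', Q')) (f2 (V', Q')) Q' X'" for X X'
      by (rule th_comb_single_valued[OF f(2,3) c Q e(3,4)])
    show "?f x = ?f y"
      unfolding x y prod.case
      by (cases \<mu>; cases p; simp only: fixpt.case red[OF Q(1)] red[OF Q(2)];
          rule mult3_cong, intro exp_eqs e,
          (rule g, intro exp_eqs e | rule admissible_coeffD[OF f(1) Q e(3,4)]),
          rule thA_red_single_valued[OF e(4)], intro exp_eqs e)
  qed
  show "holomorphic4_on (\<lambda>(A, Z, V, Q).
      ((lpow Q (- r) * lpow A (- \<alpha>) * lpow Z (- \<beta>)) *s (sqrt_L_minus A V * E \<mu> (A, Z, V, Q))) $ p) cover"
    unfolding holomorphic4_on_iff
  proof
    fix x assume x: "x \<in> cover"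
    have E: "complex_diff J4 (\<lambda>x. E \<mu> x $ p) x"
      using f by (intro theta_form_complex_diff[OF form _ _ _ x]) (auto simp: admissible_coeff_def)
    have "complex_diff J4 (\<lambda>x. (exp (of_real (- r) * snd (snd (snd x))) * exp (of_real (- \<alpha>) * fst x) * exp (of_real (- \<beta>) * fst (snd x)))
        * (exp ((case p of P2 \<Rightarrow> - 1 | P11 \<Rightarrow> - 2) * fst x - fst (snd (snd x))) * E \<mu> x $ p)) x"
      by (intro complex_diff_intros E)
    moreover have "(\<lambda>(A, Z, V, Q). ((lpow Q (- r) * lpow A (- \<alpha>) * lpow Z (- \<beta>)) *s (sqrt_L_minus A V * E \<mu> (A, Z, V, Q))) $ p)
      = (\<lambda>x. (exp (of_real (- r) * snd (snd (snd x))) * exp (of_real (- \<alpha>) * fst x) * exp (of_real (- \<beta>) * fst (snd x)))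
        * (exp ((case p of P2 \<Rightarrow> - 1 | P11 \<Rightarrow> - 2) * fst x - fst (snd (snd x))) * E \<mu> x $ p))"
      by (rule ext) (cases p; simp add: lpow_def split: prod.splits)
    ultimately show "complex_diff J4 (\<lambda>(A, Z, V, Q). ((lpow Q (- r) * lpow A (- \<alpha>) * lpow Z (- \<beta>)) *s (sqrt_L_minus A V * E \<mu> (A, Z, V, Q))) $ p) x"
      by simp
  qed
qed

lemma theta_form_cond_S:
  fixes E :: "fixpt \<Rightarrow> pt \<Rightarrow> complex^fixpt"
  assumes form: "theta_form E f0 f1 f2"
    and f: "admissible_coeff f0 c0" "admissible_coeff f1 c1" "admissible_coeff f2 c2"
    and c: "2 * (c2 - (c1 + 3 / 4)) \<in> \<int>"
  shows "cond_S E"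
  unfolding cond_S_def Let_def
proof (intro allI impI conjI)
  fix \<mu> p and Q :: complex assume Q: "Re Q < 0"
  let ?f = "\<lambda>(A, Z, V). (lpow Z (- 1 / 2) *s (bun_O (- 1 / 2) A V * E \<mu> (A, Z, V, Q))) $ p"
  define \<kappa> where "\<kappa> = (case \<mu> of P2 \<Rightarrow> c1 + 1 / 8 | P11 \<Rightarrow> c0 + 1 / 8)"
  let ?h = "\<lambda>(A, Z, V, Q). ((lpow Q (- \<kappa>) * lpow A (- (1 / 2)) * lpow Z (- (1 / 2))) *s
        (sqrt_L_minus A V * E \<mu> (A, Z, V, Q))) $ p"
  have rel: "?f (A, Z, V) = lpow Q \<kappa> * (exp (2 * A) * ?h (A, Z, V, Q))" for A Z V
  proof -
    have 1: "lpow Z (- 1 / 2) * exp (of_real (- 1 / 2) * (2 * V - A))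
        = lpow Q \<kappa> * (exp (2 * A) * (lpow Q (- \<kappa>) * lpow A (- (1 / 2)) * lpow Z (- (1 / 2)) * exp (- A - V)))"
      "lpow Z (- 1 / 2) * exp (of_real (- 1 / 2) * (2 * V + A))
        = lpow Q \<kappa> * (exp (2 * A) * (lpow Q (- \<kappa>) * lpow A (- (1 / 2)) * lpow Z (- (1 / 2)) * exp (- 2 * A - V)))"
      unfolding lpow_def exp_add[symmetric] by (rule arg_cong[of _ _ exp], simp add: field_simps)+
    show ?thesis
      unfolding prod.case vector_smult_component vector_mult_component mult.assoc[symmetric]
      by (cases p; simp only: bun_O_nth sqrt_L_minus_nth 1 mult.assoc)
  qed
  have sv: "single_valued_via proj_HKS_double cover ?h"
    unfolding \<kappa>_def by (rule theta_form_property_A1(1)[OF form f c])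
  show "single_valued_via proj_HKS UNIV ?f"
    unfolding single_valued_via_def
  proof (intro ballI impI)
    fix x y assume xy: "proj_HKS x = proj_HKS y"
    obtain A Z V where x: "x = (A, Z, V)" by (cases x)
    obtain A' Z' V' where y: "y = (A', Z', V')" by (cases y)
    have e: "exp A = exp A'" "exp Z = exp Z'" "exp V = exp V'"
      using xy by (auto simp: x y proj_HKS_def)
    have "(A, Z, V, Q) \<in> cover" "(A', Z', V', Q) \<in> cover" "proj_HKS_double (A, Z, V, Q) = proj_HKS_double (A', Z', V', Q)"
      using Q e by (auto simp: cover_iff proj_HKS_double_def)
    then have "?h (A, Z, V, Q) = ?h (A', Z', V', Q)"
      using sv unfolding single_valued_via_def by blast
    then show "?f x = ?f y"
      unfolding x y rel exp_2_eq[OF e(1)] by (simp only:)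
  qed
  show "holomorphic3_on ?f UNIV"
  proof (rule holomorphic3_onI)
    fix x :: "complex \<times> complex \<times> complex"
    obtain A Z V where x: "x = (A, Z, V)" by (cases x)
    have "(A, Z, V, Q) \<in> cover" using Q by (simp add: cover_iff)
    then have "complex_diff J4 (\<lambda>x. E \<mu> x $ p) (fst x, fst (snd x), snd (snd x), Q)"
      using f by (intro theta_form_complex_diff[OF form]) (auto simp: admissible_coeff_def x)
    then have E: "complex_diff J3 (\<lambda>x. E \<mu> (fst x, fst (snd x), snd (snd x), Q) $ p) x"
      by (rule complex_diff_pair4) (rule complex_diff_intros)+
    have "complex_diff J3 (\<lambda>x. exp (of_real (- 1 / 2) * fst (snd x)) *
        (exp (of_real (- 1 / 2) * (2 * snd (snd x) + (case p of P2 \<Rightarrow> - 1 | P11 \<Rightarrow> 1) * fst x)) * E \<mu> (fst x, fst (snd x), snd (snd x), Q) $ p)) x"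
      by (intro complex_diff_intros E)
    moreover have "?f = (\<lambda>x. exp (of_real (- 1 / 2) * fst (snd x)) *
        (exp (of_real (- 1 / 2) * (2 * snd (snd x) + (case p of P2 \<Rightarrow> - 1 | P11 \<Rightarrow> 1) * fst x)) * E \<mu> (fst x, fst (snd x), snd (snd x), Q) $ p))"
      by (rule ext) (cases p; simp add: lpow_def split: prod.splits)
    ultimately show "complex_diff J3 ?f x" by simp
  qed
qed

subsection \<open>The limits at all slopes\<close>

lemma W_P2_eq:
  "W P2 (of_int m) A Z V = vec2 (exp (2 * of_int m * V + A) - exp (2 * of_int m * V - Z))
     (exp (2 * of_int m * V + 2 * of_int m * A) - exp (2 * of_int m * V + (2 * of_int m + 1) * A - Z))"
  "of_int m < s \<Longrightarrow> s < of_int m + 1 / 2 \<Longrightarrow>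
    W P2 s A Z V = vec2 (exp (2 * of_int m * V + A)) (exp (2 * of_int m * V + 2 * of_int m * A))"
  "W P2 (of_int m + 1 / 2) A Z V =
     vec2 (exp ((2 * of_int m + 2) * V - (2 * of_int m + 2) * A) + exp (2 * of_int m * V - 2 * of_int m * A - 2 * Z))
      (exp ((2 * of_int m + 2) * V + A) + exp (2 * of_int m * V - A - 2 * Z))"
  "of_int m + 1 / 2 < s \<Longrightarrow> s < of_int m + 1 \<Longrightarrow>
    W P2 s A Z V = vec2 (exp ((2 * of_int m + 2) * V - (2 * of_int m + 2) * A)) (exp ((2 * of_int m + 2) * V + A))"
proof -
  have fl: "of_int m \<le> s \<Longrightarrow> s < of_int m + 1 \<Longrightarrow> \<lfloor>s\<rfloor> = m" for s :: real
    by (simp add: floor_eq_iff)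
  show "W P2 (of_int m) A Z V = vec2 (exp (2 * of_int m * V + A) - exp (2 * of_int m * V - Z))
     (exp (2 * of_int m * V + 2 * of_int m * A) - exp (2 * of_int m * V + (2 * of_int m + 1) * A - Z))"
    by (simp add: W_def Let_def lpow_def algebra_simps flip: exp_add)
  show "of_int m < s \<Longrightarrow> s < of_int m + 1 / 2 \<Longrightarrow>
    W P2 s A Z V = vec2 (exp (2 * of_int m * V + A)) (exp (2 * of_int m * V + 2 * of_int m * A))"
    using fl[of s] by (simp add: W_def Let_def lpow_def algebra_simps flip: exp_add)
  show "W P2 (of_int m + 1 / 2) A Z V =
     vec2 (exp ((2 * of_int m + 2) * V - (2 * of_int m + 2) * A) + exp (2 * of_int m * V - 2 * of_int m * A - 2 * Z))
      (exp ((2 * of_int m + 2) * V + A) + exp (2 * of_int m * V - A - 2 * Z))"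
    using fl[of "of_int m + 1 / 2"] by (simp add: W_def Let_def lpow_def algebra_simps flip: exp_add)
  show "of_int m + 1 / 2 < s \<Longrightarrow> s < of_int m + 1 \<Longrightarrow>
    W P2 s A Z V = vec2 (exp ((2 * of_int m + 2) * V - (2 * of_int m + 2) * A)) (exp ((2 * of_int m + 2) * V + A))"
    using fl[of s] by (simp add: W_def Let_def lpow_def algebra_simps flip: exp_add)
qed

lemma W_P11_eq:
  "W P11 (of_int m) A Z V = vec2 (exp ((2 * of_int m + 1) * V - 2 * of_int m * A) - exp ((2 * of_int m - 1) * V + (1 - 2 * of_int m) * A - Z))
     (exp ((2 * of_int m + 1) * V + A) - exp ((2 * of_int m - 1) * V - Z))"
  "of_int m < s \<Longrightarrow> s < of_int m + 1 / 2 \<Longrightarrow>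
    W P11 s A Z V = vec2 (exp ((2 * of_int m + 1) * V - 2 * of_int m * A)) (exp ((2 * of_int m + 1) * V + A))"
  "of_int m + 1 / 2 \<le> s \<Longrightarrow> s < of_int m + 1 \<Longrightarrow>
    W P11 s A Z V = vec2 (exp ((2 * of_int m + 1) * V + A)) (exp ((2 * of_int m + 1) * V + (2 * of_int m + 2) * A))"
proof -
  have fl: "of_int m \<le> s \<Longrightarrow> s < of_int m + 1 \<Longrightarrow> \<lfloor>s\<rfloor> = m" for s :: real
    by (simp add: floor_eq_iff)
  show "W P11 (of_int m) A Z V = vec2 (exp ((2 * of_int m + 1) * V - 2 * of_int m * A) - exp ((2 * of_int m - 1) * V + (1 - 2 * of_int m) * A - Z))
     (exp ((2 * of_int m + 1) * V + A) - exp ((2 * of_int m - 1) * V - Z))"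
    by (simp add: W_def Let_def lpow_def algebra_simps flip: exp_add)
  show "of_int m < s \<Longrightarrow> s < of_int m + 1 / 2 \<Longrightarrow>
    W P11 s A Z V = vec2 (exp ((2 * of_int m + 1) * V - 2 * of_int m * A)) (exp ((2 * of_int m + 1) * V + A))"
    using fl[of s] by (simp add: W_def Let_def lpow_def algebra_simps flip: exp_add)
  show "of_int m + 1 / 2 \<le> s \<Longrightarrow> s < of_int m + 1 \<Longrightarrow>
    W P11 s A Z V = vec2 (exp ((2 * of_int m + 1) * V + A)) (exp ((2 * of_int m + 1) * V + (2 * of_int m + 2) * A))"
    using fl[of s] by (simp add: W_def Let_def lpow_def algebra_simps flip: exp_add)
qed

text \<open>This lemma and the next two compare the product of the limits of two theta series with a canonical basis
  element: one monomial each, a difference of two from the alternating series at an integral slope, and a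
  sum of two from \<open>th0\<close> at a half-integral slope.\<close>

lemma exp_match_single:
  fixes a b c d e f g \<sigma> :: complex
  assumes "a + c + d = e + f + g"
  shows "exp a * (exp b * (exp c * (\<sigma> * exp d))) = \<sigma> * exp e * exp f * (exp b * exp g)"
proof -
  have "exp a * (exp b * (exp c * (\<sigma> * exp d))) = \<sigma> * exp b * exp (a + c + d)"
    by (simp add: exp_add mult_ac)
  then show ?thesis unfolding assms by (simp add: exp_add mult_ac)
qed

lemma exp_match_diff:
  fixes a b c d e f g d' g' \<sigma> :: complex
  assumes "a + c + d = e + f + g" "a + c + d' = e + f + g'"
  shows "exp a * (exp b * (exp c * (\<sigma> * (exp d - exp d')))) = \<sigma> * exp e * exp f * (exp b * (exp g - exp g'))"
  using exp_match_single[OF assms(1), of b \<sigma>] exp_match_single[OF assms(2), of b \<sigma>]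
  by (simp only: right_diff_distrib)

lemma exp_match_sum:
  fixes a b c d e f g c' g' \<sigma> :: complex
  assumes "a + c + d = e + f + g'" "a + c' + d = e + f + g"
  shows "exp a * (exp b * ((exp c + exp c') * (\<sigma> * exp d))) = \<sigma> * exp e * exp f * (exp b * (exp g + exp g'))"
  using exp_match_single[OF assms(1), of b \<sigma>] exp_match_single[OF assms(2), of b \<sigma>]
  by (simp only: distrib_left distrib_right add.commute)

lemma property_A_limitI:
  fixes E :: "fixpt \<Rightarrow> pt \<Rightarrow> complex^fixpt"
  assumes L: "\<And>A Z V. ((\<lambda>Q. lpow Q k *s delta_z (- s) (E \<mu>) (A, Z, V, Q)) \<longlongrightarrow> vec2 (L1 A Z V) (L2 A Z V)) q_to_0"
    and eq: "\<And>A Z V. exp (- A / 2 - Z / 2) * (exp (- A - V) * L1 A Z V)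
        = (- 1) powi m * exp (of_int i * A) * exp (of_int j * Z) * (exp (- A - V) * W \<mu> s A Z V $ P2)"
      "\<And>A Z V. exp (- A / 2 - Z / 2) * (exp (- 2 * A - V) * L2 A Z V)
        = (- 1) powi m * exp (of_int i * A) * exp (of_int j * Z) * (exp (- 2 * A - V) * W \<mu> s A Z V $ P11)"
  shows "\<exists>rs::real. \<exists>\<epsilon>\<in>{1, - 1}. \<exists>i j :: int. \<forall>A Z V.
        ((\<lambda>Q. (lpow Q (- rs) * lpow A (- (1 / 2)) * lpow Z (- (1 / 2))) *s
                 (sqrt_L_minus A V * delta_z (- s) (E \<mu>) (A, Z, V, Q)))
           \<longlongrightarrow> (\<epsilon> * lpow A (of_int i) * lpow Z (of_int j)) *s
                 (sqrt_L_minus A V * W \<mu> s A Z V)) q_to_0"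
proof (intro exI bexI allI)
  show "(- 1 :: complex) powi m \<in> {1, - 1}" by (cases "even m") auto
  fix A Z V
  have R: "((- 1) powi m * lpow A (of_int i) * lpow Z (of_int j)) *s (sqrt_L_minus A V * W \<mu> s A Z V)
      = vec2 (exp (- A / 2 - Z / 2) * (exp (- A - V) * L1 A Z V)) (exp (- A / 2 - Z / 2) * (exp (- 2 * A - V) * L2 A Z V))"
    unfolding eq by (intro vec2_eqI) (simp_all add: lpow_def)
  have e: "lpow Q (- (- k)) * lpow A (- (1 / 2)) * lpow Z (- (1 / 2)) * (s * x) = exp (- A / 2 - Z / 2) * (s * (lpow Q k * x))" for Q s x
  proof -
    have "lpow A (- (1 / 2)) * lpow Z (- (1 / 2)) = exp (- A / 2 - Z / 2)"
      unfolding lpow_def exp_add[symmetric] by (rule arg_cong[of _ _ exp]) (simp add: field_simps)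
    then show ?thesis by (simp add: mult_ac)
  qed
  have l: "((\<lambda>Q. lpow Q k * delta_z (- s) (E \<mu>) (A, Z, V, Q) $ P2) \<longlongrightarrow> L1 A Z V) q_to_0"
    "((\<lambda>Q. lpow Q k * delta_z (- s) (E \<mu>) (A, Z, V, Q) $ P11) \<longlongrightarrow> L2 A Z V) q_to_0"
    using tendsto_vec_nth[OF L[of A Z V], of P2] tendsto_vec_nth[OF L[of A Z V], of P11] by simp_all
  show "((\<lambda>Q. (lpow Q (- (- k)) * lpow A (- (1 / 2)) * lpow Z (- (1 / 2))) *s
                 (sqrt_L_minus A V * delta_z (- s) (E \<mu>) (A, Z, V, Q)))
           \<longlongrightarrow> ((- 1) powi m * lpow A (of_int i) * lpow Z (of_int j)) *s
                 (sqrt_L_minus A V * W \<mu> s A Z V)) q_to_0"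
    unfolding R
    by (rule tendsto_vec2; unfold vector_smult_component vector_mult_component e sqrt_L_minus_nth; intro tendsto_intros l)
qed

text \<open>The jumps of the canonical basis element are those of the nearest indices: the alternating series has
  two leading terms at integral slopes, and \<open>th0\<close> at half-integral ones. The exponents \<open>i\<close> and \<open>j\<close> are read
  off from the leading monomials.\<close>

lemma theta_form_property_A2_P2:
  assumes form: "theta_form E f0 f1 f2" and f1: "asymp_unit f1 c1" and f2: "asymp_bounded f2 c2"
    and c: "c2 \<ge> c1 + 3 / 4"
  shows "\<exists>rs::real. \<exists>\<epsilon>\<in>{1, - 1}. \<exists>i j :: int. \<forall>A Z V.
        ((\<lambda>Q. (lpow Q (- rs) * lpow A (- (1 / 2)) * lpow Z (- (1 / 2))) *s
                 (sqrt_L_minus A V * delta_z (- s) (E P2) (A, Z, V, Q)))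
           \<longlongrightarrow> (\<epsilon> * lpow A (of_int i) * lpow Z (of_int j)) *s
                 (sqrt_L_minus A V * W P2 s A Z V)) q_to_0"
proof -
  define m where "m = \<lfloor>s\<rfloor>"
  have m: "of_int m \<le> s" "s < of_int m + 1" by (auto simp: m_def)
  have near: "(of_int n - s)\<^sup>2 \<le> 1 / 4" if "\<bar>s - of_int n\<bar> < 1 / 2" for n :: int
    using power_mono[of "\<bar>s - of_int n\<bar>" "1 / 2" 2] that by (simp add: power2_eq_square algebra_simps)
  have g: "((\<lambda>Q. exp (of_real (s\<^sup>2 - (of_int n - s)\<^sup>2 - c1) * Q) * th_comb (f1 (V, Q)) (f2 (V, Q)) Q (X - of_real s * Q))
      \<longlongrightarrow> exp (of_real (2 * of_int n) * X)) q_to_0" if "\<bar>s - of_int n\<bar> < 1 / 2" for V X n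
    by (rule th_comb_limit[OF f1 f2 c near[OF that] th0_limit_open[OF that]])
  consider "s = of_int m" | "of_int m < s" "s < of_int m + 1 / 2" | "s = of_int m + 1 / 2" | "of_int m + 1 / 2 < s"
    using m by linarith
  then show ?thesis
  proof cases
    case 1
    have b: "\<bar>s - of_int m\<bar> < 1 / 2" using 1 by simp
    note T = thA_limit_int[of m, folded 1]
    show ?thesis
      by (rule property_A_limitI[where E = E and \<mu> = P2 and s = s and m = m and i = "- m - 1" and j = "3 * m",
            OF theta_form_limit_P2[OF form g[OF b] T]];
          unfold 1 W_P2_eq(1) vec2_nth; rule exp_match_diff; simp add: field_simps)
  next
    case 2
    have b: "\<bar>s - of_int m\<bar> < 1 / 2" using 2 by simp
    note T = thA_limit_open[OF 2(1) m(2)]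
    show ?thesis
      by (rule property_A_limitI[where E = E and \<mu> = P2 and s = s and m = m and i = "- m - 1" and j = "3 * m",
            OF theta_form_limit_P2[OF form g[OF b] T]];
          unfold W_P2_eq(2)[OF 2] vec2_nth; rule exp_match_single; simp add: field_simps)
  next
    case 3
    have s: "of_int m < s" using 3 by simp
    have g': "((\<lambda>Q. exp (of_real (s\<^sup>2 - 1 / 4 - c1) * Q) * th_comb (f1 (V, Q)) (f2 (V, Q)) Q (X - of_real s * Q))
      \<longlongrightarrow> exp (of_real (2 * of_int m) * X) + exp (of_real (2 * of_int m + 2) * X)) q_to_0" for V X
      by (rule th_comb_limit[OF f1 f2 c _ th0_limit_half[OF 3]]) simp
    note T = thA_limit_open[OF s m(2)]
    show ?thesis
      by (rule property_A_limitI[where E = E and \<mu> = P2 and s = s and m = m and i = m and j = "3 * m + 2",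
            OF theta_form_limit_P2[OF form g' T]];
          unfold 3 W_P2_eq(3) vec2_nth; rule exp_match_sum; simp add: field_simps)
  next
    case 4
    have b: "\<bar>s - of_int (m + 1)\<bar> < 1 / 2" using 4 m by simp
    have s: "of_int m < s" using 4 by simp
    note T = thA_limit_open[OF s m(2)]
    show ?thesis
      by (rule property_A_limitI[where E = E and \<mu> = P2 and s = s and m = m and i = m and j = "3 * m + 2",
            OF theta_form_limit_P2[OF form g[OF b] T]];
          unfold W_P2_eq(4)[OF 4 m(2)] vec2_nth; rule exp_match_single; simp add: field_simps)
  qed
qed

text \<open>Only the integral slopes have two leading terms. From slope \<open>m + 1/2\<close> on, the listed canonical
  basis element is the previous one times \<open>a\<^bsup>2m + 1\<^esup>\<close>, which is absorbed by the exponent \<open>i\<close>.\<close>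

lemma theta_form_property_A2_P11:
  assumes form: "theta_form E f0 f1 f2" and f0: "asymp_unit f0 c0"
  shows "\<exists>rs::real. \<exists>\<epsilon>\<in>{1, - 1}. \<exists>i j :: int. \<forall>A Z V.
        ((\<lambda>Q. (lpow Q (- rs) * lpow A (- (1 / 2)) * lpow Z (- (1 / 2))) *s
                 (sqrt_L_minus A V * delta_z (- s) (E P11) (A, Z, V, Q)))
           \<longlongrightarrow> (\<epsilon> * lpow A (of_int i) * lpow Z (of_int j)) *s
                 (sqrt_L_minus A V * W P11 s A Z V)) q_to_0"
proof -
  define m where "m = \<lfloor>s\<rfloor>"
  have m: "of_int m \<le> s" "s < of_int m + 1" by (auto simp: m_def)
  have one: "exp a * (exp b * (\<sigma> * x)) = exp a * (exp b * (exp 0 * (\<sigma> * x)))" for a b \<sigma> x :: complex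
    by simp
  consider "s = of_int m" | "of_int m < s" "s < of_int m + 1 / 2" | "of_int m + 1 / 2 \<le> s"
    using m by linarith
  then show ?thesis
  proof cases
    case 1
    note T = thA_limit_int[of m, folded 1]
    show ?thesis
      by (rule property_A_limitI[where E = E and \<mu> = P11 and s = s and m = m and i = "m - 1" and j = m,
            OF theta_form_limit_P11[OF form f0 T]];
          unfold 1 W_P11_eq(1) vec2_nth; subst one; rule exp_match_diff; simp add: field_simps)
  next
    case 2
    note T = thA_limit_open[OF 2(1) m(2)]
    show ?thesis
      by (rule property_A_limitI[where E = E and \<mu> = P11 and s = s and m = m and i = "m - 1" and j = m,
            OF theta_form_limit_P11[OF form f0 T]];
          unfold W_P11_eq(2)[OF 2] vec2_nth; subst one; rule exp_match_single; simp add: field_simps)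
  next
    case 3
    have s: "of_int m < s" using 3 by simp
    note T = thA_limit_open[OF s m(2)]
    show ?thesis
      by (rule property_A_limitI[where E = E and \<mu> = P11 and s = s and m = m and i = "- m - 2" and j = m,
            OF theta_form_limit_P11[OF form f0 T]];
          unfold W_P11_eq(3)[OF 3 m(2)] vec2_nth; subst one; rule exp_match_single; simp add: field_simps)
  qed
qed

lemma theta_form_property_A:
  fixes E :: "fixpt \<Rightarrow> pt \<Rightarrow> complex^fixpt"
  assumes form: "theta_form E f0 f1 f2"
    and f: "admissible_coeff f0 c0" "admissible_coeff f1 c1" "admissible_coeff f2 c2"
    and u: "asymp_unit f0 c0" "asymp_unit f1 c1" "asymp_bounded f2 c2"
    and c: "admissible_exponents c0 c1 c2"
  shows "property_A E"
  unfolding property_A_def Let_def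
proof
  fix \<mu>
  have c': "c2 \<ge> c1 + 3 / 4" "c0 \<in> \<rat>" "c1 \<in> \<rat>" "2 * (c2 - (c1 + 3 / 4)) \<in> \<int>"
    using c by (auto simp: admissible_exponents_def)
  have r: "(case \<mu> of P2 \<Rightarrow> c1 + 1 / 8 | P11 \<Rightarrow> c0 + 1 / 8) \<in> \<rat>"
    using c' by (cases \<mu>) auto
  have A2: "\<exists>rs::real. \<exists>\<epsilon>\<in>{1, - 1}. \<exists>i j :: int. \<forall>A Z V.
        ((\<lambda>Q. (lpow Q (- rs) * lpow A (- (1 / 2)) * lpow Z (- (1 / 2))) *s
                 (sqrt_L_minus A V * delta_z (- s) (E \<mu>) (A, Z, V, Q)))
           \<longlongrightarrow> (\<epsilon> * lpow A (of_int i) * lpow Z (of_int j)) *s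
                 (sqrt_L_minus A V * W \<mu> s A Z V)) q_to_0" for s
    using theta_form_property_A2_P2[OF form u(2,3) c'(1), of s] theta_form_property_A2_P11[OF form u(1), of s]
    by (cases \<mu>) simp_all
  note A1 = theta_form_property_A1[OF form f c'(4), where \<mu> = \<mu>]
  show "\<exists>\<alpha>\<in>\<rat>. \<exists>\<beta>\<in>\<rat>. \<exists>r\<in>\<rat>. (\<forall>p. single_valued_via proj_HKS_double cover (\<lambda>(A, Z, V, Q).
              ((lpow Q (- r) * lpow A (- \<alpha>) * lpow Z (- \<beta>)) *s (sqrt_L_minus A V * E \<mu> (A, Z, V, Q))) $ p) \<and>
        holomorphic4_on (\<lambda>(A, Z, V, Q).
              ((lpow Q (- r) * lpow A (- \<alpha>) * lpow Z (- \<beta>)) *s (sqrt_L_minus A V * E \<mu> (A, Z, V, Q))) $ p) cover) \<and>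
     (\<forall>s::real. \<exists>rs::real. \<exists>\<epsilon>\<in>{1, - 1}. \<exists>i j :: int. \<forall>A Z V.
        ((\<lambda>Q. (lpow Q (- rs) * lpow A (- \<alpha>) * lpow Z (- \<beta>)) *s
                 (sqrt_L_minus A V * delta_z (- s) (E \<mu>) (A, Z, V, Q)))
           \<longlongrightarrow> (\<epsilon> * lpow A (of_int i) * lpow Z (of_int j)) *s
                 (sqrt_L_minus A V * W \<mu> s A Z V)) q_to_0)"
    by (rule bexI[of _ "1 / 2"], rule bexI[of _ "1 / 2"], rule bexI[OF _ r], intro conjI allI A1 A2) auto
qed

section \<open>The conditions imply the explicit formulas\<close>

lemma single_valued_viaD:
  "single_valued_via \<pi> S f \<Longrightarrow> x \<in> S \<Longrightarrow> y \<in> S \<Longrightarrow> \<pi> x = \<pi> y \<Longrightarrow> f x = f y"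
  unfolding single_valued_via_def by blast

lemma property_AE:
  fixes E :: "fixpt \<Rightarrow> pt \<Rightarrow> complex^fixpt"
  assumes "property_A E"
  obtains \<alpha> \<beta> r where "\<alpha> \<in> \<rat>" "\<beta> \<in> \<rat>" "r \<in> \<rat>"
    "\<And>p. single_valued_via proj_HKS_double cover (\<lambda>(A, Z, V, Q). ((lpow Q (- r) * lpow A (- \<alpha>) * lpow Z (- \<beta>)) *s
                 (sqrt_L_minus A V * E \<mu> (A, Z, V, Q))) $ p)"
    "\<And>p. holomorphic4_on (\<lambda>(A, Z, V, Q). ((lpow Q (- r) * lpow A (- \<alpha>) * lpow Z (- \<beta>)) *s
                 (sqrt_L_minus A V * E \<mu> (A, Z, V, Q))) $ p) cover"
    "\<And>s::real. \<exists>rs::real. \<exists>\<epsilon>\<in>{1, - 1}. \<exists>i j :: int. \<forall>A Z V.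
        ((\<lambda>Q. (lpow Q (- rs) * lpow A (- \<alpha>) * lpow Z (- \<beta>)) *s
                 (sqrt_L_minus A V * delta_z (- s) (E \<mu>) (A, Z, V, Q)))
           \<longlongrightarrow> (\<epsilon> * lpow A (of_int i) * lpow Z (of_int j)) *s
                 (sqrt_L_minus A V * W \<mu> s A Z V)) q_to_0"
  using spec[OF assms[unfolded property_A_def Let_def], of \<mu>]
  by (elim bexE conjE) (rule that; (assumption | erule spec | (drule spec, erule conjunct1) | (drule spec, erule conjunct2)))

text \<open>The normalising factors are exponentials, so the holomorphy of the normalised entries is that of the
  entries themselves.\<close>

lemma property_A_complex_diff:
  fixes E :: "fixpt \<Rightarrow> pt \<Rightarrow> complex^fixpt"
  assumes A: "property_A E" and x: "x \<in> cover"
  shows "complex_diff J4 (\<lambda>x. E \<mu> x $ p) x"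
proof -
  obtain \<alpha> \<beta> r where "holomorphic4_on (\<lambda>(A, Z, V, Q). ((lpow Q (- r) * lpow A (- \<alpha>) * lpow Z (- \<beta>)) *s
                 (sqrt_L_minus A V * E \<mu> (A, Z, V, Q))) $ p) cover"
    by (rule property_AE[OF A, of \<mu>]) blast
  then have h: "complex_diff J4 (\<lambda>(A, Z, V, Q). ((lpow Q (- r) * lpow A (- \<alpha>) * lpow Z (- \<beta>)) *s
                 (sqrt_L_minus A V * E \<mu> (A, Z, V, Q))) $ p) x" (is "complex_diff J4 ?h x")
    using x by (simp add: holomorphic4_on_iff)
  have "complex_diff J4 (\<lambda>x. exp (of_real r * snd (snd (snd x)) + of_real \<alpha> * fst x + of_real \<beta> * fst (snd x)
      + (case p of P2 \<Rightarrow> 1 | P11 \<Rightarrow> 2) * fst x + fst (snd (snd x))) * ?h x) x"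
    by (intro complex_diff_intros h)
  moreover have "(\<lambda>x. exp (of_real r * snd (snd (snd x)) + of_real \<alpha> * fst x + of_real \<beta> * fst (snd x)
      + (case p of P2 \<Rightarrow> 1 | P11 \<Rightarrow> 2) * fst x + fst (snd (snd x))) * ?h x) = (\<lambda>x. E \<mu> x $ p)"
  proof (rule ext)
    fix x :: pt
    obtain A Z V Q where xe: "x = (A, Z, V, Q)" by (cases x)
    have 1: "exp (of_real r * Q + of_real \<alpha> * A + of_real \<beta> * Z + of_nat k * A + V) *
        (lpow Q (- r) * lpow A (- \<alpha>) * lpow Z (- \<beta>) * (exp (- of_nat k * A - V) * e)) = e" for k :: nat and e
    proof -
      have "exp (of_real r * Q + of_real \<alpha> * A + of_real \<beta> * Z + of_nat k * A + V) *
        (lpow Q (- r) * lpow A (- \<alpha>) * lpow Z (- \<beta>) * exp (- of_nat k * A - V)) = exp 0"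
        unfolding lpow_def exp_add[symmetric] by (rule arg_cong[of _ _ exp]) simp
      then show ?thesis by (simp add: mult_ac)
    qed
    show "exp (of_real r * snd (snd (snd x)) + of_real \<alpha> * fst x + of_real \<beta> * fst (snd x)
      + (case p of P2 \<Rightarrow> 1 | P11 \<Rightarrow> 2) * fst x + fst (snd (snd x))) * ?h x = E \<mu> x $ p"
      using 1[of 1] 1[of 2] by (cases p) (simp_all add: xe)
  qed
  ultimately show ?thesis by simp
qed

text \<open>The factor \<open>z\<^bsup>- 1/2\<^esup>\<close> changes sign along the loop around \<open>z = 0\<close>.\<close>

lemma cond_S_period:
  fixes E :: "fixpt \<Rightarrow> pt \<Rightarrow> complex^fixpt"
  assumes S: "cond_S E" and Q: "Re Q < 0"
  shows "E \<mu> (A, Z + 2 * of_real pi * \<i>, V, Q) $ p = - E \<mu> (A, Z, V, Q) $ p"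
proof -
  have "single_valued_via proj_HKS UNIV (\<lambda>(A, Z, V). (lpow Z (- 1 / 2) *s (bun_O (- 1 / 2) A V * E \<mu> (A, Z, V, Q))) $ p)"
    using S Q unfolding cond_S_def Let_def by blast
  moreover have "proj_HKS (A, Z + 2 * of_real pi * \<i>, V) = proj_HKS (A, Z, V)"
    by (simp add: proj_HKS_def exp_add)
  ultimately have "(lpow (Z + 2 * of_real pi * \<i>) (- 1 / 2) *s (bun_O (- 1 / 2) A V * E \<mu> (A, Z + 2 * of_real pi * \<i>, V, Q))) $ p
      = (lpow Z (- 1 / 2) *s (bun_O (- 1 / 2) A V * E \<mu> (A, Z, V, Q))) $ p"
    by (auto dest: single_valued_viaD[of _ _ _ "(A, Z + 2 * of_real pi * \<i>, V)" "(A, Z, V)"])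
  moreover have "lpow (Z + 2 * of_real pi * \<i>) (- 1 / 2) = - lpow Z (- 1 / 2)"
  proof -
    have "of_real (- 1 / 2) * (Z + 2 * of_real pi * \<i>) = of_real (- 1 / 2) * Z - of_real pi * \<i>"
      by (simp add: field_simps)
    then show ?thesis unfolding lpow_def by (simp add: exp_diff)
  qed
  moreover have "lpow Z (- 1 / 2) \<noteq> 0" by (simp add: lpow_def)
  moreover have "bun_O (- 1 / 2) A V $ p \<noteq> 0" by (cases p) simp_all
  ultimately have "lpow Z (- 1 / 2) * (- E \<mu> (A, Z + 2 * of_real pi * \<i>, V, Q) $ p)
      = lpow Z (- 1 / 2) * E \<mu> (A, Z, V, Q) $ p"
    by simp
  then have "- E \<mu> (A, Z + 2 * of_real pi * \<i>, V, Q) $ p = E \<mu> (A, Z, V, Q) $ p"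
    using \<open>lpow Z (- 1 / 2) \<noteq> 0\<close> by (simp only: mult_cancel_left simp_thms)
  then show ?thesis by (metis minus_minus)
qed

lemma cond_Q_shift:
  fixes E :: "fixpt \<Rightarrow> pt \<Rightarrow> complex^fixpt"
  assumes "cond_Q1 E" "cond_Q2 E" and Q: "Re Q < 0"
  shows "E P2 (A, Z + Q, V, Q) $ P2 = - exp (- 3 * Q / 2 - 3 * Z - 2 * V + A) * E P2 (A, Z, V, Q) $ P2"
    "E P2 (A, Z + Q, V, Q) $ P11 = - exp (- 3 * Q / 2 - 3 * Z - 2 * V - A) * E P2 (A, Z, V, Q) $ P11"
    "E P11 (A, Z + Q, V, Q) $ P2 = - exp (- Q / 2 - Z - 2 * V + A) * E P11 (A, Z, V, Q) $ P2"
    "E P11 (A, Z + Q, V, Q) $ P11 = - exp (- Q / 2 - Z - 2 * V - A) * E P11 (A, Z, V, Q) $ P11"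
proof -
  have x: "(A, Z, V, Q) \<in> cover" using Q by (simp add: cover_iff)
  have 1: "E P2 (A, Z + Q, V, Q) = (- lpow Q (- 3 / 2) * lpow Z (- 3)) *s (bun_O (- 1) A V * E P2 (A, Z, V, Q))"
    using bspec[OF assms(1)[unfolded cond_Q1_def] x] by (simp add: delta_z_apply)
  have 2: "E P11 (A, Z + Q, V, Q) = (- lpow Q (- 1 / 2) * lpow Z (- 1)) *s (bun_O (- 1) A V * E P11 (A, Z, V, Q))"
    using bspec[OF assms(2)[unfolded cond_Q2_def] x] by (simp add: delta_z_apply)
  have *: "- lpow Q c * lpow Z d * (exp (of_real (- 1) * B) * e) = - exp (of_real c * Q + of_real d * Z - B) * e" for c d B e
    unfolding lpow_def by (simp add: exp_add exp_diff exp_minus field_simps)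
  show "E P2 (A, Z + Q, V, Q) $ P2 = - exp (- 3 * Q / 2 - 3 * Z - 2 * V + A) * E P2 (A, Z, V, Q) $ P2"
    "E P2 (A, Z + Q, V, Q) $ P11 = - exp (- 3 * Q / 2 - 3 * Z - 2 * V - A) * E P2 (A, Z, V, Q) $ P11"
    "E P11 (A, Z + Q, V, Q) $ P2 = - exp (- Q / 2 - Z - 2 * V + A) * E P11 (A, Z, V, Q) $ P2"
    "E P11 (A, Z + Q, V, Q) $ P11 = - exp (- Q / 2 - Z - 2 * V - A) * E P11 (A, Z, V, Q) $ P11"
    unfolding 1 2 vector_smult_component vector_mult_component bun_O_nth *
    by (intro arg_cong2[of _ _ _ _ "(*)"] arg_cong[of _ _ "\<lambda>x. - exp x"] refl; simp add: field_simps)+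
qed

text \<open>The normalising factors that do not depend on \<open>q\<close> are moved to the other side.\<close>

lemma property_A_limit:
  fixes E :: "fixpt \<Rightarrow> pt \<Rightarrow> complex^fixpt"
  assumes "property_A E"
  obtains rs a b :: real and \<epsilon> :: complex where "\<epsilon> \<noteq> 0"
    "\<And>A Z V p. ((\<lambda>Q. exp (- of_real rs * Q) * delta_z (- s) (E \<mu>) (A, Z, V, Q) $ p)
        \<longlongrightarrow> \<epsilon> * exp (of_real a * A + of_real b * Z) * W \<mu> s A Z V $ p) q_to_0"
proof -
  obtain \<alpha> \<beta> :: real where "\<exists>rs::real. \<exists>\<epsilon>\<in>{1, - 1}. \<exists>i j :: int. \<forall>A Z V.
        ((\<lambda>Q. (lpow Q (- rs) * lpow A (- \<alpha>) * lpow Z (- \<beta>)) *s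
                 (sqrt_L_minus A V * delta_z (- s) (E \<mu>) (A, Z, V, Q)))
           \<longlongrightarrow> (\<epsilon> * lpow A (of_int i) * lpow Z (of_int j)) *s
                 (sqrt_L_minus A V * W \<mu> s A Z V)) q_to_0"
    by (rule property_AE[OF assms, of \<mu>]) blast
  then obtain rs \<epsilon> i j where \<epsilon>: "\<epsilon> \<in> {1, - 1 :: complex}" and lim: "\<And>A Z V. ((\<lambda>Q. (lpow Q (- rs) * lpow A (- \<alpha>) * lpow Z (- \<beta>)) *s
                 (sqrt_L_minus A V * delta_z (- s) (E \<mu>) (A, Z, V, Q)))
           \<longlongrightarrow> (\<epsilon> * lpow A (of_int i) * lpow Z (of_int j)) *s
                 (sqrt_L_minus A V * W \<mu> s A Z V)) q_to_0"
    by (elim exE bexE) (rule that, assumption, elim allE)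
  show ?thesis
  proof (rule that[of \<epsilon> rs "\<alpha> + of_int i" "\<beta> + of_int j"])
    show "\<epsilon> \<noteq> 0" using \<epsilon> by auto
    fix A Z V p
    have Lp: "sqrt_L_minus A V $ p \<noteq> 0" by (cases p) simp_all
    define k where "k = lpow A \<alpha> * lpow Z \<beta> / sqrt_L_minus A V $ p"
    have k1: "k * (lpow Q (- rs) * lpow A (- \<alpha>) * lpow Z (- \<beta>) * (sqrt_L_minus A V $ p * e)) = exp (- of_real rs * Q) * e" for Q e
      using Lp by (simp add: k_def lpow_def exp_minus field_simps)
    have k2: "k * (\<epsilon> * lpow A (of_int i) * lpow Z (of_int j) * (sqrt_L_minus A V $ p * e))
      = \<epsilon> * exp (of_real (\<alpha> + of_int i) * A + of_real (\<beta> + of_int j) * Z) * e" for e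
      using Lp by (simp add: k_def lpow_def exp_add algebra_simps)
    show "((\<lambda>Q. exp (- of_real rs * Q) * delta_z (- s) (E \<mu>) (A, Z, V, Q) $ p)
        \<longlongrightarrow> \<epsilon> * exp (of_real (\<alpha> + of_int i) * A + of_real (\<beta> + of_int j) * Z) * W \<mu> s A Z V $ p) q_to_0"
      using tendsto_mult_left[OF tendsto_vec_nth[OF lim[of A Z V], of p], of k]
      unfolding vector_smult_component vector_mult_component k1 k2 .
  qed
qed

text \<open>If \<open>\<Upsilon>\<close> vanished at \<open>v = e\<^bsup>- 1\<^esup>\<close> for all small \<open>q\<close>, the leading terms at slope \<open>0\<close> of the two summands of the
  upper left entry would cancel. But at \<open>a = e\<close> and \<open>z = e\<^bsup>- 1\<^esup>\<close> the leading coefficient of the first summand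
  is zero because \<open>a z = 1\<close>, and that of the second one is not.\<close>

lemma Y_not_identically_zero:
  fixes E :: "fixpt \<Rightarrow> pt \<Rightarrow> complex^fixpt"
  assumes A: "property_A E" and B: "cond_B E Y" and Y: "holomorphic2_on Y cover_vq"
  shows "\<exists>Q. Re Q < - 5 \<and> Y (- 1, Q) \<noteq> 0"
proof (rule ccontr)
  assume "\<not> ?thesis"
  then have Y0: "Y (- 1, Q) = 0" if "Re Q < - 5" for Q using that by blast
  obtain r1 a1 b1 \<epsilon>1 where e1: "\<epsilon>1 \<noteq> 0" and l1: "\<And>A Z V p. ((\<lambda>Q. exp (- of_real r1 * Q) * delta_z (- 0) (E P2) (A, Z, V, Q) $ p)
        \<longlongrightarrow> \<epsilon>1 * exp (of_real a1 * A + of_real b1 * Z) * W P2 0 A Z V $ p) q_to_0"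
    by (rule property_A_limit[OF A, where s = 0 and \<mu> = P2]) (rule that, assumption+)
  obtain r2 a2 b2 \<epsilon>2 where e2: "\<epsilon>2 \<noteq> 0" and l2: "\<And>A Z V p. ((\<lambda>Q. exp (- of_real r2 * Q) * delta_z (- 0) (E P11) (A, Z, V, Q) $ p)
        \<longlongrightarrow> \<epsilon>2 * exp (of_real a2 * A + of_real b2 * Z) * W P11 0 A Z V $ p) q_to_0"
    by (rule property_A_limit[OF A, where s = 0 and \<mu> = P11]) (rule that, assumption+)
  define k1 where "k1 = (\<lambda>A Z. \<epsilon>1 * exp (of_real a1 * A + of_real b1 * Z))"
  define k2 where "k2 = (\<lambda>A Z. \<epsilon>2 * exp (of_real a2 * A + of_real b2 * Z))"
  have k: "k1 A Z \<noteq> 0" "k2 A Z \<noteq> 0" for A Z using e1 e2 by (auto simp: k1_def k2_def)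
  have l1': "((\<lambda>Q. exp (- of_real r1 * Q) * E P2 (A, Z, V, Q) $ p) \<longlongrightarrow> k1 A Z * W P2 0 A Z V $ p) q_to_0" for A Z V p
    using l1[of A Z V p] by (simp add: delta_z_apply k1_def)
  have l2': "((\<lambda>Q. exp (- of_real r2 * Q) * E P11 (A, Z, V, Q) $ p) \<longlongrightarrow> k2 A Z * W P11 0 A Z V $ p) q_to_0" for A Z V p
    using l2[of A Z V p] by (simp add: delta_z_apply k2_def)
  have W2: "W P2 0 A Z V = vec2 (exp A - exp (- Z)) (1 - exp (A - Z))" for A Z V
    using W_P2_eq(1)[of 0 A Z V] by simp
  have W11: "W P11 0 A Z V $ P2 = exp V - exp (- V + A - Z)" for A Z V
    using W_P11_eq(1)[of 0 A Z V] by simp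
  have "((\<lambda>Q. (exp (- of_real r1 * Q) * E P2 (1, - 1, - 1, Q) $ P2) * (exp (- of_real r2 * Q) * E P11 (- 1, 1, - 1, Q) $ P11)
      + (exp (- of_real r2 * Q) * E P11 (1, - 1, - 1, Q) $ P2) * (exp (- of_real r1 * Q) * E P2 (- 1, 1, - 1, Q) $ P11))
    \<longlongrightarrow> (k1 1 (- 1) * W P2 0 1 (- 1) (- 1) $ P2) * (k2 (- 1) 1 * W P11 0 (- 1) 1 (- 1) $ P11)
      + (k2 1 (- 1) * W P11 0 1 (- 1) (- 1) $ P2) * (k1 (- 1) 1 * W P2 0 (- 1) 1 (- 1) $ P11)) q_to_0"
    by (intro tendsto_intros l1' l2')
  then have lim: "((\<lambda>Q. (exp (- of_real r1 * Q) * E P2 (1, - 1, - 1, Q) $ P2) * (exp (- of_real r2 * Q) * E P11 (- 1, 1, - 1, Q) $ P11)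
      + (exp (- of_real r2 * Q) * E P11 (1, - 1, - 1, Q) $ P2) * (exp (- of_real r1 * Q) * E P2 (- 1, 1, - 1, Q) $ P11))
    \<longlongrightarrow> (k2 1 (- 1) * (exp (- 1) - exp 3)) * (k1 (- 1) 1 * (1 - exp (- 2)))) q_to_0"
    unfolding W2 W11 vec2_nth by simp
  have "\<forall>\<^sub>F Q in q_to_0. (exp (- of_real r1 * Q) * E P2 (1, - 1, - 1, Q) $ P2) * (exp (- of_real r2 * Q) * E P11 (- 1, 1, - 1, Q) $ P11)
      + (exp (- of_real r2 * Q) * E P11 (1, - 1, - 1, Q) $ P2) * (exp (- of_real r1 * Q) * E P2 (- 1, 1, - 1, Q) $ P11) = 0"
    unfolding eventually_q_to_0
  proof (intro exI allI impI)
    fix Q :: complex assume "Re Q \<le> - 6"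
    then have Q: "Re Q < 0" "Y (- 1, Q) = 0" using Y0 by auto
    have "E P2 (1, - 1, - 1, Q) $ P2 * E P11 (- 1, 1, - 1, Q) $ P11 + E P11 (1, - 1, - 1, Q) $ P2 * E P2 (- 1, 1, - 1, Q) $ P11 = 0"
      using cond_BD(1)[OF B property_A_complex_diff[OF A] Y Q(1), where V = "- 1" and A = 1 and Z = "- 1"] by (simp add: Q(2))
    then have "(exp (- of_real r1 * Q) * exp (- of_real r2 * Q)) *
      (E P2 (1, - 1, - 1, Q) $ P2 * E P11 (- 1, 1, - 1, Q) $ P11 + E P11 (1, - 1, - 1, Q) $ P2 * E P2 (- 1, 1, - 1, Q) $ P11) = 0"
      by simp
    then show "(exp (- of_real r1 * Q) * E P2 (1, - 1, - 1, Q) $ P2) * (exp (- of_real r2 * Q) * E P11 (- 1, 1, - 1, Q) $ P11)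
      + (exp (- of_real r2 * Q) * E P11 (1, - 1, - 1, Q) $ P2) * (exp (- of_real r1 * Q) * E P2 (- 1, 1, - 1, Q) $ P11) = 0"
      by (simp only: distrib_left mult_ac)
  qed
  then have "((\<lambda>Q. (exp (- of_real r1 * Q) * E P2 (1, - 1, - 1, Q) $ P2) * (exp (- of_real r2 * Q) * E P11 (- 1, 1, - 1, Q) $ P11)
      + (exp (- of_real r2 * Q) * E P11 (1, - 1, - 1, Q) $ P2) * (exp (- of_real r1 * Q) * E P2 (- 1, 1, - 1, Q) $ P11)) \<longlongrightarrow> 0) q_to_0"
    by (rule tendsto_eventually)
  from tendsto_unique[OF q_to_0_neq_bot lim this] k
  have "(exp (- 1) - exp 3 :: complex) = 0 \<or> (1 - exp (- 2) :: complex) = 0" by simp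
  moreover have "(exp (- 1) :: complex) \<noteq> exp 3" "(1 :: complex) \<noteq> exp (- 2)"
  proof -
    have "norm (exp (- 1) :: complex) \<noteq> norm (exp 3 :: complex)"
      unfolding norm_exp_eq_Re by simp
    then show "(exp (- 1) :: complex) \<noteq> exp 3"
      by (rule contrapos_nn) (rule arg_cong)
    have "norm (1 :: complex) \<noteq> norm (exp (- 2) :: complex)"
      unfolding norm_exp_eq_Re by simp
    then show "(1 :: complex) \<noteq> exp (- 2)"
      by (rule contrapos_nn) (rule arg_cong)
  qed
  ultimately show False by auto
qed

text \<open>The identity theorem in two variables, from the one-variable theorem on the complex line through \<open>x\<^sub>0\<close> and
  the given point: its intersection with the domain is a half-plane or the whole line, hence connected.\<close>

lemma nonzero_dense:
  assumes F: "\<And>x. x \<in> cover_vq \<Longrightarrow> complex_diff J2 F x" and x0: "x0 \<in> cover_vq" "F x0 \<noteq> 0"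
  shows "cover_vq \<subseteq> closure {x \<in> cover_vq. F x \<noteq> 0}"
proof
  fix y assume y: "y \<in> cover_vq"
  obtain V0 Q0 where x0e: "x0 = (V0, Q0)" by (cases x0)
  obtain V1 Q1 where ye: "y = (V1, Q1)" by (cases y)
  have Q: "Re Q0 < 0" "Re Q1 < 0" using x0 y by (auto simp: x0e ye cover_vq_iff)
  define l where "l = (\<lambda>t. (V1 + (V0 - V1) * t, Q1 + (Q0 - Q1) * t))"
  define S where "S = {t. Re (Q1 + (Q0 - Q1) * t) < 0}"
  have S: "open S" unfolding S_def by (intro open_Collect_less continuous_intros)
  have "convex S"
  proof -
    have "S = (\<lambda>t. Re ((Q0 - Q1) * t)) -` {..< - Re Q1}" by (auto simp: S_def)
    moreover have "linear (\<lambda>t. Re ((Q0 - Q1) * t))"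
      by (intro bounded_linear.linear bounded_linear_compose[OF bounded_linear_Re] bounded_linear_mult_right)
    ultimately show ?thesis using convex_linear_vimage by blast
  qed
  then have "connected S" by (rule convex_connected)
  have l1: "l 1 = x0" "l 0 = y" by (simp_all add: l_def x0e ye)
  have "(\<lambda>t. F (l t)) field_differentiable at t" if "t \<in> S" for t
    unfolding complex_diff_field_iff[symmetric] l_def
  proof (rule complex_diff_pair2)
    show "complex_diff J2 F (V1 + (V0 - V1) * t, Q1 + (Q0 - Q1) * t)"
      using that by (intro F) (simp add: S_def cover_vq_iff)
    have id: "complex_diff ((*) \<i>) (\<lambda>t. t) t"
      by (rule complex_diff_linear[OF bounded_linear_ident]) simp
    show "complex_diff ((*) \<i>) (\<lambda>t. V1 + (V0 - V1) * t) t" "complex_diff ((*) \<i>) (\<lambda>t. Q1 + (Q0 - Q1) * t) t"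
      by (intro complex_diff_intros id)+
  qed
  then have hol: "(\<lambda>t. F (l t)) holomorphic_on S"
    by (simp add: holomorphic_on_def field_differentiable_at_within)
  show "y \<in> closure {x \<in> cover_vq. F x \<noteq> 0}"
    unfolding closure_approachable
  proof (intro allI impI)
    fix e :: real assume e: "e > 0"
    define \<delta> where "\<delta> = e / (norm (x0 - y) + 1)"
    have d: "\<delta> > 0" using e by (simp add: \<delta>_def add_nonneg_pos)
    have "\<exists>t\<in>S \<inter> ball 0 \<delta>. F (l t) \<noteq> 0"
    proof (rule ccontr)
      assume "\<not> ?thesis"
      then have z: "F (l t) = 0" if "t \<in> S \<inter> ball 0 \<delta>" for t using that by blast
      have "0 \<in> S \<inter> ball 0 \<delta>" using Q d by (simp add: S_def)
      then have ne: "S \<inter> ball 0 \<delta> \<noteq> {}" by blast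
      have "F (l 1) = 0"
        by (rule analytic_continuation_open[where s = "S \<inter> ball 0 \<delta>" and s' = S and f = "\<lambda>t. F (l t)" and g = "\<lambda>_. 0"])
           (use S \<open>connected S\<close> ne hol z Q in \<open>auto simp: S_def\<close>)
      with l1 x0 show False by simp
    qed
    then obtain t where t: "t \<in> S" "norm t < \<delta>" "F (l t) \<noteq> 0" by auto
    have "dist (l t) y < e"
    proof -
      have "l t - y = ((V0 - V1) * t, (Q0 - Q1) * t)" by (simp add: l_def ye)
      also have "norm \<dots> = norm t * norm (x0 - y)"
        by (simp add: x0e ye norm_Pair norm_mult power_mult_distrib mult.commute distrib_left[symmetric] real_sqrt_mult del: distrib_left)
      also have "\<dots> \<le> norm t * (norm (x0 - y) + 1)" by (intro mult_left_mono) auto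
      also have "\<dots> < \<delta> * (norm (x0 - y) + 1)" by (intro mult_strict_right_mono t) (simp add: add_nonneg_pos)
      also have "\<dots> = e" by (simp add: \<delta>_def add_nonneg_eq_0_iff)

      finally show ?thesis by (simp add: dist_norm)
    qed
    moreover have "l t \<in> cover_vq" using t by (simp add: l_def S_def cover_vq_iff)
    ultimately show "\<exists>x\<in>{x \<in> cover_vq. F x \<noteq> 0}. dist x y < e" using t by blast
  qed
qed

lemma thA_nonzero_Re:
  assumes Q: "Re Q < 0" and X: "0 < \<bar>Re X\<bar>" "\<bar>Re X\<bar> < - Re Q"
  shows "thA Q X \<noteq> 0"
proof
  assume "thA Q X = 0"
  then obtain n k :: int where "X = of_int n * Q + 2 * of_real pi * \<i> * of_int k"
    unfolding thA_eq_0_iff[OF Q] by blast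
  then have 1: "Re X = of_int n * Re Q" by simp
  then have "n \<noteq> 0" using X by auto
  then have "1 \<le> \<bar>n\<bar>" by linarith
  then have "1 \<le> \<bar>real_of_int n\<bar>" by linarith
  then have "\<bar>Re Q\<bar> \<le> \<bar>of_int n\<bar> * \<bar>Re Q\<bar>" using mult_right_mono[of 1 "\<bar>real_of_int n\<bar>" "\<bar>Re Q\<bar>"] by simp
  then show False using X Q by (simp add: 1 abs_mult)
qed

lemma th_determinant:
  assumes Q: "Re Q < 0"
  shows "th1 Q (Q / 2) * th0 Q 0 - th0 Q (Q / 2) * th1 Q 0 = (thA Q (Q / 2))\<^sup>2"
  using thA_addition[OF Q, of "Q / 2" 0] by (simp add: power2_eq_square)

text \<open>The determinant of the values at \<open>x = q\<^bsup>1/2\<^esup>\<close> and \<open>x = 1\<close> is a square of a nonzero value of the alternating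
  series.\<close>

lemma th_independent:
  assumes Q: "Re Q < 0" and eq: "\<And>X. a * th0 Q X + b * th1 Q X = 0"
  shows "a = 0" "b = 0"
proof -
  let ?D = "th1 Q (Q / 2) * th0 Q 0 - th0 Q (Q / 2) * th1 Q 0"
  have D: "?D \<noteq> 0" unfolding th_determinant[OF Q] using Q by simp
  have "a * ?D = (a * th0 Q 0 + b * th1 Q 0) * th1 Q (Q / 2) - (a * th0 Q (Q / 2) + b * th1 Q (Q / 2)) * th1 Q 0"
    by (simp add: algebra_simps)
  then show "a = 0" using D unfolding eq by simp
  have "b * ?D = (a * th0 Q (Q / 2) + b * th1 Q (Q / 2)) * th0 Q 0 - (a * th0 Q 0 + b * th1 Q 0) * th0 Q (Q / 2)"
    by (simp add: algebra_simps)
  then show "b = 0" using D unfolding eq by simp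
qed

text \<open>For generic \<open>(v, q)\<close> the formulas are the solution of the duality equation. The coefficients are
  recovered from values of the given functions at suitable points, which defines them as holomorphic
  functions everywhere, and the formulas extend by continuity.\<close>

theorem conditions_imp_theta_form:
  fixes E :: "fixpt \<Rightarrow> pt \<Rightarrow> complex^fixpt"
  assumes Q1: "cond_Q1 E" and Q2: "cond_Q2 E" and S: "cond_S E" and B: "cond_B E Y"
    and A: "property_A E" and Y: "holomorphic2_on Y cover_vq"
  obtains f0 f1 f2 where "theta_form E f0 f1 f2"
    "holomorphic2_on f0 cover_vq" "holomorphic2_on f1 cover_vq" "holomorphic2_on f2 cover_vq"
    "\<And>V Q. Re Q < 0 \<Longrightarrow> Y (V, Q) / (theta_scale Q)\<^sup>2 = f0 (V, Q) * th_comb (f1 (V, Q)) (f2 (V, Q)) Q V"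
proof -
  note hol = property_A_complex_diff[OF A]
  \<comment> \<open>At these points the alternating series is evaluated at \<open>q\<^bsup>1/2\<^esup>\<close>, and \<open>G0\<close> and \<open>G1\<close> are the values of
    \<open>f\<^sub>1 th0 + f\<^sub>2 th1\<close> at \<open>1\<close> and \<open>q\<^bsup>1/2\<^esup>\<close>, from which \<open>f\<^sub>1\<close> and \<open>f\<^sub>2\<close> follow by Cramer's rule.\<close>
  define f0 where "f0 = (\<lambda>x. E P11 (0, snd x / 2 - 2 * fst x, fst x, snd x) $ P11 / thA (snd x) (snd x / 2))"
  define G0 where "G0 = (\<lambda>x. E P2 (- fst x / 2 - snd x / 4, - fst x / 2 + snd x / 4, fst x, snd x) $ P11 / thA (snd x) (snd x / 2))"
  define G1 where "G1 = (\<lambda>x. E P2 (- fst x / 2, snd x / 2 - fst x / 2, fst x, snd x) $ P11 / thA (snd x) (snd x / 2))"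
  define f1 where "f1 = (\<lambda>x. (G0 x * th1 (snd x) (snd x / 2) - G1 x * th1 (snd x) 0) / (thA (snd x) (snd x / 2))\<^sup>2)"
  define f2 where "f2 = (\<lambda>x. (G1 x * th0 (snd x) 0 - G0 x * th0 (snd x) (snd x / 2)) / (thA (snd x) (snd x / 2))\<^sup>2)"
  have cd: "complex_diff J2 f0 x" "complex_diff J2 f1 x" "complex_diff J2 f2 x" if "x \<in> cover_vq" for x
  proof -
    have Q: "Re (snd x) < 0" using that by (simp add: cover_vq_eq)
    have T: "thA (snd x) (snd x / 2) \<noteq> 0" using Q by simp
    have half: "complex_diff J2 (\<lambda>x. snd x / 2) x" "complex_diff J2 (\<lambda>x. fst x / 2) x" "complex_diff J2 (\<lambda>x. snd x / 4) x"
      by (intro complex_diff_divide complex_diff_intros; simp)+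
    have n: "complex_diff J2 (\<lambda>x. - fst x / 2) x"
      by (intro complex_diff_divide complex_diff_intros; simp)
    have e: "complex_diff J2 (\<lambda>x. E \<mu> (a x, z x, fst x, snd x) $ p) x"
      if "complex_diff J2 a x" "complex_diff J2 z x" for a z \<mu> p
      by (rule complex_diff_pair4[where F = "\<lambda>y. E \<mu> y $ p", OF hol]) (use Q that in \<open>auto simp: cover_eq complex_diff_coords2\<close>)
    show "complex_diff J2 f0 x"
      unfolding f0_def by (intro complex_diff_divide e complex_diff_intros half Q T)
    have G: "complex_diff J2 G0 x" "complex_diff J2 G1 x"
      unfolding G0_def G1_def by (intro complex_diff_divide e complex_diff_intros half n Q T)+
    show "complex_diff J2 f1 x" "complex_diff J2 f2 x"
      unfolding f1_def f2_def power2_eq_square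
      by (intro complex_diff_divide complex_diff_intros half G Q; use T in simp)+
  qed
  \<comment> \<open>Where \<open>gen\<close> is not zero, the duality equation can be solved.\<close>
  define gen where "gen = (\<lambda>x. Y x * thA (snd x) (2 * fst x) * thA (snd x) (4 * fst x))"
  have solution: "(\<forall>A Z. E P2 (A, Z, V, Q) $ P2 = th_comb (f1 (V, Q)) (f2 (V, Q)) Q (V + Z - A) * thA Q (Z + A) \<and>
      E P2 (A, Z, V, Q) $ P11 = th_comb (f1 (V, Q)) (f2 (V, Q)) Q (V + Z + A) * thA Q (Z - A) \<and>
      E P11 (A, Z, V, Q) $ P2 = f0 (V, Q) * thA Q (Z + 2 * V - A) \<and>
      E P11 (A, Z, V, Q) $ P11 = f0 (V, Q) * thA Q (Z + 2 * V + A)) \<and>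
      Y (V, Q) / (theta_scale Q)\<^sup>2 = f0 (V, Q) * th_comb (f1 (V, Q)) (f2 (V, Q)) Q V"
    if Q: "Re Q < 0" and g: "gen (V, Q) \<noteq> 0" for V Q
  proof -
    have h: "(\<lambda>u. E \<mu> (a + b * u, c + d * u, V, Q) $ p) holomorphic_on UNIV" for \<mu> p a b c d
      unfolding holomorphic_on_def complex_diff_field_iff[symmetric]
    proof
      fix u
      have id: "complex_diff ((*) \<i>) (\<lambda>t. t) u"
        by (rule complex_diff_linear[OF bounded_linear_ident]) simp
      show "complex_diff ((*) \<i>) (\<lambda>u. E \<mu> (a + b * u, c + d * u, V, Q) $ p) u"
        by (rule complex_diff_pair4[where F = "\<lambda>y. E \<mu> y $ p", OF hol]; (intro complex_diff_intros id)?; use Q in \<open>simp add: cover_iff\<close>)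
    qed
    have nz: "Y (V, Q) / (theta_scale Q)\<^sup>2 \<noteq> 0" "thA Q (2 * V) \<noteq> 0" "thA Q (4 * V) \<noteq> 0"
      using g theta_scale_nonzero[OF Q] by (auto simp: gen_def)
    obtain F0 F1 F2 where F: "\<And>A Z. E P2 (A, Z, V, Q) $ P2 = th_comb F1 F2 Q (V + Z - A) * thA Q (Z + A)"
      "\<And>A Z. E P2 (A, Z, V, Q) $ P11 = th_comb F1 F2 Q (V + Z + A) * thA Q (Z - A)"
      "\<And>A Z. E P11 (A, Z, V, Q) $ P2 = F0 * thA Q (Z + 2 * V - A)"
      "\<And>A Z. E P11 (A, Z, V, Q) $ P11 = F0 * thA Q (Z + 2 * V + A)"
      "Y (V, Q) / (theta_scale Q)\<^sup>2 = F0 * th_comb F1 F2 Q V"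
      using duality_solution[OF Q h h h h cond_S_period[OF S Q] cond_S_period[OF S Q] cond_S_period[OF S Q] cond_S_period[OF S Q]
        cond_Q_shift[OF Q1 Q2 Q] cond_BD[OF B hol Y Q] nz] by blast
    have T: "thA Q (Q / 2) \<noteq> 0" using Q by simp
    have F0: "f0 (V, Q) = F0" using T by (simp add: f0_def F)
    have G: "G0 (V, Q) = th_comb F1 F2 Q 0" "G1 (V, Q) = th_comb F1 F2 Q (Q / 2)"
      using T by (simp_all add: G0_def G1_def F field_simps)
    have "F1 * (thA Q (Q / 2))\<^sup>2 = G0 (V, Q) * th1 Q (Q / 2) - G1 (V, Q) * th1 Q 0"
      "F2 * (thA Q (Q / 2))\<^sup>2 = G1 (V, Q) * th0 Q 0 - G0 (V, Q) * th0 Q (Q / 2)"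
      unfolding th_determinant[OF Q, symmetric] G th_comb_def by (simp_all add: algebra_simps)
    then have F12: "f1 (V, Q) = F1" "f2 (V, Q) = F2"
      using T by (simp_all add: f1_def f2_def field_simps)
    show ?thesis unfolding F0 F12 using F by simp
  qed
  have gen_cd: "complex_diff J2 gen x" if "x \<in> cover_vq" for x
    unfolding gen_def
    by (intro complex_diff_intros) (use bspec[OF Y[unfolded holomorphic2_on_iff] that] that in \<open>auto simp: cover_vq_eq\<close>)
  obtain q0 where q0: "Re q0 < - 5" "Y (- 1, q0) \<noteq> 0"
    using Y_not_identically_zero[OF A B Y] by blast
  \<comment> \<open>For \<open>v = e\<^bsup>- 1\<^esup>\<close> and \<open>\<bar>q\<bar> < e\<^bsup>- 5\<^esup>\<close> the numbers \<open>v\<^sup>2\<close> and \<open>v\<^sup>4\<close> are strictly between \<open>q\<close> and \<open>1\<close> in absolute value.\<close>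
  have "thA q0 (- 2) \<noteq> 0" "thA q0 (- 4) \<noteq> 0"
    by (rule thA_nonzero_Re; use q0 in simp)+
  then have "gen (- 1, q0) \<noteq> 0" using q0 by (simp add: gen_def)
  then have dense: "cover_vq \<subseteq> closure {x \<in> cover_vq. gen x \<noteq> 0}"
    using q0 by (intro nonzero_dense[OF gen_cd, of "(- 1, q0)"]) (auto simp: cover_vq_iff)
  have extend: "L x = R x"
    if "x \<in> cover_vq" "complex_diff J2 L x" "complex_diff J2 R x" "\<And>x. x \<in> cover_vq \<Longrightarrow> gen x \<noteq> 0 \<Longrightarrow> L x = R x" for L R x
    by (rule continuous_eq_on_dense[OF dense that(1) complex_diff_imp_isCont complex_diff_imp_isCont, OF that(2,3)])
       (use that(4) in auto)
  have all: "E P2 (A, Z, V, Q) $ P2 = th_comb (f1 (V, Q)) (f2 (V, Q)) Q (V + Z - A) * thA Q (Z + A)"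
      "E P2 (A, Z, V, Q) $ P11 = th_comb (f1 (V, Q)) (f2 (V, Q)) Q (V + Z + A) * thA Q (Z - A)"
      "E P11 (A, Z, V, Q) $ P2 = f0 (V, Q) * thA Q (Z + 2 * V - A)"
      "E P11 (A, Z, V, Q) $ P11 = f0 (V, Q) * thA Q (Z + 2 * V + A)" if Q: "Re Q < 0" for A Z V Q
  proof -
    have x: "(V, Q) \<in> cover_vq" using Q by (simp add: cover_vq_iff)
    have e: "complex_diff J2 (\<lambda>x. E \<mu> (A, Z, fst x, snd x) $ p) (V, Q)" for \<mu> p
      by (rule complex_diff_pair4[where F = "\<lambda>y. E \<mu> y $ p", OF hol]; (intro complex_diff_intros)?; use Q in \<open>simp add: cover_iff\<close>)
    note ci = complex_diff_intros cd[OF x]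
    show "E P2 (A, Z, V, Q) $ P2 = th_comb (f1 (V, Q)) (f2 (V, Q)) Q (V + Z - A) * thA Q (Z + A)"
      using extend[OF x e, of "\<lambda>x. (f1 x * th0 (snd x) (fst x + Z - A) + f2 x * th1 (snd x) (fst x + Z - A)) * thA (snd x) (Z + A)" P2 P2]
        solution Q by (force simp: cover_vq_iff th_comb_def intro!: ci)
    show "E P2 (A, Z, V, Q) $ P11 = th_comb (f1 (V, Q)) (f2 (V, Q)) Q (V + Z + A) * thA Q (Z - A)"
      using extend[OF x e, of "\<lambda>x. (f1 x * th0 (snd x) (fst x + Z + A) + f2 x * th1 (snd x) (fst x + Z + A)) * thA (snd x) (Z - A)" P2 P11]
        solution Q by (force simp: cover_vq_iff th_comb_def intro!: ci)
    show "E P11 (A, Z, V, Q) $ P2 = f0 (V, Q) * thA Q (Z + 2 * V - A)"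
      using extend[OF x e, of "\<lambda>x. f0 x * thA (snd x) (Z + 2 * fst x - A)" P11 P2]
        solution Q by (force simp: cover_vq_iff intro!: ci)
    show "E P11 (A, Z, V, Q) $ P11 = f0 (V, Q) * thA Q (Z + 2 * V + A)"
      using extend[OF x e, of "\<lambda>x. f0 x * thA (snd x) (Z + 2 * fst x + A)" P11 P11]
        solution Q by (force simp: cover_vq_iff intro!: ci)
  qed
  have Yall: "Y (V, Q) / (theta_scale Q)\<^sup>2 = f0 (V, Q) * th_comb (f1 (V, Q)) (f2 (V, Q)) Q V" if Q: "Re Q < 0" for V Q
  proof -
    have x: "(V, Q) \<in> cover_vq" using Q by (simp add: cover_vq_iff)
    have "isCont Y (V, Q)"
      using Y x by (intro complex_diff_imp_isCont[of J2]) (simp add: holomorphic2_on_iff)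
    moreover have "isCont (\<lambda>x :: complex \<times> complex. theta_scale (snd x)) (V, Q)"
      by (rule isCont_o2[where g = theta_scale and f = snd]) (use isCont_theta_scale[OF Q] in \<open>auto intro!: continuous_intros\<close>)
    ultimately have 1: "isCont (\<lambda>x. Y x / (theta_scale (snd x))\<^sup>2) (V, Q)"
      using theta_scale_nonzero[OF Q] by (intro continuous_intros) auto
    have 2: "isCont (\<lambda>x. f0 x * (f1 x * th0 (snd x) (fst x) + f2 x * th1 (snd x) (fst x))) (V, Q)"
      by (intro complex_diff_imp_isCont[of J2] complex_diff_intros cd[OF x]) (use Q in auto)
    have "Y (V, Q) / (theta_scale (snd (V, Q)))\<^sup>2 = f0 (V, Q) * (f1 (V, Q) * th0 (snd (V, Q)) (fst (V, Q)) + f2 (V, Q) * th1 (snd (V, Q)) (fst (V, Q)))"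
      by (rule continuous_eq_on_dense[OF dense x 1 2]) (use solution in \<open>auto simp: cover_vq_iff th_comb_def\<close>)
    then show ?thesis by (simp add: th_comb_def)
  qed
  show ?thesis
  proof (rule that[of f0 f1 f2])
    show "theta_form E f0 f1 f2"
      unfolding theta_form_def by (intro allI impI conjI vec2_eqI all)
    show "holomorphic2_on f0 cover_vq" "holomorphic2_on f1 cover_vq" "holomorphic2_on f2 cover_vq"
      using cd by (simp_all add: holomorphic2_on_iff)
  qed (rule Yall)
qed

section \<open>The asymptotics of the coefficients\<close>

text \<open>The condition of single-valuedness in an admissible coefficient, apart from holomorphy, since the two are
  established at different places.\<close>

definition sv_scaled :: "(complex \<times> complex \<Rightarrow> complex) \<Rightarrow> real \<Rightarrow> bool" where
  "sv_scaled f c \<longleftrightarrow> (\<forall>V V' Q Q'. Re Q < 0 \<longrightarrow> Re Q' < 0 \<longrightarrow> exp V = exp V' \<longrightarrow> exp (Q / 2) = exp (Q' / 2) \<longrightarrow>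
    exp (- of_real c * Q) * f (V, Q) = exp (- of_real c * Q') * f (V', Q'))"

lemma admissible_coeff_iff: "admissible_coeff f c \<longleftrightarrow> holomorphic2_on f cover_vq \<and> sv_scaled f c"
  unfolding admissible_coeff_def single_valued_via_def sv_scaled_def proj_v_double_def lpow_def
  by (auto simp: cover_vq_def)

lemma sv_scaled_shift:
  assumes f: "sv_scaled f c" and k: "c' = c + of_int k / 2"
  shows "sv_scaled f c'"
  unfolding sv_scaled_def
proof (intro allI impI)
  fix V V' Q Q' :: complex
  assume Q: "Re Q < 0" "Re Q' < 0" and e: "exp V = exp V'" "exp (Q / 2) = exp (Q' / 2)"
  have *: "exp (- of_real c' * Q) * x = exp (Q / 2) powi (- k) * (exp (- of_real c * Q) * x)" for Q x :: complex
  proof -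
    have "exp (Q / 2) powi (- k) = exp (of_int (- k) * (Q / 2))" by (rule exp_power_int)
    then have "exp (Q / 2) powi (- k) * exp (- of_real c * Q) = exp (of_int (- k) * (Q / 2) + - of_real c * Q)"
      by (simp only: exp_add)
    also have "of_int (- k) * (Q / 2) + - of_real c * Q = - of_real c' * Q"
      unfolding k by (simp add: field_simps)
    finally show ?thesis by (simp flip: mult.assoc)
  qed
  have "exp (- of_real c * Q) * f (V, Q) = exp (- of_real c * Q') * f (V', Q')"
    using f Q e unfolding sv_scaled_def by blast
  then show "exp (- of_real c' * Q) * f (V, Q) = exp (- of_real c' * Q') * f (V', Q')"
    unfolding * e(2) by (rule arg_cong)
qed

lemma filterlim_q_to_0_shift: "filterlim (\<lambda>Q. Q + of_real t * \<i>) q_to_0 q_to_0"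
  unfolding filterlim_iff eventually_q_to_0
proof (intro allI impI, elim exE)
  fix P B assume "\<forall>Q. Re Q \<le> B \<longrightarrow> P Q"
  then show "\<exists>B. \<forall>Q. Re Q \<le> B \<longrightarrow> P (Q + of_real t * \<i>)"
    by (intro exI[of _ B]) simp
qed

text \<open>A nonzero limit of \<open>q\<^bsup>- c'\<^esup> f\<close> determines \<open>c'\<close> up to half-integers: going once around the double cover
  multiplies the function by a constant, which has to be \<open>1\<close>.\<close>

lemma sv_scaled_limit_exponent:
  assumes f: "sv_scaled f c" and lim: "((\<lambda>Q. exp (- of_real c' * Q) * f (V, Q)) \<longlongrightarrow> L) q_to_0" and L: "L \<noteq> 0"
  shows "\<exists>k. c' = c + of_int k / 2"
proof -
  define a where "a = (\<lambda>Q. exp (- of_real c' * Q) * f (V, Q))"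
  define \<omega> where "\<omega> = exp (of_real ((c - c') * (4 * pi)) * \<i>)"
  have step: "\<omega> * a Q = a (Q + of_real (4 * pi) * \<i>)" if "Re Q < 0" for Q
  proof -
    have "exp ((Q + of_real (4 * pi) * \<i>) / 2) = exp (Q / 2)"
      unfolding exp_eq by (rule exI[of _ 1]) (simp add: field_simps)
    then have "exp (- of_real c * (Q + of_real (4 * pi) * \<i>)) * f (V, Q + of_real (4 * pi) * \<i>) = exp (- of_real c * Q) * f (V, Q)"
      by (intro f[unfolded sv_scaled_def, rule_format]) (use that in simp_all)
    then have "exp (of_real (c - c') * (Q + of_real (4 * pi) * \<i>)) * (exp (- of_real c * (Q + of_real (4 * pi) * \<i>)) * f (V, Q + of_real (4 * pi) * \<i>))
      = exp (of_real (c - c') * (Q + of_real (4 * pi) * \<i>)) * (exp (- of_real c * Q) * f (V, Q))" by (rule arg_cong)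
    moreover have "exp (of_real (c - c') * (Q + of_real (4 * pi) * \<i>)) * exp (- of_real c * (Q + of_real (4 * pi) * \<i>))
        = exp (- of_real c' * (Q + of_real (4 * pi) * \<i>))"
      "exp (of_real (c - c') * (Q + of_real (4 * pi) * \<i>)) * exp (- of_real c * Q) = \<omega> * exp (- of_real c' * Q)"
      unfolding \<omega>_def exp_add[symmetric] by (rule arg_cong[of _ _ exp], simp add: algebra_simps)+
    ultimately show ?thesis unfolding a_def by (simp only: mult.assoc[symmetric])
  qed
  have "((\<lambda>Q. \<omega> * a Q) \<longlongrightarrow> \<omega> * L) q_to_0"
    unfolding a_def by (intro tendsto_intros lim)
  moreover have "((\<lambda>Q. \<omega> * a Q) \<longlongrightarrow> L) q_to_0"
  proof (rule Lim_transform_eventually)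
    show "((\<lambda>Q. a (Q + of_real (4 * pi) * \<i>)) \<longlongrightarrow> L) q_to_0"
      using filterlim_compose[OF lim filterlim_q_to_0_shift[of "4 * pi"]] by (simp add: a_def)
    show "\<forall>\<^sub>F Q in q_to_0. a (Q + of_real (4 * pi) * \<i>) = \<omega> * a Q"
      using eventually_Re_neg by eventually_elim (simp only: step)
  qed
  ultimately have "\<omega> * L = L" by (rule tendsto_unique[OF q_to_0_neq_bot])
  then have "\<omega> = 1" using L by simp
  then obtain n :: int where "(c - c') * (4 * pi) = of_int (2 * n) * pi"
    unfolding \<omega>_def exp_eq_1 by auto
  then have "pi * (4 * (c - c')) = pi * of_int (2 * n)" by (simp add: mult_ac)
  then have "4 * (c - c') = of_int (2 * n)" unfolding mult_cancel_left by simp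
  then have "c' = c + of_int (- n) / 2" by (simp add: field_simps)
  then show ?thesis by blast
qed

text \<open>As a function of \<open>q\<^bsup>1/2\<^esup>\<close>, a single-valued function with a limit at \<open>0\<close> has a removable singularity there,
  and the difference quotient is bounded.\<close>

lemma single_valued_limit_bigo:
  assumes sv: "\<And>Q Q'. Re Q < 0 \<Longrightarrow> Re Q' < 0 \<Longrightarrow> exp (Q / 2) = exp (Q' / 2) \<Longrightarrow> \<psi> Q = \<psi> Q'"
    and hol: "\<And>Q. Re Q < 0 \<Longrightarrow> \<psi> field_differentiable at Q"
    and lim: "(\<psi> \<longlongrightarrow> L) q_to_0"
  shows "(\<lambda>Q. \<psi> Q - L) \<in> O[q_to_0](\<lambda>Q. lpow Q (1 / 2))"
proof -
  define \<Phi> where "\<Phi> = (\<lambda>w. if w = 0 then L else \<psi> (2 * Ln w))"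
  have ReLn: "Re (2 * Ln w) < 0" if "w \<noteq> 0" "norm w < 1" for w
    using that by (simp add: ln_less_zero)
  have fd: "\<Phi> field_differentiable at w0" if w0: "w0 \<noteq> 0" "norm w0 < 1" for w0
  proof -
    define S where "S = {w. norm w < 1} \<inter> ((\<lambda>w. w / w0) -` (- \<real>\<^sub>\<le>\<^sub>0))"
    have "open S"
    proof -
      have "open {w :: complex. norm w < 1}"
        by (intro open_Collect_less continuous_intros)
      moreover have "open ((\<lambda>w. w / w0) -` (- \<real>\<^sub>\<le>\<^sub>0))"
        by (rule open_vimage) (use w0 in \<open>auto intro!: continuous_intros open_Compl closed_nonpos_Reals_complex\<close>)
      ultimately show ?thesis unfolding S_def by (rule open_Int)
    qed
    have "w0 \<in> S" using w0 by (simp add: S_def)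
    \<comment> \<open>A branch of \<open>2 ln w\<close> near \<open>w0\<close>.\<close>
    define l where "l = (\<lambda>w. 2 * (Ln w0 + Ln (w / w0)))"
    have l: "exp (l w / 2) = w" if "w \<in> S" for w
    proof -
      have "w \<noteq> 0" using that w0 by (auto simp: S_def)
      then have "exp (Ln w0 + Ln (w / w0)) = w" using w0 by (simp add: exp_add)
      moreover have "l w / 2 = Ln w0 + Ln (w / w0)" unfolding l_def by simp
      ultimately show ?thesis by (simp only:)
    qed
    have lneg: "Re (l w) < 0" if "w \<in> S" for w
    proof -
      have "exp (Re (l w) / 2) = norm w" using l[OF that] norm_exp_eq_Re[of "l w / 2"] by simp
      then have "exp (Re (l w) / 2) < 1" using that by (simp add: S_def)
      then show ?thesis by simp
    qed
    have eq: "\<Phi> w = \<psi> (l w)" if "w \<in> S" for w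
    proof -
      have w: "w \<noteq> 0" "norm w < 1" using that w0 by (auto simp: S_def)
      have "\<psi> (2 * Ln w) = \<psi> (l w)"
        by (rule sv[OF ReLn[OF w] lneg[OF that]]) (use w in \<open>simp add: l[OF that]\<close>)
      then show ?thesis using w by (simp add: \<Phi>_def)
    qed
    have "l field_differentiable at w0"
    proof -
      have "(l has_field_derivative 2 * (0 + inverse (w0 / w0) * (1 / w0))) (at w0)"
        unfolding l_def using w0 by (auto intro!: derivative_eq_intros)
      then show ?thesis by (auto simp: field_differentiable_def)
    qed
    then have "(\<psi> \<circ> l) field_differentiable at w0"
      by (intro field_differentiable_compose hol lneg \<open>w0 \<in> S\<close>)
    then show ?thesis
      by (rule field_differentiable_transform_open[OF _ \<open>open S\<close> \<open>w0 \<in> S\<close>]) (simp add: eq)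
  qed
  have lim0: "(\<Phi> \<longlongrightarrow> L) (at 0)"
    unfolding tendsto_def
  proof (intro allI impI)
    fix U assume U: "open U" "L \<in> U"
    then have "eventually (\<lambda>Q. \<psi> Q \<in> U) q_to_0" using lim by (simp add: tendsto_def)
    then obtain B where B: "\<And>Q. Re Q \<le> B \<Longrightarrow> \<psi> Q \<in> U" unfolding eventually_q_to_0 by blast
    show "eventually (\<lambda>w. \<Phi> w \<in> U) (at 0)"
      unfolding eventually_at
    proof (intro exI[of _ "exp (B / 2)"] conjI ballI impI)
      fix w :: complex assume w: "w \<noteq> 0 \<and> dist w 0 < exp (B / 2)"
      then have "ln (norm w) < ln (exp (B / 2))" by (subst ln_less_cancel_iff) auto
      then show "\<Phi> w \<in> U" using w by (auto simp: \<Phi>_def intro!: B)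
    qed simp
  qed
  have "\<Phi> holomorphic_on ball 0 1"
  proof (rule no_isolated_singularity[of _ _ "{0}"])
    show "continuous_on (ball 0 1) \<Phi>"
    proof (rule continuous_at_imp_continuous_on, rule ballI)
      fix w :: complex assume w: "w \<in> ball 0 1"
      show "isCont \<Phi> w"
      proof (cases "w = 0")
        case True
        then show ?thesis using lim0 by (simp add: isCont_def \<Phi>_def)
      next
        case False
        then show ?thesis using w by (intro field_differentiable_imp_continuous_at fd) auto
      qed
    qed
    show "\<Phi> holomorphic_on ball 0 1 - {0}"
      unfolding holomorphic_on_def by (rule ballI, rule field_differentiable_at_within, rule fd) auto
  qed auto
  then have "\<Phi> field_differentiable at 0"
    by (rule holomorphic_on_imp_differentiable_at) auto
  then obtain d where "(\<Phi> has_field_derivative d) (at 0)" by (auto simp: field_differentiable_def)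
  then have "((\<lambda>w. (\<Phi> w - \<Phi> 0) / (w - 0)) \<longlongrightarrow> d) (at 0)" by (simp add: has_field_derivative_iff)
  then have "((\<lambda>w. norm ((\<Phi> w - \<Phi> 0) / (w - 0))) \<longlongrightarrow> norm d) (at 0)" by (rule tendsto_norm)
  then have "eventually (\<lambda>w. norm ((\<Phi> w - \<Phi> 0) / (w - 0)) < norm d + 1) (at 0)"
    by (rule order_tendstoD(2)) simp
  then obtain \<delta> where \<delta>': "\<delta> > 0" "\<forall>w\<in>UNIV. w \<noteq> 0 \<and> dist w 0 < \<delta> \<longrightarrow> norm ((\<Phi> w - \<Phi> 0) / (w - 0)) < norm d + 1"
    unfolding eventually_at by blast
  have \<delta>: "\<delta> > 0" "\<And>w. w \<noteq> 0 \<Longrightarrow> norm w < \<delta> \<Longrightarrow> norm ((\<Phi> w - \<Phi> 0) / w) < norm d + 1"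
    using \<delta>' by (simp_all only: dist_norm diff_zero UNIV_I simp_thms)
  show ?thesis
  proof (rule landau_o.bigI[of "norm d + 1"])
    show "norm d + 1 > 0" by (simp add: add_nonneg_pos)
    show "\<forall>\<^sub>F Q in q_to_0. norm (\<psi> Q - L) \<le> (norm d + 1) * norm (lpow Q (1 / 2))"
      unfolding eventually_q_to_0
    proof (intro exI[of _ "min (- 1) (2 * ln (\<delta> / 2))"] allI impI)
      fix Q :: complex assume Q: "Re Q \<le> min (- 1) (2 * ln (\<delta> / 2))"
      define w where "w = exp (Q / 2)"
      have w: "w \<noteq> 0" by (simp add: w_def)
      have "norm w \<le> exp (ln (\<delta> / 2))" using Q unfolding w_def norm_exp_eq_Re exp_le_cancel_iff by simp
      then have wd: "norm w < \<delta>" using \<delta>(1) by simp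
      have w1: "norm w < 1" using Q by (simp add: w_def)
      have "\<psi> (2 * Ln w) = \<psi> Q"
        by (rule sv[OF ReLn[OF w w1]]) (use Q w in \<open>auto simp: w_def\<close>)
      then have "\<psi> Q - L = \<Phi> w - \<Phi> 0" using w by (simp add: \<Phi>_def)
      moreover have "norm (\<Phi> w - \<Phi> 0) \<le> (norm d + 1) * norm w"
        using less_imp_le[OF \<delta>(2)[OF w wd]] w by (simp add: norm_divide divide_simps)
      moreover have "lpow Q (1 / 2) = w" by (simp add: lpow_def w_def)
      ultimately show "norm (\<psi> Q - L) \<le> (norm d + 1) * norm (lpow Q (1 / 2))" by simp
    qed
  qed
qed

lemma sv_scaled_bigo:
  assumes f: "sv_scaled f c" "holomorphic2_on f cover_vq"
    and lim: "((\<lambda>Q. exp (- of_real c * Q) * f (V, Q)) \<longlongrightarrow> L) q_to_0"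
  shows "(\<lambda>Q. exp (- of_real c * Q) * f (V, Q) - L) \<in> O[q_to_0](\<lambda>Q. lpow Q (1 / 2))"
proof (rule single_valued_limit_bigo[OF _ _ lim])
  fix Q Q' :: complex assume Q: "Re Q < 0" "Re Q' < 0" "exp (Q / 2) = exp (Q' / 2)"
  then show "exp (- of_real c * Q) * f (V, Q) = exp (- of_real c * Q') * f (V, Q')"
    using f(1) unfolding sv_scaled_def by blast
next
  fix Q :: complex assume Q: "Re Q < 0"
  have id: "complex_diff ((*) \<i>) (\<lambda>Q. Q) Q"
    by (rule complex_diff_linear[OF bounded_linear_ident]) simp
  show "(\<lambda>Q. exp (- of_real c * Q) * f (V, Q)) field_differentiable at Q"
    unfolding complex_diff_field_iff[symmetric]
    by (intro complex_diff_intros id complex_diff_vq[OF f(2)] Q)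
qed

text \<open>Cramer's rule.\<close>

lemma two_by_two_limit:
  fixes a b u w u' w' :: "'x \<Rightarrow> complex"
  assumes "((\<lambda>x. a x * u x + b x * w x) \<longlongrightarrow> l) F" "((\<lambda>x. a x * u' x + b x * w' x) \<longlongrightarrow> l') F"
    and u: "(u \<longlongrightarrow> U) F" "(w \<longlongrightarrow> R) F" "(u' \<longlongrightarrow> U') F" "(w' \<longlongrightarrow> R') F"
    and d: "U * R' - U' * R \<noteq> 0"
  shows "(a \<longlongrightarrow> (l * R' - l' * R) / (U * R' - U' * R)) F"
    "(b \<longlongrightarrow> (U * l' - U' * l) / (U * R' - U' * R)) F"
proof -
  have det: "((\<lambda>x. u x * w' x - u' x * w x) \<longlongrightarrow> U * R' - U' * R) F"
    by (intro tendsto_intros u)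
  have nz: "eventually (\<lambda>x. u x * w' x - u' x * w x \<noteq> 0) F"
    by (rule tendsto_imp_eventually_ne[OF det d])
  show "(a \<longlongrightarrow> (l * R' - l' * R) / (U * R' - U' * R)) F"
  proof (rule Lim_transform_eventually)
    show "((\<lambda>x. ((a x * u x + b x * w x) * w' x - (a x * u' x + b x * w' x) * w x) / (u x * w' x - u' x * w x))
        \<longlongrightarrow> (l * R' - l' * R) / (U * R' - U' * R)) F"
      by (intro tendsto_intros assms det)
    show "\<forall>\<^sub>F x in F. ((a x * u x + b x * w x) * w' x - (a x * u' x + b x * w' x) * w x) / (u x * w' x - u' x * w x) = a x"
      using nz by eventually_elim (simp add: divide_eq_eq, simp add: algebra_simps)
  qed
  show "(b \<longlongrightarrow> (U * l' - U' * l) / (U * R' - U' * R)) F"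
  proof (rule Lim_transform_eventually)
    show "((\<lambda>x. (u x * (a x * u' x + b x * w' x) - u' x * (a x * u x + b x * w x)) / (u x * w' x - u' x * w x))
        \<longlongrightarrow> (U * l' - U' * l) / (U * R' - U' * R)) F"
      by (intro tendsto_intros assms det)
    show "\<forall>\<^sub>F x in F. (u x * (a x * u' x + b x * w' x) - u' x * (a x * u x + b x * w x)) / (u x * w' x - u' x * w x) = b x"
      using nz by eventually_elim (simp add: divide_eq_eq, simp add: algebra_simps)
  qed
qed

text \<open>The number \<open>1/4\<close> has the same distance from \<open>0\<close> and from \<open>1/2\<close>, so at this slope the powers of \<open>q\<close> in front of
  the three series cancel.\<close>

lemma theta_limits_quarter:
  "((\<lambda>Q. thA Q (X - of_real (1 / 4) * Q)) \<longlongrightarrow> exp (X / 2)) q_to_0"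
  "((\<lambda>Q. th0 Q (X - of_real (1 / 4) * Q)) \<longlongrightarrow> 1) q_to_0"
  "((\<lambda>Q. th1 Q (X - of_real (1 / 4) * Q)) \<longlongrightarrow> exp X) q_to_0"
proof -
  show "((\<lambda>Q. thA Q (X - of_real (1 / 4) * Q)) \<longlongrightarrow> exp (X / 2)) q_to_0"
    using thA_limit_open[of 0 "1 / 4" X] by (simp add: power2_eq_square)
  show "((\<lambda>Q. th0 Q (X - of_real (1 / 4) * Q)) \<longlongrightarrow> 1) q_to_0"
    using th0_limit_open[of "1 / 4" 0 X] by (simp add: power2_eq_square)
  have x: "\<bar>- (1 / 4) - real_of_int 0\<bar> < 1 / 2" by simp
  have e: "real_of_int n + 1 / 2 - 1 / 4 = of_int n - (- (1 / 4))" for n by simp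
  have "((\<lambda>Q. exp (of_real (1 * ((1 / 4)\<^sup>2 - (of_int 0 - (- (1 / 4)))\<^sup>2)) * Q) * jtheta 1 1 (1 / 2) Q (X - of_real (1 / 4) * Q))
    \<longlongrightarrow> (\<Sum>n\<in>{0}. 1 powi n * exp (2 * of_real 1 * of_real (of_int n + 1 / 2) * X))) q_to_0"
    by (rule jtheta_limit) (use int_nearest[OF x] in \<open>auto simp: e\<close>)
  then show "((\<lambda>Q. th1 Q (X - of_real (1 / 4) * Q)) \<longlongrightarrow> exp X) q_to_0"
    by (simp add: th1_def)
qed

lemma theta_limits_half:
  "((\<lambda>Q. exp (Q / 8) * thA Q (X - of_real (1 / 2) * Q)) \<longlongrightarrow> exp (X / 2)) q_to_0"
  "((\<lambda>Q. th0 Q (X - of_real (1 / 2) * Q)) \<longlongrightarrow> 1 + exp (2 * X)) q_to_0"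
  "((\<lambda>Q. exp (Q / 4) * th1 Q (X - of_real (1 / 2) * Q)) \<longlongrightarrow> exp X) q_to_0"
proof -
  show "((\<lambda>Q. exp (Q / 8) * thA Q (X - of_real (1 / 2) * Q)) \<longlongrightarrow> exp (X / 2)) q_to_0"
    using thA_limit_open[of 0 "1 / 2" X] by (simp add: power2_eq_square)
  show "((\<lambda>Q. th0 Q (X - of_real (1 / 2) * Q)) \<longlongrightarrow> 1 + exp (2 * X)) q_to_0"
    using th0_limit_half[of "1 / 2" 0 X] by (simp add: power2_eq_square)
  have x: "\<bar>0 - real_of_int 0\<bar> < 1 / 2" by simp
  have e: "real_of_int n + 1 / 2 - 1 / 2 = of_int n - 0" for n by simp
  have "((\<lambda>Q. exp (of_real (1 * ((1 / 2)\<^sup>2 - (of_int 0 - 0)\<^sup>2)) * Q) * jtheta 1 1 (1 / 2) Q (X - of_real (1 / 2) * Q))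
    \<longlongrightarrow> (\<Sum>n\<in>{0}. 1 powi n * exp (2 * of_real 1 * of_real (of_int n + 1 / 2) * X))) q_to_0"
    by (rule jtheta_limit) (use int_nearest[OF x] in \<open>auto simp: e\<close>)
  then show "((\<lambda>Q. exp (Q / 4) * th1 Q (X - of_real (1 / 2) * Q)) \<longlongrightarrow> exp X) q_to_0"
    by (simp add: th1_def power2_eq_square)
qed

lemma exp_mult_exp_mult: "a + b = c \<Longrightarrow> exp a * (exp b * x) = exp c * (x :: complex)"
  unfolding mult.assoc[symmetric] exp_add[symmetric] by simp

lemma asymp_unitI:
  assumes "\<And>V. ((\<lambda>Q. exp (- of_real c * Q) * f (V, Q)) \<longlongrightarrow> 1) q_to_0" "sv_scaled f c" "holomorphic2_on f cover_vq"
  shows "asymp_unit f c"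
  unfolding asymp_unit_def using sv_scaled_bigo[OF assms(2,3,1)] by (simp add: lpow_def)

text \<open>The exponent \<open>r\<close> of Property A makes \<open>f\<^sub>0\<close> single-valued in \<open>q\<^bsup>1/2\<^esup>\<close> up to a rational power of \<open>q\<close>, and the limit
  at slope \<open>1/4\<close> is its leading term. The two exponents differ by a half-integer, so the second one is
  rational too.\<close>

lemma coefficient_f0:
  fixes E :: "fixpt \<Rightarrow> pt \<Rightarrow> complex^fixpt"
  assumes form: "theta_form E f0 f1 f2" and A: "property_A E" and N2: "cond_N2 E"
    and hol: "holomorphic2_on f0 cover_vq"
  obtains c0 where "c0 \<in> \<rat>" "admissible_coeff f0 c0" "asymp_unit f0 c0"
proof -
  obtain \<alpha> \<beta> r where r: "r \<in> \<rat>" and sv: "single_valued_via proj_HKS_double cover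
      (\<lambda>(A, Z, V, Q). ((lpow Q (- r) * lpow A (- \<alpha>) * lpow Z (- \<beta>)) *s (sqrt_L_minus A V * E P11 (A, Z, V, Q))) $ P11)"
    by (rule property_AE[OF A, of P11]) blast
  define \<rho> where "\<rho> = r - 1 / 8"
  have sv0: "sv_scaled f0 \<rho>"
    unfolding sv_scaled_def
  proof (intro allI impI)
    fix V V' Q Q' :: complex
    assume Q: "Re Q < 0" "Re Q' < 0" and e: "exp V = exp V'" "exp (Q / 2) = exp (Q' / 2)"
    \<comment> \<open>At \<open>a = 1\<close> and \<open>z = q\<^bsup>1/2\<^esup> v\<^bsup>- 2\<^esup>\<close> the alternating series is evaluated at \<open>q\<^bsup>1/2\<^esup>\<close>, where it is not zero.\<close>
    define Z where "Z = Q / 2 - 2 * V"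
    have val: "((lpow Q (- r) * lpow 0 (- \<alpha>) * lpow Z (- \<beta>)) *s (sqrt_L_minus 0 V * E P11 (0, Z, V, Q))) $ P11
        = exp (- of_real \<beta> * Z + Z / 2) * ((exp (- of_real \<rho> * Q) * f0 (V, Q)) * thA_red Q (Z + 2 * V))"
      if "Re Q < 0" for Q V
    proof -
      have "lpow Q (- r) * lpow Z (- \<beta>) * exp (- V) * exp (Q / 8 + (Z + 2 * V) / 2)
          = exp (- of_real \<beta> * Z + Z / 2) * exp (- of_real \<rho> * Q)"
        unfolding lpow_def \<rho>_def exp_add[symmetric] by (rule arg_cong[of _ _ exp]) (simp add: field_simps)
      then have "lpow Q (- r) * lpow Z (- \<beta>) * exp (- V) * exp (Q / 8 + (Z + 2 * V) / 2) * (f0 (V, Q) * thA_red Q (Z + 2 * V))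
          = exp (- of_real \<beta> * Z + Z / 2) * exp (- of_real \<rho> * Q) * (f0 (V, Q) * thA_red Q (Z + 2 * V))"
        by (simp only:)
      then have "lpow Q (- r) * lpow 0 (- \<alpha>) * lpow Z (- \<beta>) * (exp (- V) * (f0 (V, Q) * (exp (Q / 8 + (Z + 2 * V) / 2) * thA_red Q (Z + 2 * V))))
          = exp (- of_real \<beta> * Z + Z / 2) * ((exp (- of_real \<rho> * Q) * f0 (V, Q)) * thA_red Q (Z + 2 * V))"
        by (simp only: mult_ac lpow_def[of 0] mult_zero_left mult_zero_right exp_zero mult_1)
      then show ?thesis
        using theta_form_nth(4)[OF form that, of 0 Z V] thA_red_eq[of Q "Z + 2 * V"] by simp
    qed
    have "exp (- of_real \<beta> * Z + Z / 2) * ((exp (- of_real \<rho> * Q) * f0 (V, Q)) * thA_red Q (Z + 2 * V))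
        = exp (- of_real \<beta> * Z + Z / 2) * ((exp (- of_real \<rho> * Q') * f0 (V', Q')) * thA_red Q' (Z + 2 * V'))"
      using single_valued_viaD[OF sv, of "(0, Z, V, Q)" "(0, Z, V', Q')"] Q e
      unfolding val[OF Q(1), symmetric] val[OF Q(2), symmetric]
      by (simp add: cover_iff proj_HKS_double_def)
    moreover have "thA_red Q' (Z + 2 * V') = thA_red Q (Z + 2 * V)"
      by (rule thA_red_single_valued) (use e exp_add_eq[OF refl exp_2_eq[OF e(1)], of Z] in auto)
    moreover have "thA_red Q (Z + 2 * V) \<noteq> 0"
      using Q by (simp add: thA_red_def Z_def)
    ultimately show "exp (- of_real \<rho> * Q) * f0 (V, Q) = exp (- of_real \<rho> * Q') * f0 (V', Q')" by simp
  qed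
  obtain c0 :: real where c0: "\<And>A Z V. ((\<lambda>Q. lpow Q (- c0) *s delta_z (- (1 / 4)) (E P11) (A, Z, V, Q))
        \<longlongrightarrow> lpow Z (1 / 2) *s bun_O (1 / 2) A V) q_to_0"
    using spec[OF N2[unfolded cond_N2_def], of "1 / 4"] by auto
  have lim: "((\<lambda>Q. exp (- of_real c0 * Q) * f0 (V, Q)) \<longlongrightarrow> 1) q_to_0" for V
  proof -
    have "((\<lambda>Q. (lpow Q (- c0) *s delta_z (- (1 / 4)) (E P11) (0, 0, V, Q)) $ P2 / thA Q (2 * V - of_real (1 / 4) * Q)) \<longlongrightarrow> (lpow 0 (1 / 2) *s bun_O (1 / 2) 0 V) $ P2 / exp (2 * V / 2)) q_to_0"
      by (intro tendsto_divide tendsto_vec_nth c0 theta_limits_quarter) simp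
    moreover have "\<forall>\<^sub>F Q in q_to_0. (lpow Q (- c0) *s delta_z (- (1 / 4)) (E P11) (0, 0, V, Q)) $ P2 / thA Q (2 * V - of_real (1 / 4) * Q)
        = exp (- of_real c0 * Q) * f0 (V, Q)"
    proof -
      have "\<forall>\<^sub>F Q in q_to_0. thA Q (2 * V - of_real (1 / 4) * Q) \<noteq> 0"
        by (rule tendsto_imp_eventually_ne[OF theta_limits_quarter(1)]) simp
      with eventually_Re_neg show ?thesis
        by eventually_elim (simp add: delta_z_apply theta_form_nth[OF form] lpow_def)
    qed
    moreover have "(lpow 0 (1 / 2) *s bun_O (1 / 2) 0 V) $ P2 / exp (2 * V / 2) = 1"
      by (simp add: lpow_def)
    ultimately show ?thesis by (simp add: tendsto_cong)
  qed
  obtain k :: int where k: "c0 = \<rho> + of_int k / 2"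
    using sv_scaled_limit_exponent[OF sv0 lim[of 0]] by auto
  have sv: "sv_scaled f0 c0" by (rule sv_scaled_shift[OF sv0 k])
  show ?thesis
  proof (rule that[of c0])
    show "c0 \<in> \<rat>" using r by (simp add: k \<rho>_def)
    show "admissible_coeff f0 c0" using sv hol by (simp add: admissible_coeff_iff)
    show "asymp_unit f0 c0" by (rule asymp_unitI[OF lim sv hol])
  qed
qed

text \<open>The limits at slope \<open>1/4\<close>, at two values of \<open>x = v z a\<close>, determine the leading term of \<open>f\<^sub>1\<close>. At slope \<open>1/2\<close>
  the series \<open>th0\<close> tends to \<open>1 + x\<^sup>2\<close>, and \<open>th1\<close> to \<open>x\<close> after multiplication by \<open>q\<^bsup>1/4\<^esup>\<close>. The canonical basis element
  is a nonvanishing multiple of \<open>1 + x\<^bsup>- 2\<^esup>\<close>, which vanishes together with \<open>1 + x\<^sup>2\<close> at \<open>x = \<i>\<close>, so that \<open>q\<^bsup>- c\<^sub>1 - 1/4\<^esup> f\<^sub>2\<close>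
  tends to \<open>0\<close>. Being single-valued in \<open>q\<^bsup>1/2\<^esup>\<close> it is \<open>O(q\<^bsup>1/2\<^esup>)\<close>, whence the exponent
  \<open>c\<^sub>1 + 1/4 + 1/2\<close>.\<close>

lemma coefficients_f1_f2:
  fixes E :: "fixpt \<Rightarrow> pt \<Rightarrow> complex^fixpt"
  assumes form: "theta_form E f0 f1 f2" and A: "property_A E" and N1: "cond_N1 E"
    and hol: "holomorphic2_on f1 cover_vq" "holomorphic2_on f2 cover_vq"
  obtains c1 where "c1 \<in> \<rat>" "admissible_coeff f1 c1" "admissible_coeff f2 (c1 + 3 / 4)"
    "asymp_unit f1 c1" "asymp_bounded f2 (c1 + 3 / 4)"
proof -
  obtain \<alpha> \<beta> r where r: "r \<in> \<rat>" and sv: "single_valued_via proj_HKS_double cover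
      (\<lambda>(A, Z, V, Q). ((lpow Q (- r) * lpow A (- \<alpha>) * lpow Z (- \<beta>)) *s (sqrt_L_minus A V * E P2 (A, Z, V, Q))) $ P11)"
    by (rule property_AE[OF A, of P2]) blast
  define \<rho> where "\<rho> = r - 1 / 8"
  \<comment> \<open>As \<open>th0\<close> and \<open>th1\<close> are linearly independent, single-valuedness of the combination implies that of the
    coefficients.\<close>
  have sv12: "exp (- of_real \<rho> * Q) * f1 (V, Q) = exp (- of_real \<rho> * Q') * f1 (V', Q') \<and>
      exp (- of_real (\<rho> - 1 / 4) * Q) * f2 (V, Q) = exp (- of_real (\<rho> - 1 / 4) * Q') * f2 (V', Q')"
    if Q: "Re Q < 0" "Re Q' < 0" and e: "exp V = exp V'" "exp (Q / 2) = exp (Q' / 2)" for V V' Q Q'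
  proof -
    define a where "a = exp (- of_real \<rho> * Q) * f1 (V, Q) - exp (- of_real \<rho> * Q') * f1 (V', Q')"
    define b where "b = exp (- of_real (\<rho> - 1 / 4) * Q) * f2 (V, Q) - exp (- of_real (\<rho> - 1 / 4) * Q') * f2 (V', Q')"
    have "a * th0 Q X + (b * exp (- Q / 4)) * th1 Q X = 0" for X
    proof -
      \<comment> \<open>The point \<open>(a, z) = (exp B, exp Z)\<close> with \<open>v z a = x\<close> and \<open>z / a = q\<^bsup>1/2\<^esup>\<close>.\<close>
      define B where "B = (X - V) / 2 - Q / 4"
      define Z where "Z = (X - V) / 2 + Q / 4"
      have X: "V + Z + B = X" and ZB: "Z - B = Q / 2" by (simp_all add: B_def Z_def field_simps)
      define K where "K = exp (- of_real \<alpha> * B - of_real \<beta> * Z - 2 * B + (Z - B) / 2)"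
      have val: "((lpow Q (- r) * lpow B (- \<alpha>) * lpow Z (- \<beta>)) *s (sqrt_L_minus B V * E P2 (B, Z, V, Q))) $ P11
        = K * exp (- V) * thA_red Q (Z - B) * (exp (- of_real \<rho> * Q) * f1 (V, Q) * th0 Q (V + Z + B)
            + exp (- of_real (\<rho> - 1 / 4) * Q) * f2 (V, Q) * (exp (- Q / 4) * th1 Q (V + Z + B)))"
        if "Re Q < 0" for Q V
      proof -
        have 1: "lpow Q (- r) * lpow B (- \<alpha>) * lpow Z (- \<beta>) * exp (- 2 * B - V) * exp (Q / 8 + (Z - B) / 2) = K * exp (- V) * exp (- of_real \<rho> * Q)"
          unfolding lpow_def \<rho>_def K_def exp_add[symmetric] by (rule arg_cong[of _ _ exp]) (simp add: field_simps)
        have 2: "exp (- of_real (\<rho> - 1 / 4) * Q) * exp (- Q / 4) = exp (- of_real \<rho> * Q)"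
          unfolding exp_add[symmetric] by (rule arg_cong[of _ _ exp]) (simp add: field_simps)
        have "lpow Q (- r) * lpow B (- \<alpha>) * lpow Z (- \<beta>) * (exp (- 2 * B - V) * ((f1 (V, Q) * x + f2 (V, Q) * y) * (exp (Q / 8 + (Z - B) / 2) * t)))
          = K * exp (- V) * t * (exp (- of_real \<rho> * Q) * f1 (V, Q) * x + exp (- of_real (\<rho> - 1 / 4) * Q) * f2 (V, Q) * (exp (- Q / 4) * y))" for x y t
        proof -
          have "lpow Q (- r) * lpow B (- \<alpha>) * lpow Z (- \<beta>) * (exp (- 2 * B - V) * ((f1 (V, Q) * x + f2 (V, Q) * y) * (exp (Q / 8 + (Z - B) / 2) * t)))
            = (lpow Q (- r) * lpow B (- \<alpha>) * lpow Z (- \<beta>) * exp (- 2 * B - V) * exp (Q / 8 + (Z - B) / 2)) * ((f1 (V, Q) * x + f2 (V, Q) * y) * t)"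
            by (simp only: mult_ac)
          also have "\<dots> = K * exp (- V) * t * (exp (- of_real \<rho> * Q) * f1 (V, Q) * x + (exp (- of_real (\<rho> - 1 / 4) * Q) * exp (- Q / 4)) * f2 (V, Q) * y)"
            unfolding 1 2 by (simp add: algebra_simps)
          finally show ?thesis by (simp only: mult_ac)
        qed
        then show ?thesis
          unfolding vector_smult_component vector_mult_component sqrt_L_minus_nth theta_form_nth[OF form that] thA_red_eq[of Q "Z - B"] th_comb_def .
      qed
      have eX: "exp (V' + Z + B) = exp (V + Z + B)" using e by (simp add: exp_add)
      have T: "thA_red Q' (Z - B) = thA_red Q (Z - B)"
        by (rule thA_red_single_valued) (use e in auto)
      have nz: "K * exp (- V) * thA_red Q (Z - B) \<noteq> 0"
        using Q by (simp add: thA_red_def ZB K_def)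
      have "K * exp (- V) * thA_red Q (Z - B) * (exp (- of_real \<rho> * Q) * f1 (V, Q) * th0 Q (V + Z + B)
            + exp (- of_real (\<rho> - 1 / 4) * Q) * f2 (V, Q) * (exp (- Q / 4) * th1 Q (V + Z + B)))
          = K * exp (- V') * thA_red Q' (Z - B) * (exp (- of_real \<rho> * Q') * f1 (V', Q') * th0 Q' (V' + Z + B)
            + exp (- of_real (\<rho> - 1 / 4) * Q') * f2 (V', Q') * (exp (- Q' / 4) * th1 Q' (V' + Z + B)))"
        using single_valued_viaD[OF sv, of "(B, Z, V, Q)" "(B, Z, V', Q')"] Q e
        unfolding val[OF Q(1), symmetric] val[OF Q(2), symmetric]
        by (simp add: cover_iff proj_HKS_double_def)
      then have "exp (- of_real \<rho> * Q) * f1 (V, Q) * th0 Q (V + Z + B)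
            + exp (- of_real (\<rho> - 1 / 4) * Q) * f2 (V, Q) * (exp (- Q / 4) * th1 Q (V + Z + B))
          = exp (- of_real \<rho> * Q') * f1 (V', Q') * th0 Q (V + Z + B)
            + exp (- of_real (\<rho> - 1 / 4) * Q') * f2 (V', Q') * (exp (- Q / 4) * th1 Q (V + Z + B))"
        unfolding T exp_minus_eq[OF e(1), symmetric] th0_single_valued[OF exp_half_eq[OF e(2)[symmetric]] eX]
          th1_single_valued[OF exp_half_eq[OF e(2)[symmetric]] eX]
        using nz by simp
      then show ?thesis unfolding X a_def b_def by (simp add: algebra_simps)
    qed
    from th_independent[OF Q(1) this] show ?thesis by (simp add: a_def b_def)
  qed
  then have sv1: "sv_scaled f1 \<rho>" and sv2: "sv_scaled f2 (\<rho> - 1 / 4)"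
    unfolding sv_scaled_def by blast+

  obtain c1 :: real where c1: "\<And>A Z V. ((\<lambda>Q. lpow Q (- c1) *s delta_z (- (1 / 4)) (E P2) (A, Z, V, Q))
        \<longlongrightarrow> (lpow V 1 * lpow Z (1 / 2)) *s bun_O (- 1 / 2) A V) q_to_0"
    using spec[OF N1[unfolded cond_N1_def], of "1 / 4"] by auto
  have lim1: "((\<lambda>Q. exp (- of_real c1 * Q) * f1 (V, Q)) \<longlongrightarrow> 1) q_to_0" for V
  proof -
    have g: "((\<lambda>Q. (exp (- of_real c1 * Q) * f1 (V, Q)) * th0 Q (X - of_real (1 / 4) * Q)
        + (exp (- of_real c1 * Q) * f2 (V, Q)) * th1 Q (X - of_real (1 / 4) * Q)) \<longlongrightarrow> 1) q_to_0" for X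
    proof -
      define Z where "Z = X - V"
      have "((\<lambda>Q. (lpow Q (- c1) *s delta_z (- (1 / 4)) (E P2) (0, Z, V, Q)) $ P11 / thA Q (Z - of_real (1 / 4) * Q))
          \<longlongrightarrow> ((lpow V 1 * lpow Z (1 / 2)) *s bun_O (- 1 / 2) 0 V) $ P11 / exp (Z / 2)) q_to_0"
        by (intro tendsto_divide tendsto_vec_nth c1 theta_limits_quarter) simp
      moreover have "\<forall>\<^sub>F Q in q_to_0. (lpow Q (- c1) *s delta_z (- (1 / 4)) (E P2) (0, Z, V, Q)) $ P11 / thA Q (Z - of_real (1 / 4) * Q)
          = (exp (- of_real c1 * Q) * f1 (V, Q)) * th0 Q (X - of_real (1 / 4) * Q)
            + (exp (- of_real c1 * Q) * f2 (V, Q)) * th1 Q (X - of_real (1 / 4) * Q)"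
      proof -
        have "\<forall>\<^sub>F Q in q_to_0. thA Q (Z - of_real (1 / 4) * Q) \<noteq> 0"
          by (rule tendsto_imp_eventually_ne[OF theta_limits_quarter(1)]) simp
        with eventually_Re_neg show ?thesis
        proof eventually_elim
          case (elim Q)
          have "delta_z (- (1 / 4)) (E P2) (0, Z, V, Q) $ P11
              = (f1 (V, Q) * th0 Q (X - of_real (1 / 4) * Q) + f2 (V, Q) * th1 Q (X - of_real (1 / 4) * Q)) * thA Q (Z - of_real (1 / 4) * Q)"
            using elim(1) by (simp add: delta_z_apply theta_form_nth[OF form] th_comb_def Z_def algebra_simps)
          then show ?case
            using elim(2) by (simp add: lpow_def distrib_left mult.assoc)
        qed
      qed
      moreover have "((lpow V 1 * lpow Z (1 / 2)) *s bun_O (- 1 / 2) 0 V) $ P11 / exp (Z / 2) = 1"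
        by (simp add: lpow_def exp_minus field_simps)
      ultimately show ?thesis by (simp add: tendsto_cong)
    qed
    have "exp (of_real pi * \<i>) = (- 1 :: complex)" by simp
    with two_by_two_limit(1)[OF g[of 0] g[of "of_real pi * \<i>"] theta_limits_quarter(2,3) theta_limits_quarter(2,3)]
    show ?thesis by simp
  qed
  obtain k :: int where k: "c1 = \<rho> + of_int k / 2"
    using sv_scaled_limit_exponent[OF sv1 lim1[of 0]] by auto
  have sv1': "sv_scaled f1 c1" by (rule sv_scaled_shift[OF sv1 k])
  have sv2': "sv_scaled f2 (c1 + 1 / 4)"
    by (rule sv_scaled_shift[OF sv2, of _ "k + 1"]) (simp add: k field_simps)
  have sv2'': "sv_scaled f2 (c1 + 3 / 4)"
    by (rule sv_scaled_shift[OF sv2, of _ "k + 2"]) (simp add: k field_simps)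

  obtain rs a b :: real and \<epsilon> :: complex where \<epsilon>: "\<epsilon> \<noteq> 0"
    and l2: "\<And>A Z V p. ((\<lambda>Q. exp (- of_real rs * Q) * delta_z (- (1 / 2)) (E P2) (A, Z, V, Q) $ p)
        \<longlongrightarrow> \<epsilon> * exp (of_real a * A + of_real b * Z) * W P2 (1 / 2) A Z V $ p) q_to_0"
    by (rule property_A_limit[OF A, where s = "1 / 2" and \<mu> = P2]) (rule that, assumption+)
  define \<tau> where "\<tau> = rs + 1 / 8"
  have lim2: "((\<lambda>Q. exp (- of_real (c1 + 1 / 4) * Q) * f2 (V, Q)) \<longlongrightarrow> 0) q_to_0" for V
  proof -
    \<comment> \<open>The limit required by Property A, divided by the one of the alternating series.\<close>
    define R where "R = (\<lambda>X. \<epsilon> * exp (of_real b * (X - V)) * exp (2 * V - (X - V) / 2) * (1 + exp (- 2 * X)))"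
    have g: "((\<lambda>Q. (exp (- of_real \<tau> * Q) * f1 (V, Q)) * th0 Q (X - of_real (1 / 2) * Q)
        + (exp (- of_real (\<tau> + 1 / 4) * Q) * f2 (V, Q)) * (exp (Q / 4) * th1 Q (X - of_real (1 / 2) * Q))) \<longlongrightarrow> R X) q_to_0" for X
    proof -
      define Z where "Z = X - V"
      have "((\<lambda>Q. (exp (- of_real rs * Q) * delta_z (- (1 / 2)) (E P2) (0, Z, V, Q) $ P11) / (exp (Q / 8) * thA Q (Z - of_real (1 / 2) * Q)))
          \<longlongrightarrow> (\<epsilon> * exp (of_real a * 0 + of_real b * Z) * W P2 (1 / 2) 0 Z V $ P11) / exp (Z / 2)) q_to_0"
        by (intro tendsto_divide l2 theta_limits_half) simp
      moreover have "\<forall>\<^sub>F Q in q_to_0. (exp (- of_real rs * Q) * delta_z (- (1 / 2)) (E P2) (0, Z, V, Q) $ P11) / (exp (Q / 8) * thA Q (Z - of_real (1 / 2) * Q))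
          = (exp (- of_real \<tau> * Q) * f1 (V, Q)) * th0 Q (X - of_real (1 / 2) * Q)
        + (exp (- of_real (\<tau> + 1 / 4) * Q) * f2 (V, Q)) * (exp (Q / 4) * th1 Q (X - of_real (1 / 2) * Q))"
      proof -
        have "\<forall>\<^sub>F Q in q_to_0. exp (Q / 8) * thA Q (Z - of_real (1 / 2) * Q) \<noteq> 0"
          by (rule tendsto_imp_eventually_ne[OF theta_limits_half(1)]) simp
        with eventually_Re_neg show ?thesis
        proof eventually_elim
          case (elim Q)
          have e: "exp (- of_real rs * Q) = exp (- of_real \<tau> * Q) * exp (Q / 8)"
            "exp (- of_real \<tau> * Q) = exp (- of_real (\<tau> + 1 / 4) * Q) * exp (Q / 4)"
            unfolding \<tau>_def exp_add[symmetric] by (rule arg_cong[of _ _ exp], simp add: field_simps)+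
          have d: "delta_z (- (1 / 2)) (E P2) (0, Z, V, Q) $ P11
              = (f1 (V, Q) * th0 Q (X - of_real (1 / 2) * Q) + f2 (V, Q) * th1 Q (X - of_real (1 / 2) * Q)) * thA Q (Z - of_real (1 / 2) * Q)"
            using elim(1) by (simp add: delta_z_apply theta_form_nth[OF form] th_comb_def Z_def algebra_simps)
          have "(exp (- of_real rs * Q) * delta_z (- (1 / 2)) (E P2) (0, Z, V, Q) $ P11) / (exp (Q / 8) * thA Q (Z - of_real (1 / 2) * Q))
            = exp (- of_real \<tau> * Q) * (f1 (V, Q) * th0 Q (X - of_real (1 / 2) * Q) + f2 (V, Q) * th1 Q (X - of_real (1 / 2) * Q))"
            unfolding d e(1) using elim(2) by (simp add: field_simps)
          also have "\<dots> = exp (- of_real \<tau> * Q) * (f1 (V, Q) * th0 Q (X - of_real (1 / 2) * Q))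
              + (exp (- of_real (\<tau> + 1 / 4) * Q) * exp (Q / 4)) * (f2 (V, Q) * th1 Q (X - of_real (1 / 2) * Q))"
            unfolding e(2)[symmetric] by (rule distrib_left)
          finally show ?case by (simp only: mult_ac)
        qed
      qed
      moreover have "(\<epsilon> * exp (of_real a * 0 + of_real b * Z) * W P2 (1 / 2) 0 Z V $ P11) / exp (Z / 2) = R X"
      proof -
        have "W P2 (1 / 2) 0 Z V $ P11 = exp (2 * V) + exp (- 2 * Z)"
          using W_P2_eq(3)[of 0 0 Z V] by simp
        also have "\<dots> = exp (2 * V) * (1 + exp (- 2 * X))"
          by (simp add: Z_def distrib_left algebra_simps flip: exp_add)
        finally show ?thesis by (simp add: R_def Z_def exp_diff)
      qed
      ultimately show ?thesis by (simp add: tendsto_cong)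
    qed
    have R: "R (of_real (pi / 2) * \<i>) = 0" "R 0 \<noteq> 0"
    proof -
      have "- 2 * (of_real (pi / 2) * \<i>) = - (of_real pi * \<i>)" by simp
      then have "exp (- 2 * (of_real (pi / 2) * \<i>)) = - 1" by (simp only: exp_minus exp_pi_i) simp
      then show "R (of_real (pi / 2) * \<i>) = 0" unfolding R_def by simp
      show "R 0 \<noteq> 0" using \<epsilon> by (simp add: R_def)
    qed
    have "2 * (of_real (pi / 2) * \<i>) = of_real pi * \<i>" by simp
    then have e: "exp (2 * (of_real (pi / 2) * \<i>)) = - 1" by (simp only: exp_pi_i)
    have det: "(1 + exp (2 * 0)) * exp (of_real (pi / 2) * \<i>) - (1 + exp (2 * (of_real (pi / 2) * \<i>))) * exp 0 \<noteq> (0 :: complex)"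
      unfolding e by simp
    note lims = two_by_two_limit[OF g[of 0] g[of "of_real (pi / 2) * \<i>"] theta_limits_half(2,3) theta_limits_half(2,3) det]
    have a1: "((\<lambda>Q. exp (- of_real \<tau> * Q) * f1 (V, Q)) \<longlongrightarrow> R 0 / 2) q_to_0"
      using lims(1) unfolding e R(1) by simp
    have b1: "((\<lambda>Q. exp (- of_real (\<tau> + 1 / 4) * Q) * f2 (V, Q)) \<longlongrightarrow> 0) q_to_0"
      using lims(2) unfolding e R(1) by simp
    \<comment> \<open>Both powers of \<open>q\<close> normalise \<open>f\<^sub>1\<close> to a nonzero limit.\<close>
    have "\<tau> = c1"
    proof (rule ccontr)
      assume "\<tau> \<noteq> c1"
      then consider "c1 - \<tau> > 0" | "\<tau> - c1 > 0" by linarith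
      then show False
      proof cases
        case 1
        have "((\<lambda>Q. exp (of_real (c1 - \<tau>) * Q) * (exp (- of_real c1 * Q) * f1 (V, Q))) \<longlongrightarrow> 0 * 1) q_to_0"
          by (intro tendsto_mult tendsto_q_power_0 1 lim1)
        moreover have "exp (of_real (c1 - \<tau>) * Q) * (exp (- of_real c1 * Q) * x) = exp (- of_real \<tau> * Q) * x" for Q x :: complex
          by (rule exp_mult_exp_mult) (simp add: algebra_simps)
        ultimately have "((\<lambda>Q. exp (- of_real \<tau> * Q) * f1 (V, Q)) \<longlongrightarrow> 0) q_to_0"
          by (simp only: mult_zero_left)
        from tendsto_unique[OF q_to_0_neq_bot a1 this] R(2) show False by simp
      next
        case 2
        have "((\<lambda>Q. exp (of_real (\<tau> - c1) * Q) * (exp (- of_real \<tau> * Q) * f1 (V, Q))) \<longlongrightarrow> 0 * (R 0 / 2)) q_to_0"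
          by (intro tendsto_mult tendsto_q_power_0 2 a1)
        moreover have "exp (of_real (\<tau> - c1) * Q) * (exp (- of_real \<tau> * Q) * x) = exp (- of_real c1 * Q) * x" for Q x :: complex
          by (rule exp_mult_exp_mult) (simp add: algebra_simps)
        ultimately have "((\<lambda>Q. exp (- of_real c1 * Q) * f1 (V, Q)) \<longlongrightarrow> 0) q_to_0"
          by (simp only: mult_zero_left)
        from tendsto_unique[OF q_to_0_neq_bot lim1 this] show False by simp
      qed
    qed
    with b1 show ?thesis by simp
  qed
  show ?thesis
  proof (rule that[of c1])
    show "c1 \<in> \<rat>" using r by (simp add: k \<rho>_def)
    show "admissible_coeff f1 c1" "admissible_coeff f2 (c1 + 3 / 4)"
      using sv1' sv2'' hol by (simp_all add: admissible_coeff_iff)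
    show "asymp_unit f1 c1" by (rule asymp_unitI[OF lim1 sv1' hol(1)])
    show "asymp_bounded f2 (c1 + 3 / 4)"
      unfolding asymp_bounded_def
    proof
      fix V
      have "(\<lambda>Q. exp (- of_real (c1 + 1 / 4) * Q) * f2 (V, Q) - 0) \<in> O[q_to_0](\<lambda>Q. lpow Q (1 / 2))"
        by (rule sv_scaled_bigo[OF sv2' hol(2) lim2])
      then have "(\<lambda>Q. lpow Q (- (1 / 2)) * (exp (- of_real (c1 + 1 / 4) * Q) * f2 (V, Q))) \<in> O[q_to_0](\<lambda>Q. lpow Q (- (1 / 2)) * lpow Q (1 / 2))"
        by (intro landau_o.big.mult landau_o.big_refl) simp
      moreover have "lpow Q (- (1 / 2)) * lpow Q (1 / 2) = 1" for Q
        unfolding lpow_def exp_add[symmetric] by simp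
      moreover have "lpow Q (- (1 / 2)) * (exp (- of_real (c1 + 1 / 4) * Q) * x) = lpow Q (- (c1 + 3 / 4)) * x" for Q x :: complex
        unfolding lpow_def by (rule exp_mult_exp_mult) (simp add: algebra_simps)
      ultimately show "(\<lambda>Q. lpow Q (- (c1 + 3 / 4)) * f2 (V, Q)) \<in> O[q_to_0](\<lambda>_. 1)"
        by (simp only:)
    qed
  qed
qed

section \<open>The equivalence\<close>

lemma Y_formula_iff:
  assumes "Re Q < 0"
  shows "Y (V, Q) / (theta_scale Q)\<^sup>2 = f0 (V, Q) * th_comb (f1 (V, Q)) (f2 (V, Q)) Q V \<longleftrightarrow>
    Y (V, Q) = lpow Q (1 / 4) * (qpoch Q)\<^sup>2 * f0 (V, Q) *
             (f1 (V, Q) * theta_even (V, Q) + f2 (V, Q) * theta_odd (V, Q))"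
  unfolding theta_scale_square[symmetric] theta_even_eq theta_odd_eq th_comb_def[symmetric]
  using theta_scale_nonzero[OF assms] by (simp add: divide_eq_eq mult_ac)

theorem theorem4p1:
  fixes E :: "fixpt \<Rightarrow> pt \<Rightarrow> complex^fixpt"
    and Y :: "complex \<times> complex \<Rightarrow> complex"
  assumes "\<And>\<mu> p. (\<lambda>x. E \<mu> x $ p) \<in> mero_field"
    and "holomorphic2_on Y cover_vq"
  shows "(cond_Q1 E \<and> cond_Q2 E \<and> cond_S E \<and> cond_N1 E \<and> cond_N2 E \<and> cond_B E Y \<and> property_A E)
     \<longleftrightarrow>
     (\<exists>f0 f1 f2. \<exists>c0 c1 c2 :: real.
        admissible_coeff f0 c0 \<and> admissible_coeff f1 c1 \<and> admissible_coeff f2 c2 \<and>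
        asymp_unit f0 c0 \<and> asymp_unit f1 c1 \<and> asymp_bounded f2 c2 \<and>
        admissible_exponents c0 c1 c2 \<and>
        (\<forall>(A, Z, V, Q)\<in>cover.
           E P2 (A, Z, V, Q) =
             f1 (V, Q) *s series_1 (A, Z, V, Q) + f2 (V, Q) *s series_2 (A, Z, V, Q)) \<and>
        (\<forall>(A, Z, V, Q)\<in>cover.
           E P11 (A, Z, V, Q) = f0 (V, Q) *s series_0 (A, Z, V, Q)) \<and>
        (\<forall>(V, Q)\<in>cover_vq.
           Y (V, Q) = lpow Q (1 / 4) * (qpoch Q)\<^sup>2 * f0 (V, Q) *
             (f1 (V, Q) * theta_even (V, Q) + f2 (V, Q) * theta_odd (V, Q))))"
    (is "?I \<longleftrightarrow> ?II")
proof
  assume I: ?I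
  then obtain f0 f1 f2 where form: "theta_form E f0 f1 f2"
    and hol: "holomorphic2_on f0 cover_vq" "holomorphic2_on f1 cover_vq" "holomorphic2_on f2 cover_vq"
    and Y: "\<And>V Q. Re Q < 0 \<Longrightarrow> Y (V, Q) / (theta_scale Q)\<^sup>2 = f0 (V, Q) * th_comb (f1 (V, Q)) (f2 (V, Q)) Q V"
    using conditions_imp_theta_form[OF _ _ _ _ _ assms(2)] by blast
  have conds: "property_A E" "cond_N1 E" "cond_N2 E" using I by blast+
  obtain c0 where c0: "c0 \<in> \<rat>" "admissible_coeff f0 c0" "asymp_unit f0 c0"
    by (rule coefficient_f0[OF form conds(1,3) hol(1)])
  obtain c1 where c1: "c1 \<in> \<rat>" "admissible_coeff f1 c1" "admissible_coeff f2 (c1 + 3 / 4)"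
    "asymp_unit f1 c1" "asymp_bounded f2 (c1 + 3 / 4)"
    by (rule coefficients_f1_f2[OF form conds(1,2) hol(2,3)])
  have "admissible_exponents c0 c1 (c1 + 3 / 4)"
    using c0 c1 by (simp add: admissible_exponents_def)
  moreover have "\<forall>(V, Q)\<in>cover_vq. Y (V, Q) = lpow Q (1 / 4) * (qpoch Q)\<^sup>2 * f0 (V, Q) *
             (f1 (V, Q) * theta_even (V, Q) + f2 (V, Q) * theta_odd (V, Q))"
    using Y Y_formula_iff by (auto simp: cover_vq_iff)
  ultimately show ?II
    using c0(2,3) c1(2-5) form[THEN theta_form_iff[THEN iffD1], THEN conjunct1]
      form[THEN theta_form_iff[THEN iffD1], THEN conjunct2]
    by (intro exI[of _ f0] exI[of _ f1] exI[of _ f2] exI[of _ c0] exI[of _ c1] exI[of _ "c1 + 3 / 4"] conjI)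
next
  assume ?II
  then obtain f0 f1 f2 and c0 c1 c2 :: real where
    f: "admissible_coeff f0 c0" "admissible_coeff f1 c1" "admissible_coeff f2 c2"
    and u: "asymp_unit f0 c0" "asymp_unit f1 c1" "asymp_bounded f2 c2"
    and c: "admissible_exponents c0 c1 c2"
    and form: "theta_form E f0 f1 f2"
    and Y: "\<forall>(V, Q)\<in>cover_vq. Y (V, Q) = lpow Q (1 / 4) * (qpoch Q)\<^sup>2 * f0 (V, Q) *
             (f1 (V, Q) * theta_even (V, Q) + f2 (V, Q) * theta_odd (V, Q))"
  proof (elim exE conjE, goal_cases)
    case (1 f0 f1 f2 c0 c1 c2)
    show ?case
      by (rule 1(1)[of f0 c0 f1 c1 f2 c2]) (use 1(2-) in \<open>simp_all only: theta_form_iff simp_thms\<close>)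
  qed
  have c': "c2 \<ge> c1 + 3 / 4" "2 * (c2 - (c1 + 3 / 4)) \<in> \<int>"
    using c by (auto simp: admissible_exponents_def)
  have "Y (V, Q) / (theta_scale Q)\<^sup>2 = f0 (V, Q) * th_comb (f1 (V, Q)) (f2 (V, Q)) Q V" if "Re Q < 0" for V Q
    unfolding Y_formula_iff[OF that] using Y that by (auto simp: cover_vq_iff)
  then have "cond_B E Y" by (rule theta_form_cond_B[OF form])
  then show ?I
    using theta_form_cond_Q1[OF form] theta_form_cond_Q2[OF form] theta_form_cond_S[OF form f c'(2)]
      theta_form_cond_N1[OF form u(2,3) c'(1)] theta_form_cond_N2[OF form u(1)] theta_form_property_A[OF form f u c]
    by blast
qed

end
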